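(* Let $N\ge1$ be dyadic. Then $$\|e^{it\Delta_{\mathbb{R}\times\mathbb{T}^2}}P_{\le N}u_0\|_{l^q_\gamma L^p_{x,y,t}(\mathbb{R}\times\mathbb{T}^2\times[2\pi\gamma,2\pi(\gamma+1)])}\lesssim N^{\frac32-\frac5p}\|u_0\|_{L^2(\mathbb{R}\times\mathbb{T}^2)}$$ for all $u_0\in L^2(\mathbb{R}\times\mathbb{T}^2)$, whenever $$p>4\quad\text{and}\quad\frac2q+\frac1p=\frac12.$$ The implicit constant is independent of $N$ and $u_0$.
   Context: $\mathbb{T}=\mathbb{R}/2\pi\mathbb{Z}$; coordinates on $\mathbb{R}\times\mathbb{T}^2$ are $(x,y)=(x,y_1,y_2)$, with dual frequencies $(\xi,k_1,k_2)\in\mathbb{R}\times\mathbb{Z}^2$. Fix a smooth cutoff $\eta^1\in C^\infty(\mathbb{R})$ with $\eta^1(s)=1$ for $|s|\le1$ and $\eta^1(s)=0$ for $|s|\ge2$. For $N\ge1$ dyadic, $P_{\le N}$ is the Fourier multiplier with symbol $\eta^1(\xi/N)\eta^1(k_1/N)\eta^1(k_2/N)$. The notation $\|u\|_{l^q_\gamma L^p_{x,y,t}(\mathbb{R}\times\mathbb{T}^2\times[2\pi\gamma,2\pi(\gamma+1)])}$ means the $\ell^q$ norm over $\gamma\in\mathbb{Z}$ of the numbers $\|u\|_{L^p(\mathbb{R}\times\mathbb{T}^2\times[2\pi\gamma,2\pi(\gamma+1)])}$. *)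

theory Defs
  imports "HOL-Analysis.Analysis" "HOL-Probability.Essential_Supremum"
begin

subsection \<open>Lebesgue norms with exponents up to infinity\<close>

definition ennpowr :: "ennreal \<Rightarrow> real \<Rightarrow> ennreal" where
  "ennpowr a r = (if a = top then top else ennreal (enn2real a powr r))"

text \<open>Nonnegative functions may take the value infinity, so that norms can be nested.
  As for \<open>esssup\<close>, the norm of a non-measurable function is infinite.
  Only used for exponents \<open>p \<ge> 1\<close>.\<close>

definition Lp_ennnorm :: "'a measure \<Rightarrow> ennreal \<Rightarrow> ('a \<Rightarrow> ennreal) \<Rightarrow> ennreal" where
  "Lp_ennnorm M p f =
     (if p = top then esssup M f
      else if f \<in> borel_measurable M
        then ennpowr (\<integral>\<^sup>+ x. ennpowr (f x) (enn2real p) \<partial>M) (1 / enn2real p)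
      else top)"

definition Lp_norm :: "'a measure \<Rightarrow> ennreal \<Rightarrow> ('a \<Rightarrow> complex) \<Rightarrow> ennreal" where
  "Lp_norm M p f =
     (if f \<in> borel_measurable M then Lp_ennnorm M p (\<lambda>x. ennreal (norm (f x))) else top)"

abbreviation lq_norm :: "ennreal \<Rightarrow> ('i \<Rightarrow> ennreal) \<Rightarrow> ennreal" where
  "lq_norm q a \<equiv> Lp_ennnorm (count_space UNIV) q a"


subsection \<open>Function spaces on the product of the line and the two-dimensional torus\<close>

text \<open>Functions on the product of \<open>\<real>\<close> with the square of \<open>\<real>/2\<pi>\<int>\<close> are represented by
  functions of \<open>(x, y\<^sub>1, y\<^sub>2)\<close> that are \<open>2\<pi>\<close>-periodic in \<open>y\<^sub>1\<close> and \<open>y\<^sub>2\<close>,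
  integrated over one period cell.\<close>

definition RT2_cell :: "(real \<times> real \<times> real) set" where
  "RT2_cell = UNIV \<times> {0..<2 * pi} \<times> {0..<2 * pi}"

definition RT2 :: "(real \<times> real \<times> real) measure" where
  "RT2 = restrict_space lborel RT2_cell"

definition L2_RT2 :: "(real \<times> real \<times> real \<Rightarrow> complex) set" where
  "L2_RT2 = {f \<in> borel_measurable borel.
     (\<forall>x y1 y2. f (x, y1 + 2 * pi, y2) = f (x, y1, y2) \<and> f (x, y1, y2 + 2 * pi) = f (x, y1, y2)) \<and>
     Lp_norm RT2 2 f < top}"

text \<open>Space-time slab with points \<open>((x, y\<^sub>1, y\<^sub>2), t)\<close>.\<close>

definition RT2_slab :: "int \<Rightarrow> ((real \<times> real \<times> real) \<times> real) measure" where
  "RT2_slab \<gamma> = restrict_space lborel (RT2_cell \<times> {2 * pi * \<gamma> .. 2 * pi * (\<gamma> + 1)})"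


subsection \<open>Fourier transform on square-integrable functions\<close>

definition RZ2 :: "(real \<times> int \<times> int) measure" where
  "RZ2 = lborel \<Otimes>\<^sub>M count_space UNIV"

definition character :: "real \<times> int \<times> int \<Rightarrow> real \<times> real \<times> real \<Rightarrow> complex" where
  "character = (\<lambda>(\<xi>, k1, k2) (x, y1, y2). cis (\<xi> * x + real_of_int k1 * y1 + real_of_int k2 * y2))"

definition fourier_integral ::
    "(real \<times> real \<times> real \<Rightarrow> complex) \<Rightarrow> real \<times> int \<times> int \<Rightarrow> complex" where
  "fourier_integral f \<zeta> = (LINT z|RT2. cnj (character \<zeta> z) * f z)"

definition inv_fourier_integral ::
    "(real \<times> int \<times> int \<Rightarrow> complex) \<Rightarrow> real \<times> real \<times> real \<Rightarrow> complex" where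
  "inv_fourier_integral g z = of_real (1 / (2 * pi) ^ 3) * (LINT \<zeta>|RZ2. character \<zeta> z * g \<zeta>)"

text \<open>The transform of a square-integrable function is the \<open>L\<^sup>2\<close>-limit of the transforms of its
  truncations, which are integrable. It is determined almost everywhere; \<open>SOME\<close> picks a
  representative.\<close>

definition fourier ::
    "(real \<times> real \<times> real \<Rightarrow> complex) \<Rightarrow> real \<times> int \<times> int \<Rightarrow> complex" where
  "fourier f = (SOME F. Lp_norm RZ2 2 F < top \<and>
     ((\<lambda>R. Lp_norm RZ2 2
        (\<lambda>\<zeta>. F \<zeta> - fourier_integral (\<lambda>(x, y). if \<bar>x\<bar> \<le> R then f (x, y) else 0) \<zeta>)) \<longlongrightarrow> 0) at_top)"

text \<open>If \<open>g\<close> is integrable, the inverse transform has a distinguished representative, namely the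
  continuous one. Choosing it makes the evolution below jointly continuous in space and time
  for band-limited data; selecting a representative separately for each time would not even
  ensure joint measurability.\<close>

definition inv_fourier ::
    "(real \<times> int \<times> int \<Rightarrow> complex) \<Rightarrow> real \<times> real \<times> real \<Rightarrow> complex" where
  "inv_fourier g =
     (if integrable RZ2 g then inv_fourier_integral g
      else (SOME f. f \<in> L2_RT2 \<and>
        ((\<lambda>R. Lp_norm RT2 2
           (\<lambda>z. f z - inv_fourier_integral
              (\<lambda>(\<xi>, k1, k2). if \<bar>\<xi>\<bar> \<le> R \<and> \<bar>real_of_int k1\<bar> \<le> R \<and> \<bar>real_of_int k2\<bar> \<le> R
                 then g (\<xi>, k1, k2) else 0) z)) \<longlongrightarrow> 0) at_top))"

definition fourier_multiplier ::
    "(real \<times> int \<times> int \<Rightarrow> complex) \<Rightarrow> (real \<times> real \<times> real \<Rightarrow> complex) \<Rightarrow>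
     (real \<times> real \<times> real \<Rightarrow> complex)" where
  "fourier_multiplier m f = inv_fourier (\<lambda>\<zeta>. m \<zeta> * fourier f \<zeta>)"


subsection \<open>Littlewood-Paley projection and free Schroedinger evolution\<close>

definition smooth_cutoff :: "(real \<Rightarrow> real) \<Rightarrow> bool" where
  "smooth_cutoff \<eta> \<longleftrightarrow>
     (\<forall>n x. (deriv ^^ n) \<eta> differentiable (at x)) \<and>
     (\<forall>s. \<bar>s\<bar> \<le> 1 \<longrightarrow> \<eta> s = 1) \<and> (\<forall>s. \<bar>s\<bar> \<ge> 2 \<longrightarrow> \<eta> s = 0)"

definition P_le ::
    "(real \<Rightarrow> real) \<Rightarrow> nat \<Rightarrow> (real \<times> real \<times> real \<Rightarrow> complex) \<Rightarrow> (real \<times> real \<times> real \<Rightarrow> complex)" where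
  "P_le \<eta> N = fourier_multiplier
     (\<lambda>(\<xi>, k1, k2). of_real (\<eta> (\<xi> / N) * \<eta> (real_of_int k1 / N) * \<eta> (real_of_int k2 / N)))"

text \<open>The Laplacian has symbol \<open>- (\<xi>\<^sup>2 + k\<^sub>1\<^sup>2 + k\<^sub>2\<^sup>2)\<close>.\<close>

definition schroedinger ::
    "real \<Rightarrow> (real \<times> real \<times> real \<Rightarrow> complex) \<Rightarrow> (real \<times> real \<times> real \<Rightarrow> complex)" where
  "schroedinger t = fourier_multiplier
     (\<lambda>(\<xi>, k1, k2). cis (- t * (\<xi>\<^sup>2 + (real_of_int k1)\<^sup>2 + (real_of_int k2)\<^sup>2)))"

end

theory Submission
  imports Defs "HOL-Probability.Characteristic_Functions"
begin

text \<open>Testing the evolution against its own sign on level sets and applying Cauchy-Schwarz in frequency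
  (the \<open>TT*\<close> argument) reduces a weak-type estimate to a bilinear form of functions supported in two
  time slabs, with a kernel that is a Gaussian-truncated Schroedinger kernel on the line times two Weyl
  sums. Differencing bounds this kernel at time \<open>\<tau>\<close> by an explicit function \<open>kernel_bound M \<tau>\<close>, of
  size \<open>M powr 3 * (1 + \<bar>n\<bar>) powr (-1/2)\<close> on slabs at distance \<open>n\<close>, and small outside a set of times of small
  measure. Where the kernel is at most \<open>H\<close> one uses the dispersive estimate, on the remaining times
  Bessel's inequality; optimising \<open>H\<close> yields a decay \<open>(1 + \<bar>n\<bar>) powr (- 2/q)\<close>, which the discrete
  Hardy-Littlewood-Sobolev inequality sums over the slabs.

  This gives a weak-type bound in each slab, \<open>l\<^sup>q\<close>-summable over the slabs, both for the supremum
  (\<open>q = 4\<close>) and for every exponent \<open>p\<^sub>0\<close> strictly between 4 and 6. For \<open>p\<^sub>0 < p\<close>, interpolating inside each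
  slab and applying Hoelder's inequality to the sum over slabs yields the strong estimate.\<close>

section \<open>The discrete Hardy-Littlewood-Sobolev inequality\<close>

text \<open>Test functions of modulus at most one have squared L2 norm on each time slice at most
  their L1 norm there. So the dispersive and the energy bound are both measured by the volume of the
  tested sets, and the level \<open>H\<close> may depend on these volumes. This is what a restricted
  weak-type statement buys. The exponents: with \<open>\<iota>\<close> equal to 1/p0, the
  exceptional times are bounded by Chebyshev's inequality for the power r = p0/2 - 1 of the kernel.
  As 1/(1 + r) = 2 \<iota>, the moment M powr (3r - 2) becomes M powr (3 - 10 \<iota>), the square
  of the final loss. The range of p0 is that of this moment: at r = 1 the integral of
  1/\<bar>sin\<bar> would cost a logarithm of M, and r < 2 keeps \<tau> powr (- r/2), the decay of
  the line factor, integrable at 0. Every p > 4 lies above an admissible p0, so large p require no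
  further kernel estimate. A separate obstacle is that the evolution is defined through chosen
  representatives of transforms, one time after another. It has to be rewritten as one absolutely
  convergent frequency integral whose amplitude does not depend on the time.\<close>

lemma sum_powr_minus_le:
  fixes s :: real
  assumes "0 \<le> s" "s < 1"
  shows "(\<Sum>i=1..n. real i powr (- s)) \<le> real n powr (1 - s) / (1 - s)"
proof (induction n)
  case 0
  then show ?case using assms by simp
next
  case (Suc n)
  have "real n powr (1 - s) + (1 - s) * real (Suc n) powr (- s) \<le> real (Suc n) powr (1 - s)"
  proof (cases "n = 0")
    case False
    \<comment> \<open>Weighted arithmetic-geometric mean: the right side is n + s. After
      multiplication by (n+1) powr (-s) it becomes (n+1) powr (1-s) - (1-s) * (n+1) powr (-s),
      exactly the increment that the induction needs.\<close>
    have "real n powr (1 - s) * real (Suc n) powr s \<le> (1 - s) * real n + s * real (Suc n)"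
      using assms False by (intro Youngs_inequality_0) auto
    then have "real n powr (1 - s) * real (Suc n) powr s * real (Suc n) powr (- s)
        \<le> (real n + s) * real (Suc n) powr (- s)"
      by (intro mult_right_mono) (auto simp: algebra_simps)
    moreover have "real (Suc n) powr s * real (Suc n) powr (- s) = 1"
      by (simp add: powr_add[symmetric])
    moreover have "real (Suc n) powr (1 - s) = real (Suc n) * real (Suc n) powr (- s)"
      using powr_add[of "real (Suc n)" 1 "- s"] by simp
    ultimately show ?thesis
      by (simp add: algebra_simps)
  qed (use assms in auto)
  then show ?case
    using Suc assms by (simp add: field_simps)
qed

lemma sum_inverse_square_tail:
  assumes "m \<ge> 1"
  shows "(\<Sum>i=m..<m+n. 1 / (1 + real i)\<^sup>2) \<le> 1 / real m"
proof -
  have "(\<Sum>i=m..<m+n. 1 / (1 + real i)\<^sup>2) \<le> 1 / real m - 1 / real (m + n)"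
  proof (induction n)
    case (Suc n)
    have "1 / (1 + real (m + n))\<^sup>2 \<le> 1 / real (m + n) - 1 / real (m + Suc n)"
      using assms by (simp add: field_simps power2_eq_square add_pos_nonneg)
    with Suc show ?case
      by simp
  qed simp
  also have "\<dots> \<le> 1 / real m" by simp
  finally show ?thesis .
qed

text \<open>On each of the two sign classes of J the absolute value is injective, whence the factor
  2. Nonnegativity of f allows I to be larger than the image.\<close>

lemma sum_abs_int_le:
  fixes f :: "nat \<Rightarrow> real"
  assumes "finite J" "finite I" "(\<lambda>n. nat \<bar>n\<bar>) ` J \<subseteq> I" "\<And>i. f i \<ge> 0"
  shows "(\<Sum>n\<in>J. f (nat \<bar>n\<bar>)) \<le> 2 * (\<Sum>i\<in>I. f i)"
proof -
  have half: "(\<Sum>n\<in>K. f (nat \<bar>n\<bar>)) \<le> (\<Sum>i\<in>I. f i)"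
    if "K \<subseteq> J" "inj_on (\<lambda>n. nat \<bar>n\<bar>) K" for K
  proof -
    have "(\<Sum>n\<in>K. f (nat \<bar>n\<bar>)) = (\<Sum>i\<in>(\<lambda>n. nat \<bar>n\<bar>) ` K. f i)"
      using that by (simp add: sum.reindex)
    also have "\<dots> \<le> (\<Sum>i\<in>I. f i)"
      using that assms by (intro sum_mono2) auto
    finally show ?thesis .
  qed
  have "(\<Sum>n\<in>J. f (nat \<bar>n\<bar>)) =
      (\<Sum>n\<in>J \<inter> {0..}. f (nat \<bar>n\<bar>)) + (\<Sum>n\<in>J \<inter> {..<0}. f (nat \<bar>n\<bar>))"
    using assms(1) by (subst sum.union_disjoint[symmetric]) (auto intro!: sum.cong)
  also have "\<dots> \<le> 2 * (\<Sum>i\<in>I. f i)"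
    using half[of "J \<inter> {0..}"] half[of "J \<inter> {..<0}"] by (force simp: inj_on_def)
  finally show ?thesis .
qed

text \<open>In the constant 4, one factor 2 counts the two signs of j - k and the other absorbs
  floor R + 1 \<le> 2 R, since 2 powr (1 - l) \<le> 2.\<close>

lemma sum_near_le:
  fixes l R :: real and j :: int
  assumes "finite K" "\<And>k. k \<in> K \<Longrightarrow> \<bar>real_of_int (j - k)\<bar> \<le> R" "0 \<le> l" "l < 1" "R \<ge> 1"
  shows "(\<Sum>k\<in>K. (1 + \<bar>real_of_int (j - k)\<bar>) powr (- l)) \<le> 4 / (1 - l) * R powr (1 - l)"
proof -
  define m where "m = nat \<lfloor>R\<rfloor>"
  define f where "f i = (1 + real i) powr (- l)" for i
  have inj: "inj_on (\<lambda>k. j - k) K" by (auto simp: inj_on_def)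
  have "(\<Sum>k\<in>K. (1 + \<bar>real_of_int (j - k)\<bar>) powr (- l)) = (\<Sum>n\<in>(\<lambda>k. j - k) ` K. f (nat \<bar>n\<bar>))"
    by (subst sum.reindex[OF inj]) (simp add: f_def)
  also have "\<dots> \<le> 2 * (\<Sum>i\<in>{0..m}. f i)"
  proof (intro sum_abs_int_le)
    show "(\<lambda>n. nat \<bar>n\<bar>) ` (\<lambda>k. j - k) ` K \<subseteq> {0..m}"
      using assms(2,5) unfolding m_def by (fastforce simp: le_nat_iff le_floor_iff nat_le_iff)
  qed (use assms in \<open>auto simp: f_def\<close>)
  also have "(\<Sum>i\<in>{0..m}. f i) = (\<Sum>i=1..Suc m. real i powr (- l))"
    using sum.shift_bounds_cl_Suc_ivl[of "\<lambda>i. real i powr (- l)" 0 m] by (simp add: f_def)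
  also have "\<dots> \<le> real (Suc m) powr (1 - l) / (1 - l)"
    using assms by (intro sum_powr_minus_le) auto
  also have "\<dots> \<le> (2 * R) powr (1 - l) / (1 - l)"
    using assms unfolding m_def by (intro divide_right_mono powr_mono2) linarith+
  also have "\<dots> \<le> 2 * R powr (1 - l) / (1 - l)"
    using assms powr_mono[of "1 - l" 1 2]
    by (intro divide_right_mono) (auto simp: powr_mult mult_right_mono)
  finally show ?thesis by (simp add: field_simps)
qed

lemma sum_far_le:
  fixes R :: real and j :: int
  assumes "finite K" "\<And>k. k \<in> K \<Longrightarrow> \<bar>real_of_int (j - k)\<bar> \<ge> R" "R \<ge> 1"
  shows "(\<Sum>k\<in>K. (1 + \<bar>real_of_int (j - k)\<bar>) powr (- 2)) \<le> 2 / R"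
proof -
  define m where "m = nat \<lceil>R\<rceil>"
  define f where "f i = 1 / (1 + real i)\<^sup>2" for i
  have m1: "m \<ge> 1" "real m \<ge> R" using assms(3) unfolding m_def by linarith+
  have inj: "inj_on (\<lambda>k. j - k) K" by (auto simp: inj_on_def)
  define I where "I = (\<lambda>n. nat \<bar>n\<bar>) ` (\<lambda>k. j - k) ` K"
  have "finite I" using assms by (auto simp: I_def)
  then obtain n where n: "I \<subseteq> {..<n}" using finite_nat_iff_bounded by auto
  have "(\<Sum>k\<in>K. (1 + \<bar>real_of_int (j - k)\<bar>) powr (- 2)) = (\<Sum>n\<in>(\<lambda>k. j - k) ` K. f (nat \<bar>n\<bar>))"
    by (subst sum.reindex[OF inj]) (auto simp: f_def powr_minus powr_realpow field_simps)
  also have "\<dots> \<le> 2 * (\<Sum>i\<in>{m..<m+n}. f i)"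
  proof (intro sum_abs_int_le)
    have "m \<le> i" if "i \<in> I" for i
      using that assms(2) unfolding I_def m_def by (fastforce simp: nat_le_iff ceiling_le_iff)
    with n show "(\<lambda>n. nat \<bar>n\<bar>) ` (\<lambda>k. j - k) ` K \<subseteq> {m..<m+n}"
      unfolding I_def[symmetric] by fastforce
  qed (use assms in \<open>auto simp: f_def\<close>)
  also have "(\<Sum>i\<in>{m..<m+n}. f i) \<le> 1 / real m"
    unfolding f_def by (rule sum_inverse_square_tail[OF m1(1)])
  also have "\<dots> \<le> 1 / R"
    using m1 assms by (intro divide_left_mono) auto
  finally show ?thesis by simp
qed

text \<open>Restricting to \<open>b k \<le> b j\<close>, the sum over \<open>k\<close> is split at distance \<open>(b j) powr (- q')\<close>; near terms are bounded
  using \<open>b k \<le> b j\<close>, far terms by Young's inequality.\<close>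

lemma hls_row:
  fixes b :: "int \<Rightarrow> real" and q :: real
  assumes q: "q > 2" and fin: "finite K" and b0: "\<And>k. k \<in> K \<Longrightarrow> 0 \<le> b k"
    and s: "0 < s" "s \<le> 1" and bs: "\<And>k. k \<in> K \<Longrightarrow> b k \<le> s"
    and sum: "(\<Sum>k\<in>K. b k powr (q / (q - 1))) \<le> 1"
  shows "(\<Sum>k\<in>K. b k * (1 + \<bar>real_of_int (j - k)\<bar>) powr (- (2 / q)))
      \<le> (4 / (1 - 2 / q) + 3) * s powr (1 / (q - 1))"
proof -
  define q' where "q' = q / (q - 1)"
  have q': "q' > 1" "1 / q' + 1 / q = 1" using q by (auto simp: q'_def field_simps)
  \<comment> \<open>As the sum of b k powr q' is at most 1, no more than s powr (- q') indices can
    carry the size s. With this scale the near part s * R powr (1 - 2/q) and the far part R powr (-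
    1/q) are the same power s powr (1/(q - 1)).\<close>
  define R where "R = s powr (- q')"
  have R: "R \<ge> 1" unfolding R_def using s q' ge_one_powr_ge_zero[of "1/s" q']
    by (simp add: powr_minus powr_divide field_simps)
  define w where "w k = (1 + \<bar>real_of_int (j - k)\<bar>) powr (- (2 / q))" for k
  have w0: "w k \<ge> 0" for k by (simp add: w_def)
  \<comment> \<open>The free parameter of Young's inequality, chosen so that t powr q' and t powr (-
    q) / R both equal R powr (- 1/q).\<close>
  define t where "t = R powr (- (1 / (q * q')))"
  have t: "t > 0" using R by (simp add: t_def)
  define A where "A = {k \<in> K. \<bar>real_of_int (j - k)\<bar> \<le> R}"
  define B where "B = {k \<in> K. \<not> \<bar>real_of_int (j - k)\<bar> \<le> R}"
  have "(\<Sum>k\<in>A. b k * w k) \<le> (\<Sum>k\<in>A. s * w k)"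
    by (intro sum_mono mult_right_mono) (use bs w0 in \<open>auto simp: A_def\<close>)
  also have "\<dots> = s * (\<Sum>k\<in>A. w k)" by (simp add: sum_distrib_left)
  also have "\<dots> \<le> s * (4 / (1 - 2 / q) * R powr (1 - 2 / q))"
    unfolding w_def using q fin R s by (intro mult_left_mono sum_near_le) (auto simp: A_def)
  also have "\<dots> = 4 / (1 - 2 / q) * (s * R powr (1 - 2 / q))" by simp
  also have "s * R powr (1 - 2 / q) = s powr (1 + (- q') * (1 - 2 / q))"
    unfolding R_def using s by (subst powr_add) (simp add: powr_powr)
  also have "1 + (- q') * (1 - 2 / q) = 1 / (q - 1)"
    using q by (simp add: q'_def field_simps)
  finally have near: "(\<Sum>k\<in>A. b k * w k) \<le> 4 / (1 - 2 / q) * s powr (1 / (q - 1))" .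
  have pt: "b k * w k \<le> t powr q' * b k powr q' + t powr (- q) * (w k) powr q" if "k \<in> B" for k
  proof -
    have bk: "b k \<ge> 0" using that b0 by (auto simp: B_def)
    have "b k * w k = (t * b k) * (w k / t)" using t by simp
    also have "\<dots> \<le> (t * b k) powr q' / q' + (w k / t) powr q / q"
      using q' q t bk w0 by (intro Youngs_inequality) auto
    also have "\<dots> \<le> (t * b k) powr q' + (w k / t) powr q"
      using q' q by (intro add_mono) (auto simp: divide_le_eq mult_le_cancel_left1)
    also have "\<dots> = t powr q' * b k powr q' + t powr (- q) * (w k) powr q"
      using t bk w0 by (simp add: powr_mult powr_divide powr_minus field_simps)
    finally show ?thesis .
  qed
  have "(\<Sum>k\<in>B. b k * w k) \<le> (\<Sum>k\<in>B. t powr q' * b k powr q' + t powr (- q) * (w k) powr q)"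
    by (intro sum_mono pt)
  also have "\<dots> = t powr q' * (\<Sum>k\<in>B. b k powr q') + t powr (- q) * (\<Sum>k\<in>B. (w k) powr q)"
    by (simp add: sum.distrib sum_distrib_left)
  also have "\<dots> \<le> t powr q' * 1 + t powr (- q) * (2 / R)"
  proof (intro add_mono mult_left_mono)
    have "(\<Sum>k\<in>B. b k powr q') \<le> (\<Sum>k\<in>K. b k powr q')"
      using fin by (intro sum_mono2) (auto simp: B_def)
    with sum show "(\<Sum>k\<in>B. b k powr q') \<le> 1" by (simp add: q'_def)
    have "(\<Sum>k\<in>B. (w k) powr q) = (\<Sum>k\<in>B. (1 + \<bar>real_of_int (j - k)\<bar>) powr (- 2))"
      using q by (intro sum.cong) (auto simp: w_def powr_powr)
    also have "\<dots> \<le> 2 / R" using fin R by (intro sum_far_le) (auto simp: B_def)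
    finally show "(\<Sum>k\<in>B. (w k) powr q) \<le> 2 / R" .
  qed auto
  also have "t powr q' = R powr (- (1 / q))"
    using q' q by (simp add: t_def powr_powr)
  also have "t powr (- q) * (2 / R) = 2 * R powr (- (1 / q))"
  proof -
    have "t powr (- q) = R powr (1 / q')" using q' q by (simp add: t_def powr_powr)
    also have "1 / q' = 1 + (- (1 / q))" using q' by simp
    also have "R powr (1 + (- (1 / q))) = R * R powr (- (1 / q))"
      using R by (subst powr_add) auto
    finally show ?thesis using R by simp
  qed
  also have "R powr (- (1 / q)) = s powr (1 / (q - 1))"
    using q by (simp add: R_def powr_powr q'_def)
  finally have far: "(\<Sum>k\<in>B. b k * w k) \<le> 3 * s powr (1 / (q - 1))" by simp
  have "(\<Sum>k\<in>K. b k * w k) = (\<Sum>k\<in>A. b k * w k) + (\<Sum>k\<in>B. b k * w k)"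
    using fin by (subst sum.union_disjoint[symmetric]) (auto simp: A_def B_def intro!: sum.cong)
  with near far show ?thesis by (simp add: w_def algebra_simps)
qed

text \<open>Every pair is charged to its larger entry. The row estimate then leaves b j * b j powr
  (1/(q - 1)) = b j powr q', with q' the dual exponent of q, and these sum to at most 1; the
  symmetric half of the pairs costs the factor 2.\<close>

lemma discrete_hls:
  fixes b :: "int \<Rightarrow> real" and q :: real
  assumes q: "q > 2" and fin: "finite K" and b0: "\<And>k. k \<in> K \<Longrightarrow> 0 \<le> b k"
    and sum: "(\<Sum>k\<in>K. b k powr (q / (q - 1))) \<le> 1"
  shows "(\<Sum>j\<in>K. \<Sum>k\<in>K. b j * b k * (1 + \<bar>real_of_int (j - k)\<bar>) powr (- (2 / q)))
      \<le> 2 * (4 / (1 - 2 / q) + 3)"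
proof -
  define q' where "q' = q / (q - 1)"
  have q': "q' > 1" using q by (auto simp: q'_def field_simps)
  define w where "w j k = (1 + \<bar>real_of_int (j - k)\<bar>) powr (- (2 / q))" for j k
  have w0: "w j k \<ge> 0" for j k by (simp add: w_def)
  have wc: "w j k = w k j" for j k by (simp add: w_def abs_minus_commute)
  define C where "C = 4 / (1 - 2 / q) + 3"
  define f where "f j k = (if b k \<le> b j then b j * b k * w j k else 0)" for j k
  have b1: "b j \<le> 1" if "j \<in> K" for j
  proof (rule ccontr)
    assume "\<not> b j \<le> 1"
    then have "1 < b j powr q'" using q' by (simp add: gr_one_powr)
    also have "\<dots> \<le> (\<Sum>k\<in>K. b k powr q')"
      using that fin by (intro member_le_sum) auto
    finally show False using sum by (simp add: q'_def)
  qed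
  have row: "(\<Sum>k\<in>K. f j k) \<le> C * b j powr q'" if j: "j \<in> K" for j
  proof (cases "b j = 0")
    case True
    then have "f j k = 0" for k by (simp add: f_def)
    then show ?thesis using True by simp
  next
    case False
    with b0 j have bj: "b j > 0" by force
    define L where "L = {k \<in> K. b k \<le> b j}"
    have "(\<Sum>k\<in>K. f j k) = b j * (\<Sum>k\<in>L. b k * w j k)"
      unfolding f_def L_def using fin
      by (simp add: sum.inter_filter sum_distrib_left if_distrib mult.assoc cong: if_cong)
    also have "(\<Sum>k\<in>L. b k * w j k) \<le> C * b j powr (1 / (q - 1))"
      unfolding w_def C_def
    proof (rule hls_row[OF q])
      have "(\<Sum>k\<in>L. b k powr (q / (q - 1))) \<le> (\<Sum>k\<in>K. b k powr (q / (q - 1)))"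
        using fin by (intro sum_mono2) (auto simp: L_def)
      with sum show "(\<Sum>k\<in>L. b k powr (q / (q - 1))) \<le> 1" by simp
    qed (use fin b0 bj b1 j in \<open>auto simp: L_def\<close>)
    also have "b j * (C * b j powr (1 / (q - 1))) = C * b j powr (1 + 1 / (q - 1))"
      using bj by (simp add: powr_add)
    also have "1 + 1 / (q - 1) = q'" using q by (simp add: q'_def field_simps)
    finally show ?thesis using bj by simp
  qed
  have C0: "C \<ge> 0" using q by (simp add: C_def)
  have "(\<Sum>j\<in>K. \<Sum>k\<in>K. f j k) \<le> (\<Sum>j\<in>K. C * b j powr q')"
    by (intro sum_mono row)
  also have "\<dots> = C * (\<Sum>j\<in>K. b j powr q')" by (simp add: sum_distrib_left)
  also have "\<dots> \<le> C * 1" using sum C0 by (intro mult_left_mono) (auto simp: q'_def)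
  finally have half: "(\<Sum>j\<in>K. \<Sum>k\<in>K. f j k) \<le> C" by simp
  have "(\<Sum>j\<in>K. \<Sum>k\<in>K. b j * b k * w j k) \<le> (\<Sum>j\<in>K. \<Sum>k\<in>K. f j k + f k j)"
  proof (intro sum_mono)
    fix j k assume "j \<in> K" "k \<in> K"
    then have "b j * b k * w j k \<ge> 0" using b0 w0 by simp
    then show "b j * b k * w j k \<le> f j k + f k j"
      using wc[of j k] by (auto simp: f_def)
  qed
  also have "\<dots> = (\<Sum>j\<in>K. \<Sum>k\<in>K. f j k) + (\<Sum>j\<in>K. \<Sum>k\<in>K. f k j)"
    by (simp add: sum.distrib)
  also have "(\<Sum>j\<in>K. \<Sum>k\<in>K. f k j) = (\<Sum>j\<in>K. \<Sum>k\<in>K. f j k)"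
    by (rule sum.swap)
  finally show ?thesis using half by (simp add: w_def C_def)
qed

section \<open>Gaussian integrals and Weyl sums\<close>

lemma integrable_gauss:
  fixes a :: real
  assumes "a > 0"
  shows "integrable lborel (\<lambda>v. exp (- a * v\<^sup>2))"
proof -
  have "integrable lborel (\<lambda>v. sqrt (pi / a) * normal_density 0 (sqrt (1 / (2 * a))) v)"
    using assms by (intro integrable_mult_right integrable_normal_density) auto
  also have "(\<lambda>v. sqrt (pi / a) * normal_density 0 (sqrt (1 / (2 * a))) v) = (\<lambda>v. exp (- a * v\<^sup>2))"
    using assms by (auto simp: normal_density_def field_simps real_sqrt_divide real_sqrt_mult)
  finally show ?thesis .
qed

text \<open>This is the characteristic function of the standard normal distribution at b/c, rescaled
  by c = sqrt (2a).\<close>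

lemma integral_gauss_cis:
  fixes a b :: real
  assumes "a > 0"
  shows "(LINT v|lborel. of_real (exp (- a * v\<^sup>2)) * cis (b * v)) = of_real (sqrt (pi / a) * exp (- b\<^sup>2 / (4 * a)))"
proof -
  define c where "c = sqrt (2 * a)"
  have c: "c > 0" "c\<^sup>2 = 2 * a" using assms by (auto simp: c_def)
  have "of_real (exp (- (b / c)\<^sup>2 / 2)) = char std_normal_distribution (b / c)"
    by (simp add: char_std_normal_distribution)
  also have "\<dots> = (LINT x|lborel. std_normal_density x *\<^sub>R iexp (b / c * x))"
    unfolding char_def by (subst integral_density) auto
  also have "\<dots> = c *\<^sub>R (LINT v|lborel. std_normal_density (c * v) *\<^sub>R iexp (b / c * (c * v)))"
    using c by (subst lborel_integral_real_affine[where c=c and t=0]) auto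
  also have "(\<lambda>v. std_normal_density (c * v) *\<^sub>R iexp (b / c * (c * v)))
      = (\<lambda>v. of_real (1 / sqrt (2 * pi)) * (of_real (exp (- a * v\<^sup>2)) * cis (b * v)))"
    using c by (auto simp: std_normal_density_def scaleR_conv_of_real power_mult_distrib cis_conv_exp
        field_simps)
  also have "c *\<^sub>R (LINT v|lborel. of_real (1 / sqrt (2 * pi)) * (of_real (exp (- a * v\<^sup>2)) * cis (b * v)))
      = of_real (c / sqrt (2 * pi)) * (LINT v|lborel. of_real (exp (- a * v\<^sup>2)) * cis (b * v))"
    by (simp add: scaleR_conv_of_real)
  finally have eq: "of_real (exp (- (b / c)\<^sup>2 / 2)) =
      of_real (c / sqrt (2 * pi)) * (LINT v|lborel. of_real (exp (- a * v\<^sup>2)) * cis (b * v))" .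
  have "sqrt (pi / a) * (c / sqrt (2 * pi)) = 1"
    using assms by (simp add: c_def real_sqrt_mult real_sqrt_divide)
  then have "(LINT v|lborel. of_real (exp (- a * v\<^sup>2)) * cis (b * v))
     = of_real (sqrt (pi / a)) * (of_real (c / sqrt (2 * pi)) * (LINT v|lborel. of_real (exp (- a * v\<^sup>2)) * cis (b * v)))"
    by (metis (no_types, lifting) mult.assoc mult_1 of_real_1 of_real_mult)
  also have "\<dots> = of_real (sqrt (pi / a)) * of_real (exp (- (b / c)\<^sup>2 / 2))"
    by (simp only: eq)
  also have "- (b / c)\<^sup>2 / 2 = - b\<^sup>2 / (4 * a)"
    using c by (simp add: power_divide)
  finally show ?thesis by simp
qed

lemma integral_gauss:
  fixes a :: real
  assumes "a > 0"
  shows "(LINT v|lborel. exp (- a * v\<^sup>2)) = sqrt (pi / a)"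
proof -
  have "complex_of_real (LINT v|lborel. exp (- a * v\<^sup>2)) = of_real (sqrt (pi / a))"
    using integral_gauss_cis[OF assms, of 0] by (simp flip: integral_complex_of_real)
  then show ?thesis by (simp only: of_real_eq_iff)
qed

definition gauss_kernel :: "real \<Rightarrow> real \<Rightarrow> real \<Rightarrow> complex" where
  "gauss_kernel \<sigma> \<tau> x =
     (LINT \<xi>|lborel. of_real (exp (- \<xi>\<^sup>2 / (2 * \<sigma>\<^sup>2))) * cis (\<xi> * x - \<tau> * \<xi>\<^sup>2))"

text \<open>Differencing: in \<open>\<bar>gauss_kernel\<bar>\<^sup>2\<close>, written as a double integral over \<open>\<xi>\<close> and \<open>\<xi> - h\<close>, the
  inner integral is the Fourier transform of a real Gaussian, so no complex Gaussian is needed.\<close>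

lemma norm_gauss_kernel:
  assumes "\<sigma> > 0"
  shows "(norm (gauss_kernel \<sigma> \<tau> x))\<^sup>2 \<le> pi / sqrt (1 / (4 * \<sigma> ^ 4) + \<tau>\<^sup>2)"
proof -
  define f where "f \<xi> = of_real (exp (- \<xi>\<^sup>2 / (2 * \<sigma>\<^sup>2))) * cis (\<xi> * x - \<tau> * \<xi>\<^sup>2)" for \<xi>
  have [measurable]: "f \<in> borel_measurable borel"
    unfolding f_def cis_conv_exp by measurable
  have [measurable]: "cnj \<in> borel_measurable borel"
    by (intro borel_measurable_continuous_onI continuous_intros)
  have normf: "norm (f \<xi>) = exp (- (1 / (2 * \<sigma>\<^sup>2)) * \<xi>\<^sup>2)" for \<xi>
    by (simp add: f_def norm_mult)
  have int_norm: "integrable lborel (\<lambda>\<xi>. norm (f \<xi>))"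
    unfolding normf using assms by (intro integrable_gauss) auto
  then have intf: "integrable lborel f"
    by (subst (asm) integrable_norm_iff) auto
  have intshift: "integrable lborel (\<lambda>h. f (\<xi> - h))" for \<xi>
    using lborel_integrable_real_affine[OF intf, of "-1" \<xi>] by simp
  define I where "I = (LINT h|lborel. norm (f h))"
  have I: "(LINT h|lborel. norm (f (\<xi> - h))) = I" for \<xi>
    unfolding I_def by (subst lborel_integral_real_affine[where c="-1" and t=\<xi>]) auto
  have int2: "integrable (lborel \<Otimes>\<^sub>M lborel) (\<lambda>(\<xi>, h). f \<xi> * cnj (f (\<xi> - h)))"
  proof (intro lborel_pair.Fubini_integrable)
    show "integrable lborel (\<lambda>\<xi>. LINT h|lborel. norm (case (\<xi>, h) of (\<xi>, h) \<Rightarrow> f \<xi> * cnj (f (\<xi> - h))))"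
      using int_norm by (simp add: norm_mult I)
    show "AE \<xi> in lborel. integrable lborel (\<lambda>h. case (\<xi>, h) of (\<xi>, h) \<Rightarrow> f \<xi> * cnj (f (\<xi> - h)))"
      using intshift by (intro AE_I2) auto
  qed measurable
  have inner: "(LINT \<xi>|lborel. f \<xi> * cnj (f (\<xi> - h))) =
      of_real (\<sigma> * sqrt pi) * of_real (exp (- (1 / (4 * \<sigma>\<^sup>2) + \<sigma>\<^sup>2 * \<tau>\<^sup>2) * h\<^sup>2)) * cis (h * x)" for h
  proof -
    \<comment> \<open>Centring the two frequencies at h/2 + v and v - h/2 makes the quadratic phases
      cancel up to the linear term -2 \<tau> h v, and splits the product of Gaussians into a factor
      in h and a factor in v.\<close>
    have "(LINT \<xi>|lborel. f \<xi> * cnj (f (\<xi> - h))) =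
        (LINT v|lborel. f (h / 2 + v) * cnj (f (v - h / 2)))"
      by (subst lborel_integral_real_affine[where c=1 and t="h/2"]) (auto simp: algebra_simps)
    also have "(\<lambda>v. f (h / 2 + v) * cnj (f (v - h / 2))) = (\<lambda>v.
        of_real (exp (- h\<^sup>2 / (4 * \<sigma>\<^sup>2))) * cis (h * x) *
        (of_real (exp (- (1 / \<sigma>\<^sup>2) * v\<^sup>2)) * cis ((- 2 * \<tau> * h) * v)))"
    proof
      fix v
      have "f (h / 2 + v) * cnj (f (v - h / 2)) =
         of_real (exp (- (h / 2 + v)\<^sup>2 / (2 * \<sigma>\<^sup>2)) * exp (- (v - h / 2)\<^sup>2 / (2 * \<sigma>\<^sup>2))) *
         (cis ((h / 2 + v) * x - \<tau> * (h / 2 + v)\<^sup>2) * cis (- ((v - h / 2) * x - \<tau> * (v - h / 2)\<^sup>2)))"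
        by (simp add: f_def cis_cnj del: minus_diff_eq)
      also have "exp (- (h / 2 + v)\<^sup>2 / (2 * \<sigma>\<^sup>2)) * exp (- (v - h / 2)\<^sup>2 / (2 * \<sigma>\<^sup>2))
          = exp (- h\<^sup>2 / (4 * \<sigma>\<^sup>2)) * exp (- (1 / \<sigma>\<^sup>2) * v\<^sup>2)"
      proof -
        have "- (h / 2 + v)\<^sup>2 / (2 * \<sigma>\<^sup>2) + - (v - h / 2)\<^sup>2 / (2 * \<sigma>\<^sup>2) = - h\<^sup>2 / (4 * \<sigma>\<^sup>2) + - (1 / \<sigma>\<^sup>2) * v\<^sup>2"
          using assms by (simp add: field_simps power2_eq_square)
        then show ?thesis by (simp only: exp_add[symmetric])
      qed
      also have "cis ((h / 2 + v) * x - \<tau> * (h / 2 + v)\<^sup>2) * cis (- ((v - h / 2) * x - \<tau> * (v - h / 2)\<^sup>2))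
          = cis (h * x) * cis ((- 2 * \<tau> * h) * v)"
        unfolding cis_mult by (rule arg_cong[of _ _ cis]) (simp add: power2_eq_square field_simps)
      finally show "f (h / 2 + v) * cnj (f (v - h / 2)) =
        of_real (exp (- h\<^sup>2 / (4 * \<sigma>\<^sup>2))) * cis (h * x) *
        (of_real (exp (- (1 / \<sigma>\<^sup>2) * v\<^sup>2)) * cis ((- 2 * \<tau> * h) * v))"
        by simp
    qed
    also have "(LINT v|lborel. of_real (exp (- h\<^sup>2 / (4 * \<sigma>\<^sup>2))) * cis (h * x) *
        (of_real (exp (- (1 / \<sigma>\<^sup>2) * v\<^sup>2)) * cis ((- 2 * \<tau> * h) * v))) =
       of_real (exp (- h\<^sup>2 / (4 * \<sigma>\<^sup>2))) * cis (h * x) *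
         of_real (sqrt (pi / (1 / \<sigma>\<^sup>2)) * exp (- (- 2 * \<tau> * h)\<^sup>2 / (4 * (1 / \<sigma>\<^sup>2))))"
      using assms by (subst integral_mult_right_zero, subst integral_gauss_cis) auto
    also have "sqrt (pi / (1 / \<sigma>\<^sup>2)) = \<sigma> * sqrt pi"
      using assms by (simp add: real_sqrt_mult)
    also have "of_real (exp (- h\<^sup>2 / (4 * \<sigma>\<^sup>2))) * cis (h * x) *
         of_real (\<sigma> * sqrt pi * exp (- (- 2 * \<tau> * h)\<^sup>2 / (4 * (1 / \<sigma>\<^sup>2)))) =
       of_real (\<sigma> * sqrt pi) * of_real (exp (- h\<^sup>2 / (4 * \<sigma>\<^sup>2)) * exp (- (- 2 * \<tau> * h)\<^sup>2 / (4 * (1 / \<sigma>\<^sup>2)))) * cis (h * x)"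
      by simp
    also have "exp (- h\<^sup>2 / (4 * \<sigma>\<^sup>2)) * exp (- (- 2 * \<tau> * h)\<^sup>2 / (4 * (1 / \<sigma>\<^sup>2)))
       = exp (- (1 / (4 * \<sigma>\<^sup>2) + \<sigma>\<^sup>2 * \<tau>\<^sup>2) * h\<^sup>2)"
    proof -
      have "- h\<^sup>2 / (4 * \<sigma>\<^sup>2) + - (- 2 * \<tau> * h)\<^sup>2 / (4 * (1 / \<sigma>\<^sup>2)) = - (1 / (4 * \<sigma>\<^sup>2) + \<sigma>\<^sup>2 * \<tau>\<^sup>2) * h\<^sup>2"
        using assms by (simp add: field_simps power2_eq_square)
      then show ?thesis by (simp only: exp_add[symmetric])
    qed
    finally show ?thesis .
  qed
  define b where "b = 1 / (4 * \<sigma>\<^sup>2) + \<sigma>\<^sup>2 * \<tau>\<^sup>2"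
  have b: "b > 0" using assms by (auto simp: b_def intro!: add_pos_nonneg)
  have "complex_of_real ((norm (gauss_kernel \<sigma> \<tau> x))\<^sup>2) = (LINT \<xi>|lborel. f \<xi>) * cnj (LINT \<xi>'|lborel. f \<xi>')"
    unfolding gauss_kernel_def f_def by (rule complex_norm_square)
  also have "\<dots> = (LINT \<xi>|lborel. f \<xi> * cnj (LINT \<xi>'|lborel. f \<xi>'))" by simp
  also have "\<dots> = (LINT \<xi>|lborel. LINT h|lborel. f \<xi> * cnj (f (\<xi> - h)))"
  proof (intro Bochner_Integration.integral_cong refl)
    fix \<xi>
    have "cnj (LINT \<xi>'|lborel. f \<xi>') = (LINT h|lborel. cnj (f (\<xi> - h)))"
      by (subst lborel_integral_real_affine[where c="-1" and t=\<xi>]) auto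
    then show "f \<xi> * cnj (LINT \<xi>'|lborel. f \<xi>') = (LINT h|lborel. f \<xi> * cnj (f (\<xi> - h)))"
      by (simp only: integral_mult_right_zero)
  qed
  also have "\<dots> = (LINT h|lborel. LINT \<xi>|lborel. f \<xi> * cnj (f (\<xi> - h)))"
    by (rule lborel_pair.Fubini_integral[OF int2, symmetric])
  also have "\<dots> = (LINT h|lborel. of_real (\<sigma> * sqrt pi) * of_real (exp (- b * h\<^sup>2)) * cis (h * x))"
    unfolding inner b_def ..
  finally have "(norm (gauss_kernel \<sigma> \<tau> x))\<^sup>2 =
      norm (LINT h|lborel. of_real (\<sigma> * sqrt pi) * of_real (exp (- b * h\<^sup>2)) * cis (h * x))"
    by (metis norm_of_real abs_power2)
  also have "\<dots> \<le> (LINT h|lborel. norm (of_real (\<sigma> * sqrt pi) * of_real (exp (- b * h\<^sup>2)) * cis (h * x)))"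
    by (rule integral_norm_bound)
  also have "\<dots> = (LINT h|lborel. \<sigma> * sqrt pi * exp (- b * h\<^sup>2))"
    using assms by (simp add: norm_mult)
  also have "\<dots> = \<sigma> * sqrt pi * sqrt (pi / b)"
    using b by (subst integral_mult_right_zero, subst integral_gauss) auto
  \<comment> \<open>The bound interpolates between the value 2 pi times the square of \<sigma> at
    \<tau> = 0, given by the mass of the Gaussian, and the dispersive decay
    pi/\<bar>\<tau>\<bar>.\<close>
  also have "\<dots> = pi / sqrt (1 / (4 * \<sigma> ^ 4) + \<tau>\<^sup>2)"
  proof -
    have eq: "b = \<sigma>\<^sup>2 * (1 / (4 * \<sigma> ^ 4) + \<tau>\<^sup>2)"
      using assms by (simp add: b_def field_simps power2_eq_square power4_eq_xxxx)
    have "sqrt b = \<sigma> * sqrt (1 / (4 * \<sigma> ^ 4) + \<tau>\<^sup>2)"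
      unfolding eq using assms by (subst real_sqrt_mult) auto
    then show ?thesis using assms by (simp add: real_sqrt_divide)
  qed
  finally show ?thesis .
qed

text \<open>The minimum of L and 1/\<bar>sin u\<bar>. The case distinction gives the value L at the
  zeros of the sine, where the convention 1/0 = 0 would turn a literal minimum into 0.\<close>

definition weyl_term :: "real \<Rightarrow> real \<Rightarrow> real" where
  "weyl_term L u = (if \<bar>sin u\<bar> * L \<le> 1 then L else 1 / \<bar>sin u\<bar>)"

text \<open>A geometric sum with ratio \<open>cis (2 * \<theta>)\<close>: multiplication by
  \<open>cis (2 * \<theta>) - 1\<close>, of modulus 2 \<bar>sin \<theta>\<bar>, telescopes it to a
  difference of two unimodular numbers. The other alternative is the number of terms.\<close>

lemma norm_geometric_sum_le:
  fixes \<theta> :: real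
  assumes "real n \<le> L"
  shows "norm (\<Sum>k=a..<a + int n. cis (2 * \<theta> * real_of_int k)) \<le> weyl_term L \<theta>"
proof -
  define S where "S n = (\<Sum>k=a..<a + int n. cis (2 * \<theta> * real_of_int k))" for n
  have "norm (S n) \<le> (\<Sum>k=a..<a + int n. norm (cis (2 * \<theta> * real_of_int k)))"
    unfolding S_def by (rule norm_sum)
  then have triv: "norm (S n) \<le> real n" by simp
  have tel: "(cis (2 * \<theta>) - 1) * S n = cis (2 * \<theta> * real_of_int (a + int n)) - cis (2 * \<theta> * real_of_int a)" for n
  proof (induction n)
    case (Suc n)
    have "{a..<a + int (Suc n)} = insert (a + int n) {a..<a + int n}" by auto
    then have "S (Suc n) = S n + cis (2 * \<theta> * real_of_int (a + int n))"
      by (simp add: S_def)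
    then have "(cis (2 * \<theta>) - 1) * S (Suc n) = (cis (2 * \<theta>) - 1) * S n
        + (cis (2 * \<theta>) - 1) * cis (2 * \<theta> * real_of_int (a + int n))"
      by (simp add: algebra_simps)
    also have "(cis (2 * \<theta>) - 1) * cis (2 * \<theta> * real_of_int (a + int n)) =
        cis (2 * \<theta> * real_of_int (a + int (Suc n))) - cis (2 * \<theta> * real_of_int (a + int n))"
      by (simp add: algebra_simps cis_mult)
    finally show ?case using Suc by simp
  qed (simp add: S_def)
  have "norm (cis (2 * \<theta>) - 1) = 2 * \<bar>sin \<theta>\<bar>"
  proof -
    have "(norm (cis (2 * \<theta>) - 1))\<^sup>2 = (cos (2 * \<theta>) - 1)\<^sup>2 + (sin (2 * \<theta>))\<^sup>2"
      by (simp add: cmod_power2)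
    also have "\<dots> = (2 * \<bar>sin \<theta>\<bar>)\<^sup>2"
    proof -
      have "(sin (2 * \<theta>))\<^sup>2 = 1 - (cos (2 * \<theta>))\<^sup>2" using sin_squared_eq by blast
      moreover have "cos (2 * \<theta>) = 1 - 2 * (sin \<theta>)\<^sup>2" by (rule cos_double_sin)
      ultimately show ?thesis by (simp add: power2_eq_square algebra_simps)
    qed
    finally show ?thesis by (rule power2_eq_imp_eq) auto
  qed
  moreover have "norm ((cis (2 * \<theta>) - 1) * S n) \<le> 2"
    unfolding tel using norm_triangle_ineq4[of "cis (2 * \<theta> * real_of_int (a + int n))" "cis (2 * \<theta> * real_of_int a)"]
    by simp
  ultimately have "\<bar>sin \<theta>\<bar> * norm (S n) \<le> 1" by (simp add: norm_mult)
  then have "norm (S n) \<le> 1 / \<bar>sin \<theta>\<bar>" if "sin \<theta> \<noteq> 0"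
    using that by (simp add: field_simps)
  with triv assms show ?thesis
    unfolding weyl_term_def S_def[symmetric] by (cases "sin \<theta> = 0") auto
qed

definition weyl_sum :: "int \<Rightarrow> real \<Rightarrow> real \<Rightarrow> complex" where
  "weyl_sum M \<tau> y = (\<Sum>k=-M..M. cis (real_of_int k * y - \<tau> * (real_of_int k)\<^sup>2))"

definition weyl_bound :: "int \<Rightarrow> real \<Rightarrow> real" where
  "weyl_bound M \<tau> = (\<Sum>h=-2*M..2*M. weyl_term (2 * real_of_int M + 1) (real_of_int h * \<tau>))"

text \<open>Weyl differencing: squaring the sum and grouping the pairs (k + h, k) by h leaves for
  each h a phase linear in k, hence a geometric sum. The point y enters only through a unimodular
  factor, so the bound is uniform in y.\<close>

lemma norm_weyl_sum:
  assumes "M \<ge> 0"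
  shows "(norm (weyl_sum M \<tau> y))\<^sup>2 \<le> weyl_bound M \<tau>"
proof -
  define f where "f k = cis (real_of_int k * y - \<tau> * (real_of_int k)\<^sup>2)" for k
  define g where "g k h = (if k + h \<in> {-M..M} then f (k + h) * cnj (f k) else 0)" for k h
  have inner: "norm (\<Sum>k=-M..M. g k h) \<le> weyl_term (2 * real_of_int M + 1) (real_of_int h * \<tau>)" for h
  proof -
    \<comment> \<open>The k for which both k and k + h lie in {-M..M} form an interval from a to b
      of at most 2M + 1 integers. If it is empty, \<open>nat\<close> sets its length to 0.\<close>
    define a b where "a = max (-M) (-M - h)" and "b = min M (M - h)"
    define n where "n = nat (b - a + 1)"
    have I: "{k \<in> {-M..M}. k + h \<in> {-M..M}} = {a..<a + int n}"
      by (auto simp: a_def b_def n_def)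
    have "(\<Sum>k=-M..M. g k h) = (\<Sum>k=a..<a + int n. f (k + h) * cnj (f k))"
      unfolding g_def I[symmetric] by (subst sum.inter_filter[symmetric]) simp_all
    also have "\<dots> = (\<Sum>k=a..<a + int n. cis (h * y - \<tau> * h\<^sup>2) * cis (2 * (- (h * \<tau>)) * real_of_int k))"
      by (intro sum.cong refl) (simp add: f_def cis_cnj cis_mult power2_eq_square algebra_simps)
    also have "norm \<dots> = norm (\<Sum>k=a..<a + int n. cis (2 * (- (h * \<tau>)) * real_of_int k))"
      by (simp add: sum_distrib_left[symmetric] norm_mult)
    also have "\<dots> \<le> weyl_term (2 * real_of_int M + 1) (- (h * \<tau>))"
      using assms by (intro norm_geometric_sum_le) (auto simp: n_def a_def b_def)
    also have "\<dots> = weyl_term (2 * real_of_int M + 1) (h * \<tau>)"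
      by (simp add: weyl_term_def)
    finally show ?thesis .
  qed
  have col: "(\<Sum>h=-2*M..2*M. g k h) = weyl_sum M \<tau> y * cnj (f k)" if "k \<in> {-M..M}" for k
  proof -
    have "(\<Sum>h=-2*M..2*M. g k h) = (\<Sum>h\<in>{h \<in> {-2*M..2*M}. k + h \<in> {-M..M}}. f (k + h) * cnj (f k))"
      unfolding g_def by (subst sum.inter_filter[symmetric]) auto
    also have "\<dots> = (\<Sum>j=-M..M. f j * cnj (f k))"
      using that by (intro sum.reindex_bij_witness[where i="\<lambda>j. j - k" and j="\<lambda>h. k + h"]) auto
    finally show ?thesis by (simp add: weyl_sum_def f_def sum_distrib_right)
  qed
  have "complex_of_real ((norm (weyl_sum M \<tau> y))\<^sup>2) = weyl_sum M \<tau> y * cnj (weyl_sum M \<tau> y)"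
    by (rule complex_norm_square)
  also have "\<dots> = (\<Sum>k=-M..M. weyl_sum M \<tau> y * cnj (f k))"
    by (subst (2) weyl_sum_def) (simp add: f_def sum_distrib_left)
  also have "\<dots> = (\<Sum>k=-M..M. \<Sum>h=-2*M..2*M. g k h)"
    by (intro sum.cong refl col[symmetric])
  also have "\<dots> = (\<Sum>h=-2*M..2*M. \<Sum>k=-M..M. g k h)"
    by (rule sum.swap)
  finally have "(norm (weyl_sum M \<tau> y))\<^sup>2 = norm (\<Sum>h=-2*M..2*M. \<Sum>k=-M..M. g k h)"
    by (metis norm_of_real abs_power2)
  also have "\<dots> \<le> (\<Sum>h=-2*M..2*M. norm (\<Sum>k=-M..M. g k h))"
    by (rule norm_sum)
  also have "\<dots> \<le> weyl_bound M \<tau>"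
    unfolding weyl_bound_def by (intro sum_mono inner)
  finally show ?thesis .
qed

section \<open>Moments of the Weyl majorant on time slabs\<close>

lemma borel_measurable_weyl_term [measurable]: "weyl_term L \<in> borel_measurable borel"
proof -
  have [measurable]: "(sin :: real \<Rightarrow> real) \<in> borel_measurable borel"
    by (intro borel_measurable_continuous_onI continuous_intros)
  show ?thesis unfolding weyl_term_def by measurable
qed

lemma borel_measurable_weyl_bound [measurable]: "weyl_bound M \<in> borel_measurable borel"
  unfolding weyl_bound_def by measurable

lemma weyl_term_pos: "L > 0 \<Longrightarrow> weyl_term L u > 0"
  unfolding weyl_term_def by (cases "sin u = 0") auto

lemma weyl_term_le: "L > 0 \<Longrightarrow> weyl_term L u \<le> L"
  unfolding weyl_term_def by (cases "sin u = 0") (auto simp: field_simps)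

lemma weyl_term_minus [simp]: "weyl_term L (- u) = weyl_term L u"
  by (simp add: weyl_term_def)

lemma weyl_term_pi_minus: "weyl_term L (pi - u) = weyl_term L u"
  by (simp add: weyl_term_def)

lemma weyl_term_periodic: "weyl_term L (pi * real n + u) = weyl_term L u"
proof -
  have "\<bar>sin (pi * real n + u)\<bar> = \<bar>sin u\<bar>"
    by (simp add: sin_add abs_mult)
  then show ?thesis by (simp add: weyl_term_def)
qed

lemma sin_ge_half:
  assumes "0 \<le> u" "u \<le> pi / 2"
  shows "sin u \<ge> u / 2"
proof (cases "u \<le> pi / 3")
  case True
  have "(\<lambda>x. sin x - x / 2) 0 \<le> (\<lambda>x. sin x - x / 2) u"
  proof (rule DERIV_nonneg_imp_nondecreasing[OF assms(1)])
    fix x assume x: "0 \<le> x" "x \<le> u"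
    have "cos (pi / 3) \<le> cos x" using x True by (intro cos_monotone_0_pi_le) auto
    then have "cos x - 1 / 2 \<ge> 0" by (simp add: cos_60)
    moreover have "((\<lambda>x. sin x - x / 2) has_real_derivative cos x - 1 / 2) (at x)"
      by (auto intro!: derivative_eq_intros)
    ultimately show "\<exists>y. ((\<lambda>x. sin x - x / 2) has_real_derivative y) (at x) \<and> 0 \<le> y" by blast
  qed
  then show ?thesis by simp
next
  case False
  \<comment> \<open>Beyond pi/3 numbers suffice: sin u is at least sqrt 3 / 2 \<ge> 0.85, while u/2
    is at most pi/4 < 0.8.\<close>
  have "sin (pi / 3) \<le> sin u" using False assms by (intro sin_monotone_2pi_le) auto
  moreover have "sin (pi / 3) = sqrt 3 / 2" by (rule sin_60)
  moreover have "sqrt 3 \<ge> 17 / 10" by (rule real_le_rsqrt) (simp add: power2_eq_square)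
  moreover have "pi < 3.2" using pi_approx by simp
  ultimately show ?thesis using assms by simp
qed

lemma weyl_term_le_powr:
  assumes "L > 0" "0 < u" "u \<le> pi / 2"
  shows "weyl_term L u \<le> 2 / u"
proof -
  have s: "sin u \<ge> u / 2" by (rule sin_ge_half) (use assms in auto)
  then have s0: "sin u > 0" using assms by linarith
  have "1 / sin u \<le> 2 / u" using s s0 assms by (simp add: field_simps)
  moreover have "weyl_term L u \<le> 1 / sin u" using s0 by (auto simp: weyl_term_def field_simps)
  ultimately show ?thesis by linarith
qed

lemma nn_integral_Icc_affine:
  fixes c t a b :: real and f :: "real \<Rightarrow> ennreal"
  assumes [measurable]: "f \<in> borel_measurable borel" and "c > 0"
  shows "(\<integral>\<^sup>+u\<in>{t + c * a..t + c * b}. f u \<partial>lborel) = ennreal c * (\<integral>\<^sup>+v\<in>{a..b}. f (t + c * v) \<partial>lborel)"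
proof -
  have "indicator {t + c * a..t + c * b} (t + c * v) = (indicator {a..b} v :: ennreal)" for v
    using assms(2) by (auto simp: indicator_def)
  then show ?thesis
    using assms(2) by (subst nn_integral_real_affine[where c=c and t=t]) auto
qed

lemma nn_integral_powr_from_0:
  fixes a c :: real
  assumes "a > -1" "c \<ge> 0"
  shows "(\<integral>\<^sup>+u\<in>{0..c}. ennreal (u powr a) \<partial>lborel) = ennreal (c powr (a + 1) / (a + 1))"
  using nn_integral_has_integral_lebesgue[OF _ has_integral_powr_from_0[OF assms]]
  by (simp add: ennreal_mult' ennreal_indicator mult.commute)

lemma nn_integral_powr_to_inf:
  fixes a e :: real
  assumes "e < -1" "a > 0"
  shows "(\<integral>\<^sup>+u\<in>{a..}. ennreal (u powr e) \<partial>lborel) = ennreal (a powr (e + 1) / (- e - 1))"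
proof -
  have "- (a powr (e + 1)) / (e + 1) = a powr (e + 1) / (- e - 1)"
    using assms by (simp add: field_simps)
  then show ?thesis
    using nn_integral_has_integral_lebesgue[OF _ has_integral_powr_to_inf[OF assms]]
    by (simp add: ennreal_mult' ennreal_indicator mult.commute)
qed

text \<open>The integral is cut at u = 1/L, using the bound L below and 2/u above. The condition s <
  1 makes the weight integrable at 0, r + s > 1 makes the tail integrable, and both pieces scale
  like L powr (r + s - 1).\<close>

lemma weyl_term_integral_half:
  fixes r s L :: real
  assumes "0 \<le> s" "s < 1" "r + s > 1" "r > 0" "L \<ge> 1"
  shows "(\<integral>\<^sup>+u\<in>{0..pi/2}. ennreal (u powr (- s) * weyl_term L u powr r) \<partial>lborel)
    \<le> ennreal ((1 / (1 - s) + 2 powr r / (r + s - 1)) * L powr (r + s - 1))"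
proof -
  have pt: "ennreal (u powr (- s) * weyl_term L u powr r) * indicator {0..pi/2} u
     \<le> ennreal (L powr r) * (ennreal (u powr (- s)) * indicator {0..1/L} u)
       + ennreal (2 powr r) * (ennreal (u powr (- (r + s))) * indicator {1/L..} u)" for u
  proof (cases "u \<in> {0<..pi/2}")
    case True
    have "ennreal (u powr (- s) * weyl_term L u powr r) \<le> ennreal (L powr r) * ennreal (u powr (- s))"
      if "u \<le> 1 / L"
    proof -
      have "weyl_term L u powr r \<le> L powr r"
        using weyl_term_le[of L u] weyl_term_pos[of L u] assms by (intro powr_mono2) auto
      then have "u powr (- s) * weyl_term L u powr r \<le> u powr (- s) * L powr r"
        by (intro mult_left_mono) auto
      then show ?thesis
        by (simp add: ennreal_mult[symmetric] mult.commute)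
    qed
    moreover have "ennreal (u powr (- s) * weyl_term L u powr r) \<le> ennreal (2 powr r) * ennreal (u powr (- (r + s)))"
    proof -
      have "weyl_term L u powr r \<le> (2 / u) powr r"
        using weyl_term_le_powr[of L u] weyl_term_pos[of L u] assms True by (intro powr_mono2) auto
      also have "\<dots> = 2 powr r * u powr (- r)"
        using True by (simp add: powr_divide powr_minus field_simps)
      finally have "u powr (- s) * weyl_term L u powr r \<le> u powr (- s) * (2 powr r * u powr (- r))"
        by (intro mult_left_mono) auto
      also have "\<dots> = 2 powr r * u powr (- (r + s))"
        using powr_add[of u "- s" "- r"] by (simp add: add.commute)
      finally show ?thesis by (simp add: ennreal_mult[symmetric])
    qed
    ultimately show ?thesis
      using True assms by (auto simp: indicator_def intro: add_increasing2 add_increasing)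
  qed (auto simp: indicator_def not_less)
  have "(\<integral>\<^sup>+u\<in>{0..pi/2}. ennreal (u powr (- s) * weyl_term L u powr r) \<partial>lborel)
     \<le> (\<integral>\<^sup>+u. ennreal (L powr r) * (ennreal (u powr (- s)) * indicator {0..1/L} u)
       + ennreal (2 powr r) * (ennreal (u powr (- (r + s))) * indicator {1/L..} u) \<partial>lborel)"
    by (intro nn_integral_mono pt)
  also have "\<dots> = ennreal (L powr r) * (\<integral>\<^sup>+u\<in>{0..1/L}. ennreal (u powr (- s)) \<partial>lborel)
       + ennreal (2 powr r) * (\<integral>\<^sup>+u\<in>{1/L..}. ennreal (u powr (- (r + s))) \<partial>lborel)"
    by (simp add: nn_integral_add nn_integral_cmult)
  also have "\<dots> = ennreal (L powr r) * ennreal ((1 / L) powr (- s + 1) / (- s + 1))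
       + ennreal (2 powr r) * ennreal ((1 / L) powr (- (r + s) + 1) / (- (- (r + s)) - 1))"
    using assms by (subst nn_integral_powr_from_0, simp, simp, subst nn_integral_powr_to_inf) auto
  also have "\<dots> = ennreal (L powr r * ((1 / L) powr (- s + 1) / (- s + 1))
       + 2 powr r * ((1 / L) powr (- (r + s) + 1) / (- (- (r + s)) - 1)))"
    using assms by (simp add: ennreal_mult[symmetric] ennreal_plus[symmetric] del: ennreal_plus)
  also have "(1 / L) powr (- s + 1) = L powr (s - 1)"
    using assms powr_minus[of L "1 - s"] by (simp add: powr_divide field_simps)
  also have "(1 / L) powr (- (r + s) + 1) = L powr (r + s - 1)"
    using assms powr_minus[of L "r + s - 1"] by (simp add: powr_divide field_simps)
  also have "L powr r * (L powr (s - 1) / (- s + 1)) = L powr (r + s - 1) / (1 - s)"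
    using powr_add[of L r "s - 1"] by (simp add: add_diff_eq)
  finally show ?thesis by (simp add: field_simps)
qed

lemma weyl_term_integral_half0:
  fixes r L :: real
  assumes "r > 1" "L \<ge> 1"
  shows "(\<integral>\<^sup>+u\<in>{0..pi/2}. ennreal (weyl_term L u powr r) \<partial>lborel)
    \<le> ennreal ((1 + 2 powr r / (r - 1)) * L powr (r - 1))"
proof -
  \<comment> \<open>The case s = 0 of the weighted estimate, except that \<open>0 powr 0\<close> is
    0: the trivial weight differs from 1 at the origin, a null set.\<close>
  have "AE u in lborel. (u::real) \<noteq> 0" by (rule AE_lborel_singleton)
  then have "AE u in lborel. ennreal (weyl_term L u powr r) * indicator {0..pi/2} u =
      ennreal (u powr (- 0) * weyl_term L u powr r) * indicator {0..pi/2} u"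
    by eventually_elim simp
  then have "(\<integral>\<^sup>+u\<in>{0..pi/2}. ennreal (weyl_term L u powr r) \<partial>lborel) =
      (\<integral>\<^sup>+u\<in>{0..pi/2}. ennreal (u powr (- 0) * weyl_term L u powr r) \<partial>lborel)"
    by (rule nn_integral_cong_AE)
  also have "\<dots> \<le> ennreal ((1 / (1 - 0) + 2 powr r / (r + 0 - 1)) * L powr (r + 0 - 1))"
    using assms by (intro weyl_term_integral_half) auto
  finally show ?thesis by simp
qed

lemma weyl_term_integral_upper_half:
  "(\<integral>\<^sup>+u\<in>{pi/2..pi}. ennreal (weyl_term L u powr r) \<partial>lborel)
    = (\<integral>\<^sup>+u\<in>{0..pi/2}. ennreal (weyl_term L u powr r) \<partial>lborel)"
proof -
  have eq: "pi + - 1 * u = pi - u" for u :: real by simp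
  have "indicator {pi/2..pi} (pi - u) = (indicator {0..pi/2} u :: ennreal)" for u
    by (auto simp: indicator_def)
  then show ?thesis
    by (subst nn_integral_real_affine[where c="-1" and t=pi]) (simp_all add: eq weyl_term_pi_minus)
qed

lemma weyl_term_integral_period:
  fixes r L :: real and i :: nat
  assumes "r > 1" "L \<ge> 1"
  shows "(\<integral>\<^sup>+u\<in>{pi * i..pi * (i + 1)}. ennreal (weyl_term L u powr r) \<partial>lborel)
    \<le> ennreal (2 * (1 + 2 powr r / (r - 1)) * L powr (r - 1))"
proof -
  define C where "C = (1 + 2 powr r / (r - 1)) * L powr (r - 1)"
  have C0: "C \<ge> 0" using assms by (simp add: C_def)
  have "(\<integral>\<^sup>+u\<in>{pi * i..pi * (i + 1)}. ennreal (weyl_term L u powr r) \<partial>lborel)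
     = (\<integral>\<^sup>+u\<in>{pi * i + 1 * 0..pi * i + 1 * pi}. ennreal (weyl_term L u powr r) \<partial>lborel)"
    by (simp add: algebra_simps)
  also have "\<dots> = (\<integral>\<^sup>+u\<in>{0..pi}. ennreal (weyl_term L u powr r) \<partial>lborel)"
    by (subst nn_integral_Icc_affine) (simp_all add: weyl_term_periodic)
  also have "\<dots> \<le> (\<integral>\<^sup>+u. ennreal (weyl_term L u powr r) * indicator {0..pi/2} u
      + ennreal (weyl_term L u powr r) * indicator {pi/2..pi} u \<partial>lborel)"
    by (intro nn_integral_mono) (auto simp: indicator_def)
  also have "\<dots> = (\<integral>\<^sup>+u\<in>{0..pi/2}. ennreal (weyl_term L u powr r) \<partial>lborel)
      + (\<integral>\<^sup>+u\<in>{pi/2..pi}. ennreal (weyl_term L u powr r) \<partial>lborel)"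
    by (subst nn_integral_add) auto
  also have "\<dots> \<le> ennreal C + ennreal C"
    unfolding weyl_term_integral_upper_half C_def
    by (intro add_mono weyl_term_integral_half0 assms)
  also have "\<dots> = ennreal (2 * C)" using C0 by (simp add: ennreal_plus[symmetric] del: ennreal_plus)
  also have "2 * C = 2 * (1 + 2 powr r / (r - 1)) * L powr (r - 1)" by (simp add: C_def)
  finally show ?thesis .
qed

text \<open>Only the half period next to 0 meets the singularity of the weight together with that of
  the sine. In the period starting at pi * i the weight is at most i powr (- s), and summing over
  the periods gives the growth n powr (1 - s) in place of n.\<close>

lemma weyl_term_integral_long:
  fixes r L s :: real and n :: nat
  assumes r: "r > 1" and L: "L \<ge> 1" and s: "0 < s" "s < 1" and n: "n \<ge> 1"
  defines "A \<equiv> 1 / (1 - s) + 2 powr r / (r + s - 1)" and "B \<equiv> 1 + 2 powr r / (r - 1)"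
  shows "(\<integral>\<^sup>+u\<in>{0..pi * n}. ennreal (u powr (- s) * weyl_term L u powr r) \<partial>lborel)
    \<le> ennreal (A * L powr (r + s - 1) + B * L powr (r - 1) + 2 * B * L powr (r - 1) * (n powr (1 - s) / (1 - s)))"
proof -
  define f where "f u = ennreal (u powr (- s) * weyl_term L u powr r)" for u
  have [measurable]: "f \<in> borel_measurable borel" unfolding f_def by measurable
  define D where "D = 2 * B * L powr (r - 1)"
  have B0: "B \<ge> 0" and A0: "A \<ge> 0" and D0: "D \<ge> 0"
    using assms by (auto simp: A_def B_def D_def)
  \<comment> \<open>An overlapping cover is enough for an upper bound. The piece i = n lies beyond
    the interval and serves only its right endpoint, where the floor of u/pi is n.\<close>
  have cover: "indicator {0..pi * n} u \<le> indicator {0..pi/2} u + indicator {pi/2..pi} u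
      + (\<Sum>i=1..n. indicator {pi * i..pi * (i + 1)} u :: ennreal)" for u
  proof (cases "u \<in> {pi<..pi * n}")
    case True
    define i where "i = nat \<lfloor>u / pi\<rfloor>"
    have "u / pi \<ge> 1" "u / pi \<le> n" using True by (auto simp: field_simps)
    then have fl: "1 \<le> \<lfloor>u / pi\<rfloor>" "\<lfloor>u / pi\<rfloor> \<le> int n" by linarith+
    then have "real i = real_of_int \<lfloor>u / pi\<rfloor>" unfolding i_def by (intro of_nat_nat) linarith
    moreover have "1 \<le> i" "i \<le> n" unfolding i_def using fl by linarith+
    ultimately have i: "i \<in> {1..n}" "real i \<le> u / pi" "u / pi \<le> real i + 1"
      by auto
    have "u \<in> {pi * i..pi * (i + 1)}"
      using i(2,3) by (auto simp: field_simps)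
    then have "1 \<le> (indicator {pi * i..pi * (i + 1)} u :: ennreal)" by simp
    also have "\<dots> \<le> (\<Sum>i=1..n. indicator {pi * i..pi * (i + 1)} u :: ennreal)"
      using i(1) by (intro member_le_sum) auto
    finally show ?thesis
      by (auto simp: indicator_def intro: add_increasing)
  qed (auto simp: indicator_def not_less not_le)
  have piece: "(\<integral>\<^sup>+u\<in>{pi * i..pi * (i + 1)}. f u \<partial>lborel) \<le> ennreal (D * real i powr (- s))"
    if "i \<in> {1..n}" for i :: nat
  proof -
    have i1: "i \<ge> 1" using that by simp
    have "(\<integral>\<^sup>+u\<in>{pi * i..pi * (i + 1)}. f u \<partial>lborel)
      \<le> (\<integral>\<^sup>+u. ennreal (real i powr (- s)) * (ennreal (weyl_term L u powr r) * indicator {pi * i..pi * (i + 1)} u) \<partial>lborel)"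
    proof (intro nn_integral_mono)
      fix u
      have "u powr (- s) \<le> real i powr (- s)" if u: "u \<in> {pi * i..pi * (i + 1)}"
      proof (rule powr_mono2')
        have "1 * real i \<le> pi * real i" using pi_gt3 by (intro mult_right_mono) auto
        then show "real i \<le> u" using u by simp
      qed (use s i1 in auto)
      then have "u powr (- s) * weyl_term L u powr r \<le> real i powr (- s) * weyl_term L u powr r"
        if "u \<in> {pi * i..pi * (i + 1)}" using that by (intro mult_right_mono) auto
      then show "f u * indicator {pi * i..pi * (i + 1)} u \<le>
        ennreal (real i powr (- s)) * (ennreal (weyl_term L u powr r) * indicator {pi * i..pi * (i + 1)} u)"
        by (auto simp: f_def indicator_def ennreal_mult[symmetric])
    qed
    also have "\<dots> = ennreal (real i powr (- s)) * (\<integral>\<^sup>+u\<in>{pi * i..pi * (i + 1)}. ennreal (weyl_term L u powr r) \<partial>lborel)"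
      by (intro nn_integral_cmult) auto
    also have "\<dots> \<le> ennreal (real i powr (- s)) * ennreal D"
      unfolding D_def B_def by (intro mult_left_mono weyl_term_integral_period r L) auto
    finally show ?thesis using D0 by (simp add: ennreal_mult[symmetric] mult.commute)
  qed
  have upper: "(\<integral>\<^sup>+u\<in>{pi/2..pi}. f u \<partial>lborel) \<le> ennreal (B * L powr (r - 1))"
  proof -
    have "(\<integral>\<^sup>+u\<in>{pi/2..pi}. f u \<partial>lborel) \<le> (\<integral>\<^sup>+u\<in>{pi/2..pi}. ennreal (weyl_term L u powr r) \<partial>lborel)"
    proof (intro nn_integral_mono)
      fix u
      have "u powr (- s) \<le> 1" if u: "u \<in> {pi/2..pi}"
      proof -
        have "u \<ge> 1" using u pi_gt3 by auto
        then show ?thesis using s by (simp add: powr_minus ge_one_powr_ge_zero inverse_le_1_iff)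
      qed
      then have "u powr (- s) * weyl_term L u powr r \<le> weyl_term L u powr r"
        if "u \<in> {pi/2..pi}" using that by (intro mult_left_le_one_le) auto
      then show "f u * indicator {pi/2..pi} u \<le> ennreal (weyl_term L u powr r) * indicator {pi/2..pi} u"
        by (auto simp: f_def indicator_def)
    qed
    also have "\<dots> \<le> ennreal (B * L powr (r - 1))"
      unfolding weyl_term_integral_upper_half B_def by (intro weyl_term_integral_half0 r L)
    finally show ?thesis .
  qed
  have "(\<integral>\<^sup>+u\<in>{0..pi * n}. f u \<partial>lborel)
    \<le> (\<integral>\<^sup>+u. f u * indicator {0..pi/2} u + f u * indicator {pi/2..pi} u
      + (\<Sum>i=1..n. f u * indicator {pi * i..pi * (i + 1)} u) \<partial>lborel)"
    by (intro nn_integral_mono order_trans[OF mult_left_mono[OF cover]])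
      (auto simp: distrib_left sum_distrib_left)
  also have "\<dots> = (\<integral>\<^sup>+u\<in>{0..pi/2}. f u \<partial>lborel) + (\<integral>\<^sup>+u\<in>{pi/2..pi}. f u \<partial>lborel)
      + (\<Sum>i=1..n. \<integral>\<^sup>+u\<in>{pi * i..pi * (i + 1)}. f u \<partial>lborel)"
    by (subst nn_integral_add, simp, simp, subst nn_integral_add, simp, simp, subst nn_integral_sum) auto
  also have "\<dots> \<le> ennreal (A * L powr (r + s - 1)) + ennreal (B * L powr (r - 1))
      + (\<Sum>i=1..n. ennreal (D * real i powr (- s)))"
  proof (intro add_mono sum_mono piece upper)
    show "(\<integral>\<^sup>+u\<in>{0..pi/2}. f u \<partial>lborel) \<le> ennreal (A * L powr (r + s - 1))"
      unfolding f_def A_def using assms by (intro weyl_term_integral_half) auto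
  qed
  also have "\<dots> = ennreal (A * L powr (r + s - 1) + B * L powr (r - 1) + D * (\<Sum>i=1..n. real i powr (- s)))"
    using A0 B0 D0 by (simp add: sum_ennreal sum_distrib_left ennreal_plus[symmetric] sum_nonneg del: ennreal_plus)
  also have "\<dots> \<le> ennreal (A * L powr (r + s - 1) + B * L powr (r - 1) + D * (n powr (1 - s) / (1 - s)))"
    using s D0 by (intro ennreal_leI add_left_mono mult_left_mono sum_powr_minus_le) auto
  finally show ?thesis unfolding f_def D_def .
qed

lemma weyl_term_integral_periods:
  fixes r L :: real and a m :: nat
  assumes "r > 1" "L \<ge> 1"
  shows "(\<integral>\<^sup>+u\<in>{pi * a..pi * (a + m)}. ennreal (weyl_term L u powr r) \<partial>lborel)
    \<le> ennreal (real m * (2 * (1 + 2 powr r / (r - 1)) * L powr (r - 1)))"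
proof (induction m)
  case 0
  have "AE u in lborel. (u::real) \<noteq> pi * a" by (rule AE_lborel_singleton)
  then have "AE u in lborel. ennreal (weyl_term L u powr r) * indicator {pi * a..pi * a} u = 0"
    by eventually_elim auto
  then show ?case by (simp add: nn_integral_0_iff_AE)
next
  case (Suc m)
  define D where "D = 2 * (1 + 2 powr r / (r - 1)) * L powr (r - 1)"
  have D0: "D \<ge> 0" using assms by (simp add: D_def)
  have "(\<integral>\<^sup>+u\<in>{pi * a..pi * (a + Suc m)}. ennreal (weyl_term L u powr r) \<partial>lborel)
    \<le> (\<integral>\<^sup>+u. ennreal (weyl_term L u powr r) * indicator {pi * a..pi * (a + m)} u
        + ennreal (weyl_term L u powr r) * indicator {pi * (a + m)..pi * ((a + m) + 1)} u \<partial>lborel)"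
    by (intro nn_integral_mono) (auto simp: indicator_def algebra_simps)
  also have "\<dots> = (\<integral>\<^sup>+u\<in>{pi * a..pi * (a + m)}. ennreal (weyl_term L u powr r) \<partial>lborel)
     + (\<integral>\<^sup>+u\<in>{pi * (a + m)..pi * ((a + m) + 1)}. ennreal (weyl_term L u powr r) \<partial>lborel)"
    by (subst nn_integral_add) auto
  also have "\<dots> \<le> ennreal (real m * D) + ennreal D"
    using Suc weyl_term_integral_period[OF assms, of "a + m"] unfolding D_def
    by (intro add_mono) simp_all
  also have "\<dots> = ennreal (real (Suc m) * D)"
    using D0 by (simp add: ennreal_plus[symmetric] algebra_simps del: ennreal_plus)
  finally show ?case by (simp add: D_def)
qed

text \<open>Jensen's inequality for the convex power r over the 4M + 1 \<le> 2 L shifts gives the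
  factor (2 L) powr (r - 1); evenness of the majorant in the shift gives the factor 2.\<close>

lemma weyl_bound_powr_le:
  fixes r :: real and M :: int
  assumes "r > 1" "M \<ge> 1"
  defines "L \<equiv> 2 * real_of_int M + 1"
  shows "weyl_bound M \<tau> powr r
      \<le> 2 * (2 * L) powr (r - 1) * (\<Sum>i=0..nat (2 * M). weyl_term L (real i * \<tau>) powr r)"
proof -
  define S where "S = {-2*M..2*M}"
  define c where "c = real (card S)"
  have L: "L > 0" using assms by (simp add: L_def)
  have c: "c > 0" "c \<le> 2 * L" using assms by (auto simp: c_def S_def L_def)
  have pos: "weyl_term L u > 0" for u by (rule weyl_term_pos[OF L])
  have W0: "weyl_bound M \<tau> > 0"
    unfolding weyl_bound_def L_def[symmetric] using assms(2) pos by (intro sum_pos) auto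
  have "(\<Sum>h\<in>S. (1 / c) *\<^sub>R weyl_term L (real_of_int h * \<tau>)) powr r
      \<le> (\<Sum>h\<in>S. (1 / c) * weyl_term L (real_of_int h * \<tau>) powr r)"
    using assms c pos by (intro convex_on_sum[OF _ _ powr_convex]) (auto simp: S_def c_def)
  also have "(\<Sum>h\<in>S. (1 / c) *\<^sub>R weyl_term L (real_of_int h * \<tau>)) = weyl_bound M \<tau> / c"
    by (simp add: weyl_bound_def S_def L_def sum_divide_distrib)
  also have "(weyl_bound M \<tau> / c) powr r = weyl_bound M \<tau> powr r / c powr r"
    using c W0 by (simp add: powr_divide)
  finally have "weyl_bound M \<tau> powr r \<le> c powr r * (1 / c) * (\<Sum>h\<in>S. weyl_term L (real_of_int h * \<tau>) powr r)"
    using c by (simp add: sum_distrib_left[symmetric] sum_divide_distrib[symmetric] field_simps)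
  also have "c powr r * (1 / c) = c powr (r - 1)"
    using c by (simp add: powr_diff)
  also have "c powr (r - 1) * (\<Sum>h\<in>S. weyl_term L (real_of_int h * \<tau>) powr r)
      \<le> (2 * L) powr (r - 1) * (2 * (\<Sum>i=0..nat (2 * M). weyl_term L (real i * \<tau>) powr r))"
  proof (intro mult_mono)
    have ev: "weyl_term L (real_of_int h * \<tau>) = weyl_term L (real (nat \<bar>h\<bar>) * \<tau>)" for h
      using weyl_term_minus[of L "real_of_int h * \<tau>"] by (cases "h \<ge> 0") auto
    show "(\<Sum>h\<in>S. weyl_term L (real_of_int h * \<tau>) powr r) \<le> 2 * (\<Sum>i=0..nat (2 * M). weyl_term L (real i * \<tau>) powr r)"
      unfolding ev by (intro sum_abs_int_le) (auto simp: S_def)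
  qed (use c assms in \<open>auto intro!: powr_mono2 sum_nonneg\<close>)
  finally show ?thesis by (simp add: mult_ac)
qed

text \<open>The substitution u to h u turns the slab into 2h periods and costs h powr (s - 1). This
  factor stays with the singular piece at 0, where it makes the later sum over h gain, and cancels
  exactly the growth h powr (1 - s) of the remaining periods.\<close>

lemma weyl_term_dilate_first:
  fixes r L s :: real and h :: nat
  assumes r: "r > 1" and L: "L \<ge> 1" and s: "0 < s" "s < 1" and h: "h \<ge> 1"
  defines "A \<equiv> 1 / (1 - s) + 2 powr r / (r + s - 1)" and "B \<equiv> 1 + 2 powr r / (r - 1)"
  shows "(\<integral>\<^sup>+u\<in>{0..2*pi}. ennreal (u powr (- s) * weyl_term L (real h * u) powr r) \<partial>lborel)
    \<le> ennreal ((A + B) * L powr (r + s - 1) * h powr (s - 1) + 4 * B / (1 - s) * L powr (r - 1))"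
proof -
  define f where "f u = ennreal (u powr (- s) * weyl_term L u powr r)" for u
  have [measurable]: "f \<in> borel_measurable borel" unfolding f_def by measurable
  have B0: "B \<ge> 0" and A0: "A \<ge> 0" using assms by (auto simp: A_def B_def)
  have h0: "real h > 0" using h by simp
  define X where "X = A * L powr (r + s - 1) + B * L powr (r - 1) + 2 * B * L powr (r - 1) * (real (2 * h) powr (1 - s) / (1 - s))"
  have eq: "ennreal (u powr (- s) * weyl_term L (real h * u) powr r) * indicator {0..2*pi} u
      = ennreal (h powr s) * (f (0 + real h * u) * indicator {0..2*pi} u)" for u
  proof (cases "u \<in> {0..2*pi}")
    case True
    have "h powr s * (real h * u) powr (- s) = u powr (- s)"
      using h0 True by (simp add: powr_mult powr_minus)
    then show ?thesis
      using True by (simp add: f_def ennreal_mult[symmetric] mult.assoc[symmetric])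
  qed simp
  have "(\<integral>\<^sup>+u\<in>{0..2*pi}. ennreal (u powr (- s) * weyl_term L (real h * u) powr r) \<partial>lborel)
      = ennreal (h powr s) * (\<integral>\<^sup>+u\<in>{0..2*pi}. f (0 + real h * u) \<partial>lborel)"
    unfolding eq by (intro nn_integral_cmult) auto
  also have "h powr s = h powr (s - 1) * real h"
    using h0 by (simp add: powr_diff)
  also have "ennreal (h powr (s - 1) * real h) * (\<integral>\<^sup>+u\<in>{0..2*pi}. f (0 + real h * u) \<partial>lborel)
      = ennreal (h powr (s - 1)) * (ennreal (real h) * (\<integral>\<^sup>+u\<in>{0..2*pi}. f (0 + real h * u) \<partial>lborel))"
    by (simp add: ennreal_mult mult.assoc)
  also have "ennreal (real h) * (\<integral>\<^sup>+u\<in>{0..2*pi}. f (0 + real h * u) \<partial>lborel)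
      = (\<integral>\<^sup>+u\<in>{0 + real h * 0..0 + real h * (2 * pi)}. f u \<partial>lborel)"
    using h0 by (subst nn_integral_Icc_affine) simp_all
  also have "{0 + real h * 0..0 + real h * (2 * pi)} = {0..pi * real (2 * h)}"
    by (simp add: mult_ac)
  also have "(\<integral>\<^sup>+u\<in>{0..pi * real (2 * h)}. f u \<partial>lborel) \<le> ennreal X"
    unfolding f_def X_def A_def B_def using h by (intro weyl_term_integral_long r L s) auto
  also have "ennreal (h powr (s - 1)) * ennreal X = ennreal (h powr (s - 1) * X)"
    by (simp add: ennreal_mult')
  also have "\<dots> \<le> ennreal ((A + B) * L powr (r + s - 1) * h powr (s - 1) + 4 * B / (1 - s) * L powr (r - 1))"
  proof (intro ennreal_leI)
    have 1: "B * L powr (r - 1) \<le> B * L powr (r + s - 1)"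
      using B0 L s by (intro mult_left_mono powr_mono) auto
    have "real (2 * h) powr (1 - s) = 2 powr (1 - s) * h powr (1 - s)"
      by (simp add: powr_mult)
    also have "\<dots> \<le> 2 * h powr (1 - s)"
      using s powr_mono[of "1 - s" 1 2] by (intro mult_right_mono) auto
    finally have "2 * B * L powr (r - 1) * (real (2 * h) powr (1 - s) / (1 - s))
        \<le> 2 * B * L powr (r - 1) * (2 * h powr (1 - s) / (1 - s))"
      using s B0 by (intro mult_left_mono divide_right_mono) auto
    with 1 have "X \<le> (A + B) * L powr (r + s - 1) + 4 * B / (1 - s) * L powr (r - 1) * h powr (1 - s)"
      unfolding X_def by (simp add: algebra_simps)
    then have "h powr (s - 1) * X \<le> h powr (s - 1) *
       ((A + B) * L powr (r + s - 1) + 4 * B / (1 - s) * L powr (r - 1) * h powr (1 - s))"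
      by (intro mult_left_mono) auto
    also have "\<dots> = (A + B) * L powr (r + s - 1) * h powr (s - 1)
       + 4 * B / (1 - s) * L powr (r - 1) * (h powr (s - 1) * h powr (1 - s))"
      by (simp add: algebra_simps)
    also have "h powr (s - 1) * h powr (1 - s) = 1"
      using h0 by (simp add: powr_add[symmetric])
    finally show "h powr (s - 1) * X \<le> (A + B) * L powr (r + s - 1) * h powr (s - 1) + 4 * B / (1 - s) * L powr (r - 1)"
      by simp
  qed
  finally show ?thesis by (simp add: mult_left_mono)
qed

text \<open>Away from the origin the weight is left out. For h > 0 the slab becomes 2h periods and
  the Jacobian 1/h removes the dependence on h; for h = 0 the integrand is the constant L powr
  r.\<close>

lemma weyl_term_dilate_later:
  fixes r L :: real and h j :: nat
  assumes r: "r > 1" and L: "L \<ge> 1"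
  defines "B \<equiv> 1 + 2 powr r / (r - 1)"
  shows "(\<integral>\<^sup>+u\<in>{2*pi*j..2*pi*(j+1)}. ennreal (weyl_term L (real h * u) powr r) \<partial>lborel)
    \<le> ennreal (if h = 0 then 2 * pi * L powr r else 4 * B * L powr (r - 1))"
proof (cases "h = 0")
  case True
  have "(\<integral>\<^sup>+u\<in>{2*pi*j..2*pi*(j+1)}. ennreal (weyl_term L (real h * u) powr r) \<partial>lborel)
     = ennreal (L powr r) * emeasure lborel {2*pi*j..2*pi*(j+1)}"
    using True L by (simp add: weyl_term_def nn_integral_cmult)
  also have "\<dots> = ennreal (2 * pi * L powr r)"
    by (subst emeasure_lborel_Icc) (simp_all add: algebra_simps ennreal_mult'[symmetric])
  finally show ?thesis using True by simp
next
  case False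
  then have h0: "real h > 0" by simp
  have B0: "B \<ge> 0" using assms by (auto simp: B_def)
  define I where "I = (\<integral>\<^sup>+u\<in>{2*pi*j..2*pi*(j+1)}. ennreal (weyl_term L (0 + real h * u) powr r) \<partial>lborel)"
  have "ennreal (real h) * I = (\<integral>\<^sup>+u\<in>{0 + real h * (2*pi*j)..0 + real h * (2*pi*(j+1))}. ennreal (weyl_term L u powr r) \<partial>lborel)"
    unfolding I_def using h0 by (subst nn_integral_Icc_affine) simp_all
  also have "{0 + real h * (2*pi*j)..0 + real h * (2*pi*(j+1))} = {pi * real (2*h*j)..pi * (real (2*h*j) + real (2*h))}"
    by (simp add: algebra_simps)
  also have "(\<integral>\<^sup>+u\<in>{pi * real (2*h*j)..pi * (real (2*h*j) + real (2*h))}. ennreal (weyl_term L u powr r) \<partial>lborel)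
     \<le> ennreal (real (2 * h) * (2 * (1 + 2 powr r / (r - 1)) * L powr (r - 1)))"
    using weyl_term_integral_periods[OF r L, of "2*h*j" "2*h"] by simp
  also have "real (2 * h) * (2 * (1 + 2 powr r / (r - 1)) * L powr (r - 1)) = real h * (4 * B * L powr (r - 1))"
    by (simp add: B_def)
  finally have "ennreal (real h) * I \<le> ennreal (real h) * ennreal (4 * B * L powr (r - 1))"
    by (simp add: ennreal_mult')
  then have "I \<le> ennreal (4 * B * L powr (r - 1))"
    using h0 by (simp add: ennreal_mult_le_mult_iff)
  then show ?thesis using False by (simp add: I_def)
qed

lemma weyl_bound_pos: "M \<ge> 0 \<Longrightarrow> weyl_bound M \<tau> > 0"
  unfolding weyl_bound_def by (intro sum_pos weyl_term_pos) auto

lemma weyl_bound_minus [simp]: "weyl_bound M (- \<tau>) = weyl_bound M \<tau>"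
  by (simp add: weyl_bound_def)

lemma weyl_bound_le: "M \<ge> 0 \<Longrightarrow> weyl_bound M \<tau> \<le> 2 * (2 * real_of_int M + 1)\<^sup>2"
proof -
  assume M: "M \<ge> 0"
  define L where "L = 2 * real_of_int M + 1"
  have "weyl_bound M \<tau> \<le> (\<Sum>h=-2*M..2*M. L)"
    unfolding weyl_bound_def L_def using M by (intro sum_mono weyl_term_le) auto
  also have "\<dots> = (4 * real_of_int M + 1) * L"
    using M by simp
  also have "\<dots> \<le> (2 * L) * L"
    using M by (intro mult_right_mono) (auto simp: L_def)
  finally show ?thesis unfolding L_def power2_eq_square by (simp only: mult.assoc)
qed

text \<open>The weight \<tau> powr (- r/2) is the r-th power of the decay of the kernel on the line.
  Writing s = r/2, the sum over h of L powr (r + s - 1) * h powr (s - 1) is of size L powr (2r - 1)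
  on the first slab; Jensen's factor L powr (r - 1) raises this to the exponent 3r - 2. On later
  slabs the sum over h is only of size L powr r, so the same power of L suffices and the weight
  supplies the decay in j.\<close>

lemma weyl_bound_integral:
  fixes r :: real
  assumes r: "1 < r" "r < 2"
  obtains C where "C > 0" "\<And>M j. M \<ge> 1 \<Longrightarrow>
    (\<integral>\<^sup>+\<tau>\<in>{2*pi*real j..2*pi*(real j+1)}. ennreal (\<tau> powr (- (r / 2)) * weyl_bound M \<tau> powr r) \<partial>lborel)
      \<le> ennreal (C * (2 * real_of_int M + 1) powr (3 * r - 2) * (1 + real j) powr (- (r / 2)))"
proof -
  define s where "s = r / 2"
  have s: "0 < s" "s < 1" "2 * s = r" using r by (auto simp: s_def)
  define A where "A = 1 / (1 - s) + 2 powr r / (r + s - 1)"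
  define B where "B = 1 + 2 powr r / (r - 1)"
  define K where "K = (2 * pi) powr (1 - s) / (1 - s) + (A + B) / s + 4 * B / (1 - s)"
  define C where "C = 2 powr (r + 1) * (K + 2 * pi + 4 * B)"
  have B0: "B \<ge> 0" and A0: "A \<ge> 0" using r s by (auto simp: A_def B_def)
  have K0: "K \<ge> 0" using A0 B0 s by (auto simp: K_def)
  have C0: "C > 0" unfolding C_def using K0 B0 by (intro mult_pos_pos add_pos_nonneg add_nonneg_pos) auto
  show ?thesis
  proof (rule that[OF C0])
    fix M :: int and j :: nat assume M: "M \<ge> 1"
    define L where "L = 2 * real_of_int M + 1"
    define m where "m = nat (2 * M)"
    have L: "L \<ge> 1" "real m \<le> L" using M by (auto simp: L_def m_def)
    define c where "c = 2 * (2 * L) powr (r - 1)"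
    have c0: "c \<ge> 0" by (simp add: c_def)
    have c: "c = 2 powr r * L powr (r - 1)"
      using L powr_add[of 2 1 "r - 1"] by (simp add: c_def powr_mult)
    have Lr: "L powr r \<le> L powr (2 * r - 1)" using r L by (intro powr_mono) auto
    define T where "T i \<tau> = ennreal (\<tau> powr (- s) * weyl_term L (real i * \<tau>) powr r)" for i \<tau>
    have [measurable]: "T i \<in> borel_measurable borel" for i unfolding T_def by measurable
    have pt: "ennreal (\<tau> powr (- s) * weyl_bound M \<tau> powr r) \<le> ennreal c * (\<Sum>i=0..m. T i \<tau>)" for \<tau>
    proof -
      have "\<tau> powr (- s) * weyl_bound M \<tau> powr r \<le> \<tau> powr (- s) * (c * (\<Sum>i=0..m. weyl_term L (real i * \<tau>) powr r))"
        using weyl_bound_powr_le[OF r(1) M, of \<tau>] by (intro mult_left_mono) (auto simp: c_def L_def m_def)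
      also have "\<dots> = c * (\<Sum>i=0..m. \<tau> powr (- s) * weyl_term L (real i * \<tau>) powr r)"
        by (simp add: sum_distrib_left mult_ac)
      finally show ?thesis
        using c0 by (simp add: T_def ennreal_mult'[symmetric] sum_ennreal ennreal_leI)
    qed
    have start: "(\<integral>\<^sup>+\<tau>\<in>{2*pi*real j..2*pi*(real j+1)}. ennreal (\<tau> powr (- s) * weyl_bound M \<tau> powr r) \<partial>lborel)
      \<le> ennreal c * (\<Sum>i=0..m. \<integral>\<^sup>+\<tau>\<in>{2*pi*real j..2*pi*(real j+1)}. T i \<tau> \<partial>lborel)"
    proof -
      have "(\<integral>\<^sup>+\<tau>\<in>{2*pi*real j..2*pi*(real j+1)}. ennreal (\<tau> powr (- s) * weyl_bound M \<tau> powr r) \<partial>lborel)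
        \<le> (\<integral>\<^sup>+\<tau>. ennreal c * (\<Sum>i=0..m. T i \<tau> * indicator {2*pi*real j..2*pi*(real j+1)} \<tau>) \<partial>lborel)"
        using pt by (intro nn_integral_mono) (auto simp: indicator_def)
      also have "\<dots> = ennreal c * (\<Sum>i=0..m. \<integral>\<^sup>+\<tau>\<in>{2*pi*real j..2*pi*(real j+1)}. T i \<tau> \<partial>lborel)"
        by (subst nn_integral_cmult, simp, subst nn_integral_sum) auto
      finally show ?thesis .
    qed
    have goal: "(\<integral>\<^sup>+\<tau>\<in>{2*pi*real j..2*pi*(real j+1)}. ennreal (\<tau> powr (- s) * weyl_bound M \<tau> powr r) \<partial>lborel)
      \<le> ennreal (C * L powr (3 * r - 2) * (1 + real j) powr (- s))"
    proof (cases "j = 0")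
      case True
      \<comment> \<open>The zero shift has no oscillation: the majorant is L throughout, and the
        integral of the weight alone is finite because s < 1.\<close>
      have i0: "(\<integral>\<^sup>+\<tau>\<in>{0..2*pi}. T 0 \<tau> \<partial>lborel) = ennreal (L powr r * ((2 * pi) powr (1 - s) / (1 - s)))"
      proof -
        have "(\<integral>\<^sup>+\<tau>\<in>{0..2*pi}. T 0 \<tau> \<partial>lborel) = (\<integral>\<^sup>+\<tau>. ennreal (L powr r) * (ennreal (\<tau> powr (- s)) * indicator {0..2*pi} \<tau>) \<partial>lborel)"
          by (intro nn_integral_cong) (auto simp: T_def weyl_term_def ennreal_mult[symmetric] indicator_def mult.commute)
        also have "\<dots> = ennreal (L powr r) * ennreal ((2 * pi) powr (- s + 1) / (- s + 1))"
          using s by (subst nn_integral_cmult, simp, subst nn_integral_powr_from_0) auto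
        finally show ?thesis by (simp add: ennreal_mult'[symmetric])
      qed
      define b where "b i = (A + B) * L powr (r + s - 1) * real i powr (s - 1) + 4 * B / (1 - s) * L powr (r - 1)" for i
      have b0: "b i \<ge> 0" for i using A0 B0 s by (simp add: b_def)
      have "(\<Sum>i=0..m. \<integral>\<^sup>+\<tau>\<in>{0..2*pi}. T i \<tau> \<partial>lborel)
          = (\<integral>\<^sup>+\<tau>\<in>{0..2*pi}. T 0 \<tau> \<partial>lborel) + (\<Sum>i=1..m. \<integral>\<^sup>+\<tau>\<in>{0..2*pi}. T i \<tau> \<partial>lborel)"
        by (simp add: sum.atLeast_Suc_atMost)
      also have "\<dots> \<le> ennreal (L powr r * ((2 * pi) powr (1 - s) / (1 - s))) + (\<Sum>i=1..m. ennreal (b i))"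
        unfolding i0 unfolding T_def b_def A_def B_def
        by (intro add_mono sum_mono weyl_term_dilate_first r L s) auto
      also have "\<dots> = ennreal (L powr r * ((2 * pi) powr (1 - s) / (1 - s)) + (\<Sum>i=1..m. b i))"
        using s b0 by (simp add: sum_ennreal ennreal_plus[symmetric] sum_nonneg del: ennreal_plus)
      also have "\<dots> \<le> ennreal (L powr (2 * r - 1) * K)"
      proof (intro ennreal_leI)
        have "(\<Sum>i=1..m. real i powr (- (1 - s))) \<le> real m powr (1 - (1 - s)) / (1 - (1 - s))"
          using s by (intro sum_powr_minus_le) auto
        also have "\<dots> \<le> L powr s / s"
          using L s by (simp add: divide_right_mono powr_mono2)
        finally have "(A + B) * L powr (r + s - 1) * (\<Sum>i=1..m. real i powr (- (1 - s)))
            \<le> (A + B) * L powr (r + s - 1) * (L powr s / s)"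
          using A0 B0 by (intro mult_left_mono) auto
        also have "\<dots> = (A + B) / s * (L powr (r + s - 1) * L powr s)"
          by simp
        also have "L powr (r + s - 1) * L powr s = L powr (2 * r - 1)"
          using s by (subst powr_add[symmetric]) (simp add: algebra_simps)
        finally have 1: "(A + B) * L powr (r + s - 1) * (\<Sum>i=1..m. real i powr (- (1 - s)))
            \<le> (A + B) / s * L powr (2 * r - 1)" .
        have "real m * (4 * B / (1 - s) * L powr (r - 1)) \<le> L * (4 * B / (1 - s) * L powr (r - 1))"
          using L s B0 by (intro mult_right_mono) auto
        also have "\<dots> = 4 * B / (1 - s) * (L powr 1 * L powr (r - 1))"
          using L by simp
        also have "L powr 1 * L powr (r - 1) = L powr r"
          by (subst powr_add[symmetric]) simp
        also have "4 * B / (1 - s) * L powr r \<le> 4 * B / (1 - s) * L powr (2 * r - 1)"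
          using Lr B0 s by (intro mult_left_mono) auto
        finally have 2: "real m * (4 * B / (1 - s) * L powr (r - 1)) \<le> 4 * B / (1 - s) * L powr (2 * r - 1)" .
        have "(\<Sum>i=1..m. b i) = (A + B) * L powr (r + s - 1) * (\<Sum>i=1..m. real i powr (- (1 - s)))
            + real m * (4 * B / (1 - s) * L powr (r - 1))"
          by (simp add: b_def sum.distrib sum_distrib_left)
        with 1 2 have "(\<Sum>i=1..m. b i) \<le> (A + B) / s * L powr (2 * r - 1) + 4 * B / (1 - s) * L powr (2 * r - 1)"
          by linarith
        moreover have "L powr r * ((2 * pi) powr (1 - s) / (1 - s)) \<le> L powr (2 * r - 1) * ((2 * pi) powr (1 - s) / (1 - s))"
          using Lr s by (intro mult_right_mono) auto
        ultimately have "L powr r * ((2 * pi) powr (1 - s) / (1 - s)) + (\<Sum>i=1..m. b i) \<le>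
            L powr (2 * r - 1) * ((2 * pi) powr (1 - s) / (1 - s)) +
            ((A + B) / s * L powr (2 * r - 1) + 4 * B / (1 - s) * L powr (2 * r - 1))"
          by (intro add_mono)
        also have "\<dots> = L powr (2 * r - 1) * K"
          by (simp only: K_def distrib_left add.assoc mult.commute)
        finally show "L powr r * ((2 * pi) powr (1 - s) / (1 - s)) + (\<Sum>i=1..m. b i) \<le> L powr (2 * r - 1) * K" .
      qed
      finally have "ennreal c * (\<Sum>i=0..m. \<integral>\<^sup>+\<tau>\<in>{0..2*pi}. T i \<tau> \<partial>lborel) \<le> ennreal c * ennreal (L powr (2 * r - 1) * K)"
        by (intro mult_left_mono) auto
      also have "\<dots> = ennreal (c * (L powr (2 * r - 1) * K))"
        using c0 by (simp add: ennreal_mult')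
      also have "\<dots> \<le> ennreal (C * L powr (3 * r - 2))"
      proof (intro ennreal_leI)
        have e: "L powr (r - 1) * L powr (2 * r - 1) = L powr (3 * r - 2)"
          by (simp add: powr_add[symmetric])
        have "c * (L powr (2 * r - 1) * K) = 2 powr r * K * (L powr (r - 1) * L powr (2 * r - 1))"
          unfolding c by simp
        also have "\<dots> = 2 powr r * K * L powr (3 * r - 2)" by (simp only: e)
        also have "\<dots> \<le> C * L powr (3 * r - 2)"
          unfolding C_def using K0 B0 by (intro mult_right_mono mult_mono powr_mono) auto
        finally show "c * (L powr (2 * r - 1) * K) \<le> C * L powr (3 * r - 2)" .
      qed
      finally have fin: "ennreal c * (\<Sum>i=0..m. \<integral>\<^sup>+\<tau>\<in>{0..2*pi}. T i \<tau> \<partial>lborel)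
          \<le> ennreal (C * L powr (3 * r - 2))" .
      have set_eq: "{2*pi*real j..2*pi*(real j+1)} = {0..2*pi}" using True by simp
      show ?thesis
        using order_trans[OF start[unfolded set_eq] fin] True unfolding set_eq by simp
    next
      case False
      then have j: "j \<ge> 1" by simp
      have js: "\<tau> powr (- s) \<le> 2 * (1 + real j) powr (- s)" if "\<tau> \<ge> 2*pi*real j" for \<tau>
      proof -
        have "1 * real j \<le> 2 * pi * real j" using pi_gt3 by (intro mult_right_mono) auto
        with that have "real j \<le> \<tau>" by linarith
        then have "\<tau> powr (- s) \<le> real j powr (- s)" using s j by (intro powr_mono2') auto
        also have "\<dots> \<le> ((1 + real j) / 2) powr (- s)" using s j by (intro powr_mono2') auto
        also have "\<dots> = 2 powr s * (1 + real j) powr (- s)"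
          by (simp add: powr_divide powr_minus field_simps)
        also have "\<dots> \<le> 2 * (1 + real j) powr (- s)"
          using s powr_mono[of s 1 2] by (intro mult_right_mono) auto
        finally show ?thesis .
      qed
      define V where "V i = (\<integral>\<^sup>+\<tau>\<in>{2*pi*real j..2*pi*(real j+1)}. ennreal (weyl_term L (real i * \<tau>) powr r) \<partial>lborel)" for i
      have TV: "(\<integral>\<^sup>+\<tau>\<in>{2*pi*real j..2*pi*(real j+1)}. T i \<tau> \<partial>lborel) \<le> ennreal (2 * (1 + real j) powr (- s)) * V i" for i
      proof -
        have "(\<integral>\<^sup>+\<tau>\<in>{2*pi*real j..2*pi*(real j+1)}. T i \<tau> \<partial>lborel)
          \<le> (\<integral>\<^sup>+\<tau>. ennreal (2 * (1 + real j) powr (- s)) * (ennreal (weyl_term L (real i * \<tau>) powr r) * indicator {2*pi*real j..2*pi*(real j+1)} \<tau>) \<partial>lborel)"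
          using js by (intro nn_integral_mono) (auto simp: indicator_def T_def ennreal_mult[symmetric] intro!: ennreal_leI mult_right_mono)
        also have "\<dots> = ennreal (2 * (1 + real j) powr (- s)) * V i"
          unfolding V_def by (intro nn_integral_cmult) auto
        finally show ?thesis .
      qed
      have "(\<Sum>i=0..m. V i) = V 0 + (\<Sum>i=1..m. V i)"
        by (simp add: sum.atLeast_Suc_atMost)
      also have "\<dots> \<le> ennreal (2 * pi * L powr r) + (\<Sum>i=1..m. ennreal (4 * B * L powr (r - 1)))"
      proof (intro add_mono sum_mono)
        show "V 0 \<le> ennreal (2 * pi * L powr r)"
          using weyl_term_dilate_later[OF r(1) L(1), where j=j and h=0] by (simp add: V_def add.commute)
        fix i assume "i \<in> {1..m}"
        then show "V i \<le> ennreal (4 * B * L powr (r - 1))"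
          using weyl_term_dilate_later[OF r(1) L(1), where j=j and h=i] by (simp add: V_def B_def add.commute)
      qed
      also have "\<dots> = ennreal (2 * pi * L powr r + real m * (4 * B * L powr (r - 1)))"
        using B0 by (simp add: sum_ennreal ennreal_plus[symmetric] ennreal_mult'[symmetric] ennreal_of_nat_eq_real_of_nat del: ennreal_plus)
      also have "\<dots> \<le> ennreal ((2 * pi + 4 * B) * L powr r)"
      proof (intro ennreal_leI)
        have "real m * (4 * B * L powr (r - 1)) \<le> L * (4 * B * L powr (r - 1))"
          using L B0 by (intro mult_right_mono) auto
        also have "\<dots> = 4 * B * (L powr 1 * L powr (r - 1))" using L by simp
        also have "L powr 1 * L powr (r - 1) = L powr r"
          by (subst powr_add[symmetric]) simp
        finally show "2 * pi * L powr r + real m * (4 * B * L powr (r - 1)) \<le> (2 * pi + 4 * B) * L powr r"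
          by (simp add: algebra_simps)
      qed
      finally have V: "(\<Sum>i=0..m. V i) \<le> ennreal ((2 * pi + 4 * B) * L powr r)" .
      have "(\<Sum>i=0..m. \<integral>\<^sup>+\<tau>\<in>{2*pi*real j..2*pi*(real j+1)}. T i \<tau> \<partial>lborel) \<le> (\<Sum>i=0..m. ennreal (2 * (1 + real j) powr (- s)) * V i)"
        by (intro sum_mono TV)
      also have "\<dots> = ennreal (2 * (1 + real j) powr (- s)) * (\<Sum>i=0..m. V i)"
        by (simp add: sum_distrib_left)
      also have "\<dots> \<le> ennreal (2 * (1 + real j) powr (- s)) * ennreal ((2 * pi + 4 * B) * L powr r)"
        by (intro mult_left_mono V) auto
      finally have "ennreal c * (\<Sum>i=0..m. \<integral>\<^sup>+\<tau>\<in>{2*pi*real j..2*pi*(real j+1)}. T i \<tau> \<partial>lborel)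
         \<le> ennreal c * (ennreal (2 * (1 + real j) powr (- s)) * ennreal ((2 * pi + 4 * B) * L powr r))"
        by (intro mult_left_mono) auto
      also have "\<dots> = ennreal (c * (2 * (1 + real j) powr (- s) * ((2 * pi + 4 * B) * L powr r)))"
        using c0 by (simp add: ennreal_mult'[symmetric])
      also have "\<dots> \<le> ennreal (C * L powr (3 * r - 2) * (1 + real j) powr (- s))"
      proof (intro ennreal_leI)
        have e: "L powr (r - 1) * L powr (2 * r - 1) = L powr (3 * r - 2)"
          by (simp add: powr_add[symmetric])
        have "L powr (r - 1) * L powr r \<le> L powr (3 * r - 2)"
          unfolding e[symmetric] using Lr by (intro mult_left_mono) auto
        then have "2 powr (r + 1) * (2 * pi + 4 * B) * (L powr (r - 1) * L powr r) * (1 + real j) powr (- s)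
           \<le> 2 powr (r + 1) * (K + 2 * pi + 4 * B) * L powr (3 * r - 2) * (1 + real j) powr (- s)"
          using K0 B0 by (intro mult_right_mono mult_mono) auto
        also have "2 powr (r + 1) * (2 * pi + 4 * B) * (L powr (r - 1) * L powr r) * (1 + real j) powr (- s)
            = c * (2 * (1 + real j) powr (- s) * ((2 * pi + 4 * B) * L powr r))"
          unfolding c by (simp add: powr_add)
        finally show "c * (2 * (1 + real j) powr (- s) * ((2 * pi + 4 * B) * L powr r)) \<le> C * L powr (3 * r - 2) * (1 + real j) powr (- s)"
          unfolding C_def .
      qed
      finally show ?thesis using start by (rule order_trans[rotated])
    qed
    then show "(\<integral>\<^sup>+\<tau>\<in>{2*pi*real j..2*pi*(real j+1)}. ennreal (\<tau> powr (- (r / 2)) * weyl_bound M \<tau> powr r) \<partial>lborel)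
      \<le> ennreal (C * (2 * real_of_int M + 1) powr (3 * r - 2) * (1 + real j) powr (- (r / 2)))"
      unfolding s_def L_def .
  qed
qed

section \<open>Size and level sets of the space-time kernel\<close>

text \<open>Majorant of the kernel of the weighted evolution. The square root bounds the factor from
  the line with Gaussian width M. The two Weyl sums contribute a square root of
  \<open>weyl_bound\<close> each, so their product contributes its first power.\<close>

definition kernel_bound :: "int \<Rightarrow> real \<Rightarrow> real" where
  "kernel_bound M \<tau> = sqrt (pi / sqrt (1 / (4 * real_of_int M ^ 4) + \<tau>\<^sup>2)) * weyl_bound M \<tau>"

lemma borel_measurable_kernel_bound [measurable]: "kernel_bound M \<in> borel_measurable borel"
  unfolding kernel_bound_def by measurable

lemma kernel_bound_pos: "M \<ge> 1 \<Longrightarrow> kernel_bound M \<tau> > 0"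
  unfolding kernel_bound_def
  by (intro mult_pos_pos weyl_bound_pos) (auto intro!: divide_pos_pos add_pos_nonneg)

lemma kernel_bound_le:
  assumes "M \<ge> 1" "\<tau> \<noteq> 0"
  shows "kernel_bound M \<tau> \<le> sqrt pi * \<bar>\<tau>\<bar> powr (- (1 / 2)) * weyl_bound M \<tau>"
  unfolding kernel_bound_def
proof (intro mult_right_mono)
  have "\<bar>\<tau>\<bar> \<le> sqrt (1 / (4 * real_of_int M ^ 4) + \<tau>\<^sup>2)"
    by (rule real_le_rsqrt) auto
  then have "pi / sqrt (1 / (4 * real_of_int M ^ 4) + \<tau>\<^sup>2) \<le> pi / \<bar>\<tau>\<bar>"
    using assms by (intro divide_left_mono mult_pos_pos) (auto intro!: add_pos_nonneg)
  then have "sqrt (pi / sqrt (1 / (4 * real_of_int M ^ 4) + \<tau>\<^sup>2)) \<le> sqrt (pi / \<bar>\<tau>\<bar>)"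
    by (rule real_sqrt_le_mono)
  also have "\<dots> = sqrt pi * \<bar>\<tau>\<bar> powr (- (1 / 2))"
    by (simp add: real_sqrt_divide powr_minus powr_half_sqrt field_simps)
  finally show "sqrt (pi / sqrt (1 / (4 * real_of_int M ^ 4) + \<tau>\<^sup>2)) \<le> sqrt pi * \<bar>\<tau>\<bar> powr (- (1 / 2))" .
qed (use assms weyl_bound_pos[of M \<tau>] in auto)

lemma kernel_bound_le_near:
  assumes "M \<ge> 1"
  shows "kernel_bound M \<tau> \<le> sqrt (2 * pi) * real_of_int M * weyl_bound M \<tau>"
  unfolding kernel_bound_def
proof (intro mult_right_mono)
  have "1 / (2 * real_of_int M ^ 2) \<le> sqrt (1 / (4 * real_of_int M ^ 4) + \<tau>\<^sup>2)"
    by (rule real_le_rsqrt) (simp add: power_divide power_mult_distrib flip: power_mult)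
  then have "pi / sqrt (1 / (4 * real_of_int M ^ 4) + \<tau>\<^sup>2) \<le> pi / (1 / (2 * real_of_int M ^ 2))"
    using assms by (intro divide_left_mono mult_pos_pos) (auto intro!: add_pos_nonneg)
  then have "sqrt (pi / sqrt (1 / (4 * real_of_int M ^ 4) + \<tau>\<^sup>2)) \<le> sqrt (2 * pi * (real_of_int M)\<^sup>2)"
    by (intro real_sqrt_le_mono) (simp add: mult_ac)
  also have "\<dots> = sqrt (2 * pi) * real_of_int M"
    using assms by (simp add: real_sqrt_mult)
  finally show "sqrt (pi / sqrt (1 / (4 * real_of_int M ^ 4) + \<tau>\<^sup>2)) \<le> sqrt (2 * pi) * real_of_int M" .
qed (use assms weyl_bound_pos[of M \<tau>] in auto)

text \<open>The window \<bar>\<tau> - 2 pi n\<bar> \<le> 2 pi contains every difference of times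
  from two slabs at distance n. For \<bar>n\<bar> \<le> 1 it can contain \<tau> = 0, so the bound by
  M is used there; otherwise \<bar>\<tau>\<bar> \<ge> 1 + \<bar>n\<bar> and the decay in \<tau>
  applies.\<close>

lemma kernel_bound_sup:
  obtains C where "C > 0" "\<And>M n \<tau>. M \<ge> 1 \<Longrightarrow> \<bar>\<tau> - 2 * pi * real_of_int n\<bar> \<le> 2 * pi \<Longrightarrow>
    kernel_bound M \<tau> \<le> C * real_of_int M powr 3 * (1 + \<bar>real_of_int n\<bar>) powr (- (1 / 2))"
proof -
  \<comment> \<open>Here 18 comes from 2 * (2M + 1) ^ 2 \<le> 18 * M ^ 2, and the last 2 pays for
    the factor (1 + \<bar>n\<bar>) powr (- 1/2) when \<bar>n\<bar> \<le> 1.\<close>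
  define C where "C = sqrt (2 * pi) * 18 * 2"
  have C0: "C > 0" by (simp add: C_def)
  show ?thesis
  proof (rule that[OF C0])
    fix M n :: int and \<tau> :: real
    assume M: "M \<ge> 1" and n: "\<bar>\<tau> - 2 * pi * real_of_int n\<bar> \<le> 2 * pi"
    have M1: "real_of_int M \<ge> 1" using M by simp
    have W0: "weyl_bound M \<tau> > 0" using M by (simp add: weyl_bound_pos)
    have "weyl_bound M \<tau> \<le> 2 * (2 * real_of_int M + 1)\<^sup>2" using M by (intro weyl_bound_le) auto
    also have "\<dots> \<le> 2 * (3 * real_of_int M)\<^sup>2" using M1 by (intro mult_left_mono power_mono) auto
    finally have W: "weyl_bound M \<tau> \<le> 18 * (real_of_int M)\<^sup>2" by (simp add: power_mult_distrib)
    have M3: "real_of_int M powr 3 = real_of_int M * (real_of_int M)\<^sup>2"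
      using M1 by (simp add: powr_numeral power3_eq_cube power2_eq_square)
    show "kernel_bound M \<tau> \<le> C * real_of_int M powr 3 * (1 + \<bar>real_of_int n\<bar>) powr (- (1 / 2))"
    proof (cases "\<bar>n\<bar> \<le> 1")
      case True
      have "kernel_bound M \<tau> \<le> sqrt (2 * pi) * real_of_int M * (18 * (real_of_int M)\<^sup>2)"
        using kernel_bound_le_near[OF M, of \<tau>] M1 W by (smt (verit, best) mult_left_mono mult_nonneg_nonneg real_sqrt_ge_zero pi_ge_zero)
      also have "\<dots> = sqrt (2 * pi) * 18 * real_of_int M powr 3 * 1" unfolding M3 by simp
      also have "\<dots> \<le> sqrt (2 * pi) * 18 * real_of_int M powr 3 * (2 * (1 + \<bar>real_of_int n\<bar>) powr (- (1 / 2)))"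
      proof (intro mult_left_mono)
        have "(1 + \<bar>real_of_int n\<bar>) powr (1 / 2) \<le> 2 powr (1 / 2)"
          using True by (intro powr_mono2) auto
        also have "\<dots> \<le> 2 powr 1" by (intro powr_mono) auto
        finally show "1 \<le> 2 * (1 + \<bar>real_of_int n\<bar>) powr (- (1 / 2))"
          by (simp add: powr_minus field_simps)
      qed auto
      finally show ?thesis unfolding C_def by (simp only: mult.assoc mult.left_commute)
    next
      case False
      have "2 * pi * \<bar>real_of_int n\<bar> = \<bar>2 * pi * real_of_int n\<bar>" by (simp add: abs_mult)
      then have "\<bar>\<tau>\<bar> \<ge> 2 * pi * (\<bar>real_of_int n\<bar> - 1)" using n by (simp add: algebra_simps)
      moreover have "2 * pi * (\<bar>real_of_int n\<bar> - 1) \<ge> 3 * (\<bar>real_of_int n\<bar> - 1)"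
        using False pi_gt3 by (intro mult_right_mono) auto
      moreover have "\<bar>real_of_int n\<bar> \<ge> 2" using False by linarith
      moreover have "3 * (a - 1) \<ge> 1 + a" if "a \<ge> 2" for a :: real
        using that by (simp add: algebra_simps)
      ultimately have t: "\<bar>\<tau>\<bar> \<ge> 1 + \<bar>real_of_int n\<bar>" by (meson order_trans)
      have "kernel_bound M \<tau> \<le> sqrt pi * \<bar>\<tau>\<bar> powr (- (1 / 2)) * weyl_bound M \<tau>"
        using t by (intro kernel_bound_le M) auto
      also have "\<dots> \<le> sqrt pi * (1 + \<bar>real_of_int n\<bar>) powr (- (1 / 2)) * (18 * (real_of_int M) ^ 3)"
      proof -
        have "18 * (real_of_int M)\<^sup>2 \<le> 18 * real_of_int M ^ 3"
          using M1 by (intro mult_left_mono power_increasing) auto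
        with W have "weyl_bound M \<tau> \<le> 18 * real_of_int M ^ 3" by linarith
        then show ?thesis
          using t W0 M1 by (intro mult_mono powr_mono2' order_refl) auto
      qed
      also have "\<dots> \<le> C * real_of_int M powr 3 * (1 + \<bar>real_of_int n\<bar>) powr (- (1 / 2))"
      proof -
        have "sqrt pi \<le> sqrt (2 * pi)" by (intro real_sqrt_le_mono) auto
        moreover have "sqrt (2 * pi) \<ge> 0" by simp
        ultimately have "sqrt pi * 18 \<le> C" unfolding C_def by linarith
        then have "(sqrt pi * 18) * (real_of_int M powr 3 * (1 + \<bar>real_of_int n\<bar>) powr (- (1 / 2)))
            \<le> C * (real_of_int M powr 3 * (1 + \<bar>real_of_int n\<bar>) powr (- (1 / 2)))"
          by (intro mult_right_mono) auto
        then show ?thesis using M1 by (simp add: powr_numeral mult_ac)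
      qed
      finally show ?thesis .
    qed
  qed
qed

text \<open>Chebyshev's inequality for the r-th power of the kernel majorant, fed by the moment of
  \<open>weyl_bound\<close> weighted with the power of \<tau>.\<close>

lemma emeasure_kernel_bound_gt:
  fixes r :: real
  assumes r: "1 < r" "r < 2"
  obtains C where "C > 0" "\<And>M n H. M \<ge> 1 \<Longrightarrow> H > 0 \<Longrightarrow>
    emeasure lborel {\<tau>. \<bar>\<tau> - 2 * pi * real_of_int n\<bar> \<le> 2 * pi \<and> kernel_bound M \<tau> > H}
      \<le> ennreal (C * real_of_int M powr (3 * r - 2) * (1 + \<bar>real_of_int n\<bar>) powr (- (r / 2)) * H powr (- r))"
proof -
  obtain C where C: "C > 0" and int: "\<And>M j. M \<ge> 1 \<Longrightarrow>
    (\<integral>\<^sup>+\<tau>\<in>{2*pi*real j..2*pi*(real j+1)}. ennreal (\<tau> powr (- (r / 2)) * weyl_bound M \<tau> powr r) \<partial>lborel)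
      \<le> ennreal (C * (2 * real_of_int M + 1) powr (3 * r - 2) * (1 + real j) powr (- (r / 2)))"
    using weyl_bound_integral[OF r] by blast
  define C' where "C' = pi powr (r / 2) * (8 * C * 3 powr (3 * r - 2))"
  have C'0: "C' > 0" using C by (simp add: C'_def)
  show ?thesis
  proof (rule that[OF C'0])
    fix M n :: int and H :: real assume M: "M \<ge> 1" and H: "H > 0"
    define f where "f \<tau> = ennreal (\<tau> powr (- (r / 2)) * weyl_bound M \<tau> powr r)" for \<tau>
    have [measurable]: "f \<in> borel_measurable borel" unfolding f_def by measurable
    define I where "I j = {2*pi*real j..2*pi*(real j+1)}" for j
    have I_meas [measurable]: "I j \<in> sets borel" for j by (simp add: I_def)
    \<comment> \<open>After reflection to \<bar>\<tau>\<bar> the window of length 4 pi is covered by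
      these two slabs. Subtraction is truncated, so for n = 0 both are the slab 0; in all cases 1 +
      j is at least (1 + \<bar>n\<bar>)/2.\<close>
    define j1 j2 where "j1 = nat \<bar>n\<bar> - 1" and "j2 = nat \<bar>n\<bar>"
    define Q where "Q \<tau> = f \<tau> * indicator (I j1) \<tau> + f \<tau> * indicator (I j2) \<tau>" for \<tau>
    have [measurable]: "Q \<in> borel_measurable borel" unfolding Q_def by measurable
    have Q: "(\<integral>\<^sup>+\<tau>. Q \<tau> \<partial>lborel) \<le> ennreal (4 * C * 3 powr (3 * r - 2) * real_of_int M powr (3 * r - 2) * (1 + \<bar>real_of_int n\<bar>) powr (- (r / 2)))"
    proof -
      have piece: "(\<integral>\<^sup>+\<tau>\<in>I j. f \<tau> \<partial>lborel) \<le> ennreal (2 * C * 3 powr (3 * r - 2) * real_of_int M powr (3 * r - 2) * (1 + \<bar>real_of_int n\<bar>) powr (- (r / 2)))"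
        if j: "j = j1 \<or> j = j2" for j
      proof -
        have "(\<integral>\<^sup>+\<tau>\<in>I j. f \<tau> \<partial>lborel) \<le> ennreal (C * (2 * real_of_int M + 1) powr (3 * r - 2) * (1 + real j) powr (- (r / 2)))"
          unfolding I_def f_def using int[OF M] .
        also have "\<dots> \<le> ennreal (C * (3 * real_of_int M) powr (3 * r - 2) * (2 * (1 + \<bar>real_of_int n\<bar>) powr (- (r / 2))))"
        proof (intro ennreal_leI mult_mono powr_mono2)
          have "1 + real j \<ge> (1 + \<bar>real_of_int n\<bar>) / 2" using j by (auto simp: j1_def j2_def)
          then have "(1 + real j) powr (- (r / 2)) \<le> ((1 + \<bar>real_of_int n\<bar>) / 2) powr (- (r / 2))"
            using r by (intro powr_mono2') auto
          also have "\<dots> = 2 powr (r / 2) * (1 + \<bar>real_of_int n\<bar>) powr (- (r / 2))"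
            by (simp add: powr_divide powr_minus field_simps)
          also have "\<dots> \<le> 2 powr 1 * (1 + \<bar>real_of_int n\<bar>) powr (- (r / 2))"
            using r by (intro mult_right_mono powr_mono) auto
          finally show "(1 + real j) powr (- (r / 2)) \<le> 2 * (1 + \<bar>real_of_int n\<bar>) powr (- (r / 2))" by simp
        qed (use M C r in auto)
        also have "(3 * real_of_int M) powr (3 * r - 2) = 3 powr (3 * r - 2) * real_of_int M powr (3 * r - 2)"
          using M by (simp add: powr_mult)
        finally show ?thesis by (simp add: mult_ac)
      qed
      have "(\<integral>\<^sup>+\<tau>. Q \<tau> \<partial>lborel) = (\<integral>\<^sup>+\<tau>\<in>I j1. f \<tau> \<partial>lborel) + (\<integral>\<^sup>+\<tau>\<in>I j2. f \<tau> \<partial>lborel)"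
        unfolding Q_def by (subst nn_integral_add) auto
      also have "\<dots> \<le> ennreal (2 * C * 3 powr (3 * r - 2) * real_of_int M powr (3 * r - 2) * (1 + \<bar>real_of_int n\<bar>) powr (- (r / 2)))
         + ennreal (2 * C * 3 powr (3 * r - 2) * real_of_int M powr (3 * r - 2) * (1 + \<bar>real_of_int n\<bar>) powr (- (r / 2)))"
        by (intro add_mono piece) auto
      also have "\<dots> = ennreal (4 * C * 3 powr (3 * r - 2) * real_of_int M powr (3 * r - 2) * (1 + \<bar>real_of_int n\<bar>) powr (- (r / 2)))"
        using C by (simp add: ennreal_plus[symmetric] del: ennreal_plus)
      finally show ?thesis .
    qed
    define A where "A = {\<tau>. \<bar>\<tau> - 2 * pi * real_of_int n\<bar> \<le> 2 * pi \<and> kernel_bound M \<tau> > H}"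
    have [measurable]: "A \<in> sets borel" unfolding A_def by measurable
    define c where "c = pi powr (r / 2) * H powr (- r)"
    \<comment> \<open>The decay estimate for the kernel is available only for nonzero \<tau>, where
      \<open>powr\<close> has its usual meaning.\<close>
    have "AE \<tau> in lborel. (\<tau>::real) \<noteq> 0" by (rule AE_lborel_singleton)
    then have pt: "AE \<tau> in lborel. indicator A \<tau> \<le> ennreal c * (Q \<tau> + Q (- \<tau>))"
    proof eventually_elim
      fix \<tau> :: real assume \<tau>: "\<tau> \<noteq> 0"
      show "indicator A \<tau> \<le> ennreal c * (Q \<tau> + Q (- \<tau>))"
      proof (cases "\<tau> \<in> A")
        case True
        have one: "1 \<le> ennreal c * f \<bar>\<tau>\<bar>"
        proof -
          have "H \<le> sqrt pi * \<bar>\<tau>\<bar> powr (- (1 / 2)) * weyl_bound M \<tau>"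
            using kernel_bound_le[OF M \<tau>] True by (auto simp: A_def)
          then have "H powr r \<le> (sqrt pi * \<bar>\<tau>\<bar> powr (- (1 / 2)) * weyl_bound M \<tau>) powr r"
            using H r by (intro powr_mono2) auto
          also have "\<dots> = (sqrt pi) powr r * (\<bar>\<tau>\<bar> powr (- (1 / 2))) powr r * weyl_bound M \<tau> powr r"
            using weyl_bound_pos[of M \<tau>] M by (simp add: powr_mult)
          also have "(sqrt pi) powr r = pi powr (r / 2)"
            by (simp add: powr_half_sqrt[symmetric] powr_powr)
          also have "(\<bar>\<tau>\<bar> powr (- (1 / 2))) powr r = \<bar>\<tau>\<bar> powr (- (r / 2))"
            by (simp add: powr_powr)
          finally have "H powr r * H powr (- r) \<le> pi powr (r / 2) * \<bar>\<tau>\<bar> powr (- (r / 2)) * weyl_bound M \<tau> powr r * H powr (- r)"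
            by (intro mult_right_mono) auto
          moreover have "H powr r * H powr (- r) = 1" using H by (simp add: powr_add[symmetric])
          moreover have "weyl_bound M \<bar>\<tau>\<bar> = weyl_bound M \<tau>" by (cases "\<tau> \<ge> 0") auto
          ultimately have "1 \<le> c * (\<bar>\<tau>\<bar> powr (- (r / 2)) * weyl_bound M \<bar>\<tau>\<bar> powr r)"
            by (simp add: c_def mult_ac)
          then show ?thesis
            unfolding f_def by (simp add: ennreal_mult'[symmetric] c_def)
        qed
        have nabs: "\<bar>2 * pi * real_of_int n\<bar> = 2 * pi * \<bar>real_of_int n\<bar>" by (simp add: abs_mult)
        have t: "\<bar>\<tau>\<bar> \<le> 2 * pi * \<bar>real_of_int n\<bar> + 2 * pi" "\<bar>\<tau>\<bar> \<ge> 2 * pi * \<bar>real_of_int n\<bar> - 2 * pi"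
          using True nabs unfolding A_def by auto
        have "\<bar>\<tau>\<bar> \<in> I j1 \<or> \<bar>\<tau>\<bar> \<in> I j2"
        proof (cases "n = 0")
          case True
          then show ?thesis using t by (auto simp: I_def j2_def)
        next
          case False
          then have j: "real j1 = \<bar>real_of_int n\<bar> - 1" "real j2 = \<bar>real_of_int n\<bar>"
            by (auto simp: j1_def j2_def of_nat_diff)
          show ?thesis using t unfolding I_def atLeastAtMost_iff j by (auto simp: algebra_simps)
        qed
        then have "f \<bar>\<tau>\<bar> \<le> Q \<bar>\<tau>\<bar>" by (auto simp: Q_def)
        also have "\<dots> \<le> Q \<tau> + Q (- \<tau>)" by (cases "\<tau> \<ge> 0") auto
        finally have "ennreal c * f \<bar>\<tau>\<bar> \<le> ennreal c * (Q \<tau> + Q (- \<tau>))" by (intro mult_left_mono) auto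
        then show ?thesis using one True by simp
      qed simp
    qed
    have "emeasure lborel A = (\<integral>\<^sup>+\<tau>. indicator A \<tau> \<partial>lborel)" by simp
    also have "\<dots> \<le> (\<integral>\<^sup>+\<tau>. ennreal c * (Q \<tau> + Q (- \<tau>)) \<partial>lborel)"
      by (rule nn_integral_mono_AE[OF pt])
    also have "\<dots> = ennreal c * ((\<integral>\<^sup>+\<tau>. Q \<tau> \<partial>lborel) + (\<integral>\<^sup>+\<tau>. Q (- \<tau>) \<partial>lborel))"
      by (subst nn_integral_cmult, simp, subst nn_integral_add) auto
    also have "(\<integral>\<^sup>+\<tau>. Q (- \<tau>) \<partial>lborel) = (\<integral>\<^sup>+\<tau>. Q \<tau> \<partial>lborel)"
      by (subst (2) nn_integral_real_affine[where c="-1" and t=0]) auto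
    also have "ennreal c * ((\<integral>\<^sup>+\<tau>. Q \<tau> \<partial>lborel) + (\<integral>\<^sup>+\<tau>. Q \<tau> \<partial>lborel)) \<le> ennreal c *
      (ennreal (4 * C * 3 powr (3 * r - 2) * real_of_int M powr (3 * r - 2) * (1 + \<bar>real_of_int n\<bar>) powr (- (r / 2))) +
       ennreal (4 * C * 3 powr (3 * r - 2) * real_of_int M powr (3 * r - 2) * (1 + \<bar>real_of_int n\<bar>) powr (- (r / 2))))"
      by (intro mult_left_mono add_mono Q) auto
    also have "\<dots> = ennreal (c * (8 * C * 3 powr (3 * r - 2) * real_of_int M powr (3 * r - 2) * (1 + \<bar>real_of_int n\<bar>) powr (- (r / 2))))"
      using C by (simp add: c_def ennreal_plus[symmetric] ennreal_mult'[symmetric] del: ennreal_plus)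
    also have "c * (8 * C * 3 powr (3 * r - 2) * real_of_int M powr (3 * r - 2) * (1 + \<bar>real_of_int n\<bar>) powr (- (r / 2)))
       = C' * real_of_int M powr (3 * r - 2) * (1 + \<bar>real_of_int n\<bar>) powr (- (r / 2)) * H powr (- r)"
      by (simp add: c_def C'_def mult_ac)
    finally show "emeasure lborel {\<tau>. \<bar>\<tau> - 2 * pi * real_of_int n\<bar> \<le> 2 * pi \<and> kernel_bound M \<tau> > H}
      \<le> ennreal (C' * real_of_int M powr (3 * r - 2) * (1 + \<bar>real_of_int n\<bar>) powr (- (r / 2)) * H powr (- r))"
      unfolding A_def .
  qed
qed

section \<open>Fourier analysis on the product space\<close>

text \<open>Unlike \<open>RT2\<close>, the measure \<open>cell_measure\<close> lives on the whole Borel space.\<close>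

definition cell_measure :: "(real \<times> real \<times> real) measure" where
  "cell_measure = density lborel (indicator RT2_cell)"

lemma RT2_cell_borel [measurable]: "RT2_cell \<in> sets borel"
proof -
  have "RT2_cell = (UNIV :: real set) \<times> ({0..<2*pi} \<times> {0..<2*pi})" by (simp add: RT2_cell_def)
  also have "\<dots> \<in> sets (borel \<Otimes>\<^sub>M (borel \<Otimes>\<^sub>M borel))"
    by (intro pair_measureI) auto
  finally show ?thesis unfolding borel_prod .
qed

lemma sets_cell_measure [simp, measurable_cong]: "sets cell_measure = sets borel"
  by (simp add: cell_measure_def)

lemma space_cell_measure [simp]: "space cell_measure = UNIV"
  by (simp add: cell_measure_def)

lemma nn_integral_RT2:
  "f \<in> borel_measurable borel \<Longrightarrow> (\<integral>\<^sup>+z. f z \<partial>RT2) = (\<integral>\<^sup>+z. f z \<partial>cell_measure)"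
  unfolding RT2_def cell_measure_def
  by (subst nn_integral_restrict_space) (auto simp: nn_integral_density mult.commute)

lemma integral_RT2:
  fixes f :: "real \<times> real \<times> real \<Rightarrow> complex"
  assumes "f \<in> borel_measurable borel"
  shows "(LINT z|RT2. f z) = (LINT z|cell_measure. f z)"
  unfolding RT2_def cell_measure_def
  using assms by (subst integral_restrict_space)
    (auto simp: integral_density[where g="indicator RT2_cell", simplified ennreal_indicator])

lemma borel_measurable_RT2 [measurable (raw)]:
  "f \<in> borel_measurable borel \<Longrightarrow> f \<in> borel_measurable RT2"
  unfolding RT2_def by (simp add: measurable_restrict_space1)

interpretation cell: sigma_finite_measure cell_measure
proof -
  have "sigma_finite_measure (density lborel (indicator RT2_cell :: _ \<Rightarrow> ennreal))"
    by (subst sigma_finite_measure.sigma_finite_iff_density_finite)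
      (auto intro: sigma_finite_lborel simp: indicator_def)
  then show "sigma_finite_measure cell_measure" by (simp add: cell_measure_def)
qed

interpretation RZ2: sigma_finite_measure RZ2
proof -
  have "sigma_finite_measure (count_space (UNIV :: (int \<times> int) set))"
    by (rule sigma_finite_measure_count_space_countable) auto
  then show "sigma_finite_measure RZ2"
    unfolding RZ2_def by (intro sigma_finite_pair_measure sigma_finite_lborel)
qed

interpretation cell_pair: pair_sigma_finite cell_measure cell_measure ..
interpretation RZ2_cell: pair_sigma_finite RZ2 cell_measure ..

lemma sets_RZ2 [simp, measurable_cong]: "sets RZ2 = sets (borel \<Otimes>\<^sub>M count_space UNIV)"
  unfolding RZ2_def by (intro sets_pair_measure_cong) auto

lemma space_RZ2 [simp]: "space RZ2 = UNIV"
  by (simp add: RZ2_def space_pair_measure)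

lemma measurable_RZ2_components [measurable]:
  "(\<lambda>\<zeta>. fst \<zeta>) \<in> borel_measurable RZ2"
  "(\<lambda>\<zeta>. h (snd \<zeta>)) \<in> RZ2 \<rightarrow>\<^sub>M borel"
proof -
  show "(\<lambda>\<zeta>. fst \<zeta>) \<in> borel_measurable RZ2" by measurable
  have "(snd :: real \<times> int \<times> int \<Rightarrow> _) \<in> RZ2 \<rightarrow>\<^sub>M count_space UNIV" by measurable
  then show "(\<lambda>\<zeta>. h (snd \<zeta>)) \<in> RZ2 \<rightarrow>\<^sub>M borel"
    by (rule measurable_compose) auto
qed

lemma character_eq:
  "character \<zeta> z = cis (fst \<zeta> * fst z + real_of_int (fst (snd \<zeta>)) * fst (snd z) + real_of_int (snd (snd \<zeta>)) * snd (snd z))"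
  by (cases \<zeta>; cases z) (auto simp: character_def)

lemma norm_character [simp]: "norm (character \<zeta> z) = 1"
  by (simp add: character_eq)

lemma cnj_character_mult: "cnj (character \<zeta> z) * character \<zeta> w = character \<zeta> (w - z)"
  unfolding character_eq cis_cnj cis_mult by (simp add: algebra_simps)

lemma measurable_cis [measurable]: "cis \<in> borel_measurable borel"
  unfolding cis_conv_exp by measurable

lemma measurable_cnj [measurable]: "cnj \<in> borel_measurable borel"
  by (intro borel_measurable_continuous_onI continuous_intros)

lemma measurable_character [measurable]:
  assumes [measurable]: "f \<in> M \<rightarrow>\<^sub>M RZ2" "g \<in> M \<rightarrow>\<^sub>M borel"
  shows "(\<lambda>x. character (f x) (g x)) \<in> borel_measurable M"
proof -
  have [measurable]: "(\<lambda>x. real_of_int (fst (snd (f x)))) \<in> borel_measurable M"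
     "(\<lambda>x. real_of_int (snd (snd (f x)))) \<in> borel_measurable M"
    by (rule measurable_compose[OF assms(1) measurable_RZ2_components(2)])+
  have [measurable]: "(\<lambda>x. fst (f x)) \<in> borel_measurable M"
    by (rule measurable_compose[OF assms(1) measurable_RZ2_components(1)])
  have [measurable]: "(\<lambda>x. fst (g x)) \<in> borel_measurable M"
     "(\<lambda>x. fst (snd (g x))) \<in> borel_measurable M" "(\<lambda>x. snd (snd (g x))) \<in> borel_measurable M"
    by (rule measurable_compose[OF assms(2)], intro borel_measurable_continuous_onI continuous_intros)+
  show ?thesis unfolding character_eq by measurable
qed

text \<open>No integrability is required, because the Bochner integral of a nonintegrable function
  is 0.\<close>

lemma ennreal_norm_integral_le:
  fixes f :: "'a \<Rightarrow> 'b :: {banach, second_countable_topology}"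
  shows "ennreal (norm (integral\<^sup>L M f)) \<le> (\<integral>\<^sup>+x. ennreal (norm (f x)) \<partial>M)"
  by (cases "integrable M f") (auto simp: integral_norm_bound_ennreal not_integrable_integral_eq)

text \<open>The pattern of all later interchanges of integrals: one integrable factor per variable,
  and a coupling between the variables that is merely bounded, such as a character or a
  phase.\<close>

lemma (in pair_sigma_finite) integrable_product_bounded:
  fixes a :: "'a \<Rightarrow> complex" and b :: "'b \<Rightarrow> complex"
  assumes a: "integrable M1 a" and b: "integrable M2 b"
    and [measurable]: "case_prod k \<in> borel_measurable (M1 \<Otimes>\<^sub>M M2)" and k: "\<And>x y. norm (k x y) \<le> C"
  shows "integrable (M1 \<Otimes>\<^sub>M M2) (\<lambda>(x, y). a x * b y * k x y)"
proof -
  have [measurable]: "a \<in> borel_measurable M1" "b \<in> borel_measurable M2"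
    using a b by auto
  have C: "C \<ge> 0" using k[of undefined undefined] norm_ge_zero order_trans by blast
  have "integrable (M1 \<Otimes>\<^sub>M M2) (\<lambda>(x, y). a x * b y)"
  proof (intro Fubini_integrable)
    have "(\<lambda>x. \<integral>y. norm (case (x, y) of (x, y) \<Rightarrow> a x * b y) \<partial>M2) = (\<lambda>x. norm (a x) * (\<integral>y. norm (b y) \<partial>M2))"
      by (simp add: norm_mult)
    then show "integrable M1 (\<lambda>x. \<integral>y. norm (case (x, y) of (x, y) \<Rightarrow> a x * b y) \<partial>M2)"
      using a by simp
    show "AE x in M1. integrable M2 (\<lambda>y. case (x, y) of (x, y) \<Rightarrow> a x * b y)"
      using b by (intro AE_I2) simp
  qed measurable
  then have "integrable (M1 \<Otimes>\<^sub>M M2) (\<lambda>p. of_real C * (case p of (x, y) \<Rightarrow> a x * b y))"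
    by (intro integrable_mult_right) auto
  then show ?thesis
  proof (rule Bochner_Integration.integrable_bound)
    show "AE p in M1 \<Otimes>\<^sub>M M2. norm (case p of (x, y) \<Rightarrow> a x * b y * k x y)
        \<le> norm (complex_of_real C * (case p of (x, y) \<Rightarrow> a x * b y))"
    proof (intro AE_I2)
      fix p :: "'a \<times> 'b"
      obtain x y where p: "p = (x, y)" by (cases p)
      have "norm (a x * b y) * norm (k x y) \<le> norm (a x * b y) * C"
        by (intro mult_left_mono k) auto
      then show "norm (case p of (x, y) \<Rightarrow> a x * b y * k x y) \<le> norm (complex_of_real C * (case p of (x, y) \<Rightarrow> a x * b y))"
        using C by (simp add: p norm_mult mult_ac)
    qed
  qed measurable
qed

lemma (in pair_sigma_finite) swap_integrals_bounded:
  fixes a :: "'a \<Rightarrow> complex" and b :: "'b \<Rightarrow> complex"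
  assumes "integrable M1 a" "integrable M2 b" "case_prod k \<in> borel_measurable (M1 \<Otimes>\<^sub>M M2)" "\<And>x y. norm (k x y) \<le> C"
  shows "(LINT x|M1. LINT y|M2. a x * b y * k x y) = (LINT y|M2. LINT x|M1. a x * b y * k x y)"
  using Fubini_integral[OF integrable_product_bounded[OF assms]] by simp

definition fhat :: "(real \<times> real \<times> real \<Rightarrow> complex) \<Rightarrow> real \<times> int \<times> int \<Rightarrow> complex" where
  "fhat f \<zeta> = (LINT z|cell_measure. cnj (character \<zeta> z) * f z)"

lemma fourier_integral_eq_fhat:
  assumes [measurable]: "f \<in> borel_measurable borel"
  shows "fourier_integral f \<zeta> = fhat f \<zeta>"
  unfolding fourier_integral_def fhat_def by (intro integral_RT2) measurable

lemma measurable_fhat [measurable]: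
  assumes [measurable]: "f \<in> borel_measurable borel"
  shows "fhat f \<in> borel_measurable RZ2"
  unfolding fhat_def by measurable

lemma norm_fhat_le: "norm (fhat f \<zeta>) \<le> (LINT z|cell_measure. norm (f z))"
  unfolding fhat_def by (rule order_trans[OF integral_norm_bound]) (simp add: norm_mult)

lemma integrable_character_mult:
  assumes f: "integrable cell_measure f"
  shows "integrable cell_measure (\<lambda>z. cnj (character \<zeta> z) * f z)" "integrable cell_measure (\<lambda>z. character \<zeta> z * f z)"
proof -
  have [measurable]: "f \<in> borel_measurable borel" using f by auto
  have [measurable]: "(\<lambda>z. character \<zeta> z) \<in> borel_measurable borel"
    by (intro measurable_character measurable_const) auto
  show "integrable cell_measure (\<lambda>z. cnj (character \<zeta> z) * f z)" "integrable cell_measure (\<lambda>z. character \<zeta> z * f z)"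
    by (rule Bochner_Integration.integrable_bound[OF f]; simp add: norm_mult)+
qed

text \<open>The convolution kernel of the Fourier multiplier \<rho>, without the normalising factor
  \<open>1 / (2 * pi) ^ 3\<close>.\<close>

definition multiplier_kernel :: "(real \<times> int \<times> int \<Rightarrow> complex) \<Rightarrow> real \<times> real \<times> real \<Rightarrow> complex" where
  "multiplier_kernel \<rho> u = (LINT \<zeta>|RZ2. \<rho> \<zeta> * character \<zeta> u)"

lemma measurable_multiplier_kernel [measurable]:
  assumes [measurable]: "\<rho> \<in> borel_measurable RZ2"
  shows "multiplier_kernel \<rho> \<in> borel_measurable borel"
  unfolding multiplier_kernel_def by measurable

text \<open>Both transforms are expanded and the frequency integral is moved inside, past one space
  variable at a time. The multiplier supplies integrability in frequency, so the transforms need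
  only the bound by the L1 norm.\<close>

lemma bilinear_identity:
  assumes \<rho>: "integrable RZ2 \<rho>" and f: "integrable cell_measure f" and g: "integrable cell_measure g"
  shows "(LINT \<zeta>|RZ2. \<rho> \<zeta> * fhat f \<zeta> * cnj (fhat g \<zeta>)) =
    (LINT z|cell_measure. f z * (LINT w|cell_measure. cnj (g w) * multiplier_kernel \<rho> (w - z)))"
proof -
  have [measurable]: "f \<in> borel_measurable borel" "g \<in> borel_measurable borel" "\<rho> \<in> borel_measurable RZ2"
    using f g \<rho> by auto
  have g': "integrable cell_measure (\<lambda>w. cnj (g w))" using g by simp
  have "(LINT \<zeta>|RZ2. \<rho> \<zeta> * fhat f \<zeta> * cnj (fhat g \<zeta>))
     = (LINT \<zeta>|RZ2. LINT z|cell_measure. \<rho> \<zeta> * f z * (cnj (character \<zeta> z) * cnj (fhat g \<zeta>)))"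
  proof (intro Bochner_Integration.integral_cong refl)
    fix \<zeta>
    have "(LINT z|cell_measure. \<rho> \<zeta> * f z * (cnj (character \<zeta> z) * cnj (fhat g \<zeta>)))
       = (LINT z|cell_measure. (\<rho> \<zeta> * cnj (fhat g \<zeta>)) * (cnj (character \<zeta> z) * f z))"
      by (simp add: mult_ac)
    also have "\<dots> = \<rho> \<zeta> * fhat f \<zeta> * cnj (fhat g \<zeta>)"
      by (subst integral_mult_right_zero) (simp add: fhat_def mult_ac)
    finally show "\<rho> \<zeta> * fhat f \<zeta> * cnj (fhat g \<zeta>) = (LINT z|cell_measure. \<rho> \<zeta> * f z * (cnj (character \<zeta> z) * cnj (fhat g \<zeta>)))"
      by simp
  qed
  also have "\<dots> = (LINT z|cell_measure. LINT \<zeta>|RZ2. \<rho> \<zeta> * f z * (cnj (character \<zeta> z) * cnj (fhat g \<zeta>)))"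
    by (rule RZ2_cell.swap_integrals_bounded[OF \<rho> f]) (auto simp: norm_mult intro: norm_fhat_le)
  also have "\<dots> = (LINT z|cell_measure. f z * (LINT w|cell_measure. cnj (g w) * multiplier_kernel \<rho> (w - z)))"
  proof (intro Bochner_Integration.integral_cong refl)
    fix z
    have [measurable]: "(\<lambda>\<zeta>. character \<zeta> z) \<in> borel_measurable RZ2"
      by (intro measurable_character) auto
    have "(LINT \<zeta>|RZ2. \<rho> \<zeta> * f z * (cnj (character \<zeta> z) * cnj (fhat g \<zeta>)))
       = (LINT \<zeta>|RZ2. f z * (\<rho> \<zeta> * cnj (character \<zeta> z) * cnj (fhat g \<zeta>)))"
      by (simp add: mult_ac)
    also have "\<dots> = f z * (LINT \<zeta>|RZ2. \<rho> \<zeta> * cnj (character \<zeta> z) * cnj (fhat g \<zeta>))"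
      by (rule integral_mult_right_zero)
    also have "(LINT \<zeta>|RZ2. \<rho> \<zeta> * cnj (character \<zeta> z) * cnj (fhat g \<zeta>))
      = (LINT \<zeta>|RZ2. LINT w|cell_measure. \<rho> \<zeta> * cnj (g w) * character \<zeta> (w - z))"
    proof (intro Bochner_Integration.integral_cong refl)
      fix \<zeta>
      have "cnj (fhat g \<zeta>) = (LINT w|cell_measure. character \<zeta> w * cnj (g w))"
        unfolding fhat_def by (simp add: Bochner_Integration.integral_cnj[symmetric] del: Bochner_Integration.integral_cnj)
      then have "\<rho> \<zeta> * cnj (character \<zeta> z) * cnj (fhat g \<zeta>) =
          (LINT w|cell_measure. \<rho> \<zeta> * cnj (character \<zeta> z) * (character \<zeta> w * cnj (g w)))"
        by (simp only: integral_mult_right_zero)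
      also have "(\<lambda>w. \<rho> \<zeta> * cnj (character \<zeta> z) * (character \<zeta> w * cnj (g w))) =
          (\<lambda>w. \<rho> \<zeta> * cnj (g w) * character \<zeta> (w - z))"
        by (simp add: cnj_character_mult[symmetric] mult_ac)
      finally show "\<rho> \<zeta> * cnj (character \<zeta> z) * cnj (fhat g \<zeta>) = (LINT w|cell_measure. \<rho> \<zeta> * cnj (g w) * character \<zeta> (w - z))" .
    qed
    also have "\<dots> = (LINT w|cell_measure. LINT \<zeta>|RZ2. \<rho> \<zeta> * cnj (g w) * character \<zeta> (w - z))"
      by (rule RZ2_cell.swap_integrals_bounded[OF \<rho> g', where C=1]) auto
    also have "\<dots> = (LINT w|cell_measure. cnj (g w) * multiplier_kernel \<rho> (w - z))"
    proof (intro Bochner_Integration.integral_cong refl)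
      fix w
      have "(LINT \<zeta>|RZ2. \<rho> \<zeta> * cnj (g w) * character \<zeta> (w - z)) = (LINT \<zeta>|RZ2. cnj (g w) * (\<rho> \<zeta> * character \<zeta> (w - z)))"
        by (simp add: mult_ac)
      also have "\<dots> = cnj (g w) * multiplier_kernel \<rho> (w - z)"
        unfolding multiplier_kernel_def by (rule integral_mult_right_zero)
      finally show "(LINT \<zeta>|RZ2. \<rho> \<zeta> * cnj (g w) * character \<zeta> (w - z)) = cnj (g w) * multiplier_kernel \<rho> (w - z)" .
    qed
    finally show "(LINT \<zeta>|RZ2. \<rho> \<zeta> * f z * (cnj (character \<zeta> z) * cnj (fhat g \<zeta>)))
       = f z * (LINT w|cell_measure. cnj (g w) * multiplier_kernel \<rho> (w - z))" .
  qed
  finally show ?thesis .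
qed

lemma norm_bilinear_le:
  assumes \<rho>: "integrable RZ2 \<rho>" and f: "integrable cell_measure f" and g: "integrable cell_measure g"
  shows "ennreal (norm (LINT \<zeta>|RZ2. \<rho> \<zeta> * fhat f \<zeta> * cnj (fhat g \<zeta>))) \<le>
    (\<integral>\<^sup>+z. \<integral>\<^sup>+w. ennreal (norm (f z) * norm (g w) * norm (multiplier_kernel \<rho> (w - z))) \<partial>cell_measure \<partial>cell_measure)"
proof -
  have "ennreal (norm (LINT \<zeta>|RZ2. \<rho> \<zeta> * fhat f \<zeta> * cnj (fhat g \<zeta>))) \<le>
    (\<integral>\<^sup>+z. ennreal (norm (f z * (LINT w|cell_measure. cnj (g w) * multiplier_kernel \<rho> (w - z)))) \<partial>cell_measure)"
    unfolding bilinear_identity[OF assms] by (rule ennreal_norm_integral_le)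
  also have "\<dots> \<le> (\<integral>\<^sup>+z. \<integral>\<^sup>+w. ennreal (norm (f z) * norm (g w) * norm (multiplier_kernel \<rho> (w - z))) \<partial>cell_measure \<partial>cell_measure)"
  proof (intro nn_integral_mono)
    fix z
    have [measurable]: "g \<in> borel_measurable borel" "\<rho> \<in> borel_measurable RZ2"
      using g \<rho> by auto
    have "ennreal (norm (f z * (LINT w|cell_measure. cnj (g w) * multiplier_kernel \<rho> (w - z))))
      \<le> ennreal (norm (f z)) * (\<integral>\<^sup>+w. ennreal (norm (cnj (g w) * multiplier_kernel \<rho> (w - z))) \<partial>cell_measure)"
      unfolding norm_mult[of "f z"] by (subst ennreal_mult) (auto intro!: mult_left_mono ennreal_norm_integral_le)
    also have "\<dots> = (\<integral>\<^sup>+w. ennreal (norm (f z)) * ennreal (norm (cnj (g w) * multiplier_kernel \<rho> (w - z))) \<partial>cell_measure)"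
      by (intro nn_integral_cmult[symmetric]) measurable
    also have "\<dots> = (\<integral>\<^sup>+w. ennreal (norm (f z) * norm (g w) * norm (multiplier_kernel \<rho> (w - z))) \<partial>cell_measure)"
      by (simp add: norm_mult ennreal_mult mult.assoc)
    finally show "ennreal (norm (f z * (LINT w|cell_measure. cnj (g w) * multiplier_kernel \<rho> (w - z))))
      \<le> (\<integral>\<^sup>+w. ennreal (norm (f z) * norm (g w) * norm (multiplier_kernel \<rho> (w - z))) \<partial>cell_measure)" .
  qed
  finally show ?thesis .
qed

lemma nn_integral_lborel_product:
  fixes f :: "'a :: euclidean_space \<Rightarrow> ennreal" and g :: "'b :: euclidean_space \<Rightarrow> ennreal"
  assumes [measurable]: "f \<in> borel_measurable borel" "g \<in> borel_measurable borel"
  shows "(\<integral>\<^sup>+p. f (fst p) * g (snd p) \<partial>lborel) = (\<integral>\<^sup>+x. f x \<partial>lborel) * (\<integral>\<^sup>+y. g y \<partial>lborel)"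
proof -
  have "(\<integral>\<^sup>+p. f (fst p) * g (snd p) \<partial>lborel) = (\<integral>\<^sup>+p. f (fst p) * g (snd p) \<partial>(lborel \<Otimes>\<^sub>M lborel))"
    by (simp add: lborel_prod)
  also have "\<dots> = (\<integral>\<^sup>+x. \<integral>\<^sup>+y. f x * g y \<partial>lborel \<partial>lborel)"
    by (subst lborel.nn_integral_fst[symmetric]) auto
  also have "\<dots> = (\<integral>\<^sup>+x. f x * (\<integral>\<^sup>+y. g y \<partial>lborel) \<partial>lborel)"
    by (simp add: nn_integral_cmult)
  also have "\<dots> = (\<integral>\<^sup>+x. f x \<partial>lborel) * (\<integral>\<^sup>+y. g y \<partial>lborel)"
    by (simp add: nn_integral_multc)
  finally show ?thesis .
qed

lemma nn_integral_cell_product: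
  assumes [measurable]: "f \<in> borel_measurable borel" "g \<in> borel_measurable borel" "h \<in> borel_measurable borel"
  shows "(\<integral>\<^sup>+w. f (fst w) * (g (fst (snd w)) * h (snd (snd w))) \<partial>cell_measure) =
    (\<integral>\<^sup>+x. f x \<partial>lborel) * ((\<integral>\<^sup>+y\<in>{0..<2*pi}. g y \<partial>lborel) * (\<integral>\<^sup>+y\<in>{0..<2*pi}. h y \<partial>lborel))"
proof -
  have [measurable]: "(\<lambda>w. fst w) \<in> borel_measurable (borel :: (real \<times> real \<times> real) measure)"
    "(\<lambda>w. fst (snd w)) \<in> borel_measurable (borel :: (real \<times> real \<times> real) measure)"
    "(\<lambda>w. snd (snd w)) \<in> borel_measurable (borel :: (real \<times> real \<times> real) measure)"
    "(\<lambda>w. fst w) \<in> borel_measurable (borel :: (real \<times> real) measure)"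
    "(\<lambda>w. snd w) \<in> borel_measurable (borel :: (real \<times> real) measure)"
    by (intro borel_measurable_continuous_onI continuous_intros)+
  have ind: "indicator RT2_cell w * (f (fst w) * (g (fst (snd w)) * h (snd (snd w)))) =
     f (fst w) * ((\<lambda>v. g (fst v) * indicator {0..<2*pi} (fst v) * (h (snd v) * indicator {0..<2*pi} (snd v))) (snd w))" for w
    by (cases w) (auto simp: RT2_cell_def indicator_def)
  have "(\<integral>\<^sup>+w. f (fst w) * (g (fst (snd w)) * h (snd (snd w))) \<partial>cell_measure)
    = (\<integral>\<^sup>+w. f (fst w) * ((\<lambda>v. g (fst v) * indicator {0..<2*pi} (fst v) * (h (snd v) * indicator {0..<2*pi} (snd v))) (snd w)) \<partial>lborel)"
    unfolding cell_measure_def by (subst nn_integral_density) (measurable, simp add: ind)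
  also have "\<dots> = (\<integral>\<^sup>+x. f x \<partial>lborel) * (\<integral>\<^sup>+v. g (fst v) * indicator {0..<2*pi} (fst v) * (h (snd v) * indicator {0..<2*pi} (snd v)) \<partial>lborel)"
    by (rule nn_integral_lborel_product) measurable
  also have "(\<integral>\<^sup>+v. g (fst v) * indicator {0..<2*pi} (fst v) * (h (snd v) * indicator {0..<2*pi} (snd v)) \<partial>lborel)
     = (\<integral>\<^sup>+y\<in>{0..<2*pi}. g y \<partial>lborel) * (\<integral>\<^sup>+y\<in>{0..<2*pi}. h y \<partial>lborel)"
    by (rule nn_integral_lborel_product) measurable
  finally show ?thesis .
qed

lemma RZ2_product_integral:
  fixes a :: "real \<Rightarrow> complex" and c :: "int \<times> int \<Rightarrow> complex"
  assumes a: "integrable lborel a" and K: "finite K" "\<And>k. k \<notin> K \<Longrightarrow> c k = 0"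
  shows "integrable RZ2 (\<lambda>\<zeta>. a (fst \<zeta>) * c (snd \<zeta>))"
    and "(LINT \<zeta>|RZ2. a (fst \<zeta>) * c (snd \<zeta>)) = (LINT \<xi>|lborel. a \<xi>) * (\<Sum>k\<in>K. c k)"
proof -
  interpret count: sigma_finite_measure "count_space (UNIV :: (int \<times> int) set)"
    by (rule sigma_finite_measure_count_space_countable) auto
  interpret P: pair_sigma_finite "lborel :: real measure" "count_space (UNIV :: (int \<times> int) set)" ..
  have fin: "finite {k. c k \<noteq> 0}" by (rule finite_subset[OF _ K(1)]) (use K(2) in auto)
  then have "integrable (count_space UNIV) c"
    unfolding integrable_iff_bounded by (subst nn_integral_count_space) auto
  then have int: "integrable (lborel \<Otimes>\<^sub>M count_space UNIV) (\<lambda>(\<xi>, k). a \<xi> * c k * 1)"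
    by (intro P.integrable_product_bounded[OF a, where C=1]) auto
  then show "integrable RZ2 (\<lambda>\<zeta>. a (fst \<zeta>) * c (snd \<zeta>))"
    by (simp add: RZ2_def case_prod_beta')
  have c: "(LINT k|count_space UNIV. c k) = (\<Sum>k\<in>K. c k)"
    using fin K by (subst lebesgue_integral_count_space_finite_support) (auto intro!: sum.mono_neutral_left)
  have "(LINT \<zeta>|RZ2. a (fst \<zeta>) * c (snd \<zeta>)) = (LINT \<xi>|lborel. LINT k|count_space UNIV. a \<xi> * c k)"
    using P.integral_fst'[OF int] by (simp add: RZ2_def case_prod_beta')
  also have "\<dots> = (LINT \<xi>|lborel. a \<xi>) * (\<Sum>k\<in>K. c k)"
    by (simp only: integral_mult_right_zero c integral_mult_left_zero)
  finally show "(LINT \<zeta>|RZ2. a (fst \<zeta>) * c (snd \<zeta>)) = (LINT \<xi>|lborel. a \<xi>) * (\<Sum>k\<in>K. c k)" .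
qed

text \<open>A tensor-product multiplier has a tensor-product kernel. It is applied twice: to the
  summability weights behind Bessel's inequality and to the weighted Schroedinger
  multiplier.\<close>

lemma multiplier_kernel_product:
  fixes a :: "real \<Rightarrow> complex" and c1 c2 :: "int \<Rightarrow> complex"
  assumes a: "integrable lborel a" and K: "finite K" "\<And>k. k \<notin> K \<Longrightarrow> c1 k = 0" "\<And>k. k \<notin> K \<Longrightarrow> c2 k = 0"
  shows "integrable RZ2 (\<lambda>\<zeta>. a (fst \<zeta>) * (c1 (fst (snd \<zeta>)) * c2 (snd (snd \<zeta>))))"
    and "multiplier_kernel (\<lambda>\<zeta>. a (fst \<zeta>) * (c1 (fst (snd \<zeta>)) * c2 (snd (snd \<zeta>)))) u =
      (LINT \<xi>|lborel. a \<xi> * cis (\<xi> * fst u)) *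
      ((\<Sum>k\<in>K. c1 k * cis (real_of_int k * fst (snd u))) * (\<Sum>k\<in>K. c2 k * cis (real_of_int k * snd (snd u))))"
proof -
  show "integrable RZ2 (\<lambda>\<zeta>. a (fst \<zeta>) * (c1 (fst (snd \<zeta>)) * c2 (snd (snd \<zeta>))))"
  proof (rule RZ2_product_integral(1)[OF a, of "K \<times> K" "\<lambda>k. c1 (fst k) * c2 (snd k)"])
    show "c1 (fst k) * c2 (snd k) = 0" if "k \<notin> K \<times> K" for k
      using that K(2)[of "fst k"] K(3)[of "snd k"] by (cases k) auto
  qed (use K(1) in auto)
  define x y1 y2 where "x = fst u" and "y1 = fst (snd u)" and "y2 = snd (snd u)"
  have [measurable]: "a \<in> borel_measurable borel" using a by auto
  have a': "integrable lborel (\<lambda>\<xi>. a \<xi> * cis (\<xi> * x))"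
    by (rule Bochner_Integration.integrable_bound[OF a]) (auto simp: norm_mult)
  define d1 d2 where "d1 k = c1 k * cis (real_of_int k * y1)" and "d2 k = c2 k * cis (real_of_int k * y2)" for k
  have "multiplier_kernel (\<lambda>\<zeta>. a (fst \<zeta>) * (c1 (fst (snd \<zeta>)) * c2 (snd (snd \<zeta>)))) u =
     (LINT \<zeta>|RZ2. a (fst \<zeta>) * cis (fst \<zeta> * x) * (\<lambda>k. d1 (fst k) * d2 (snd k)) (snd \<zeta>))"
    unfolding multiplier_kernel_def character_eq cis_mult[symmetric] d1_def d2_def x_def y1_def y2_def
    by (simp add: mult_ac)
  also have "\<dots> = (LINT \<xi>|lborel. a \<xi> * cis (\<xi> * x)) * (\<Sum>k\<in>K\<times>K. d1 (fst k) * d2 (snd k))"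
  proof (rule RZ2_product_integral(2)[OF a'])
    show "d1 (fst k) * d2 (snd k) = 0" if "k \<notin> K \<times> K" for k
      using that K(2)[of "fst k"] K(3)[of "snd k"] by (cases k) (auto simp: d1_def d2_def)
  qed (use K(1) in auto)
  also have "(\<Sum>k\<in>K\<times>K. d1 (fst k) * d2 (snd k)) = (\<Sum>k\<in>K. d1 k) * (\<Sum>k\<in>K. d2 k)"
    by (simp add: sum_product sum.cartesian_product case_prod_beta')
  finally show "multiplier_kernel (\<lambda>\<zeta>. a (fst \<zeta>) * (c1 (fst (snd \<zeta>)) * c2 (snd (snd \<zeta>)))) u =
      (LINT \<xi>|lborel. a \<xi> * cis (\<xi> * fst u)) *
      ((\<Sum>k\<in>K. c1 k * cis (real_of_int k * fst (snd u))) * (\<Sum>k\<in>K. c2 k * cis (real_of_int k * snd (snd u))))"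
    by (simp add: d1_def d2_def x_def y1_def y2_def)
qed

section \<open>Gauss-Fejer kernels and Bessel's inequality\<close>

text \<open>This is 1 - \<bar>k\<bar>/(n + 1) for \<bar>k\<bar> \<le> n and 0 beyond. Counting the
  pairs (j, j - k) in a square makes the associated kernel a squared modulus by mere regrouping, so
  that its positivity is visible.\<close>

definition fejer_coeff :: "nat \<Rightarrow> int \<Rightarrow> real" where
  "fejer_coeff n k = real (card {j \<in> {0..int n}. j - k \<in> {0..int n}}) / (real n + 1)"

definition fejer_kernel :: "nat \<Rightarrow> real \<Rightarrow> real" where
  "fejer_kernel n y = (norm (\<Sum>j=0..int n. cis (real_of_int j * y)))\<^sup>2 / (real n + 1)"

lemma fejer_coeff_nonneg: "fejer_coeff n k \<ge> 0"
  by (simp add: fejer_coeff_def)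

lemma fejer_coeff_eq_0: "k \<notin> {-int n..int n} \<Longrightarrow> fejer_coeff n k = 0"
  by (auto simp: fejer_coeff_def card_eq_0_iff)

lemma fejer_coeff_tendsto: "(\<lambda>n. fejer_coeff n k) \<longlonglongrightarrow> 1"
proof -
  have eq: "fejer_coeff n k = 1 - \<bar>real_of_int k\<bar> / (real n + 1)" if "n \<ge> nat \<bar>k\<bar>" for n
  proof -
    have "{j \<in> {0..int n}. j - k \<in> {0..int n}} = {max 0 k..min (int n) (int n + k)}" by auto
    moreover have "min (int n) (int n + k) - max 0 k = int n - \<bar>k\<bar>" by auto
    moreover have "int n + 1 - \<bar>k\<bar> \<ge> 0" using that by auto
    ultimately show ?thesis by (simp add: fejer_coeff_def of_nat_diff field_simps)
  qed
  have "(\<lambda>n. 1 - \<bar>real_of_int k\<bar> * inverse (real (Suc n))) \<longlonglongrightarrow> 1 - \<bar>real_of_int k\<bar> * 0"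
    by (intro tendsto_intros LIMSEQ_inverse_real_of_nat)
  then have "(\<lambda>n. 1 - \<bar>real_of_int k\<bar> / (real n + 1)) \<longlonglongrightarrow> 1"
    by (simp add: divide_inverse add.commute)
  then show ?thesis
    by (rule Lim_transform_eventually) (use eq in \<open>auto simp: eventually_sequentially intro!: exI[of _ "nat \<bar>k\<bar>"]\<close>)
qed

lemma fejer_sum_general:
  fixes c :: "int \<Rightarrow> 'a :: real_vector"
  shows "(\<Sum>k\<in>{-int n..int n}. fejer_coeff n k *\<^sub>R c k) = (1 / (real n + 1)) *\<^sub>R (\<Sum>j=0..int n. \<Sum>i=0..int n. c (j - i))"
proof -
  have "(\<Sum>j=0..int n. \<Sum>i=0..int n. c (j - i)) = (\<Sum>j=0..int n. \<Sum>k=-int n..int n. if j - k \<in> {0..int n} then c k else 0)"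
  proof (rule sum.cong[OF refl])
    fix j assume j: "j \<in> {0..int n}"
    have "(\<Sum>i=0..int n. c (j - i)) = (\<Sum>k\<in>{k \<in> {-int n..int n}. j - k \<in> {0..int n}}. c k)"
      using j by (intro sum.reindex_bij_witness[where i="\<lambda>k. j - k" and j="\<lambda>i. j - i"]) auto
    then show "(\<Sum>i=0..int n. c (j - i)) = (\<Sum>k=-int n..int n. if j - k \<in> {0..int n} then c k else 0)"
      by (subst sum.inter_filter[symmetric]) auto
  qed
  also have "\<dots> = (\<Sum>k=-int n..int n. \<Sum>j=0..int n. if j - k \<in> {0..int n} then c k else 0)"
    by (rule sum.swap)
  also have "\<dots> = (\<Sum>k=-int n..int n. real (card {j \<in> {0..int n}. j - k \<in> {0..int n}}) *\<^sub>R c k)"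
    by (intro sum.cong refl, subst sum.inter_filter[symmetric]) (simp_all add: sum_constant_scaleR)
  finally show ?thesis
    by (simp add: scaleR_sum_right fejer_coeff_def)
qed

lemma norm_cis_sum_square:
  "complex_of_real ((norm (\<Sum>j=0..int n. cis (real_of_int j * y)))\<^sup>2) = (\<Sum>j=0..int n. \<Sum>i=0..int n. cis (real_of_int (j - i) * y))"
proof -
  have "complex_of_real ((norm (\<Sum>j=0..int n. cis (real_of_int j * y)))\<^sup>2)
    = (\<Sum>j=0..int n. cis (real_of_int j * y)) * cnj (\<Sum>j=0..int n. cis (real_of_int j * y))"
    by (rule complex_norm_square)
  also have "\<dots> = (\<Sum>j=0..int n. \<Sum>i=0..int n. cis (real_of_int (j - i) * y))"
    by (simp add: sum_product cis_cnj cis_mult algebra_simps)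
  finally show ?thesis .
qed

lemma fejer_kernel_eq:
  "(\<Sum>k\<in>{-int n..int n}. of_real (fejer_coeff n k) * cis (real_of_int k * y)) = of_real (fejer_kernel n y)"
proof -
  have "(\<Sum>k\<in>{-int n..int n}. of_real (fejer_coeff n k) * cis (real_of_int k * y))
     = (\<Sum>k\<in>{-int n..int n}. fejer_coeff n k *\<^sub>R cis (real_of_int k * y))"
    by (simp add: scaleR_conv_of_real)
  also have "\<dots> = (1 / (real n + 1)) *\<^sub>R (\<Sum>j=0..int n. \<Sum>i=0..int n. cis (real_of_int (j - i) * y))"
    by (rule fejer_sum_general)
  also have "\<dots> = of_real (fejer_kernel n y)"
    unfolding norm_cis_sum_square[symmetric] by (simp add: fejer_kernel_def scaleR_conv_of_real)
  finally show ?thesis .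
qed

lemma fejer_kernel_nonneg: "fejer_kernel n y \<ge> 0"
  by (simp add: fejer_kernel_def)

lemma fejer_kernel_minus: "fejer_kernel n (- y) = fejer_kernel n y"
proof -
  have "(\<Sum>j=0..int n. cis (real_of_int j * - y)) = cnj (\<Sum>j=0..int n. cis (real_of_int j * y))"
    by (simp add: cis_cnj)
  then show ?thesis unfolding fejer_kernel_def by (metis complex_mod_cnj)
qed

lemma measurable_fejer_kernel [measurable]: "fejer_kernel n \<in> borel_measurable borel"
  unfolding fejer_kernel_def by measurable

lemma cos_has_integral_period:
  fixes m :: int
  shows "((\<lambda>y. cos (real_of_int m * (y - a))) has_integral (if m = 0 then 2 * pi else 0)) {0..2*pi}"
proof (cases "m = 0")
  case True
  then show ?thesis using has_integral_const_real[of "1::real" 0 "2*pi"] by simp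
next
  case False
  define F where "F y = sin (real_of_int m * (y - a)) / real_of_int m" for y
  have "((\<lambda>y. cos (real_of_int m * (y - a))) has_integral (F (2*pi) - F 0)) {0..2*pi}"
    unfolding F_def using False
    by (intro fundamental_theorem_of_calculus)
       (auto intro!: derivative_eq_intros simp flip: has_real_derivative_iff_has_vector_derivative)
  moreover have "sin (real_of_int m * (2*pi - a)) = sin (real_of_int m * (0 - a))"
  proof -
    have "real_of_int m * (2*pi - a) = real_of_int m * (0 - a) + 2 * pi * real_of_int m" by (simp add: algebra_simps)
    then show ?thesis by (simp add: sin_diff sin_int_2pin cos_int_2pin)
  qed
  ultimately show ?thesis using False by (simp add: F_def)
qed

text \<open>Only the diagonal terms j = i of the double sum of cosines survive integration over a
  period. Equality holds, but Schur's test uses an upper bound.\<close>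

lemma nn_integral_fejer_kernel:
  "(\<integral>\<^sup>+y\<in>{0..<2*pi}. ennreal (fejer_kernel n (y - a)) \<partial>lborel) \<le> ennreal (2 * pi)"
proof -
  have re: "fejer_kernel n y = (1 / (real n + 1)) * (\<Sum>j=0..int n. \<Sum>i=0..int n. cos (real_of_int (j - i) * y))" for y
    using norm_cis_sum_square[where n=n and y=y, THEN arg_cong[of _ _ Re]] by (simp add: fejer_kernel_def)
  have "((\<lambda>y. (1 / (real n + 1)) * (\<Sum>j=0..int n. \<Sum>i=0..int n. cos (real_of_int (j - i) * (y - a)))) has_integral
     ((1 / (real n + 1)) * (\<Sum>j=0..int n. \<Sum>i=0..int n. (if j - i = 0 then 2 * pi else 0)))) {0..2*pi}"
    by (intro has_integral_mult_right has_integral_sum cos_has_integral_period) auto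
  also have "(\<Sum>j=0..int n. \<Sum>i=0..int n. (if j - i = 0 then 2 * pi else 0)) = (real n + 1) * (2 * pi)"
    by simp
  finally have "((\<lambda>y. fejer_kernel n (y - a)) has_integral 2 * pi) {0..2*pi}"
    unfolding re by (simp add: add_pos_nonneg)
  then have "(\<integral>\<^sup>+y. ennreal (indicator {0..2*pi} y * fejer_kernel n (y - a)) \<partial>lborel) = ennreal (2 * pi)"
    by (intro nn_integral_has_integral_lebesgue fejer_kernel_nonneg)
  moreover have "(\<integral>\<^sup>+y\<in>{0..<2*pi}. ennreal (fejer_kernel n (y - a)) \<partial>lborel)
      \<le> (\<integral>\<^sup>+y. ennreal (indicator {0..2*pi} y * fejer_kernel n (y - a)) \<partial>lborel)"
    by (intro nn_integral_mono) (auto simp: indicator_def)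
  ultimately show ?thesis by simp
qed

text \<open>The integrand is the Fourier transform of exp (- a \<xi>^2), shifted by b. Its total
  mass is 2 pi whatever the width, the analogue on the line of the normalisation of the Fejer
  kernel.\<close>

lemma nn_integral_gauss_shift:
  assumes "a > 0"
  shows "(\<integral>\<^sup>+x. ennreal (sqrt (pi / a) * exp (- (x - b)\<^sup>2 / (4 * a))) \<partial>lborel) = ennreal (2 * pi)"
proof -
  have "(\<integral>\<^sup>+x. ennreal (sqrt (pi / a) * exp (- (x - b)\<^sup>2 / (4 * a))) \<partial>lborel)
     = (\<integral>\<^sup>+x. ennreal (sqrt (pi / a) * exp (- (1 / (4 * a)) * x\<^sup>2)) \<partial>lborel)"
    by (subst nn_integral_real_affine[where c=1 and t=b]) auto
  also have "\<dots> = ennreal (LINT x|lborel. sqrt (pi / a) * exp (- (1 / (4 * a)) * x\<^sup>2))"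
    using assms by (intro nn_integral_eq_integral integrable_mult_right integrable_gauss) auto
  also have "(LINT x|lborel. sqrt (pi / a) * exp (- (1 / (4 * a)) * x\<^sup>2)) = sqrt (pi / a) * sqrt (pi / (1 / (4 * a)))"
    using assms by (subst integral_mult_right_zero, subst integral_gauss) auto
  also have "\<dots> = 2 * pi"
    using assms by (simp add: real_sqrt_mult[symmetric] real_sqrt_divide[symmetric]) (simp add: real_sqrt_mult)
  finally show ?thesis .
qed

text \<open>The L2 theory is run on squared norms in \<open>ennreal\<close>, so that no roots of
  extended reals have to be taken. The passage to \<open>Lp_norm\<close> is made only where the
  definitions require it.\<close>

definition sqnorm :: "'a measure \<Rightarrow> ('a \<Rightarrow> complex) \<Rightarrow> ennreal" where
  "sqnorm M f = (\<integral>\<^sup>+x. ennreal ((norm (f x))\<^sup>2) \<partial>M)"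

lemma norm_add_square_le: "(norm (a + b :: complex))\<^sup>2 \<le> 2 * (norm a)\<^sup>2 + 2 * (norm b)\<^sup>2"
proof -
  have "(norm (a + b))\<^sup>2 \<le> (norm a + norm b)\<^sup>2" by (intro power_mono norm_triangle_ineq) auto
  also have "\<dots> \<le> 2 * (norm a)\<^sup>2 + 2 * (norm b)\<^sup>2"
    using sum_squares_bound[of "norm a" "norm b"] by (simp add: power2_sum)
  finally show ?thesis .
qed

lemma sqnorm_add_le:
  assumes [measurable]: "f \<in> borel_measurable M" "g \<in> borel_measurable M"
  shows "sqnorm M (\<lambda>x. f x + g x) \<le> 2 * sqnorm M f + 2 * sqnorm M g"
proof -
  have "sqnorm M (\<lambda>x. f x + g x) \<le> (\<integral>\<^sup>+x. 2 * ennreal ((norm (f x))\<^sup>2) + 2 * ennreal ((norm (g x))\<^sup>2) \<partial>M)"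
    unfolding sqnorm_def
  proof (intro nn_integral_mono)
    fix x
    have "ennreal ((norm (f x + g x))\<^sup>2) \<le> ennreal (2 * (norm (f x))\<^sup>2 + 2 * (norm (g x))\<^sup>2)"
      by (intro ennreal_leI norm_add_square_le)
    then show "ennreal ((norm (f x + g x))\<^sup>2) \<le> 2 * ennreal ((norm (f x))\<^sup>2) + 2 * ennreal ((norm (g x))\<^sup>2)"
      by (simp add: ennreal_mult)
  qed
  also have "\<dots> = 2 * sqnorm M f + 2 * sqnorm M g"
    unfolding sqnorm_def by (simp add: nn_integral_add nn_integral_cmult)
  finally show ?thesis .
qed

lemma sqnorm_mono:
  "(\<And>x. x \<in> space M \<Longrightarrow> norm (f x) \<le> norm (g x)) \<Longrightarrow> sqnorm M f \<le> sqnorm M g"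
  unfolding sqnorm_def by (intro nn_integral_mono ennreal_leI power_mono) auto

text \<open>Only an eventual bound is asked for, so that the lemma applies both to uniformly bounded
  sequences and to sequences whose norms tend to 0.\<close>

lemma sqnorm_fatou:
  assumes [measurable]: "\<And>n. u n \<in> borel_measurable M"
    and lim: "AE x in M. (\<lambda>n. u n x) \<longlonglongrightarrow> v x"
    and bound: "eventually (\<lambda>n. sqnorm M (u n) \<le> B) sequentially"
  shows "sqnorm M v \<le> B"
proof -
  have "sqnorm M v = (\<integral>\<^sup>+x. liminf (\<lambda>n. ennreal ((norm (u n x))\<^sup>2)) \<partial>M)"
    unfolding sqnorm_def
  proof (intro nn_integral_cong_AE)
    show "AE x in M. ennreal ((norm (v x))\<^sup>2) = liminf (\<lambda>n. ennreal ((norm (u n x))\<^sup>2))"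
      using lim
    proof eventually_elim
      fix x assume "(\<lambda>n. u n x) \<longlonglongrightarrow> v x"
      then have "(\<lambda>n. ennreal ((norm (u n x))\<^sup>2)) \<longlonglongrightarrow> ennreal ((norm (v x))\<^sup>2)"
        by (intro tendsto_intros)
      then show "ennreal ((norm (v x))\<^sup>2) = liminf (\<lambda>n. ennreal ((norm (u n x))\<^sup>2))"
        by (intro lim_imp_Liminf[symmetric]) auto
    qed
  qed
  also have "\<dots> \<le> liminf (\<lambda>n. sqnorm M (u n))"
    unfolding sqnorm_def by (intro nn_integral_liminf) auto
  also have "\<dots> \<le> liminf (\<lambda>n. B)"
    by (rule Liminf_mono[OF bound])
  finally show ?thesis by (simp add: Liminf_const)
qed

text \<open>Schur's test by way of 2 \<bar>f z\<bar> \<bar>f w\<bar> \<le> \<bar>f z\<bar>^2 +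
  \<bar>f w\<bar>^2: in each summand the kernel is integrated in the variable in which f no longer
  occurs.\<close>

lemma schur_bound:
  assumes [measurable]: "f \<in> borel_measurable borel" "k \<in> borel_measurable borel"
    and k0: "\<And>u. k u \<ge> 0"
    and k1: "\<And>z. (\<integral>\<^sup>+w. ennreal (k (w - z)) \<partial>cell_measure) \<le> B"
    and k2: "\<And>w. (\<integral>\<^sup>+z. ennreal (k (w - z)) \<partial>cell_measure) \<le> B"
  shows "(\<integral>\<^sup>+z. \<integral>\<^sup>+w. ennreal (norm (f z) * norm (f w) * k (w - z)) \<partial>cell_measure \<partial>cell_measure) \<le> B * sqnorm cell_measure f"
proof -
  define X where "X = (\<integral>\<^sup>+z. \<integral>\<^sup>+w. ennreal (norm (f z) * norm (f w) * k (w - z)) \<partial>cell_measure \<partial>cell_measure)"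
  define F where "F z = ennreal ((norm (f z))\<^sup>2)" for z
  have [measurable]: "F \<in> borel_measurable borel" unfolding F_def by measurable
  have pt: "2 * ennreal (norm (f z) * norm (f w) * k (w - z)) \<le> F z * ennreal (k (w - z)) + F w * ennreal (k (w - z))" for z w
  proof -
    have "2 * (norm (f z) * norm (f w)) * k (w - z) \<le> ((norm (f z))\<^sup>2 + (norm (f w))\<^sup>2) * k (w - z)"
      using sum_squares_bound[of "norm (f z)" "norm (f w)"] k0 by (intro mult_right_mono) auto
    then have "ennreal (2 * (norm (f z) * norm (f w) * k (w - z))) \<le> ennreal ((norm (f z))\<^sup>2 * k (w - z) + (norm (f w))\<^sup>2 * k (w - z))"
      by (intro ennreal_leI) (simp add: algebra_simps)
    then show ?thesis using k0 by (simp add: F_def ennreal_mult)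
  qed
  have "2 * X = (\<integral>\<^sup>+z. \<integral>\<^sup>+w. 2 * ennreal (norm (f z) * norm (f w) * k (w - z)) \<partial>cell_measure \<partial>cell_measure)"
    unfolding X_def by (subst nn_integral_cmult, measurable, subst nn_integral_cmult) measurable
  also have "\<dots> \<le> (\<integral>\<^sup>+z. \<integral>\<^sup>+w. F z * ennreal (k (w - z)) + F w * ennreal (k (w - z)) \<partial>cell_measure \<partial>cell_measure)"
    by (intro nn_integral_mono pt)
  also have "\<dots> = (\<integral>\<^sup>+z. \<integral>\<^sup>+w. F z * ennreal (k (w - z)) \<partial>cell_measure \<partial>cell_measure)
      + (\<integral>\<^sup>+z. \<integral>\<^sup>+w. F w * ennreal (k (w - z)) \<partial>cell_measure \<partial>cell_measure)"
    by (subst nn_integral_add, measurable, subst nn_integral_add) measurable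
  also have "(\<integral>\<^sup>+z. \<integral>\<^sup>+w. F w * ennreal (k (w - z)) \<partial>cell_measure \<partial>cell_measure)
      = (\<integral>\<^sup>+w. \<integral>\<^sup>+z. F w * ennreal (k (w - z)) \<partial>cell_measure \<partial>cell_measure)"
    by (rule cell_pair.Fubini') measurable
  also have "(\<integral>\<^sup>+z. \<integral>\<^sup>+w. F z * ennreal (k (w - z)) \<partial>cell_measure \<partial>cell_measure)
    + (\<integral>\<^sup>+w. \<integral>\<^sup>+z. F w * ennreal (k (w - z)) \<partial>cell_measure \<partial>cell_measure)
    \<le> (\<integral>\<^sup>+z. F z * B \<partial>cell_measure) + (\<integral>\<^sup>+w. F w * B \<partial>cell_measure)"
    using k1 k2 by (intro add_mono nn_integral_mono) (auto simp: nn_integral_cmult intro!: mult_left_mono)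
  also have "\<dots> = 2 * (B * sqnorm cell_measure f)"
    by (subst (1 2) nn_integral_multc) (simp_all add: sqnorm_def F_def[abs_def] mult_2 mult.commute)
  finally show ?thesis unfolding X_def[symmetric] by (simp add: ennreal_mult_le_mult_iff)
qed

text \<open>A nonnegative integrable weight tending pointwise to 1. Its Gaussian and Fejer factors
  are the ones whose kernels are nonnegative approximate identities.\<close>

definition bessel_weight :: "nat \<Rightarrow> real \<times> int \<times> int \<Rightarrow> real" where
  "bessel_weight n \<zeta> = exp (- (1 / (real n + 1)) * (fst \<zeta>)\<^sup>2) * (fejer_coeff n (fst (snd \<zeta>)) * fejer_coeff n (snd (snd \<zeta>)))"

definition bessel_kernel :: "nat \<Rightarrow> real \<times> real \<times> real \<Rightarrow> real" where
  "bessel_kernel n u = sqrt (pi / (1 / (real n + 1))) * exp (- (fst u)\<^sup>2 / (4 * (1 / (real n + 1)))) *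
     (fejer_kernel n (fst (snd u)) * fejer_kernel n (snd (snd u)))"

lemma bessel_multiplier_kernel:
  shows "integrable RZ2 (\<lambda>\<zeta>. complex_of_real (bessel_weight n \<zeta>))"
    and "multiplier_kernel (\<lambda>\<zeta>. of_real (bessel_weight n \<zeta>)) u = of_real (bessel_kernel n u)"
proof -
  define a where "a = 1 / (real n + 1)"
  have a: "a > 0" by (simp add: a_def)
  have eq: "(\<lambda>\<zeta>. complex_of_real (bessel_weight n \<zeta>)) =
     (\<lambda>\<zeta>. (\<lambda>\<xi>. of_real (exp (- a * \<xi>\<^sup>2))) (fst \<zeta>) *
        ((\<lambda>k. of_real (fejer_coeff n k)) (fst (snd \<zeta>)) * (\<lambda>k. of_real (fejer_coeff n k)) (snd (snd \<zeta>))))"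
    by (simp add: bessel_weight_def a_def)
  have int: "integrable lborel (\<lambda>\<xi>. complex_of_real (exp (- a * \<xi>\<^sup>2)))"
    using integrable_gauss[OF a] by (rule integrable_of_real)
  note P = multiplier_kernel_product[OF int, of "{-int n..int n}" "\<lambda>k. of_real (fejer_coeff n k)" "\<lambda>k. of_real (fejer_coeff n k)"]
  show "integrable RZ2 (\<lambda>\<zeta>. complex_of_real (bessel_weight n \<zeta>))"
    unfolding eq by (rule P(1)) (simp_all add: fejer_coeff_eq_0)
  have "multiplier_kernel (\<lambda>\<zeta>. of_real (bessel_weight n \<zeta>)) u =
     (LINT \<xi>|lborel. of_real (exp (- a * \<xi>\<^sup>2)) * cis (\<xi> * fst u)) *
      ((\<Sum>k\<in>{-int n..int n}. of_real (fejer_coeff n k) * cis (real_of_int k * fst (snd u))) *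
       (\<Sum>k\<in>{-int n..int n}. of_real (fejer_coeff n k) * cis (real_of_int k * snd (snd u))))"
    unfolding eq by (rule P(2)) (simp_all add: fejer_coeff_eq_0)
  also have "(LINT \<xi>|lborel. of_real (exp (- a * \<xi>\<^sup>2)) * cis (\<xi> * fst u)) = of_real (sqrt (pi / a) * exp (- (fst u)\<^sup>2 / (4 * a)))"
    using integral_gauss_cis[OF a, of "fst u"] by (simp add: mult.commute[of _ "fst u"])
  finally show "multiplier_kernel (\<lambda>\<zeta>. of_real (bessel_weight n \<zeta>)) u = of_real (bessel_kernel n u)"
    unfolding fejer_kernel_eq bessel_kernel_def a_def by simp
qed

lemma bessel_kernel_nonneg: "bessel_kernel n u \<ge> 0"
  unfolding bessel_kernel_def by (intro mult_nonneg_nonneg fejer_kernel_nonneg) auto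

lemma measurable_bessel_kernel [measurable]: "bessel_kernel n \<in> borel_measurable borel"
proof -
  have [measurable]: "(\<lambda>w. fst w) \<in> borel_measurable (borel :: (real \<times> real \<times> real) measure)"
    "(\<lambda>w. fst (snd w)) \<in> borel_measurable (borel :: (real \<times> real \<times> real) measure)"
    "(\<lambda>w. snd (snd w)) \<in> borel_measurable (borel :: (real \<times> real \<times> real) measure)"
    by (intro borel_measurable_continuous_onI continuous_intros)+
  show ?thesis unfolding bessel_kernel_def by measurable
qed

lemma bessel_kernel_integral:
  "(\<integral>\<^sup>+w. ennreal (bessel_kernel n (w - z)) \<partial>cell_measure) \<le> ennreal ((2 * pi) ^ 3)"
proof -
  define a where "a = 1 / (real n + 1)"
  have a: "a > 0" by (simp add: a_def)
  have eq: "ennreal (bessel_kernel n (w - z)) = ennreal (sqrt (pi / a) * exp (- (fst w - fst z)\<^sup>2 / (4 * a))) *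
      (ennreal (fejer_kernel n (fst (snd w) - fst (snd z))) * ennreal (fejer_kernel n (snd (snd w) - snd (snd z))))" for w
    unfolding bessel_kernel_def a_def
    using a by (simp add: ennreal_mult[symmetric] fejer_kernel_nonneg a_def)
  have "(\<integral>\<^sup>+w. ennreal (bessel_kernel n (w - z)) \<partial>cell_measure) =
     (\<integral>\<^sup>+x. ennreal (sqrt (pi / a) * exp (- (x - fst z)\<^sup>2 / (4 * a))) \<partial>lborel) *
     ((\<integral>\<^sup>+y\<in>{0..<2*pi}. ennreal (fejer_kernel n (y - fst (snd z))) \<partial>lborel) *
      (\<integral>\<^sup>+y\<in>{0..<2*pi}. ennreal (fejer_kernel n (y - snd (snd z))) \<partial>lborel))"
    unfolding eq by (rule nn_integral_cell_product) measurable
  also have "\<dots> \<le> ennreal (2 * pi) * (ennreal (2 * pi) * ennreal (2 * pi))"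
    using nn_integral_gauss_shift[OF a] by (intro mult_mono nn_integral_fejer_kernel) auto
  also have "\<dots> = ennreal ((2 * pi) ^ 3)"
    by (simp add: ennreal_mult[symmetric] power3_eq_cube)
  finally show ?thesis .
qed

lemma bessel_kernel_minus: "bessel_kernel n (- u) = bessel_kernel n u"
  by (cases u) (simp add: bessel_kernel_def fejer_kernel_minus)

lemma bessel_weight_nonneg: "bessel_weight n \<zeta> \<ge> 0"
  by (simp add: bessel_weight_def fejer_coeff_nonneg)

lemma bessel_weight_tendsto: "(\<lambda>n. bessel_weight n \<zeta>) \<longlonglongrightarrow> 1"
proof -
  have "(\<lambda>n. exp (- (inverse (real (Suc n)) * (fst \<zeta>)\<^sup>2)) * (fejer_coeff n (fst (snd \<zeta>)) * fejer_coeff n (snd (snd \<zeta>))))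
     \<longlonglongrightarrow> exp (- (0 * (fst \<zeta>)\<^sup>2)) * (1 * 1)"
    by (intro tendsto_intros fejer_coeff_tendsto LIMSEQ_inverse_real_of_nat)
  then show ?thesis by (simp add: bessel_weight_def divide_inverse add.commute)
qed

text \<open>Since the Gaussian and Fejer kernels are nonnegative with integral \<open>2 * pi\<close>, Schur's test
  bounds the weighted norm uniformly in \<open>n\<close>; Fatou's lemma then removes the weight.\<close>

lemma bessel_inequality:
  assumes f: "integrable cell_measure f"
  shows "sqnorm RZ2 (fhat f) \<le> ennreal ((2 * pi) ^ 3) * sqnorm cell_measure f"
proof -
  have [measurable]: "f \<in> borel_measurable borel" using f by auto
  define B where "B = ennreal ((2 * pi) ^ 3) * sqnorm cell_measure f"
  \<comment> \<open>The root of the weight is put on the function, so that the squared norm carries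
    the weight itself and is a bilinear form with multiplier \<open>bessel_weight n\<close>.\<close>
  define u where "u n \<zeta> = of_real (sqrt (bessel_weight n \<zeta>)) * fhat f \<zeta>" for n \<zeta>
  have w_meas [measurable]: "bessel_weight n \<in> borel_measurable RZ2" for n
  proof -
    have [measurable]: "(\<lambda>\<zeta>. complex_of_real (bessel_weight n \<zeta>)) \<in> borel_measurable RZ2"
      using bessel_multiplier_kernel(1)[of n] by auto
    have "(\<lambda>\<zeta>. Re (complex_of_real (bessel_weight n \<zeta>))) \<in> borel_measurable RZ2"
      by measurable
    then show ?thesis by simp
  qed
  have bound: "sqnorm RZ2 (u n) \<le> B" for n
  proof -
    have sq: "(norm (u n \<zeta>))\<^sup>2 = bessel_weight n \<zeta> * (norm (fhat f \<zeta>))\<^sup>2" for \<zeta>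
      by (simp add: u_def norm_mult power_mult_distrib bessel_weight_nonneg)
    have cpx: "of_real (bessel_weight n \<zeta>) * fhat f \<zeta> * cnj (fhat f \<zeta>) = of_real (bessel_weight n \<zeta> * (norm (fhat f \<zeta>))\<^sup>2)" for \<zeta>
      by (simp only: mult.assoc complex_norm_square[symmetric] of_real_mult)
    define C where "C = (LINT z|cell_measure. norm (f z))"
    have "integrable RZ2 (\<lambda>\<zeta>. complex_of_real (C\<^sup>2) * of_real (bessel_weight n \<zeta>))"
      by (intro integrable_mult_right bessel_multiplier_kernel)
    then have int: "integrable RZ2 (\<lambda>\<zeta>. complex_of_real (bessel_weight n \<zeta> * (norm (fhat f \<zeta>))\<^sup>2))"
    proof (rule Bochner_Integration.integrable_bound)
      show "AE \<zeta> in RZ2. norm (complex_of_real (bessel_weight n \<zeta> * (norm (fhat f \<zeta>))\<^sup>2))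
         \<le> norm (complex_of_real (C\<^sup>2) * of_real (bessel_weight n \<zeta>))"
      proof (intro AE_I2)
        fix \<zeta>
        have "(norm (fhat f \<zeta>))\<^sup>2 \<le> C\<^sup>2" unfolding C_def by (intro power_mono norm_fhat_le) auto
        then show "norm (complex_of_real (bessel_weight n \<zeta> * (norm (fhat f \<zeta>))\<^sup>2))
         \<le> norm (complex_of_real (C\<^sup>2) * of_real (bessel_weight n \<zeta>))"
          using bessel_weight_nonneg[of n \<zeta>] by (simp add: norm_mult norm_power mult_left_mono mult.commute)
      qed
    qed measurable
    then have int': "integrable RZ2 (\<lambda>\<zeta>. bessel_weight n \<zeta> * (norm (fhat f \<zeta>))\<^sup>2)"
      by (simp only: complex_of_real_integrable_eq)
    have "sqnorm RZ2 (u n) = ennreal (LINT \<zeta>|RZ2. bessel_weight n \<zeta> * (norm (fhat f \<zeta>))\<^sup>2)"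
      unfolding sqnorm_def sq
      by (intro nn_integral_eq_integral int') (auto simp: bessel_weight_nonneg)
    also have "\<dots> = ennreal (norm (LINT \<zeta>|RZ2. of_real (bessel_weight n \<zeta>) * fhat f \<zeta> * cnj (fhat f \<zeta>)))"
      unfolding cpx integral_complex_of_real norm_of_real
      by (simp add: abs_of_nonneg bessel_weight_nonneg)
    also have "\<dots> \<le> (\<integral>\<^sup>+z. \<integral>\<^sup>+w. ennreal (norm (f z) * norm (f w) * bessel_kernel n (w - z)) \<partial>cell_measure \<partial>cell_measure)"
      using norm_bilinear_le[OF bessel_multiplier_kernel(1)[of n] f f]
      by (simp add: bessel_multiplier_kernel(2) abs_of_nonneg bessel_kernel_nonneg)
    also have "\<dots> \<le> B"
      unfolding B_def
    proof (rule schur_bound)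
      fix w
      have "(\<integral>\<^sup>+z. ennreal (bessel_kernel n (w - z)) \<partial>cell_measure) = (\<integral>\<^sup>+z. ennreal (bessel_kernel n (z - w)) \<partial>cell_measure)"
        by (subst bessel_kernel_minus[symmetric]) simp
      then show "(\<integral>\<^sup>+z. ennreal (bessel_kernel n (w - z)) \<partial>cell_measure) \<le> ennreal ((2 * pi) ^ 3)"
        using bessel_kernel_integral by simp
    qed (simp_all only: bessel_kernel_nonneg bessel_kernel_integral measurable_bessel_kernel \<open>f \<in> borel_measurable borel\<close>)
    finally show ?thesis .
  qed
  have "sqnorm RZ2 (fhat f) \<le> B"
  proof (rule sqnorm_fatou[of u])
    show "u n \<in> borel_measurable RZ2" for n unfolding u_def by measurable
    show "AE \<zeta> in RZ2. (\<lambda>n. u n \<zeta>) \<longlonglongrightarrow> fhat f \<zeta>"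
    proof (intro AE_I2)
      fix \<zeta>
      have "(\<lambda>n. u n \<zeta>) \<longlonglongrightarrow> of_real (sqrt 1) * fhat f \<zeta>"
        unfolding u_def by (intro tendsto_intros bessel_weight_tendsto)
      then show "(\<lambda>n. u n \<zeta>) \<longlonglongrightarrow> fhat f \<zeta>" by simp
    qed
  qed (simp add: bound)
  then show ?thesis by (simp add: B_def)
qed

section \<open>The Fourier transform on square-integrable functions\<close>

lemma ennpowr_half_square: "(ennpowr a (1 / 2))\<^sup>2 = a"
proof (cases a)
  case (real r)
  have "(r powr (1 / 2))\<^sup>2 = r" using real by (simp add: powr_half_sqrt)
  then show ?thesis using real by (simp add: ennpowr_def ennreal_power)
next
  case top
  then show ?thesis by (simp add: ennpowr_def power2_eq_square ennreal_top_mult)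
qed

lemma Lp_norm_2:
  assumes [measurable]: "f \<in> borel_measurable M"
  shows "Lp_norm M 2 f = ennpowr (sqnorm M f) (1 / 2)"
proof -
  have "ennpowr (ennreal (norm (f x))) 2 = ennreal ((norm (f x))\<^sup>2)" for x
    by (cases "f x = 0") (auto simp: ennpowr_def powr_numeral)
  moreover have "(\<lambda>x. ennreal (norm (f x))) \<in> borel_measurable M" by measurable
  ultimately show ?thesis
    by (simp add: Lp_norm_def Lp_ennnorm_def sqnorm_def)
qed

lemma Lp_norm_2_square:
  assumes "f \<in> borel_measurable M"
  shows "(Lp_norm M 2 f)\<^sup>2 = sqnorm M f"
  unfolding Lp_norm_2[OF assms] by (rule ennpowr_half_square)

text \<open>Measurability appears on the right because \<open>Lp_norm\<close> is \<open>top\<close>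
  on functions that are not measurable. The conditions in the definition of \<open>fourier\<close>
  thereby include measurability.\<close>

lemma Lp_norm_2_finite_iff:
  "Lp_norm M 2 f < top \<longleftrightarrow> f \<in> borel_measurable M \<and> sqnorm M f < top"
proof (cases "f \<in> borel_measurable M")
  case True
  have "a < top \<longleftrightarrow> a\<^sup>2 < top" for a :: ennreal
    by (auto simp: power2_eq_square ennreal_mult_less_top)
  then show ?thesis using True Lp_norm_2_square[OF True] by metis
qed (simp add: Lp_norm_def)

lemma ennreal_tendsto_0_iff:
  fixes f :: "'a \<Rightarrow> ennreal"
  shows "(f \<longlongrightarrow> 0) F \<longleftrightarrow> (\<forall>e>0. eventually (\<lambda>x. f x < ennreal e) F)"
proof
  assume "(f \<longlongrightarrow> 0) F"
  then show "\<forall>e>0. eventually (\<lambda>x. f x < ennreal e) F" by (auto intro: order_tendstoD)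
next
  assume *: "\<forall>e>0. eventually (\<lambda>x. f x < ennreal e) F"
  show "(f \<longlongrightarrow> 0) F"
  proof (rule order_tendstoI)
    fix a :: ennreal assume "0 < a"
    then have "\<exists>e>0. ennreal e \<le> a"
      by (cases a) (auto intro: exI[of _ 1])
    then obtain e where "e > 0" "ennreal e \<le> a" by blast
    with * have "eventually (\<lambda>x. f x < ennreal e) F" by blast
    then show "eventually (\<lambda>x. f x < a) F"
      by eventually_elim (use \<open>ennreal e \<le> a\<close> in auto)
  qed auto
qed

lemma ennreal_square_tendsto_0_iff:
  fixes f :: "'a \<Rightarrow> ennreal"
  shows "((\<lambda>x. (f x)\<^sup>2) \<longlongrightarrow> 0) F \<longleftrightarrow> (f \<longlongrightarrow> 0) F"
proof -
  have sq: "a\<^sup>2 < ennreal (e\<^sup>2) \<longleftrightarrow> a < ennreal e" if "e > 0" for a e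
  proof (cases a)
    case (real r)
    then show ?thesis using that power_mono_iff[of e r 2]
      by (simp add: ennreal_power ennreal_less_iff flip: not_le)
  qed (simp add: power2_eq_square ennreal_top_mult)
  show ?thesis
    unfolding ennreal_tendsto_0_iff
  proof (intro iffI allI impI)
    fix e :: real assume "\<forall>e>0. \<forall>\<^sub>F x in F. (f x)\<^sup>2 < ennreal e" "0 < e"
    then have "\<forall>\<^sub>F x in F. (f x)\<^sup>2 < ennreal (e\<^sup>2)" by simp
    then show "\<forall>\<^sub>F x in F. f x < ennreal e" using sq[OF \<open>0 < e\<close>] by simp
  next
    fix e :: real assume "\<forall>e>0. \<forall>\<^sub>F x in F. f x < ennreal e" and e: "0 < e"
    then have "\<forall>\<^sub>F x in F. f x < ennreal (sqrt e)" by simp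
    then show "\<forall>\<^sub>F x in F. (f x)\<^sup>2 < ennreal e" using sq[of "sqrt e"] e by simp
  qed
qed

definition trunc :: "real \<Rightarrow> (real \<times> real \<times> real \<Rightarrow> complex) \<Rightarrow> real \<times> real \<times> real \<Rightarrow> complex" where
  "trunc R f z = (if \<bar>fst z\<bar> \<le> R then f z else 0)"

lemma trunc_eq: "(\<lambda>(x, y). if \<bar>x\<bar> \<le> R then f (x, y) else 0) = trunc R f"
  by (auto simp: trunc_def)

lemma measurable_fst_cell [measurable]:
  "(\<lambda>z. fst z) \<in> borel_measurable (borel :: (real \<times> real \<times> real) measure)"
  by (intro borel_measurable_continuous_onI continuous_intros)

lemma measurable_trunc [measurable]:
  assumes [measurable]: "f \<in> borel_measurable borel"
  shows "trunc R f \<in> borel_measurable borel"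
  unfolding trunc_def by measurable

lemma norm_trunc_le: "norm (trunc R f z) \<le> norm (f z)"
  by (simp add: trunc_def)

lemma sqnorm_trunc_le: "sqnorm M (trunc R f) \<le> sqnorm M f"
  by (intro sqnorm_mono norm_trunc_le)

lemma integrable_cell_strip: "integrable cell_measure (\<lambda>z. indicator {-R..R} (fst z) :: real)"
proof -
  have "(\<integral>\<^sup>+z. ennreal (norm (indicator {-R..R} (fst z) :: real)) \<partial>cell_measure)
    = (\<integral>\<^sup>+w. indicator {-R..R} (fst w) * ((\<lambda>_. 1) (fst (snd w)) * (\<lambda>_. 1) (snd (snd w))) \<partial>cell_measure)"
    by (intro nn_integral_cong) (auto simp: indicator_def)
  also have "\<dots> = (\<integral>\<^sup>+x. indicator {-R..R} x \<partial>lborel) * ((\<integral>\<^sup>+y\<in>{0..<2*pi}. 1 \<partial>lborel) * (\<integral>\<^sup>+y\<in>{0..<2*pi}. 1 \<partial>lborel))"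
    by (rule nn_integral_cell_product) auto
  also have "\<dots> < \<infinity>" by (simp add: ennreal_mult_less_top emeasure_lborel_Icc_eq)
  finally show ?thesis by (intro integrableI_bounded) auto
qed

text \<open>A strip \<bar>x\<bar> \<le> R has finite measure in the cell, and a \<le> a^2 + 1 turns
  square integrability on it into integrability.\<close>

lemma integrable_trunc:
  assumes [measurable]: "f \<in> borel_measurable borel" and fin: "sqnorm cell_measure f < top"
  shows "integrable cell_measure (trunc R f)"
proof -
  have "integrable cell_measure (\<lambda>z. (norm (f z))\<^sup>2)"
    using fin unfolding sqnorm_def by (intro integrableI_nonneg) (auto simp: infinity_ennreal_def)
  then have "integrable cell_measure (\<lambda>z. (norm (f z))\<^sup>2 + indicator {-R..R} (fst z))"
    by (intro Bochner_Integration.integrable_add integrable_cell_strip)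
  then show ?thesis
  proof (rule Bochner_Integration.integrable_bound)
    have le: "a \<le> a\<^sup>2 + 1" for a :: real
      using zero_le_power2[of "a - 1/2"] by (simp add: power2_eq_square algebra_simps)
    show "AE z in cell_measure. norm (trunc R f z) \<le> norm ((norm (f z))\<^sup>2 + indicator {-R..R} (fst z))"
      using le by (intro AE_I2) (auto simp: trunc_def indicator_def)
  qed measurable
qed

lemma fhat_diff:
  assumes "integrable cell_measure f" "integrable cell_measure g"
  shows "fhat (\<lambda>z. f z - g z) \<zeta> = fhat f \<zeta> - fhat g \<zeta>"
  unfolding fhat_def using integrable_character_mult(1)[OF assms(1), of \<zeta>] integrable_character_mult(1)[OF assms(2), of \<zeta>]
  by (simp add: right_diff_distrib)

definition tail :: "(real \<times> real \<times> real \<Rightarrow> complex) \<Rightarrow> real \<Rightarrow> ennreal" where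
  "tail f R = (\<integral>\<^sup>+z. ennreal ((norm (f z))\<^sup>2) * indicator {z. \<bar>fst z\<bar> > R} z \<partial>cell_measure)"

lemma tail_tendsto_0:
  assumes [measurable]: "f \<in> borel_measurable borel" and fin: "sqnorm cell_measure f < top"
  shows "(tail f \<longlongrightarrow> 0) at_top"
proof -
  have anti: "tail f R \<le> tail f R'" if "R' \<le> R" for R R'
    unfolding tail_def using that by (intro nn_integral_mono) (auto simp: indicator_def)
  have "(\<lambda>n. \<integral>\<^sup>+z. ennreal ((norm (f z))\<^sup>2) * indicator {z. \<bar>fst z\<bar> > real n} z \<partial>cell_measure)
     \<longlonglongrightarrow> (\<integral>\<^sup>+z. 0 \<partial>cell_measure)"
  proof (rule nn_integral_dominated_convergence[where w="\<lambda>z. ennreal ((norm (f z))\<^sup>2)"])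
    show "AE z in cell_measure. (\<lambda>n. ennreal ((norm (f z))\<^sup>2) * indicator {z. \<bar>fst z\<bar> > real n} z) \<longlonglongrightarrow> 0"
    proof (intro AE_I2)
      fix z :: "real \<times> real \<times> real"
      obtain m where "\<bar>fst z\<bar> \<le> real m" using real_arch_simple by blast
      then have "eventually (\<lambda>n. ennreal ((norm (f z))\<^sup>2) * indicator {z. \<bar>fst z\<bar> > real n} z = 0) sequentially"
        by (auto simp: eventually_sequentially intro!: exI[of _ m])
      then show "(\<lambda>n. ennreal ((norm (f z))\<^sup>2) * indicator {z. \<bar>fst z\<bar> > real n} z) \<longlonglongrightarrow> 0"
        by (rule tendsto_eventually)
    qed
  qed (use fin in \<open>auto simp: sqnorm_def indicator_def less_top\<close>)
  then have lim: "(\<lambda>n. tail f (real n)) \<longlonglongrightarrow> 0" by (simp add: tail_def)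
  show ?thesis unfolding ennreal_tendsto_0_iff
  proof (intro allI impI)
    fix e :: real assume "e > 0"
    with lim obtain n where n: "tail f (real n) < ennreal e"
      unfolding ennreal_tendsto_0_iff eventually_sequentially by blast
    have "tail f R < ennreal e" if "R \<ge> real n" for R
      using anti[OF that] n by (rule le_less_trans)
    then show "\<forall>\<^sub>F R in at_top. tail f R < ennreal e"
      unfolding eventually_at_top_linorder by blast
  qed
qed

lemma sqnorm_trunc_diff_le:
  assumes [measurable]: "f \<in> borel_measurable borel"
  shows "sqnorm cell_measure (\<lambda>z. trunc R f z - trunc R' f z) \<le> tail f R + tail f R'"
proof -
  have "sqnorm cell_measure (\<lambda>z. trunc R f z - trunc R' f z)
    \<le> (\<integral>\<^sup>+z. ennreal ((norm (f z))\<^sup>2) * indicator {z. \<bar>fst z\<bar> > R} z + ennreal ((norm (f z))\<^sup>2) * indicator {z. \<bar>fst z\<bar> > R'} z \<partial>cell_measure)"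
    unfolding sqnorm_def by (intro nn_integral_mono) (auto simp: trunc_def indicator_def)
  also have "\<dots> = tail f R + tail f R'"
    unfolding tail_def by (intro nn_integral_add) measurable
  finally show ?thesis .
qed

text \<open>Bessel's inequality makes the transforms of the truncations a Cauchy family as R grows,
  at a rate given by the mass of f far out in x.\<close>

lemma sqnorm_fhat_trunc_diff_le:
  assumes [measurable]: "f \<in> borel_measurable borel" and fin: "sqnorm cell_measure f < top"
  shows "sqnorm RZ2 (\<lambda>\<zeta>. fhat (trunc R f) \<zeta> - fhat (trunc R' f) \<zeta>) \<le> ennreal ((2 * pi) ^ 3) * (tail f R + tail f R')"
proof -
  note int = integrable_trunc[OF assms]
  have "sqnorm RZ2 (\<lambda>\<zeta>. fhat (trunc R f) \<zeta> - fhat (trunc R' f) \<zeta>) = sqnorm RZ2 (fhat (\<lambda>z. trunc R f z - trunc R' f z))"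
    using fhat_diff[OF int int] by (intro arg_cong[of _ _ "sqnorm RZ2"]) (auto simp: fun_eq_iff)
  also have "\<dots> \<le> ennreal ((2 * pi) ^ 3) * sqnorm cell_measure (\<lambda>z. trunc R f z - trunc R' f z)"
    by (intro bessel_inequality Bochner_Integration.integrable_diff int)
  also have "\<dots> \<le> ennreal ((2 * pi) ^ 3) * (tail f R + tail f R')"
    by (intro mult_left_mono sqnorm_trunc_diff_le) auto
  finally show ?thesis .
qed

lemma ennreal_suminf_term_le: "f n \<le> (\<Sum>i. f i :: ennreal)"
proof -
  have "(\<Sum>i\<in>{n}. f i) \<le> (\<Sum>i. f i)" by (intro sum_le_suminf) auto
  then show ?thesis by simp
qed

text \<open>The Riesz-Fischer argument: a rapidly convergent subsequence of truncations has almost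
  everywhere convergent transforms, and Fatou's lemma bounds the distance from their limit to every
  member of the family, not only along the subsequence.\<close>

lemma fourier_limit_exists:
  assumes f_meas [measurable]: "f \<in> borel_measurable borel" and fin: "sqnorm cell_measure f < top"
  shows "\<exists>F. F \<in> borel_measurable RZ2 \<and> sqnorm RZ2 F < top \<and>
    ((\<lambda>R. sqnorm RZ2 (\<lambda>\<zeta>. F \<zeta> - fhat (trunc R f) \<zeta>)) \<longlongrightarrow> 0) at_top"
proof -
  define k :: real where "k = (2 * pi) ^ 3"
  have k0: "k \<ge> 0" "k > 0" by (simp_all add: k_def)
  define K where "K = ennreal k"
  have K: "K < top" by (simp add: K_def)
  note tail0 = tail_tendsto_0[OF assms]
  have "\<exists>R. tail f R \<le> ennreal ((1 / 8) ^ n)" for n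
  proof -
    have "\<forall>\<^sub>F R in at_top. tail f R < ennreal ((1 / 8) ^ n)"
      using tail0 unfolding ennreal_tendsto_0_iff by simp
    then show ?thesis unfolding eventually_at_top_linorder by (meson less_imp_le order_refl)
  qed
  then obtain r where r: "\<And>n. tail f (r n) \<le> ennreal ((1 / 8) ^ n)" by metis
  define H where "H n = fhat (trunc (r n) f)" for n
  have [measurable]: "H n \<in> borel_measurable RZ2" for n unfolding H_def by measurable
  \<comment> \<open>The radii make the n-th increment of size 8 powr (- n) in squared norm. The
    weight 2 ^ n leaves a summable 4 powr (- n), and finiteness of S at a point forces increments of
    size 2 powr (- n/2) there.\<close>
  define S where "S \<zeta> = (\<Sum>n. ennreal (2 ^ n * (norm (H (Suc n) \<zeta> - H n \<zeta>))\<^sup>2))" for \<zeta>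
  have [measurable]: "S \<in> borel_measurable RZ2" unfolding S_def by measurable
  have term_le: "(\<integral>\<^sup>+\<zeta>. ennreal (2 ^ n * (norm (H (Suc n) \<zeta> - H n \<zeta>))\<^sup>2) \<partial>RZ2) \<le> ennreal (2 * k * (1 / 4) ^ n)" for n
  proof -
    have "(\<integral>\<^sup>+\<zeta>. ennreal (2 ^ n * (norm (H (Suc n) \<zeta> - H n \<zeta>))\<^sup>2) \<partial>RZ2) = ennreal (2 ^ n) * sqnorm RZ2 (\<lambda>\<zeta>. H (Suc n) \<zeta> - H n \<zeta>)"
      unfolding sqnorm_def by (subst nn_integral_cmult[symmetric]) (auto simp: ennreal_mult)
    also have "\<dots> \<le> ennreal (2 ^ n) * (K * (tail f (r (Suc n)) + tail f (r n)))"
      unfolding H_def K_def k_def by (intro mult_left_mono sqnorm_fhat_trunc_diff_le assms) auto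
    also have "\<dots> \<le> ennreal (2 ^ n) * (K * (ennreal ((1 / 8) ^ n) + ennreal ((1 / 8) ^ n)))"
    proof (intro mult_left_mono add_mono r order_trans[OF r[of "Suc n"]])
      show "ennreal ((1 / 8) ^ Suc n) \<le> ennreal ((1 / 8) ^ n)" by (intro ennreal_leI) simp
    qed auto
    also have "\<dots> = ennreal (2 ^ n * (k * ((1 / 8) ^ n + (1 / 8) ^ n)))"
      using k0 by (simp only: K_def ennreal_mult ennreal_plus zero_le_power zero_le_numeral
          zero_le_divide_1_iff add_nonneg_nonneg mult_nonneg_nonneg)
    also have "2 ^ n * (k * ((1 / 8) ^ n + (1 / 8) ^ n)) = 2 * k * (2 * (1 / 8)) ^ n"
      unfolding power_mult_distrib by (simp only: mult.assoc mult.left_commute mult_2 distrib_left distrib_right)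
    also have "2 * (1 / 8 :: real) = 1 / 4" by simp
    finally show ?thesis .
  qed
  have "(\<integral>\<^sup>+\<zeta>. S \<zeta> \<partial>RZ2) = (\<Sum>n. \<integral>\<^sup>+\<zeta>. ennreal (2 ^ n * (norm (H (Suc n) \<zeta> - H n \<zeta>))\<^sup>2) \<partial>RZ2)"
    unfolding S_def by (intro nn_integral_suminf) measurable
  also have "\<dots> \<le> (\<Sum>n. ennreal (2 * k * (1 / 4) ^ n))"
    by (intro suminf_le term_le) auto
  also have "\<dots> = ennreal (\<Sum>n. 2 * k * (1 / 4) ^ n)"
    using k0 by (intro suminf_ennreal2 summable_mult summable_geometric) auto
  finally have "(\<integral>\<^sup>+\<zeta>. S \<zeta> \<partial>RZ2) \<noteq> \<infinity>" by (auto simp: top_unique)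
  then have "AE \<zeta> in RZ2. S \<zeta> \<noteq> \<infinity>" by (intro nn_integral_PInf_AE) auto
  then have conv: "AE \<zeta> in RZ2. convergent (\<lambda>n. H n \<zeta>)"
  proof eventually_elim
    fix \<zeta> assume S: "S \<zeta> \<noteq> \<infinity>"
    then obtain v where v: "S \<zeta> = ennreal v" "v \<ge> 0" by (cases "S \<zeta>") auto
    define b where "b = sqrt v"
    have bd: "norm (H (Suc n) \<zeta> - H n \<zeta>) \<le> b * (1 / sqrt 2) ^ n" for n
    proof -
      have "ennreal (2 ^ n * (norm (H (Suc n) \<zeta> - H n \<zeta>))\<^sup>2) \<le> S \<zeta>"
        unfolding S_def by (rule ennreal_suminf_term_le[of "\<lambda>n. ennreal (2 ^ n * (norm (H (Suc n) \<zeta> - H n \<zeta>))\<^sup>2)" n])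
      then have "2 ^ n * (norm (H (Suc n) \<zeta> - H n \<zeta>))\<^sup>2 \<le> v"
        unfolding v(1) using v(2) by (subst (asm) ennreal_le_iff) auto
      moreover have "(sqrt 2 ^ n)\<^sup>2 = 2 ^ n"
        by (metis power_mult mult.commute real_sqrt_pow2 zero_le_numeral)
      ultimately have "(sqrt 2 ^ n * norm (H (Suc n) \<zeta> - H n \<zeta>))\<^sup>2 \<le> v"
        by (simp only: power_mult_distrib)
      then have "sqrt 2 ^ n * norm (H (Suc n) \<zeta> - H n \<zeta>) \<le> b"
        unfolding b_def by (rule real_le_rsqrt)
      moreover have "sqrt 2 ^ n * (1 / sqrt 2) ^ n = 1" by (simp add: power_mult_distrib[symmetric])
      ultimately have "(1 / sqrt 2) ^ n * (sqrt 2 ^ n * norm (H (Suc n) \<zeta> - H n \<zeta>)) \<le> (1 / sqrt 2) ^ n * b"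
        by (intro mult_left_mono) auto
      with \<open>sqrt 2 ^ n * (1 / sqrt 2) ^ n = 1\<close> show ?thesis
        by (metis mult.assoc mult.commute mult_1)
    qed
    have "summable (\<lambda>n. b * (1 / sqrt 2) ^ n)" by (intro summable_mult summable_geometric) auto
    then have "summable (\<lambda>n. H (Suc n) \<zeta> - H n \<zeta>)"
      by (rule summable_comparison_test') (use bd in auto)
    then have "convergent (\<lambda>n. \<Sum>k<n. H (Suc k) \<zeta> - H k \<zeta>)" by (simp add: summable_iff_convergent)
    moreover have "(\<Sum>k<n. H (Suc k) \<zeta> - H k \<zeta>) = H n \<zeta> - H 0 \<zeta>" for n
      by (rule sum_lessThan_telescope[of "\<lambda>n. H n \<zeta>" n])
    ultimately have "convergent (\<lambda>n. H n \<zeta> - H 0 \<zeta>)" by simp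
    then have "convergent (\<lambda>n. (H n \<zeta> - H 0 \<zeta>) + H 0 \<zeta>)"
      by (intro convergent_add convergent_const)
    then show "convergent (\<lambda>n. H n \<zeta>)" by simp
  qed
  define F where "F \<zeta> = lim (\<lambda>n. H n \<zeta>)" for \<zeta>
  have [measurable]: "F \<in> borel_measurable RZ2" unfolding F_def by measurable
  have limF: "AE \<zeta> in RZ2. (\<lambda>n. H n \<zeta>) \<longlonglongrightarrow> F \<zeta>"
    using conv unfolding F_def convergent_LIMSEQ_iff .
  \<comment> \<open>Here R is arbitrary and m is any lower bound for the index of the subsequence.
    Letting m grow first and R afterwards yields the limit.\<close>
  have dist: "sqnorm RZ2 (\<lambda>\<zeta>. F \<zeta> - fhat (trunc R f) \<zeta>) \<le> K * (ennreal ((1 / 8) ^ m) + tail f R)" for R m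
  proof (rule sqnorm_fatou[of "\<lambda>n \<zeta>. H n \<zeta> - fhat (trunc R f) \<zeta>"])
    show "AE \<zeta> in RZ2. (\<lambda>n. H n \<zeta> - fhat (trunc R f) \<zeta>) \<longlonglongrightarrow> F \<zeta> - fhat (trunc R f) \<zeta>"
      using limF by eventually_elim (intro tendsto_intros)
    have "sqnorm RZ2 (\<lambda>\<zeta>. H n \<zeta> - fhat (trunc R f) \<zeta>) \<le> K * (ennreal ((1 / 8) ^ m) + tail f R)" if "n \<ge> m" for n
    proof -
      have "sqnorm RZ2 (\<lambda>\<zeta>. H n \<zeta> - fhat (trunc R f) \<zeta>) \<le> K * (tail f (r n) + tail f R)"
        unfolding H_def K_def k_def by (intro sqnorm_fhat_trunc_diff_le assms)
      also have "\<dots> \<le> K * (ennreal ((1 / 8) ^ m) + tail f R)"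
      proof (intro mult_left_mono add_mono order_trans[OF r] ennreal_leI)
        show "(1 / 8 :: real) ^ n \<le> (1 / 8) ^ m" using that by (intro power_decreasing) auto
      qed auto
      finally show ?thesis .
    qed
    then show "eventually (\<lambda>n. sqnorm RZ2 (\<lambda>\<zeta>. H n \<zeta> - fhat (trunc R f) \<zeta>) \<le> K * (ennreal ((1 / 8) ^ m) + tail f R)) sequentially"
      by (auto simp: eventually_sequentially)
  qed measurable
  have lim: "((\<lambda>R. sqnorm RZ2 (\<lambda>\<zeta>. F \<zeta> - fhat (trunc R f) \<zeta>)) \<longlongrightarrow> 0) at_top"
    unfolding ennreal_tendsto_0_iff
  proof (intro allI impI)
    fix e :: real assume e: "e > 0"
    define d where "d = e / (4 * k)"
    have d: "d > 0" "k * (d + d) = e / 2" using e k0 by (simp_all add: d_def field_simps)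
    obtain m where m: "(1 / 8 :: real) ^ m < d" using real_arch_pow_inv[of d "1/8"] d(1) by auto
    have "\<forall>\<^sub>F R in at_top. tail f R < ennreal d" using tail0 d(1) unfolding ennreal_tendsto_0_iff by blast
    then show "\<forall>\<^sub>F R in at_top. sqnorm RZ2 (\<lambda>\<zeta>. F \<zeta> - fhat (trunc R f) \<zeta>) < ennreal e"
    proof eventually_elim
      fix R assume R: "tail f R < ennreal d"
      have "sqnorm RZ2 (\<lambda>\<zeta>. F \<zeta> - fhat (trunc R f) \<zeta>) \<le> K * (ennreal ((1 / 8) ^ m) + tail f R)" by (rule dist)
      also have "\<dots> \<le> K * (ennreal d + ennreal d)"
        using m R by (intro mult_left_mono add_mono ennreal_leI) auto
      also have "\<dots> = ennreal (e / 2)"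
        unfolding d(2)[symmetric] using d(1) k0 by (simp only: K_def ennreal_mult ennreal_plus less_imp_le add_nonneg_nonneg)
      also have "\<dots> < ennreal e" using e by (simp add: ennreal_less_iff)
      finally show "sqnorm RZ2 (\<lambda>\<zeta>. F \<zeta> - fhat (trunc R f) \<zeta>) < ennreal e" .
    qed
  qed
  have "sqnorm RZ2 F < top"
  proof -
    obtain R where R: "sqnorm RZ2 (\<lambda>\<zeta>. F \<zeta> - fhat (trunc R f) \<zeta>) < ennreal 1"
      using lim unfolding ennreal_tendsto_0_iff eventually_at_top_linorder by (meson order_refl zero_less_one)
    have "sqnorm RZ2 (fhat (trunc R f)) \<le> K * sqnorm cell_measure (trunc R f)"
      unfolding K_def k_def by (intro bessel_inequality integrable_trunc assms)
    also have "\<dots> \<le> K * sqnorm cell_measure f" by (intro mult_left_mono sqnorm_trunc_le) auto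
    also have "\<dots> < top" using K fin by (simp add: ennreal_mult_less_top)
    finally have 1: "sqnorm RZ2 (fhat (trunc R f)) < top" .
    have "sqnorm RZ2 F = sqnorm RZ2 (\<lambda>\<zeta>. (F \<zeta> - fhat (trunc R f) \<zeta>) + fhat (trunc R f) \<zeta>)" by simp
    also have "\<dots> \<le> 2 * sqnorm RZ2 (\<lambda>\<zeta>. F \<zeta> - fhat (trunc R f) \<zeta>) + 2 * sqnorm RZ2 (fhat (trunc R f))"
      by (intro sqnorm_add_le) measurable
    also have "\<dots> < top" using 1 less_trans[OF R ennreal_less_top] by (simp add: ennreal_mult_less_top)
    finally show ?thesis .
  qed
  with lim show ?thesis by (intro exI[of _ F]) auto
qed

text \<open>Existence gives meaning to the \<open>SOME\<close> in \<open>fourier\<close>. These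
  three properties hold for every admissible representative, and all later facts about the transform
  rest on them.\<close>

lemma fourier_spec:
  assumes f [measurable]: "f \<in> borel_measurable borel" and fin: "sqnorm cell_measure f < top"
  shows "fourier f \<in> borel_measurable RZ2" (is ?A) "sqnorm RZ2 (fourier f) < top" (is ?B)
    "((\<lambda>R. sqnorm RZ2 (\<lambda>\<zeta>. fourier f \<zeta> - fhat (trunc R f) \<zeta>)) \<longlongrightarrow> 0) at_top" (is ?C)
proof -
  have iff: "(Lp_norm RZ2 2 F < top \<and>
     ((\<lambda>R. Lp_norm RZ2 2 (\<lambda>\<zeta>. F \<zeta> - fourier_integral (\<lambda>(x, y). if \<bar>x\<bar> \<le> R then f (x, y) else 0) \<zeta>)) \<longlongrightarrow> 0) at_top)
    \<longleftrightarrow> F \<in> borel_measurable RZ2 \<and> sqnorm RZ2 F < top \<and>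
       ((\<lambda>R. sqnorm RZ2 (\<lambda>\<zeta>. F \<zeta> - fhat (trunc R f) \<zeta>)) \<longlongrightarrow> 0) at_top" for F
  proof (cases "F \<in> borel_measurable RZ2")
    case True
    note [measurable] = True
    have "((\<lambda>R. sqnorm RZ2 (\<lambda>\<zeta>. F \<zeta> - fhat (trunc R f) \<zeta>)) \<longlongrightarrow> 0) at_top
       \<longleftrightarrow> ((\<lambda>R. Lp_norm RZ2 2 (\<lambda>\<zeta>. F \<zeta> - fhat (trunc R f) \<zeta>)) \<longlongrightarrow> 0) at_top"
      by (subst Lp_norm_2_square[symmetric], measurable) (rule ennreal_square_tendsto_0_iff)
    then show ?thesis
      by (simp add: Lp_norm_2_finite_iff trunc_eq fourier_integral_eq_fhat True)
  qed (simp add: Lp_norm_2_finite_iff)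
  have "?A \<and> ?B \<and> ?C"
    unfolding fourier_def iff by (rule someI_ex[OF fourier_limit_exists[OF assms]])
  then show ?A ?B ?C by blast+
qed

text \<open>The factor 2 stems from \<bar>a + b\<bar>^2 \<le> 2 \<bar>a\<bar>^2 + 2 \<bar>b\<bar>^2
  when the transform is compared with that of a truncation. It is absorbed by the implicit
  constant.\<close>

lemma sqnorm_fourier_le:
  assumes f [measurable]: "f \<in> borel_measurable borel" and fin: "sqnorm cell_measure f < top"
  shows "sqnorm RZ2 (fourier f) \<le> 2 * (ennreal ((2 * pi) ^ 3) * sqnorm cell_measure f)"
proof (rule ennreal_le_epsilon)
  fix e :: real assume e: "e > 0"
  note [measurable] = fourier_spec(1)[OF assms]
  obtain R where R: "sqnorm RZ2 (\<lambda>\<zeta>. fourier f \<zeta> - fhat (trunc R f) \<zeta>) < ennreal (e / 2)"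
    using fourier_spec(3)[OF assms] e unfolding ennreal_tendsto_0_iff eventually_at_top_linorder
    by (meson half_gt_zero order_refl)
  have "sqnorm RZ2 (fhat (trunc R f)) \<le> ennreal ((2 * pi) ^ 3) * sqnorm cell_measure (trunc R f)"
    by (intro bessel_inequality integrable_trunc assms)
  also have "\<dots> \<le> ennreal ((2 * pi) ^ 3) * sqnorm cell_measure f" by (intro mult_left_mono sqnorm_trunc_le) auto
  finally have 1: "sqnorm RZ2 (fhat (trunc R f)) \<le> ennreal ((2 * pi) ^ 3) * sqnorm cell_measure f" .
  have "sqnorm RZ2 (fourier f) = sqnorm RZ2 (\<lambda>\<zeta>. (fourier f \<zeta> - fhat (trunc R f) \<zeta>) + fhat (trunc R f) \<zeta>)" by simp
  also have "\<dots> \<le> 2 * sqnorm RZ2 (\<lambda>\<zeta>. fourier f \<zeta> - fhat (trunc R f) \<zeta>) + 2 * sqnorm RZ2 (fhat (trunc R f))"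
    by (intro sqnorm_add_le) measurable
  also have "\<dots> \<le> 2 * ennreal (e / 2) + 2 * (ennreal ((2 * pi) ^ 3) * sqnorm cell_measure f)"
    using 1 R by (intro add_mono mult_left_mono) auto
  also have "2 * ennreal (e / 2) = ennreal e"
    using e by (simp add: ennreal_mult[symmetric] flip: ennreal_numeral)
  finally show "sqnorm RZ2 (fourier f) \<le> 2 * (ennreal ((2 * pi) ^ 3) * sqnorm cell_measure f) + ennreal e"
    by (simp add: add.commute)
qed

section \<open>The inverse transform and its adjoint\<close>

lemma measurable_inv_fourier_integral [measurable]:
  assumes [measurable]: "g \<in> borel_measurable RZ2"
  shows "inv_fourier_integral g \<in> borel_measurable borel"
  unfolding inv_fourier_integral_def by measurable

lemma norm_inv_fourier_integral_le:
  "norm (inv_fourier_integral g z) \<le> (LINT \<zeta>|RZ2. norm (g \<zeta>))"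
proof -
  have "1 \<le> (2 * pi) ^ 3" using pi_gt3 by (intro one_le_power) auto
  then have c: "1 / (2 * pi) ^ 3 \<le> 1" by (simp add: divide_le_eq)
  have "norm (inv_fourier_integral g z) = 1 / (2 * pi) ^ 3 * norm (LINT \<zeta>|RZ2. character \<zeta> z * g \<zeta>)"
    unfolding inv_fourier_integral_def norm_mult norm_of_real by simp
  also have "\<dots> \<le> 1 * norm (LINT \<zeta>|RZ2. character \<zeta> z * g \<zeta>)"
    by (intro mult_right_mono c) auto
  also have "\<dots> \<le> (LINT \<zeta>|RZ2. norm (g \<zeta>))"
    using integral_norm_bound[of RZ2 "\<lambda>\<zeta>. character \<zeta> z * g \<zeta>"] by (simp add: norm_mult)
  finally show ?thesis .
qed

lemma integrable_cell_bounded_strip: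
  fixes f :: "real \<times> real \<times> real \<Rightarrow> complex"
  assumes [measurable]: "f \<in> borel_measurable borel" and "\<And>z. norm (f z) \<le> B" "\<And>z. \<bar>fst z\<bar> > R \<Longrightarrow> f z = 0"
  shows "integrable cell_measure f"
proof -
  have "integrable cell_measure (\<lambda>z. B * indicator {-R..R} (fst z) :: real)"
    by (intro integrable_mult_right integrable_cell_strip)
  then show ?thesis
  proof (rule Bochner_Integration.integrable_bound)
  show "AE z in cell_measure. norm (f z) \<le> norm (B * indicator {-R..R} (fst z))"
  proof (intro AE_I2)
    fix z show "norm (f z) \<le> norm (B * indicator {-R..R} (fst z))"
      using assms(2)[of z] assms(3)[of z] by (cases "\<bar>fst z\<bar> \<le> R") (auto simp: indicator_def abs_le_iff)
  qed
  qed measurable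
qed

text \<open>Up to the normalising factor, \<open>fhat\<close> and the inverse transform are adjoint
  to each other. This is the source of every duality step, including the one in space-time.\<close>

lemma inv_fourier_pairing:
  assumes g: "integrable RZ2 g" and f: "integrable cell_measure f"
  shows "(LINT z|cell_measure. f z * cnj (inv_fourier_integral g z)) =
    of_real (1 / (2 * pi) ^ 3) * (LINT \<zeta>|RZ2. cnj (g \<zeta>) * fhat f \<zeta>)"
proof -
  have [measurable]: "f \<in> borel_measurable borel" "g \<in> borel_measurable RZ2" using f g by auto
  define c :: complex where "c = of_real (1 / (2 * pi) ^ 3)"
  have g': "integrable RZ2 (\<lambda>\<zeta>. cnj (g \<zeta>))" using g by simp
  have "(LINT z|cell_measure. f z * cnj (inv_fourier_integral g z)) =
     (LINT z|cell_measure. c * (LINT \<zeta>|RZ2. cnj (g \<zeta>) * f z * cnj (character \<zeta> z)))"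
  proof (intro Bochner_Integration.integral_cong refl)
    fix z
    have "cnj (inv_fourier_integral g z) = c * (LINT \<zeta>|RZ2. cnj (character \<zeta> z) * cnj (g \<zeta>))"
      unfolding inv_fourier_integral_def c_def complex_cnj_mult
      by (simp add: Bochner_Integration.integral_cnj[symmetric] del: Bochner_Integration.integral_cnj)
    then have "f z * cnj (inv_fourier_integral g z) = c * (f z * (LINT \<zeta>|RZ2. cnj (character \<zeta> z) * cnj (g \<zeta>)))"
      by simp
    also have "f z * (LINT \<zeta>|RZ2. cnj (character \<zeta> z) * cnj (g \<zeta>)) = (LINT \<zeta>|RZ2. f z * (cnj (character \<zeta> z) * cnj (g \<zeta>)))"
      by (rule integral_mult_right_zero[symmetric])
    also have "\<dots> = (LINT \<zeta>|RZ2. cnj (g \<zeta>) * f z * cnj (character \<zeta> z))"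
      by (simp add: mult_ac)
    finally show "f z * cnj (inv_fourier_integral g z) = c * (LINT \<zeta>|RZ2. cnj (g \<zeta>) * f z * cnj (character \<zeta> z))" .
  qed
  also have "\<dots> = c * (LINT z|cell_measure. LINT \<zeta>|RZ2. cnj (g \<zeta>) * f z * cnj (character \<zeta> z))"
    by (rule integral_mult_right_zero)
  also have "(LINT z|cell_measure. LINT \<zeta>|RZ2. cnj (g \<zeta>) * f z * cnj (character \<zeta> z))
     = (LINT \<zeta>|RZ2. LINT z|cell_measure. cnj (g \<zeta>) * f z * cnj (character \<zeta> z))"
    by (rule RZ2_cell.swap_integrals_bounded[OF g' f, where C=1, symmetric]) auto
  also have "\<dots> = (LINT \<zeta>|RZ2. cnj (g \<zeta>) * fhat f \<zeta>)"
  proof (intro Bochner_Integration.integral_cong refl)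
    fix \<zeta>
    have "(LINT z|cell_measure. cnj (g \<zeta>) * f z * cnj (character \<zeta> z)) = (LINT z|cell_measure. cnj (g \<zeta>) * (cnj (character \<zeta> z) * f z))"
      by (simp add: mult_ac)
    also have "\<dots> = cnj (g \<zeta>) * fhat f \<zeta>" unfolding fhat_def by (rule integral_mult_right_zero)
    finally show "(LINT z|cell_measure. cnj (g \<zeta>) * f z * cnj (character \<zeta> z)) = cnj (g \<zeta>) * fhat f \<zeta>" .
  qed
  finally show ?thesis by (simp add: c_def)
qed

text \<open>The squared form in \<open>ennreal\<close> avoids roots and integrability conditions: if
  the product is not integrable, the left side is 0.\<close>

lemma norm_integral_cauchy_schwarz:
  fixes f g :: "'a \<Rightarrow> complex"
  assumes [measurable]: "f \<in> borel_measurable M" "g \<in> borel_measurable M"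
  shows "(ennreal (norm (LINT x|M. f x * g x)))\<^sup>2 \<le> sqnorm M f * sqnorm M g"
proof -
  have "ennreal (norm (LINT x|M. f x * g x)) \<le> (\<integral>\<^sup>+x. ennreal (norm (f x)) * ennreal (norm (g x)) \<partial>M)"
    using ennreal_norm_integral_le[of M "\<lambda>x. f x * g x"] by (simp add: norm_mult ennreal_mult)
  then have "(ennreal (norm (LINT x|M. f x * g x)))\<^sup>2 \<le> (\<integral>\<^sup>+x. ennreal (norm (f x)) * ennreal (norm (g x)) \<partial>M)\<^sup>2"
    by (rule power_mono) simp
  also have "\<dots> \<le> (\<integral>\<^sup>+x. (ennreal (norm (f x)))\<^sup>2 \<partial>M) * (\<integral>\<^sup>+x. (ennreal (norm (g x)))\<^sup>2 \<partial>M)"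
    by (rule Cauchy_Schwarz_nn_integral) measurable
  finally show ?thesis by (simp add: sqnorm_def ennreal_power)
qed

text \<open>By duality, the Bessel inequality for \<open>fhat\<close> bounds the inverse transform as well.\<close>

lemma sqnorm_inv_fourier_integral_le:
  assumes g: "integrable RZ2 g"
  shows "sqnorm cell_measure (inv_fourier_integral g) \<le> ennreal ((2 * pi) ^ 3) * sqnorm RZ2 g"
proof -
  have [measurable]: "g \<in> borel_measurable RZ2" using g by auto
  define h where "h = inv_fourier_integral g"
  have [measurable]: "h \<in> borel_measurable borel" unfolding h_def by measurable
  define B where "B = (LINT \<zeta>|RZ2. norm (g \<zeta>))"
  have B: "norm (h z) \<le> B" "B \<ge> 0" for z
    unfolding h_def B_def by (auto intro: norm_inv_fourier_integral_le)
  define K where "K = ennreal ((2 * pi) ^ 3)"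
  have bound: "sqnorm cell_measure (trunc R h) \<le> K * sqnorm RZ2 g" for R
  proof -
    \<comment> \<open>The inverse transform h is tested against its own truncation: f * cnj h =
      \<bar>f\<bar>^2, and f is integrable, so Bessel's inequality applies to it.\<close>
    define f where "f = trunc R h"
    have [measurable]: "f \<in> borel_measurable borel" unfolding f_def by measurable
    have f: "integrable cell_measure f"
      unfolding f_def using B norm_trunc_le[of R h]
      by (intro integrable_cell_bounded_strip[where B=B and R=R]) (auto simp: trunc_def intro: order_trans)
    define X where "X = sqnorm cell_measure f"
    have "integrable cell_measure (\<lambda>z. B * norm (f z))"
      using f by (intro integrable_mult_right integrable_norm)
    then have int: "integrable cell_measure (\<lambda>z. (norm (f z))\<^sup>2)"
    proof (rule Bochner_Integration.integrable_bound)
      show "AE z in cell_measure. norm ((norm (f z))\<^sup>2) \<le> norm (B * norm (f z))"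
        using B by (intro AE_I2) (auto simp: f_def trunc_def power2_eq_square intro!: mult_right_mono)
    qed measurable
    have X: "X = ennreal (LINT z|cell_measure. (norm (f z))\<^sup>2)"
      unfolding X_def sqnorm_def by (intro nn_integral_eq_integral int) auto
    have "of_real (LINT z|cell_measure. (norm (f z))\<^sup>2) = (LINT z|cell_measure. complex_of_real ((norm (f z))\<^sup>2))"
      by (rule integral_complex_of_real[symmetric])
    also have "\<dots> = (LINT z|cell_measure. f z * cnj (h z))"
    proof (intro Bochner_Integration.integral_cong refl)
      fix z show "complex_of_real ((norm (f z))\<^sup>2) = f z * cnj (h z)"
        unfolding complex_norm_square by (simp add: f_def trunc_def)
    qed
    also have "\<dots> = of_real (1 / (2 * pi) ^ 3) * (LINT \<zeta>|RZ2. cnj (g \<zeta>) * fhat f \<zeta>)"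
      unfolding h_def by (rule inv_fourier_pairing[OF g f])
    finally have "complex_of_real (LINT z|cell_measure. (norm (f z))\<^sup>2) = of_real (1 / (2 * pi) ^ 3) * (LINT \<zeta>|RZ2. cnj (g \<zeta>) * fhat f \<zeta>)" .
    from arg_cong[OF this, of norm]
    have "norm (complex_of_real (LINT z|cell_measure. (norm (f z))\<^sup>2)) = 1 / (2 * pi) ^ 3 * norm (LINT \<zeta>|RZ2. cnj (g \<zeta>) * fhat f \<zeta>)"
      unfolding norm_mult norm_of_real by (simp only: abs_of_nonneg zero_le_divide_1_iff zero_le_power pi_ge_zero mult_nonneg_nonneg zero_le_numeral)
    also have "\<dots> \<le> 1 * norm (LINT \<zeta>|RZ2. cnj (g \<zeta>) * fhat f \<zeta>)"
    proof (intro mult_right_mono)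
      have "1 \<le> (2 * pi) ^ 3" using pi_gt3 by (intro one_le_power) auto
      then show "1 / (2 * pi) ^ 3 \<le> 1" by (simp add: divide_le_eq)
    qed auto
    finally have "X \<le> ennreal (norm (LINT \<zeta>|RZ2. cnj (g \<zeta>) * fhat f \<zeta>))"
      unfolding X by (intro ennreal_leI) simp
    then have "X\<^sup>2 \<le> (ennreal (norm (LINT \<zeta>|RZ2. cnj (g \<zeta>) * fhat f \<zeta>)))\<^sup>2"
      by (rule power_mono) simp
    also have "\<dots> \<le> sqnorm RZ2 (\<lambda>\<zeta>. cnj (g \<zeta>)) * sqnorm RZ2 (fhat f)"
      by (rule norm_integral_cauchy_schwarz) measurable
    also have "sqnorm RZ2 (\<lambda>\<zeta>. cnj (g \<zeta>)) = sqnorm RZ2 g" by (simp add: sqnorm_def)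
    also have "sqnorm RZ2 g * sqnorm RZ2 (fhat f) \<le> sqnorm RZ2 g * (K * X)"
      unfolding K_def X_def by (intro mult_left_mono bessel_inequality f) auto
    finally have "X * X \<le> X * (K * sqnorm RZ2 g)" by (simp add: power2_eq_square mult_ac)
    \<comment> \<open>Cancelling X uses that it is finite, which the truncation guarantees. The
      resulting bound is uniform in R.\<close>
    then have "X \<le> K * sqnorm RZ2 g"
      by (cases "X = 0") (simp_all add: ennreal_mult_le_mult_iff X)
    then show ?thesis by (simp add: X_def f_def)
  qed
  have "sqnorm cell_measure h \<le> K * sqnorm RZ2 g"
  proof (rule sqnorm_fatou[of "\<lambda>n. trunc (real n) h"])
    show "AE z in cell_measure. (\<lambda>n. trunc (real n) h z) \<longlonglongrightarrow> h z"
    proof (intro AE_I2)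
      fix z :: "real \<times> real \<times> real"
      obtain m where "\<bar>fst z\<bar> \<le> real m" using real_arch_simple by blast
      then have "eventually (\<lambda>n. trunc (real n) h z = h z) sequentially"
        by (auto simp: eventually_sequentially trunc_def intro!: exI[of _ m])
      then show "(\<lambda>n. trunc (real n) h z) \<longlonglongrightarrow> h z" by (rule tendsto_eventually)
    qed
  qed (auto simp: bound)
  then show ?thesis by (simp add: h_def K_def)
qed

lemma (in pair_sigma_finite) integral_product:
  fixes a :: "'a \<Rightarrow> complex" and b :: "'b \<Rightarrow> complex"
  assumes a: "integrable M1 a" and b: "integrable M2 b"
  shows "integrable (M1 \<Otimes>\<^sub>M M2) (\<lambda>p. a (fst p) * b (snd p))"
    and "(LINT p|(M1 \<Otimes>\<^sub>M M2). a (fst p) * b (snd p)) = (LINT x|M1. a x) * (LINT y|M2. b y)"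
proof -
  have int: "integrable (M1 \<Otimes>\<^sub>M M2) (\<lambda>(x, y). a x * b y * 1)"
    by (intro integrable_product_bounded[OF a b, where C=1]) auto
  then show "integrable (M1 \<Otimes>\<^sub>M M2) (\<lambda>p. a (fst p) * b (snd p))"
    by (simp add: case_prod_beta')
  show "(LINT p|(M1 \<Otimes>\<^sub>M M2). a (fst p) * b (snd p)) = (LINT x|M1. a x) * (LINT y|M2. b y)"
    using integral_fst'[OF int] by (simp add: case_prod_beta')
qed

lemma lborel_integral_product:
  fixes a :: "'a :: euclidean_space \<Rightarrow> complex" and b :: "'b :: euclidean_space \<Rightarrow> complex"
  assumes "integrable lborel a" "integrable lborel b"
  shows "integrable lborel (\<lambda>p. a (fst p) * b (snd p))"
    and "(LINT p|lborel. a (fst p) * b (snd p)) = (LINT x|lborel. a x) * (LINT y|lborel. b y)"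
  using lborel_pair.integral_product[OF assms] by (simp_all add: lborel_prod)

lemma cell_integral_product:
  fixes f g h :: "real \<Rightarrow> complex"
  assumes f: "integrable lborel f"
    and g: "integrable lborel (\<lambda>y. of_real (indicator {0..<2*pi} y) * g y)"
    and h: "integrable lborel (\<lambda>y. of_real (indicator {0..<2*pi} y) * h y)"
    and [measurable]: "g \<in> borel_measurable borel" "h \<in> borel_measurable borel"
  shows "integrable cell_measure (\<lambda>w. f (fst w) * (g (fst (snd w)) * h (snd (snd w))))"
    and "(LINT w|cell_measure. f (fst w) * (g (fst (snd w)) * h (snd (snd w)))) = (LINT x|lborel. f x) *
      ((LINT y|lborel. of_real (indicator {0..<2*pi} y) * g y) * (LINT y|lborel. of_real (indicator {0..<2*pi} y) * h y))"
proof -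
  define G H where "G y = of_real (indicator {0..<2*pi} y) * g y" and "H y = of_real (indicator {0..<2*pi} y) * h y" for y
  have [measurable]: "f \<in> borel_measurable borel" using f by auto
  have [measurable]: "(\<lambda>w. fst (snd w)) \<in> borel_measurable (borel :: (real \<times> real \<times> real) measure)"
    "(\<lambda>w. snd (snd w)) \<in> borel_measurable (borel :: (real \<times> real \<times> real) measure)"
    by (intro borel_measurable_continuous_onI continuous_intros)+
  have ind: "indicat_real RT2_cell w *\<^sub>R (f (fst w) * (g (fst (snd w)) * h (snd (snd w)))) =
     f (fst w) * (\<lambda>v. G (fst v) * H (snd v)) (snd w)" for w
    by (cases w) (auto simp: RT2_cell_def indicator_def G_def H_def)
  note GH = lborel_integral_product[OF g[folded G_def] h[folded H_def]]
  note P = lborel_integral_product[OF f GH(1)]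
  have d: "cell_measure = density lborel (\<lambda>w. ennreal (indicat_real RT2_cell w))"
    unfolding cell_measure_def by (simp add: ennreal_indicator)
  show "integrable cell_measure (\<lambda>w. f (fst w) * (g (fst (snd w)) * h (snd (snd w))))"
    unfolding d by (subst integrable_density) (auto simp: ind P)
  have "(LINT w|cell_measure. f (fst w) * (g (fst (snd w)) * h (snd (snd w))))
     = (LINT w|lborel. f (fst w) * (\<lambda>v. G (fst v) * H (snd v)) (snd w))"
    unfolding d by (subst integral_density) (auto simp: ind)
  also have "\<dots> = (LINT x|lborel. f x) * ((LINT y|lborel. G y) * (LINT y|lborel. H y))"
    unfolding P(2) GH(2) ..
  finally show "(LINT w|cell_measure. f (fst w) * (g (fst (snd w)) * h (snd (snd w)))) = (LINT x|lborel. f x) *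
      ((LINT y|lborel. of_real (indicator {0..<2*pi} y) * g y) * (LINT y|lborel. of_real (indicator {0..<2*pi} y) * h y))"
    by (simp add: G_def H_def)
qed

lemma integral_cis_period:
  shows "integrable lborel (\<lambda>y. of_real (indicator {0..<2*pi} y) * cis (real_of_int m * y))"
    and "(LINT y|lborel. of_real (indicator {0..<2*pi} y) * cis (real_of_int m * y)) = (if m = 0 then 2 * of_real pi else 0)"
proof -
  \<comment> \<open>The period cell is half-open, whereas the fundamental theorem of calculus lives
    on the closed interval; they differ by a point.\<close>
  have ae: "AE y in lborel. indicat_real {0..2*pi} y *\<^sub>R cis (real_of_int m * y) = of_real (indicator {0..<2*pi} y) * cis (real_of_int m * y)"
    using AE_lborel_singleton[of "2 * pi"]
    by eventually_elim (auto simp: indicator_def)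
  have *: "has_bochner_integral lborel (\<lambda>y. indicat_real {0..2*pi} y *\<^sub>R cis (real_of_int m * y)) (if m = 0 then 2 * of_real pi else 0)"
  proof (cases "m = 0")
    case True
    have "has_bochner_integral lborel (\<lambda>y. indicat_real {0..2*pi} y *\<^sub>R (1 :: complex)) (measure lborel {0..2*pi} *\<^sub>R 1)"
      by (intro has_bochner_integral_scaleR_left has_bochner_integral_real_indicator) auto
    then show ?thesis using True by (simp add: scaleR_conv_of_real)
  next
    case False
    define F where "F y = cis (real_of_int m * y) / (\<i> * of_int m)" for y
    have "has_bochner_integral lborel (\<lambda>y. indicat_real {0..2*pi} y *\<^sub>R cis (real_of_int m * y)) (F (2*pi) - F 0)"
    proof (rule has_bochner_integral_FTC_Icc)
      fix y
      have "((\<lambda>z. exp (\<i> * of_int m * z) / (\<i> * of_int m)) has_field_derivative exp (\<i> * of_int m * of_real y)) (at (of_real y))"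
        using False by (auto intro!: derivative_eq_intros)
      then have "((\<lambda>y. exp (\<i> * of_int m * of_real y) / (\<i> * of_int m)) has_vector_derivative
         exp (\<i> * of_int m * of_real y)) (at y within {0..2*pi})"
        by (rule has_vector_derivative_real_field)
      then show "(F has_vector_derivative cis (real_of_int m * y)) (at y within {0..2*pi})"
        by (simp add: F_def[abs_def] cis_conv_exp mult.assoc)
    qed (auto intro!: continuous_intros)
    moreover have "cis (real_of_int m * (2*pi)) = 1"
      by (simp add: complex_eq_iff mult.commute[of "real_of_int m"])
    ultimately show ?thesis using False by (simp add: F_def)
  qed
  then have "has_bochner_integral lborel (\<lambda>y. of_real (indicator {0..<2*pi} y) * cis (real_of_int m * y)) (if m = 0 then 2 * of_real pi else 0)"
    by (subst has_bochner_integral_cong_AE[OF _ _ ae, symmetric]) measurable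
  then show "integrable lborel (\<lambda>y. of_real (indicator {0..<2*pi} y) * cis (real_of_int m * y))"
    "(LINT y|lborel. of_real (indicator {0..<2*pi} y) * cis (real_of_int m * y)) = (if m = 0 then 2 * of_real pi else 0)"
    by (auto simp: has_bochner_integral_iff)
qed

section \<open>Gaussian damping and the frequency support of the inverse transform\<close>

text \<open>A regularisation in the unbounded variable only. The sharp cutoffs in the definition of
  \<open>fourier\<close> have slowly decaying, oscillating transforms; the transform of a Gaussian
  is explicit and concentrates as a tends to 0.\<close>

definition damping :: "real \<Rightarrow> real \<times> real \<times> real \<Rightarrow> complex" where
  "damping a z = of_real (exp (- a * (fst z)\<^sup>2))"

lemma measurable_damping [measurable]: "damping a \<in> borel_measurable borel"
  unfolding damping_def by measurable

lemma integrable_damping: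
  assumes "a > 0"
  shows "integrable cell_measure (damping a)"
proof -
  have "integrable cell_measure (\<lambda>w. (\<lambda>x. complex_of_real (exp (- a * x\<^sup>2))) (fst w) *
      (cis (real_of_int 0 * (fst (snd w))) * cis (real_of_int 0 * (snd (snd w)))))"
    using integrable_gauss[OF assms]
    by (intro cell_integral_product integral_cis_period integrable_of_real) measurable
  then show ?thesis by (simp add: damping_def[abs_def])
qed

text \<open>For each pair of frequencies the damped product of characters splits into a Gaussian
  integral in x, which concentrates on equal \<xi>, and two integrals over a period, which vanish
  unless the integer frequencies agree.\<close>

lemma norm_damping_transform:
  assumes a: "a > 0"
  defines "D \<equiv> \<lambda>\<zeta> \<zeta>'. (LINT z|cell_measure. damping a z * (cnj (character \<zeta> z) * character \<zeta>' z))"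
  shows "norm (D \<zeta> \<zeta>') \<le> (2 * pi)\<^sup>2 * sqrt (pi / a) * exp (- (fst \<zeta>' - fst \<zeta>)\<^sup>2 / (4 * a))"
    and "snd \<zeta> \<noteq> snd \<zeta>' \<Longrightarrow> D \<zeta> \<zeta>' = 0"
proof -
  define x m1 m2 where "x = fst \<zeta>' - fst \<zeta>" and "m1 = fst (snd \<zeta>') - fst (snd \<zeta>)" and "m2 = snd (snd \<zeta>') - snd (snd \<zeta>)"
  have [measurable]: "(\<lambda>x'. complex_of_real (exp (- a * x'\<^sup>2)) * cis (x * x')) \<in> borel_measurable borel" by measurable
  have int: "integrable lborel (\<lambda>x'. complex_of_real (exp (- a * x'\<^sup>2)) * cis (x * x'))"
    by (rule Bochner_Integration.integrable_bound[OF integrable_gauss[OF a]]) (auto simp: norm_mult)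
  have eq: "damping a z * (cnj (character \<zeta> z) * character \<zeta>' z) =
     (\<lambda>x'. complex_of_real (exp (- a * x'\<^sup>2)) * cis (x * x')) (fst z) * (cis (real_of_int m1 * (fst (snd z))) * cis (real_of_int m2 * (snd (snd z))))" for z
  proof -
    have "cnj (character \<zeta> z) * character \<zeta>' z = cis (x * fst z) * (cis (real_of_int m1 * (fst (snd z))) * cis (real_of_int m2 * (snd (snd z))))"
      unfolding character_eq cis_cnj cis_mult x_def m1_def m2_def by (simp add: algebra_simps)
    then show ?thesis by (simp add: damping_def)
  qed
  have D: "D \<zeta> \<zeta>' = of_real (sqrt (pi / a) * exp (- x\<^sup>2 / (4 * a))) * ((if m1 = 0 then 2 * of_real pi else 0) * (if m2 = 0 then 2 * of_real pi else 0))"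
    unfolding D_def eq
    by (subst cell_integral_product(2)[OF int integral_cis_period(1) integral_cis_period(1)], measurable)
       (simp only: integral_gauss_cis[OF a] integral_cis_period(2))
  show "snd \<zeta> \<noteq> snd \<zeta>' \<Longrightarrow> D \<zeta> \<zeta>' = 0"
    unfolding D by (auto simp: m1_def m2_def prod_eq_iff)
  have n: "norm (if m = (0::int) then 2 * of_real pi else (0::complex)) \<le> 2 * pi" for m by simp
  have "norm (D \<zeta> \<zeta>') \<le> sqrt (pi / a) * exp (- x\<^sup>2 / (4 * a)) * (2 * pi * (2 * pi))"
    unfolding D norm_mult norm_of_real using a n
    by (intro mult_mono) auto
  then show "norm (D \<zeta> \<zeta>') \<le> (2 * pi)\<^sup>2 * sqrt (pi / a) * exp (- (fst \<zeta>' - fst \<zeta>)\<^sup>2 / (4 * a))"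
    by (simp add: x_def power2_eq_square mult_ac)
qed

lemma fhat_damped_inverse:
  assumes g: "integrable RZ2 g" and a: "a > 0"
  shows "fhat (\<lambda>z. damping a z * inv_fourier_integral g z) \<zeta> =
    of_real (1 / (2 * pi) ^ 3) * (LINT \<zeta>'|RZ2. g \<zeta>' * (LINT z|cell_measure. damping a z * (cnj (character \<zeta> z) * character \<zeta>' z)))"
proof -
  have [measurable]: "g \<in> borel_measurable RZ2" using g by auto
  have [measurable]: "(\<lambda>z. character \<zeta> z) \<in> borel_measurable borel"
    by (intro measurable_character measurable_const) auto
  define c :: complex where "c = of_real (1 / (2 * pi) ^ 3)"
  have "fhat (\<lambda>z. damping a z * inv_fourier_integral g z) \<zeta> =
     (LINT z|cell_measure. c * (LINT \<zeta>'|RZ2. g \<zeta>' * damping a z * (cnj (character \<zeta> z) * character \<zeta>' z)))"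
    unfolding fhat_def
  proof (intro Bochner_Integration.integral_cong refl)
    fix z
    have "(LINT \<zeta>'|RZ2. g \<zeta>' * damping a z * (cnj (character \<zeta> z) * character \<zeta>' z))
       = (LINT \<zeta>'|RZ2. (damping a z * cnj (character \<zeta> z)) * (character \<zeta>' z * g \<zeta>'))"
      by (simp add: mult_ac)
    also have "\<dots> = (damping a z * cnj (character \<zeta> z)) * (LINT \<zeta>'|RZ2. character \<zeta>' z * g \<zeta>')"
      by (rule integral_mult_right_zero)
    finally show "cnj (character \<zeta> z) * (damping a z * inv_fourier_integral g z) =
        c * (LINT \<zeta>'|RZ2. g \<zeta>' * damping a z * (cnj (character \<zeta> z) * character \<zeta>' z))"
      unfolding inv_fourier_integral_def c_def by (simp only: mult_ac)
  qed
  also have "\<dots> = c * (LINT z|cell_measure. LINT \<zeta>'|RZ2. g \<zeta>' * damping a z * (cnj (character \<zeta> z) * character \<zeta>' z))"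
    by (rule integral_mult_right_zero)
  also have "(LINT z|cell_measure. LINT \<zeta>'|RZ2. g \<zeta>' * damping a z * (cnj (character \<zeta> z) * character \<zeta>' z))
    = (LINT \<zeta>'|RZ2. LINT z|cell_measure. g \<zeta>' * damping a z * (cnj (character \<zeta> z) * character \<zeta>' z))"
    by (rule RZ2_cell.swap_integrals_bounded[OF g integrable_damping[OF a], where C=1, symmetric]) (measurable, simp add: norm_mult)
  also have "\<dots> = (LINT \<zeta>'|RZ2. g \<zeta>' * (LINT z|cell_measure. damping a z * (cnj (character \<zeta> z) * character \<zeta>' z)))"
    by (simp only: mult.assoc integral_mult_right_zero)
  finally show ?thesis by (simp add: c_def)
qed

definition band :: "real \<Rightarrow> (int \<times> int) set \<Rightarrow> (real \<times> int \<times> int) set" where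
  "band M K = {\<zeta>. \<bar>fst \<zeta>\<bar> \<le> M \<and> snd \<zeta> \<in> K}"

text \<open>A frequency can leave the band in two ways. If its integer part is outside K,
  orthogonality gives exactly 0. If \<bar>\<xi>\<bar> exceeds M by d > 0, the Gaussian at distance d
  beats the normalising factor a powr (- 1/2).\<close>

lemma fhat_damped_tendsto_0:
  assumes g: "integrable RZ2 g" and supp: "\<And>\<zeta>. \<zeta> \<notin> band M K \<Longrightarrow> g \<zeta> = 0" and \<zeta>: "\<zeta> \<notin> band M K"
  shows "(\<lambda>j. fhat (\<lambda>z. damping (inverse (real (Suc j))) z * inv_fourier_integral g z) \<zeta>) \<longlonglongrightarrow> 0"
proof -
  define D where "D a \<zeta>' = (LINT z|cell_measure. damping a z * (cnj (character \<zeta> z) * character \<zeta>' z))" for a \<zeta>'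
  define v where "v j = fhat (\<lambda>z. damping (inverse (real (Suc j))) z * inv_fourier_integral g z) \<zeta>" for j
  have v: "v j = of_real (1 / (2 * pi) ^ 3) * (LINT \<zeta>'|RZ2. g \<zeta>' * D (inverse (real (Suc j))) \<zeta>')" for j
    unfolding v_def D_def by (rule fhat_damped_inverse[OF g]) simp
  show ?thesis
  proof (cases "\<bar>fst \<zeta>\<bar> \<le> M")
    case True
    then have K: "snd \<zeta> \<notin> K" using \<zeta> by (simp add: band_def)
    have zero: "g \<zeta>' * D a \<zeta>' = 0" if "a > 0" for a \<zeta>'
    proof (cases "\<zeta>' \<in> band M K")
      case True
      then have "snd \<zeta> \<noteq> snd \<zeta>'" using K by (auto simp: band_def)
      then show ?thesis unfolding D_def using norm_damping_transform(2)[OF that] by simp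
    qed (simp add: supp)
    have "v j = 0" for j unfolding v by (subst zero) auto
    then show ?thesis by (simp add: v_def)
  next
    case False
    define d where "d = \<bar>fst \<zeta>\<bar> - M"
    have d: "d > 0" using False by (simp add: d_def)
    define B where "B = (LINT \<zeta>'|RZ2. norm (g \<zeta>'))"
    have B0: "B \<ge> 0" unfolding B_def by (intro Bochner_Integration.integral_nonneg) auto
    have bound: "norm (v j) \<le> B * (2 * pi)\<^sup>2 * sqrt pi * (4 / d\<^sup>2) * sqrt (inverse (real (Suc j)))" for j
    proof -
      define a where "a = inverse (real (Suc j))"
      have a: "a > 0" by (simp add: a_def)
      define \<beta> where "\<beta> = (2 * pi)\<^sup>2 * sqrt (pi / a) * exp (- d\<^sup>2 / (4 * a))"
      have gD: "norm (g \<zeta>' * D a \<zeta>') \<le> norm (g \<zeta>') * \<beta>" for \<zeta>'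
      proof (cases "\<zeta>' \<in> band M K")
        case True
        then have "d \<le> \<bar>fst \<zeta>' - fst \<zeta>\<bar>" by (auto simp: d_def band_def)
        then have "d\<^sup>2 \<le> \<bar>fst \<zeta>' - fst \<zeta>\<bar>\<^sup>2" using d by (intro power_mono) auto
        then have "exp (- (fst \<zeta>' - fst \<zeta>)\<^sup>2 / (4 * a)) \<le> exp (- d\<^sup>2 / (4 * a))"
          using a by (simp add: divide_right_mono)
        then have "(2 * pi)\<^sup>2 * sqrt (pi / a) * exp (- (fst \<zeta>' - fst \<zeta>)\<^sup>2 / (4 * a)) \<le> \<beta>"
          unfolding \<beta>_def using a by (intro mult_left_mono) auto
        moreover have "norm (D a \<zeta>') \<le> (2 * pi)\<^sup>2 * sqrt (pi / a) * exp (- (fst \<zeta>' - fst \<zeta>)\<^sup>2 / (4 * a))"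
          unfolding D_def by (rule norm_damping_transform(1)[OF a])
        ultimately have "norm (D a \<zeta>') \<le> \<beta>" by linarith
        then show ?thesis by (simp add: norm_mult mult_left_mono)
      qed (simp add: supp)
      have "norm (v j) = 1 / (2 * pi) ^ 3 * norm (LINT \<zeta>'|RZ2. g \<zeta>' * D a \<zeta>')"
        unfolding v a_def norm_mult norm_of_real by simp
      also have "\<dots> \<le> 1 * norm (LINT \<zeta>'|RZ2. g \<zeta>' * D a \<zeta>')"
      proof (intro mult_right_mono)
        have "1 \<le> (2 * pi) ^ 3" using pi_gt3 by (intro one_le_power) auto
        then show "1 / (2 * pi) ^ 3 \<le> 1" by (simp add: divide_le_eq)
      qed auto
      also have "1 * norm (LINT \<zeta>'|RZ2. g \<zeta>' * D a \<zeta>') \<le> (LINT \<zeta>'|RZ2. norm (g \<zeta>') * \<beta>)"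
      proof -
        have "norm (LINT \<zeta>'|RZ2. g \<zeta>' * D a \<zeta>') \<le> (LINT \<zeta>'|RZ2. norm (g \<zeta>' * D a \<zeta>'))"
          by (rule integral_norm_bound)
        also have "\<dots> \<le> (LINT \<zeta>'|RZ2. norm (g \<zeta>') * \<beta>)"
        proof (rule integral_mono')
          show "integrable RZ2 (\<lambda>\<zeta>'. norm (g \<zeta>') * \<beta>)"
            using g by (intro integrable_mult_left integrable_norm)
          show "norm (g \<zeta>' * D a \<zeta>') \<le> norm (g \<zeta>') * \<beta>" for \<zeta>' by (rule gD)
          then show "0 \<le> norm (g \<zeta>') * \<beta>" for \<zeta>' using norm_ge_zero order_trans by blast
        qed
        finally show ?thesis by simp
      qed
      also have "\<dots> = B * \<beta>" by (simp add: B_def)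
      also have "\<dots> \<le> B * ((2 * pi)\<^sup>2 * sqrt pi * (4 / d\<^sup>2) * sqrt a)"
      proof (intro mult_left_mono B0)
        \<comment> \<open>The crude bound exp (- t) \<le> 1/t suffices: it gains a full power of a
          against the loss of its square root, leaving sqrt a.\<close>
        have "exp (- (d\<^sup>2 / (4 * a))) \<le> 1 / (d\<^sup>2 / (4 * a))"
        proof -
          define t where "t = d\<^sup>2 / (4 * a)"
          have t: "t > 0" using d a by (simp add: t_def)
          have "t \<le> exp t" using exp_ge_add_one_self[of t] by linarith
          then have "exp (- t) \<le> 1 / t" using t by (simp add: exp_minus divide_simps)
          then show ?thesis by (simp add: t_def)
        qed
        also have "1 / (d\<^sup>2 / (4 * a)) = 4 / d\<^sup>2 * a" using a d by (simp add: field_simps)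
        finally have "(2 * pi)\<^sup>2 * sqrt (pi / a) * exp (- (d\<^sup>2 / (4 * a))) \<le> (2 * pi)\<^sup>2 * sqrt (pi / a) * (4 / d\<^sup>2 * a)"
          using a by (intro mult_left_mono) auto
        also have "sqrt (pi / a) * (4 / d\<^sup>2 * a) = sqrt pi * (4 / d\<^sup>2) * sqrt a"
        proof -
          have "a / sqrt a = sqrt a" using a by (simp add: real_div_sqrt)
          moreover have "sqrt (pi / a) * (4 / d\<^sup>2 * a) = sqrt pi * (4 / d\<^sup>2) * (a / sqrt a)"
            by (simp add: real_sqrt_divide mult_ac)
          ultimately show ?thesis by simp
        qed
        then have "(2 * pi)\<^sup>2 * sqrt (pi / a) * (4 / d\<^sup>2 * a) = (2 * pi)\<^sup>2 * sqrt pi * (4 / d\<^sup>2) * sqrt a"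
          by (simp only: mult.assoc)
        finally show "\<beta> \<le> (2 * pi)\<^sup>2 * sqrt pi * (4 / d\<^sup>2) * sqrt a" unfolding \<beta>_def by simp
      qed
      finally show ?thesis by (simp add: a_def mult.assoc)
    qed
    have "(\<lambda>j. B * (2 * pi)\<^sup>2 * sqrt pi * (4 / d\<^sup>2) * sqrt (inverse (real (Suc j)))) \<longlonglongrightarrow> B * (2 * pi)\<^sup>2 * sqrt pi * (4 / d\<^sup>2) * sqrt 0"
      by (intro tendsto_intros LIMSEQ_inverse_real_of_nat)
    then have "(\<lambda>j. B * (2 * pi)\<^sup>2 * sqrt pi * (4 / d\<^sup>2) * sqrt (inverse (real (Suc j)))) \<longlonglongrightarrow> 0" by simp
    then have "v \<longlonglongrightarrow> 0"
      by (rule Lim_null_comparison[rotated]) (use bound in auto)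
    then show ?thesis by (simp add: v_def[abs_def])
  qed
qed

text \<open>The sharp and the Gaussian cutoff both take values between 0 and 1 and tend to 1
  pointwise, so their difference is dominated by h. This replaces the truncations in the definition
  of \<open>fourier\<close> by dampings.\<close>

lemma sqnorm_trunc_damped_tendsto_0:
  assumes [measurable]: "h \<in> borel_measurable borel" and fin: "sqnorm cell_measure h < top"
  shows "(\<lambda>j. sqnorm cell_measure (\<lambda>z. trunc (real j) h z - damping (inverse (real (Suc j))) z * h z)) \<longlonglongrightarrow> 0"
proof -
  define w where "w j z = trunc (real j) h z - damping (inverse (real (Suc j))) z * h z" for j z
  have [measurable]: "w j \<in> borel_measurable borel" for j unfolding w_def by measurable
  have le: "norm (w j z) \<le> norm (h z)" for j z
  proof -
    define e where "e = exp (- inverse (real (Suc j)) * (fst z)\<^sup>2)"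
    have e: "0 \<le> e" "e \<le> 1" by (auto simp: e_def)
    have "w j z = of_real ((if \<bar>fst z\<bar> \<le> real j then 1 else 0) - e) * h z"
      by (simp add: w_def trunc_def damping_def e_def algebra_simps)
    moreover have "\<bar>(if \<bar>fst z\<bar> \<le> real j then 1 else 0) - e\<bar> \<le> 1" using e by auto
    ultimately show ?thesis by (simp only: norm_mult norm_of_real mult_left_le_one_le norm_ge_zero abs_ge_zero)
  qed
  have "(\<lambda>j. \<integral>\<^sup>+z. ennreal ((norm (w j z))\<^sup>2) \<partial>cell_measure) \<longlonglongrightarrow> (\<integral>\<^sup>+z. 0 \<partial>cell_measure)"
  proof (rule nn_integral_dominated_convergence[where w="\<lambda>z. ennreal ((norm (h z))\<^sup>2)"])
    show "AE z in cell_measure. (\<lambda>j. ennreal ((norm (w j z))\<^sup>2)) \<longlonglongrightarrow> 0"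
    proof (intro AE_I2)
      fix z :: "real \<times> real \<times> real"
      have 1: "(\<lambda>j. trunc (real j) h z) \<longlonglongrightarrow> h z"
      proof -
        obtain m where "\<bar>fst z\<bar> \<le> real m" using real_arch_simple by blast
        then have "eventually (\<lambda>n. trunc (real n) h z = h z) sequentially"
          by (auto simp: eventually_sequentially trunc_def intro!: exI[of _ m])
        then show ?thesis by (rule tendsto_eventually)
      qed
      have "(\<lambda>j. of_real (exp (- inverse (real (Suc j)) * (fst z)\<^sup>2)) * h z) \<longlonglongrightarrow> of_real (exp (- 0 * (fst z)\<^sup>2)) * h z"
        by (intro tendsto_intros LIMSEQ_inverse_real_of_nat)
      then have 2: "(\<lambda>j. damping (inverse (real (Suc j))) z * h z) \<longlonglongrightarrow> h z" by (simp add: damping_def)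
      have "(\<lambda>j. w j z) \<longlonglongrightarrow> h z - h z" unfolding w_def by (intro tendsto_diff 1 2)
      then have "(\<lambda>j. ennreal ((norm (w j z))\<^sup>2)) \<longlonglongrightarrow> ennreal ((norm (h z - h z))\<^sup>2)" by (intro tendsto_intros)
      then show "(\<lambda>j. ennreal ((norm (w j z))\<^sup>2)) \<longlonglongrightarrow> 0" by simp
    qed
    show "AE z in cell_measure. ennreal ((norm (w j z))\<^sup>2) \<le> ennreal ((norm (h z))\<^sup>2)" for j
      by (intro AE_I2 ennreal_leI power_mono le) auto
  qed (use fin in \<open>auto simp: sqnorm_def\<close>)
  then show ?thesis by (simp add: sqnorm_def w_def)
qed

text \<open>The Fourier transform inverts the inverse transform of band-limited data only weakly here:
  all that is needed is that the result stays inside the band.\<close>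

lemma fourier_inverse_band_limited:
  assumes g: "integrable RZ2 g" and fin: "sqnorm RZ2 g < top"
    and supp: "\<And>\<zeta>. \<zeta> \<notin> band M K \<Longrightarrow> g \<zeta> = 0" and [measurable]: "band M K \<in> sets RZ2"
  shows "AE \<zeta> in RZ2. \<zeta> \<notin> band M K \<longrightarrow> fourier (inv_fourier_integral g) \<zeta> = 0"
proof -
  have [measurable]: "g \<in> borel_measurable RZ2" using g by auto
  define h where "h = inv_fourier_integral g"
  have h [measurable]: "h \<in> borel_measurable borel" unfolding h_def by measurable
  have hfin: "sqnorm cell_measure h < top"
  proof -
    have "sqnorm cell_measure h \<le> ennreal ((2 * pi) ^ 3) * sqnorm RZ2 g"
      unfolding h_def by (rule sqnorm_inv_fourier_integral_le[OF g])
    also have "\<dots> < top" using fin by (simp add: ennreal_mult_less_top)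
    finally show ?thesis .
  qed
  note spec = fourier_spec[OF h hfin]
  define F where "F = fourier h"
  have [measurable]: "F \<in> borel_measurable RZ2" using spec(1) by (simp add: F_def)
  define a where "a j = inverse (real (Suc j))" for j
  \<comment> \<open>The damped functions are integrable because h is bounded, and their transforms
    can be followed pointwise outside the band.\<close>
  define hd where "hd j z = damping (a j) z * h z" for j z
  have a: "a j > 0" for j by (simp add: a_def)
  define B where "B = (LINT \<zeta>|RZ2. norm (g \<zeta>))"
  have hd_int: "integrable cell_measure (hd j)" for j
  proof -
    have "integrable cell_measure (\<lambda>z. of_real B * damping (a j) z)"
      by (intro integrable_mult_right integrable_damping a)
    then show ?thesis
    proof (rule Bochner_Integration.integrable_bound)
      show "AE z in cell_measure. norm (hd j z) \<le> norm (of_real B * damping (a j) z)"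
      proof (intro AE_I2)
        fix z
        have "norm (h z) \<le> B" unfolding h_def B_def by (rule norm_inv_fourier_integral_le)
        then have "norm (h z) \<le> \<bar>B\<bar>" by linarith
        then have "norm (damping (a j) z) * norm (h z) \<le> norm (damping (a j) z) * \<bar>B\<bar>" by (intro mult_left_mono) auto
        then show "norm (hd j z) \<le> norm (of_real B * damping (a j) z)"
          by (simp add: hd_def norm_mult mult.commute)
      qed
      show "hd j \<in> borel_measurable cell_measure" unfolding hd_def by measurable
    qed
  qed
  have [measurable]: "hd j \<in> borel_measurable borel" for j unfolding hd_def by measurable
  have dist: "(\<lambda>j. sqnorm RZ2 (\<lambda>\<zeta>. F \<zeta> - fhat (hd j) \<zeta>)) \<longlonglongrightarrow> 0"
  proof -
    have 1: "(\<lambda>j. sqnorm RZ2 (\<lambda>\<zeta>. F \<zeta> - fhat (trunc (real j) h) \<zeta>)) \<longlonglongrightarrow> 0"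
      using filterlim_compose[OF spec(3) filterlim_real_sequentially] by (simp add: F_def)
    have 2: "(\<lambda>j. sqnorm cell_measure (\<lambda>z. trunc (real j) h z - hd j z)) \<longlonglongrightarrow> 0"
      unfolding hd_def a_def by (rule sqnorm_trunc_damped_tendsto_0[OF h hfin])
    have up: "sqnorm RZ2 (\<lambda>\<zeta>. F \<zeta> - fhat (hd j) \<zeta>) \<le> 2 * sqnorm RZ2 (\<lambda>\<zeta>. F \<zeta> - fhat (trunc (real j) h) \<zeta>)
      + 2 * (ennreal ((2 * pi) ^ 3) * sqnorm cell_measure (\<lambda>z. trunc (real j) h z - hd j z))" for j
    proof -
      note ti = integrable_trunc[OF h hfin]
      have "sqnorm RZ2 (\<lambda>\<zeta>. F \<zeta> - fhat (hd j) \<zeta>) =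
         sqnorm RZ2 (\<lambda>\<zeta>. (F \<zeta> - fhat (trunc (real j) h) \<zeta>) + fhat (\<lambda>z. trunc (real j) h z - hd j z) \<zeta>)"
        by (simp add: fhat_diff[OF ti hd_int])
      also have "\<dots> \<le> 2 * sqnorm RZ2 (\<lambda>\<zeta>. F \<zeta> - fhat (trunc (real j) h) \<zeta>) + 2 * sqnorm RZ2 (fhat (\<lambda>z. trunc (real j) h z - hd j z))"
        by (intro sqnorm_add_le) measurable
      also have "\<dots> \<le> 2 * sqnorm RZ2 (\<lambda>\<zeta>. F \<zeta> - fhat (trunc (real j) h) \<zeta>)
      + 2 * (ennreal ((2 * pi) ^ 3) * sqnorm cell_measure (\<lambda>z. trunc (real j) h z - hd j z))"
        by (intro add_left_mono mult_left_mono bessel_inequality Bochner_Integration.integrable_diff ti hd_int) auto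
      finally show ?thesis .
    qed
    have "(\<lambda>j. 2 * sqnorm RZ2 (\<lambda>\<zeta>. F \<zeta> - fhat (trunc (real j) h) \<zeta>)
      + 2 * (ennreal ((2 * pi) ^ 3) * sqnorm cell_measure (\<lambda>z. trunc (real j) h z - hd j z))) \<longlonglongrightarrow> 2 * 0 + 2 * (ennreal ((2 * pi) ^ 3) * 0)"
      by (intro tendsto_add ennreal_tendsto_cmult 1 2) auto
    then have lim: "(\<lambda>j. 2 * sqnorm RZ2 (\<lambda>\<zeta>. F \<zeta> - fhat (trunc (real j) h) \<zeta>)
      + 2 * (ennreal ((2 * pi) ^ 3) * sqnorm cell_measure (\<lambda>z. trunc (real j) h z - hd j z))) \<longlonglongrightarrow> 0" by simp
    show ?thesis
      unfolding ennreal_tendsto_0_iff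
    proof (intro allI impI)
      fix e :: real assume "e > 0"
      with lim have "eventually (\<lambda>j. 2 * sqnorm RZ2 (\<lambda>\<zeta>. F \<zeta> - fhat (trunc (real j) h) \<zeta>)
        + 2 * (ennreal ((2 * pi) ^ 3) * sqnorm cell_measure (\<lambda>z. trunc (real j) h z - hd j z)) < ennreal e) sequentially"
        unfolding ennreal_tendsto_0_iff by blast
      then show "eventually (\<lambda>j. sqnorm RZ2 (\<lambda>\<zeta>. F \<zeta> - fhat (hd j) \<zeta>) < ennreal e) sequentially"
        by (rule eventually_mono) (rule le_less_trans[OF up])
    qed
  qed
  \<comment> \<open>Off the band the transforms of hd j tend to 0 pointwise, so u j converges to F
    restricted to the complement; at the same time the norms of u j tend to 0. By Fatou's lemma this
    restriction vanishes almost everywhere.\<close>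
  define u where "u j \<zeta> = (F \<zeta> - fhat (hd j) \<zeta>) * of_real (indicator (- band M K) \<zeta>)" for j \<zeta>
  define v where "v \<zeta> = F \<zeta> * of_real (indicator (- band M K) \<zeta>)" for \<zeta>
  have [measurable]: "- band M K \<in> sets RZ2"
    using sets.compl_sets[OF \<open>band M K \<in> sets RZ2\<close>] by (simp add: Compl_eq_Diff_UNIV del: sets_RZ2)
  have [measurable]: "u j \<in> borel_measurable RZ2" for j unfolding u_def by measurable
  have [measurable]: "v \<in> borel_measurable RZ2" unfolding v_def by measurable
  have "sqnorm RZ2 v \<le> ennreal e" if e: "e > 0" for e
  proof (rule sqnorm_fatou[of u])
    show "AE \<zeta> in RZ2. (\<lambda>j. u j \<zeta>) \<longlonglongrightarrow> v \<zeta>"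
    proof (intro AE_I2)
      fix \<zeta>
      show "(\<lambda>j. u j \<zeta>) \<longlonglongrightarrow> v \<zeta>"
      proof (cases "\<zeta> \<in> band M K")
        case False
        have "(\<lambda>j. fhat (hd j) \<zeta>) \<longlonglongrightarrow> 0"
          using fhat_damped_tendsto_0[OF g supp False] by (simp add: hd_def[abs_def] a_def h_def)
        then have "(\<lambda>j. (F \<zeta> - fhat (hd j) \<zeta>) * of_real (indicator (- band M K) \<zeta>)) \<longlonglongrightarrow> (F \<zeta> - 0) * of_real (indicator (- band M K) \<zeta>)"
          by (intro tendsto_intros)
        then show ?thesis by (simp add: u_def v_def)
      qed (simp add: u_def v_def)
    qed
    have u_le: "sqnorm RZ2 (u j) \<le> sqnorm RZ2 (\<lambda>\<zeta>. F \<zeta> - fhat (hd j) \<zeta>)" for j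
      by (intro sqnorm_mono) (auto simp: u_def indicator_def)
    have "eventually (\<lambda>j. sqnorm RZ2 (\<lambda>\<zeta>. F \<zeta> - fhat (hd j) \<zeta>) < ennreal e) sequentially"
      using dist e unfolding ennreal_tendsto_0_iff by blast
    then show "eventually (\<lambda>j. sqnorm RZ2 (u j) \<le> ennreal e) sequentially"
      by (rule eventually_mono) (rule order_trans[OF u_le less_imp_le])
  qed measurable
  then have "sqnorm RZ2 v \<le> 0 + ennreal e" if "e > 0" for e using that by simp
  then have "sqnorm RZ2 v \<le> 0" by (rule ennreal_le_epsilon)
  then have "(\<integral>\<^sup>+\<zeta>. ennreal ((norm (v \<zeta>))\<^sup>2) \<partial>RZ2) = 0" by (simp add: sqnorm_def)
  then have "AE \<zeta> in RZ2. ennreal ((norm (v \<zeta>))\<^sup>2) = 0"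
    by (subst (asm) nn_integral_0_iff_AE) auto
  then show ?thesis
    by eventually_elim (auto simp: v_def F_def h_def indicator_def)
qed

lemma smooth_cutoff_bounded:
  assumes "smooth_cutoff \<eta>"
  obtains b where "b > 0" "\<And>s. \<bar>\<eta> s\<bar> \<le> b" "\<eta> \<in> borel_measurable borel"
proof -
  have "\<eta> differentiable (at x)" for x
    using assms unfolding smooth_cutoff_def by (metis funpow_0)
  then have cont: "continuous_on A \<eta>" for A
    by (intro continuous_at_imp_continuous_on ballI differentiable_imp_continuous_within)
  have "compact (\<eta> ` {-2..2})" by (intro compact_continuous_image cont) auto
  then obtain b where b: "\<And>s. s \<in> {-2..2} \<Longrightarrow> \<bar>\<eta> s\<bar> \<le> b"
    by (metis bounded_iff compact_imp_bounded imageI real_norm_def)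
  have "\<bar>\<eta> s\<bar> \<le> \<bar>b\<bar> + 1" for s
  proof (cases "\<bar>s\<bar> \<ge> 2")
    case True
    then show ?thesis using assms by (simp add: smooth_cutoff_def)
  next
    case False
    then have "s \<in> {-2..2}" by (auto simp: abs_le_iff)
    from b[OF this] show ?thesis by linarith
  qed
  moreover have "\<eta> \<in> borel_measurable borel" using cont by (rule borel_measurable_continuous_onI)
  ultimately show ?thesis by (intro that[of "\<bar>b\<bar> + 1"]) auto
qed

section \<open>The evolution of band-limited data\<close>

definition schroedinger_phase :: "real \<Rightarrow> real \<times> int \<times> int \<Rightarrow> complex" where
  "schroedinger_phase t \<zeta> = cis (- t * ((fst \<zeta>)\<^sup>2 + (real_of_int (fst (snd \<zeta>)))\<^sup>2 + (real_of_int (snd (snd \<zeta>)))\<^sup>2))"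

lemma norm_schroedinger_phase [simp]: "norm (schroedinger_phase t \<zeta>) = 1"
  by (simp add: schroedinger_phase_def)

lemma measurable_schroedinger_phase [measurable]:
  assumes [measurable]: "f \<in> M \<rightarrow>\<^sub>M borel" and g: "g \<in> M \<rightarrow>\<^sub>M RZ2"
  shows "(\<lambda>x. schroedinger_phase (f x) (g x)) \<in> borel_measurable M"
proof -
  have [measurable]: "(\<lambda>x. real_of_int (fst (snd (g x)))) \<in> borel_measurable M"
     "(\<lambda>x. real_of_int (snd (snd (g x)))) \<in> borel_measurable M"
    by (rule measurable_compose[OF g measurable_RZ2_components(2)])+
  have [measurable]: "(\<lambda>x. fst (g x)) \<in> borel_measurable M"
    by (rule measurable_compose[OF g measurable_RZ2_components(1)])
  show ?thesis unfolding schroedinger_phase_def by measurable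
qed

definition int_box :: "int \<Rightarrow> (int \<times> int) set" where
  "int_box M = {-M..M} \<times> {-M..M}"

lemma band_sets [measurable]: "band M K \<in> sets RZ2"
proof -
  have "band M K = {-M..M} \<times> K" by (auto simp: band_def abs_le_iff)
  then show ?thesis by (auto intro: pair_measureI)
qed

lemma integrable_indicator_band:
  "integrable RZ2 (\<lambda>\<zeta>. complex_of_real (indicator (band M (int_box L)) \<zeta>))"
proof -
  have "integrable RZ2 (\<lambda>\<zeta>. (\<lambda>\<xi>. complex_of_real (indicator {-M..M} \<xi>)) (fst \<zeta>) * (\<lambda>k. of_real (indicator (int_box L) k)) (snd \<zeta>))"
    by (rule RZ2_product_integral(1)[of _ "int_box L"])
      (auto simp: int_box_def emeasure_lborel_Icc_eq intro!: integrable_of_real integrable_real_indicator)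
  moreover have "(\<lambda>\<xi>. complex_of_real (indicator {-M..M} \<xi>)) (fst \<zeta>) * (\<lambda>k. of_real (indicator (int_box L) k)) (snd \<zeta>)
     = complex_of_real (indicator (band M (int_box L)) \<zeta>)" for \<zeta>
    by (auto simp: band_def indicator_def abs_le_iff)
  ultimately show ?thesis by simp
qed

lemma integrable_band_limited:
  assumes [measurable]: "g \<in> borel_measurable RZ2" and fin: "sqnorm RZ2 g < top"
    and supp: "\<And>\<zeta>. \<zeta> \<notin> band M (int_box L) \<Longrightarrow> g \<zeta> = 0"
  shows "integrable RZ2 g"
proof -
  have "integrable RZ2 (\<lambda>\<zeta>. (norm (g \<zeta>))\<^sup>2)"
    using fin unfolding sqnorm_def by (intro integrableI_nonneg) (auto simp: infinity_ennreal_def)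
  then have "integrable RZ2 (\<lambda>\<zeta>. complex_of_real ((norm (g \<zeta>))\<^sup>2) + complex_of_real (indicator (band M (int_box L)) \<zeta>))"
    by (intro Bochner_Integration.integrable_add integrable_indicator_band integrable_of_real)
  then show ?thesis
  proof (rule Bochner_Integration.integrable_bound)
    have le: "a \<le> a\<^sup>2 + 1" for a :: real
      using zero_le_power2[of "a - 1/2"] by (simp add: power2_eq_square algebra_simps)
    show "AE \<zeta> in RZ2. norm (g \<zeta>) \<le> norm (complex_of_real ((norm (g \<zeta>))\<^sup>2) + complex_of_real (indicator (band M (int_box L)) \<zeta>))"
    proof (intro AE_I2)
      fix \<zeta>
      have "norm (complex_of_real ((norm (g \<zeta>))\<^sup>2) + complex_of_real (indicator (band M (int_box L)) \<zeta>)) = (norm (g \<zeta>))\<^sup>2 + indicator (band M (int_box L)) \<zeta>"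
        unfolding of_real_add[symmetric] norm_of_real by (auto simp: indicator_def)
      then show "norm (g \<zeta>) \<le> norm (complex_of_real ((norm (g \<zeta>))\<^sup>2) + complex_of_real (indicator (band M (int_box L)) \<zeta>))"
        using le[of "norm (g \<zeta>)"] supp[of \<zeta>] by (cases "\<zeta> \<in> band M (int_box L)") auto
    qed
  qed measurable
qed

text \<open>The cutoff confines everything to a band, where square integrability implies
  integrability; hence the inverse transforms are explicit integrals and no representative is
  chosen. The amplitude G is the transform of the projected datum cut to the band. It serves all
  times and points at once, which supplies joint measurability. The constant A is fixed before N and
  the datum.\<close>

lemma evolution_representation:
  assumes \<eta>: "smooth_cutoff \<eta>"
  shows "\<exists>A>0. \<forall>N u0. N \<ge> 1 \<longrightarrow> u0 \<in> L2_RT2 \<longrightarrow>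
    (\<exists>G. integrable RZ2 G \<and> sqnorm RZ2 G \<le> ennreal A * sqnorm cell_measure u0 \<and>
      (\<forall>\<zeta>. \<zeta> \<notin> band (2 * real N) (int_box (2 * int N)) \<longrightarrow> G \<zeta> = 0) \<and>
      (\<forall>t z. schroedinger t (P_le \<eta> N u0) z = inv_fourier_integral (\<lambda>\<zeta>. schroedinger_phase t \<zeta> * G \<zeta>) z))"
proof -
  obtain b where b: "b > 0" "\<And>s. \<bar>\<eta> s\<bar> \<le> b" and [measurable]: "\<eta> \<in> borel_measurable borel"
    using smooth_cutoff_bounded[OF \<eta>] by metis
  define k :: real where "k = (2 * pi) ^ 3"
  have k: "k > 0" by (simp add: k_def)
  \<comment> \<open>From the inside out: 2k for the transform of the datum, the square of b ^ 3 for
    the product of three cutoffs, k for the inverse transform, and 2k for transforming once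
    more.\<close>
  define A where "A = 2 * (k * (k * ((b ^ 3)\<^sup>2 * (2 * k))))"
  have A: "A > 0" using b k by (simp add: A_def)
  show ?thesis
  proof (rule exI[of _ A], rule conjI[OF A], intro allI impI)
    fix N :: nat and u0 assume N: "N \<ge> 1" and u0: "u0 \<in> L2_RT2"
    define bd where "bd = band (2 * real N) (int_box (2 * int N))"
    have bd_sets [measurable]: "bd \<in> sets RZ2" unfolding bd_def by (rule band_sets)
    have [measurable]: "u0 \<in> borel_measurable borel" and "Lp_norm RT2 2 u0 < top"
      using u0 by (auto simp: L2_RT2_def)
    then have "sqnorm RT2 u0 < top" by (simp add: Lp_norm_2_finite_iff)
    then have ufin: "sqnorm cell_measure u0 < top"
      unfolding sqnorm_def by (subst (asm) nn_integral_RT2) auto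
    define F where "F = fourier u0"
    have [measurable]: "F \<in> borel_measurable RZ2" unfolding F_def by (rule fourier_spec(1)[OF _ ufin]) measurable
    have F: "sqnorm RZ2 F \<le> ennreal (2 * k) * sqnorm cell_measure u0"
      using sqnorm_fourier_le[OF _ ufin] by (simp add: F_def k_def ennreal_mult' mult.assoc)
    define m where "m \<zeta> = \<eta> (fst \<zeta> / N) * \<eta> (real_of_int (fst (snd \<zeta>)) / N) * \<eta> (real_of_int (snd (snd \<zeta>)) / N)" for \<zeta> :: "real \<times> int \<times> int"
    define g where "g \<zeta> = of_real (m \<zeta>) * F \<zeta>" for \<zeta>
    have [measurable]: "m \<in> borel_measurable RZ2"
    proof -
      have [measurable]: "(\<lambda>\<zeta>. real_of_int (fst (snd \<zeta>))) \<in> borel_measurable RZ2"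
        "(\<lambda>\<zeta>. real_of_int (snd (snd \<zeta>))) \<in> borel_measurable RZ2"
        by (rule measurable_RZ2_components(2))+
      show ?thesis unfolding m_def by measurable
    qed
    have [measurable]: "g \<in> borel_measurable RZ2" unfolding g_def by measurable
    have \<eta>0: "\<eta> (x / real N) = 0" if "\<not> \<bar>x\<bar> \<le> 2 * real N" for x
    proof -
      have "\<bar>x / real N\<bar> \<ge> 2" using that N by (simp add: field_simps)
      then show ?thesis using \<eta> by (simp add: smooth_cutoff_def)
    qed
    have gsupp: "g \<zeta> = 0" if "\<zeta> \<notin> bd" for \<zeta>
    proof -
      have "\<not> \<bar>fst \<zeta>\<bar> \<le> 2 * real N \<or> \<not> \<bar>real_of_int (fst (snd \<zeta>))\<bar> \<le> 2 * real N \<or> \<not> \<bar>real_of_int (snd (snd \<zeta>))\<bar> \<le> 2 * real N"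
        using that by (cases \<zeta>) (auto simp: bd_def band_def int_box_def abs_le_iff)
      then show ?thesis using \<eta>0 by (auto simp: g_def m_def)
    qed
    have mb: "\<bar>m \<zeta>\<bar> \<le> b ^ 3" for \<zeta>
      unfolding m_def abs_mult power3_eq_cube using b by (intro mult_mono) auto
    have gb: "sqnorm RZ2 g \<le> ennreal ((b ^ 3)\<^sup>2) * sqnorm RZ2 F"
    proof -
      have "sqnorm RZ2 g \<le> sqnorm RZ2 (\<lambda>\<zeta>. of_real (b ^ 3) * F \<zeta>)"
      proof (intro sqnorm_mono)
        fix \<zeta>
        have "\<bar>m \<zeta>\<bar> * norm (F \<zeta>) \<le> \<bar>b ^ 3\<bar> * norm (F \<zeta>)"
          using mb[of \<zeta>] by (intro mult_right_mono) auto
        then show "norm (g \<zeta>) \<le> norm (of_real (b ^ 3) * F \<zeta>)"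
          unfolding g_def norm_mult norm_of_real .
      qed
      also have "\<dots> = (\<integral>\<^sup>+\<zeta>. ennreal ((b ^ 3)\<^sup>2) * ennreal ((norm (F \<zeta>))\<^sup>2) \<partial>RZ2)"
        unfolding sqnorm_def norm_mult norm_of_real power_mult_distrib by (simp add: ennreal_mult)
      also have "\<dots> = ennreal ((b ^ 3)\<^sup>2) * sqnorm RZ2 F"
        unfolding sqnorm_def by (rule nn_integral_cmult) measurable
      finally show ?thesis .
    qed
    have gfin: "sqnorm RZ2 g < top"
    proof -
      have "sqnorm RZ2 F < top" unfolding F_def by (rule fourier_spec(2)[OF _ ufin]) measurable
      then have "ennreal ((b ^ 3)\<^sup>2) * sqnorm RZ2 F < top" by (simp add: ennreal_mult_less_top)
      with gb show ?thesis by (rule le_less_trans)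
    qed
    have gint: "integrable RZ2 g"
      by (rule integrable_band_limited[OF _ gfin]) (use gsupp in \<open>auto simp: bd_def\<close>)
    define h where "h = inv_fourier_integral g"
    have h [measurable]: "h \<in> borel_measurable borel" unfolding h_def by measurable
    have hb: "sqnorm cell_measure h \<le> ennreal k * sqnorm RZ2 g"
      unfolding h_def k_def by (rule sqnorm_inv_fourier_integral_le[OF gint])
    have hfin: "sqnorm cell_measure h < top"
      using le_less_trans[OF hb] gfin by (simp add: ennreal_mult_less_top)
    \<comment> \<open>As g is integrable, \<open>inv_fourier\<close> takes its explicit branch, so
      the equality holds at every point and not just almost everywhere.\<close>
    have P: "P_le \<eta> N u0 = h"
    proof -
      have "(\<lambda>\<zeta>. (case \<zeta> of (\<xi>, k1, k2) \<Rightarrow> complex_of_real (\<eta> (\<xi> / real N) * \<eta> (real_of_int k1 / real N) * \<eta> (real_of_int k2 / real N))) * fourier u0 \<zeta>) = g"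
        by (auto simp: g_def m_def F_def fun_eq_iff)
      then show ?thesis
        using gint by (simp add: P_le_def fourier_multiplier_def inv_fourier_def h_def)
    qed
    \<comment> \<open>Transforming h back need not return g at each point. Cutting to the band
      changes the transform only on a null set and makes the support condition hold
      everywhere.\<close>
    define G where "G \<zeta> = fourier h \<zeta> * of_real (indicator bd \<zeta>)" for \<zeta>
    note spec = fourier_spec[OF h hfin]
    have [measurable]: "fourier h \<in> borel_measurable RZ2" by (rule spec(1))
    have [measurable]: "G \<in> borel_measurable RZ2" unfolding G_def by measurable
    have Gle: "sqnorm RZ2 G \<le> sqnorm RZ2 (fourier h)"
      by (intro sqnorm_mono) (auto simp: G_def indicator_def)
    have Gfin: "sqnorm RZ2 G < top" using Gle spec(2) by (rule le_less_trans)
    have Gsupp: "\<forall>\<zeta>. \<zeta> \<notin> bd \<longrightarrow> G \<zeta> = 0" by (simp add: G_def)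
    have Gint: "integrable RZ2 G"
      by (rule integrable_band_limited[OF _ Gfin]) (use Gsupp in \<open>auto simp: bd_def\<close>)
    have Gb: "sqnorm RZ2 G \<le> ennreal A * sqnorm cell_measure u0"
    proof -
      have "sqnorm RZ2 G \<le> 2 * (ennreal k * sqnorm cell_measure h)"
        using Gle sqnorm_fourier_le[OF h hfin] unfolding k_def by (rule order_trans)
      also have "\<dots> \<le> 2 * (ennreal k * (ennreal k * (ennreal ((b ^ 3)\<^sup>2) * (ennreal (2 * k) * sqnorm cell_measure u0))))"
        by (intro mult_left_mono order_trans[OF hb] order_trans[OF gb] F) auto
      also have "\<dots> = ennreal A * sqnorm cell_measure u0"
      proof -
        have "ennreal A = ennreal 2 * (ennreal k * (ennreal k * (ennreal ((b ^ 3)\<^sup>2) * ennreal (2 * k))))"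
          unfolding A_def by (simp only: ennreal_mult' less_imp_le[OF k] zero_le_power2 zero_le_numeral)
        then show ?thesis by (simp only: mult.assoc ennreal_numeral)
      qed
      finally show ?thesis .
    qed
    have "AE \<zeta> in RZ2. \<zeta> \<notin> bd \<longrightarrow> fourier h \<zeta> = 0"
      unfolding h_def bd_def
      by (rule fourier_inverse_band_limited[OF gint gfin _ band_sets]) (use gsupp in \<open>simp add: bd_def\<close>)
    then have AE: "AE \<zeta> in RZ2. fourier h \<zeta> = G \<zeta>"
      by eventually_elim (auto simp: G_def indicator_def)
    have evol: "schroedinger t (P_le \<eta> N u0) z = inv_fourier_integral (\<lambda>\<zeta>. schroedinger_phase t \<zeta> * G \<zeta>) z" for t z
    proof -
      have [measurable]: "(\<lambda>\<zeta>. schroedinger_phase t \<zeta>) \<in> borel_measurable RZ2"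
        by (intro measurable_schroedinger_phase) auto
      have [measurable]: "(\<lambda>\<zeta>. character \<zeta> z) \<in> borel_measurable RZ2"
        by (intro measurable_character) auto
      have "(\<lambda>\<zeta>. (case \<zeta> of (\<xi>, k1, k2) \<Rightarrow> cis (- t * (\<xi>\<^sup>2 + (real_of_int k1)\<^sup>2 + (real_of_int k2)\<^sup>2))) * fourier h \<zeta>) = (\<lambda>\<zeta>. schroedinger_phase t \<zeta> * fourier h \<zeta>)"
        by (auto simp: schroedinger_phase_def fun_eq_iff)
      then have 1: "schroedinger t (P_le \<eta> N u0) = inv_fourier (\<lambda>\<zeta>. schroedinger_phase t \<zeta> * fourier h \<zeta>)"
        by (simp add: schroedinger_def fourier_multiplier_def P)
      have "integrable RZ2 (\<lambda>\<zeta>. schroedinger_phase t \<zeta> * G \<zeta>)"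
        by (rule Bochner_Integration.integrable_bound[OF Gint]) (auto simp: norm_mult)
      moreover have "AE \<zeta> in RZ2. schroedinger_phase t \<zeta> * fourier h \<zeta> = schroedinger_phase t \<zeta> * G \<zeta>"
        using AE by eventually_elim simp
      ultimately have 2: "integrable RZ2 (\<lambda>\<zeta>. schroedinger_phase t \<zeta> * fourier h \<zeta>)"
        by (subst integrable_cong_AE) auto
      \<comment> \<open>A change on a null set of frequencies does not alter the integral, so the
        identity holds for every t and z although the two transforms agree only almost
        everywhere.\<close>
      have "(LINT \<zeta>|RZ2. character \<zeta> z * (schroedinger_phase t \<zeta> * fourier h \<zeta>)) = (LINT \<zeta>|RZ2. character \<zeta> z * (schroedinger_phase t \<zeta> * G \<zeta>))"
      proof (rule integral_cong_AE)
        show "AE \<zeta> in RZ2. character \<zeta> z * (schroedinger_phase t \<zeta> * fourier h \<zeta>) = character \<zeta> z * (schroedinger_phase t \<zeta> * G \<zeta>)"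
          using AE by eventually_elim simp
      qed measurable
      then show ?thesis
        unfolding 1 using 2 by (simp add: inv_fourier_def inv_fourier_integral_def)
    qed
    show "\<exists>G. integrable RZ2 G \<and> sqnorm RZ2 G \<le> ennreal A * sqnorm cell_measure u0 \<and>
      (\<forall>\<zeta>. \<zeta> \<notin> band (2 * real N) (int_box (2 * int N)) \<longrightarrow> G \<zeta> = 0) \<and>
      (\<forall>t z. schroedinger t (P_le \<eta> N u0) z = inv_fourier_integral (\<lambda>\<zeta>. schroedinger_phase t \<zeta> * G \<zeta>) z)"
      using Gint Gb Gsupp evol unfolding bd_def by blast
  qed
qed

section \<open>The space-time bilinear form\<close>

text \<open>The abstract expansion behind the \<open>TT*\<close> argument. With x the frequency and
  y, y' two times, the form is dominated by the double time integral of the correlation obtained by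
  performing the frequency integral first.\<close>

lemma (in pair_sigma_finite) norm_double_integral_le:
  fixes a a' :: "'a \<Rightarrow> 'b \<Rightarrow> complex"
  assumes \<rho>: "integrable M1 \<rho>" and b: "integrable M2 b" and b': "integrable M2 b'"
    and a_meas: "case_prod a \<in> borel_measurable (M1 \<Otimes>\<^sub>M M2)" and a: "\<And>x y. norm (a x y) \<le> C"
    and a'_meas: "case_prod a' \<in> borel_measurable (M1 \<Otimes>\<^sub>M M2)" and a': "\<And>x y. norm (a' x y) \<le> C"
  shows "ennreal (norm (LINT x|M1. \<rho> x * (LINT y|M2. b y * a x y) * cnj (LINT y|M2. b' y * a' x y))) \<le>
    (\<integral>\<^sup>+y. \<integral>\<^sup>+y'. ennreal (norm (b y) * norm (b' y') * norm (LINT x|M1. \<rho> x * (a x y * cnj (a' x y')))) \<partial>M2 \<partial>M2)"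
proof -
  note [measurable] = a_meas a'_meas
  have [measurable]: "\<rho> \<in> borel_measurable M1" "b \<in> borel_measurable M2" "b' \<in> borel_measurable M2"
    using \<rho> b b' by auto
  have C0: "C \<ge> 0" using a[of undefined undefined] norm_ge_zero order_trans by blast
  define w where "w x = (LINT y|M2. b' y * a' x y)" for x
  have [measurable]: "w \<in> borel_measurable M1" unfolding w_def by measurable
  have wb: "norm (w x) \<le> C * (LINT y|M2. norm (b' y))" for x
  proof -
    have "norm (w x) \<le> (LINT y|M2. norm (b' y * a' x y))" unfolding w_def by (rule integral_norm_bound)
    also have "\<dots> \<le> (LINT y|M2. C * norm (b' y))"
    proof (rule integral_mono')
      show "integrable M2 (\<lambda>y. C * norm (b' y))" using b' by (intro integrable_mult_right integrable_norm)
      show "norm (b' y * a' x y) \<le> C * norm (b' y)" for y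
        using mult_right_mono[OF a'[of x y] norm_ge_zero[of "b' y"]] by (simp add: norm_mult mult.commute)
    qed (use C0 in auto)
    finally show ?thesis by simp
  qed
  have "(LINT x|M1. \<rho> x * (LINT y|M2. b y * a x y) * cnj (w x)) = (LINT x|M1. LINT y|M2. \<rho> x * b y * (a x y * cnj (w x)))"
  proof (intro Bochner_Integration.integral_cong refl)
    fix x
    have "(LINT y|M2. \<rho> x * b y * (a x y * cnj (w x))) = (LINT y|M2. (\<rho> x * cnj (w x)) * (b y * a x y))"
      by (simp add: mult_ac)
    also have "\<dots> = (\<rho> x * cnj (w x)) * (LINT y|M2. b y * a x y)" by (rule integral_mult_right_zero)
    finally show "\<rho> x * (LINT y|M2. b y * a x y) * cnj (w x) = (LINT y|M2. \<rho> x * b y * (a x y * cnj (w x)))"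
      by (simp only: mult_ac)
  qed
  also have "\<dots> = (LINT y|M2. LINT x|M1. \<rho> x * b y * (a x y * cnj (w x)))"
  proof (rule swap_integrals_bounded[OF \<rho> b])
    show "norm (a x y * cnj (w x)) \<le> C * (C * (LINT y|M2. norm (b' y)))" for x y
      unfolding norm_mult complex_mod_cnj by (intro mult_mono a wb C0) auto
  qed measurable
  finally have eq: "(LINT x|M1. \<rho> x * (LINT y|M2. b y * a x y) * cnj (w x)) = (LINT y|M2. LINT x|M1. \<rho> x * b y * (a x y * cnj (w x)))" .
  have b'c: "integrable M2 (\<lambda>y. cnj (b' y))" using b' by simp
  have inner: "(LINT x|M1. \<rho> x * b y * (a x y * cnj (w x))) = b y * (LINT y'|M2. cnj (b' y') * (LINT x|M1. \<rho> x * (a x y * cnj (a' x y'))))"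
    if y: "y \<in> space M2" for y
  proof -
    have [measurable]: "(\<lambda>x. a x y) \<in> borel_measurable M1"
      using measurable_Pair1[OF a_meas y] by simp
    have "(LINT x|M1. \<rho> x * b y * (a x y * cnj (w x))) = (LINT x|M1. b y * (\<rho> x * a x y * cnj (w x)))"
      by (simp add: mult_ac)
    also have "\<dots> = b y * (LINT x|M1. \<rho> x * a x y * cnj (w x))" by (rule integral_mult_right_zero)
    also have "(LINT x|M1. \<rho> x * a x y * cnj (w x)) = (LINT x|M1. LINT y'|M2. \<rho> x * cnj (b' y') * (a x y * cnj (a' x y')))"
    proof (intro Bochner_Integration.integral_cong refl)
      fix x
      have "cnj (w x) = (LINT y'|M2. cnj (b' y' * a' x y'))"
        unfolding w_def by (rule Bochner_Integration.integral_cnj[symmetric])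
      then have "\<rho> x * a x y * cnj (w x) = (LINT y'|M2. \<rho> x * a x y * cnj (b' y' * a' x y'))"
        by (simp only: integral_mult_right_zero)
      then show "\<rho> x * a x y * cnj (w x) = (LINT y'|M2. \<rho> x * cnj (b' y') * (a x y * cnj (a' x y')))"
        by (simp add: mult_ac)
    qed
    also have "\<dots> = (LINT y'|M2. LINT x|M1. \<rho> x * cnj (b' y') * (a x y * cnj (a' x y')))"
    proof (rule swap_integrals_bounded[OF \<rho> b'c])
      show "norm (a x y * cnj (a' x y')) \<le> C * C" for x y'
        unfolding norm_mult complex_mod_cnj by (intro mult_mono a a' C0) auto
    qed measurable
    also have "\<dots> = (LINT y'|M2. cnj (b' y') * (LINT x|M1. \<rho> x * (a x y * cnj (a' x y'))))"
    proof (intro Bochner_Integration.integral_cong refl)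
      fix y'
      have "(LINT x|M1. \<rho> x * cnj (b' y') * (a x y * cnj (a' x y'))) = (LINT x|M1. cnj (b' y') * (\<rho> x * (a x y * cnj (a' x y'))))"
        by (simp add: mult_ac)
      also have "\<dots> = cnj (b' y') * (LINT x|M1. \<rho> x * (a x y * cnj (a' x y')))" by (rule integral_mult_right_zero)
      finally show "(LINT x|M1. \<rho> x * cnj (b' y') * (a x y * cnj (a' x y'))) = cnj (b' y') * (LINT x|M1. \<rho> x * (a x y * cnj (a' x y')))" .
    qed
    finally show ?thesis .
  qed
  have "ennreal (norm (LINT x|M1. \<rho> x * (LINT y|M2. b y * a x y) * cnj (w x))) \<le>
      (\<integral>\<^sup>+y. ennreal (norm (LINT x|M1. \<rho> x * b y * (a x y * cnj (w x)))) \<partial>M2)"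
    unfolding eq by (rule ennreal_norm_integral_le)
  also have "\<dots> \<le> (\<integral>\<^sup>+y. \<integral>\<^sup>+y'. ennreal (norm (b y) * norm (b' y') * norm (LINT x|M1. \<rho> x * (a x y * cnj (a' x y')))) \<partial>M2 \<partial>M2)"
  proof (intro nn_integral_mono)
    fix y assume y: "y \<in> space M2"
    have [measurable]: "(\<lambda>x. a x y) \<in> borel_measurable M1"
      using measurable_Pair1[OF a_meas y] by simp
    define L where "L y' = (LINT x|M1. \<rho> x * (a x y * cnj (a' x y')))" for y'
    have sw: "(\<lambda>(y', x). \<rho> x * (a x y * cnj (a' x y'))) \<in> borel_measurable (M2 \<Otimes>\<^sub>M M1)"
      by measurable
    have [measurable]: "L \<in> borel_measurable M2" unfolding L_def
      by (rule M1.borel_measurable_lebesgue_integral[OF sw])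
    have "ennreal (norm (LINT x|M1. \<rho> x * b y * (a x y * cnj (w x)))) = ennreal (norm (b y)) * ennreal (norm (LINT y'|M2. cnj (b' y') * L y'))"
      unfolding inner[OF y] L_def norm_mult by (simp add: ennreal_mult)
    also have "\<dots> \<le> ennreal (norm (b y)) * (\<integral>\<^sup>+y'. ennreal (norm (cnj (b' y') * L y')) \<partial>M2)"
      by (intro mult_left_mono ennreal_norm_integral_le) auto
    also have "\<dots> = (\<integral>\<^sup>+y'. ennreal (norm (b y)) * ennreal (norm (cnj (b' y') * L y')) \<partial>M2)"
      by (intro nn_integral_cmult[symmetric]) measurable
    also have "\<dots> = (\<integral>\<^sup>+y'. ennreal (norm (b y) * norm (b' y') * norm (L y')) \<partial>M2)"
      by (simp add: norm_mult ennreal_mult mult.assoc)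
    finally show "ennreal (norm (LINT x|M1. \<rho> x * b y * (a x y * cnj (w x)))) \<le>
       (\<integral>\<^sup>+y'. ennreal (norm (b y) * norm (b' y') * norm (LINT x|M1. \<rho> x * (a x y * cnj (a' x y')))) \<partial>M2)"
      by (simp add: L_def)
  qed
  finally show ?thesis by (simp add: w_def)
qed

interpretation RZ2_time: pair_sigma_finite RZ2 "lborel :: real measure" ..
interpretation cell_time: pair_sigma_finite cell_measure "lborel :: real measure" ..

section \<open>Test functions on time slabs and their transforms\<close>

definition time_slab :: "int \<Rightarrow> real set" where
  "time_slab \<gamma> = {2 * pi * \<gamma>..2 * pi * (\<gamma> + 1)}"

lemma time_slab_borel [measurable]: "time_slab \<gamma> \<in> sets borel"
  by (simp add: time_slab_def)

text \<open>The cutoff X only makes slices integrable and volumes finite and never enters a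
  constant. The bound by 1 makes squares of values no larger than the values.\<close>

definition slab_test :: "int \<Rightarrow> real \<Rightarrow> ((real \<times> real \<times> real) \<times> real \<Rightarrow> complex) \<Rightarrow> bool" where
  "slab_test \<gamma> X F \<longleftrightarrow> F \<in> borel_measurable borel \<and> (\<forall>p. norm (F p) \<le> 1) \<and>
     (\<forall>z t. F (z, t) \<noteq> 0 \<longrightarrow> \<bar>fst z\<bar> \<le> X \<and> t \<in> time_slab \<gamma>)"

definition slice_mass :: "((real \<times> real \<times> real) \<times> real \<Rightarrow> complex) \<Rightarrow> real \<Rightarrow> ennreal" where
  "slice_mass F t = (\<integral>\<^sup>+z. ennreal (norm (F (z, t))) \<partial>cell_measure)"

definition mass :: "((real \<times> real \<times> real) \<times> real \<Rightarrow> complex) \<Rightarrow> ennreal" where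
  "mass F = (\<integral>\<^sup>+t. slice_mass F t \<partial>lborel)"

text \<open>The adjoint of the evolution map, up to the factor \<open>1 / (2 * pi) ^ 3\<close>: each
  slice is transformed, moved back to time 0, and the results are superposed.\<close>

definition wave_transform :: "((real \<times> real \<times> real) \<times> real \<Rightarrow> complex) \<Rightarrow> real \<times> int \<times> int \<Rightarrow> complex" where
  "wave_transform F \<zeta> = (LINT t|lborel. cnj (schroedinger_phase t \<zeta>) * fhat (\<lambda>z. F (z, t)) \<zeta>)"

lemma measurable_slice [measurable]:
  assumes [measurable]: "F \<in> borel_measurable borel"
  shows "(\<lambda>z. F (z, t)) \<in> borel_measurable borel"
proof -
  have "(\<lambda>z. (z, t)) \<in> borel \<rightarrow>\<^sub>M borel"
    by (intro borel_measurable_continuous_onI continuous_intros)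
  then show ?thesis by (rule measurable_compose) fact
qed

lemma measurable_slice_mass [measurable]:
  assumes [measurable]: "F \<in> borel_measurable borel"
  shows "slice_mass F \<in> borel_measurable borel"
  unfolding slice_mass_def by measurable

context
  fixes \<gamma> X F
  assumes F: "slab_test \<gamma> X F"
begin

lemma slab_test_measurable [measurable]: "F \<in> borel_measurable borel"
  using F by (simp add: slab_test_def)

lemma slab_test_norm: "norm (F p) \<le> 1"
  using F unfolding slab_test_def by blast

lemma slab_test_support: "\<not> (\<bar>fst z\<bar> \<le> X \<and> t \<in> time_slab \<gamma>) \<Longrightarrow> F (z, t) = 0"
  using F unfolding slab_test_def by blast

lemma slab_test_slice_integrable: "integrable cell_measure (\<lambda>z. F (z, t))"
  by (rule integrable_cell_bounded_strip[where B=1 and R=X])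
    (auto simp: slab_test_norm intro: slab_test_support)

lemma slab_test_slice_bound: "(LINT z|cell_measure. norm (F (z, t))) \<le> (LINT z|cell_measure. indicator {-X..X} (fst z))"
proof (rule integral_mono'[OF integrable_cell_strip])
  show "norm (F (z, t)) \<le> indicator {-X..X} (fst z)" for z
    using slab_test_norm[of "(z, t)"] slab_test_support[of z t]
    by (cases "\<bar>fst z\<bar> \<le> X") (auto simp: indicator_def abs_le_iff)
qed auto

lemma slab_test_fhat_bound: "norm (fhat (\<lambda>z. F (z, t)) \<zeta>) \<le> (LINT z|cell_measure. indicator {-X..X} (fst z))"
  using norm_fhat_le slab_test_slice_bound by (rule order_trans)

lemma slab_test_fhat_zero: "t \<notin> time_slab \<gamma> \<Longrightarrow> fhat (\<lambda>z. F (z, t)) \<zeta> = 0"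
  using slab_test_support by (simp add: fhat_def)

lemma slab_test_fhat_measurable [measurable]:
  "(\<lambda>(\<zeta>, t). fhat (\<lambda>z. F (z, t)) \<zeta>) \<in> borel_measurable (RZ2 \<Otimes>\<^sub>M lborel)"
  unfolding fhat_def by measurable

lemma slice_mass_eq: "slice_mass F t = ennreal (LINT z|cell_measure. norm (F (z, t)))"
  unfolding slice_mass_def
  by (intro nn_integral_eq_integral integrable_norm slab_test_slice_integrable) auto

text \<open>The point of testing with functions of modulus at most 1: the energy estimate can be
  expressed by the same masses as the dispersive one.\<close>

lemma sqnorm_slice_le: "sqnorm cell_measure (\<lambda>z. F (z, t)) \<le> slice_mass F t"
  unfolding sqnorm_def slice_mass_def
proof (intro nn_integral_mono ennreal_leI)
  fix z show "(norm (F (z, t)))\<^sup>2 \<le> norm (F (z, t))"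
    using slab_test_norm[of "(z, t)"] by (simp add: power2_eq_square mult_left_le_one_le)
qed

text \<open>F already vanishes outside its slab. Writing the indicator explicitly supplies the
  integrable factor in t that the interchange lemmas ask for.\<close>

lemma wave_transform_indicator:
  "wave_transform F \<zeta> = (LINT t|lborel. of_real (indicator (time_slab \<gamma>) t) * (cnj (schroedinger_phase t \<zeta>) * fhat (\<lambda>z. F (z, t)) \<zeta>))"
  unfolding wave_transform_def
  by (intro Bochner_Integration.integral_cong refl) (auto simp: indicator_def slab_test_fhat_zero)

lemma measurable_wave_transform [measurable]: "wave_transform F \<in> borel_measurable RZ2"
  unfolding wave_transform_def by measurable

lemma integrable_time_slab: "integrable lborel (\<lambda>t. complex_of_real (indicator (time_slab \<gamma>) t))"
  by (intro integrable_of_real integrable_real_indicator) (auto simp: time_slab_def emeasure_lborel_Icc_eq)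

lemma norm_wave_transform_le:
  "norm (wave_transform F \<zeta>) \<le> 2 * pi * (LINT z|cell_measure. indicator {-X..X} (fst z))"
proof -
  define S where "S = (LINT z|cell_measure. indicator {-X..X} (fst z) :: real)"
  have "norm (wave_transform F \<zeta>) \<le> (LINT t|lborel. norm (of_real (indicator (time_slab \<gamma>) t) * (cnj (schroedinger_phase t \<zeta>) * fhat (\<lambda>z. F (z, t)) \<zeta>)))"
    unfolding wave_transform_indicator by (rule integral_norm_bound)
  also have "\<dots> \<le> (LINT t|lborel. indicator (time_slab \<gamma>) t * S)"
  proof (rule integral_mono')
    show "integrable lborel (\<lambda>t. indicator (time_slab \<gamma>) t * S)"
      by (intro integrable_mult_left integrable_real_indicator) (auto simp: time_slab_def emeasure_lborel_Icc_eq)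
    show "norm (of_real (indicator (time_slab \<gamma>) t) * (cnj (schroedinger_phase t \<zeta>) * fhat (\<lambda>z. F (z, t)) \<zeta>)) \<le> indicator (time_slab \<gamma>) t * S" for t
      using slab_test_fhat_bound[of t \<zeta>] by (auto simp: norm_mult indicator_def S_def)
    show "0 \<le> indicator (time_slab \<gamma>) t * S" for t
      unfolding S_def by (intro mult_nonneg_nonneg Bochner_Integration.integral_nonneg) auto
  qed
  also have "\<dots> = measure lborel (time_slab \<gamma>) * S" by simp
  also have "measure lborel (time_slab \<gamma>) = 2 * pi"
    by (simp add: time_slab_def algebra_simps)
  finally show ?thesis by (simp add: S_def)
qed

text \<open>The pairing in space at each fixed time, integrated over the slab; the time integral is
  then moved inside the frequency integral.\<close>

lemma wave_pairing:
  assumes G: "integrable RZ2 G"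
  shows "(LINT t|lborel. of_real (indicator (time_slab \<gamma>) t) *
      (LINT z|cell_measure. F (z, t) * cnj (inv_fourier_integral (\<lambda>\<zeta>. schroedinger_phase t \<zeta> * G \<zeta>) z))) =
    of_real (1 / (2 * pi) ^ 3) * (LINT \<zeta>|RZ2. cnj (G \<zeta>) * wave_transform F \<zeta>)"
proof -
  have [measurable]: "G \<in> borel_measurable RZ2" using G by auto
  define c :: complex where "c = of_real (1 / (2 * pi) ^ 3)"
  define b where "b t = complex_of_real (indicator (time_slab \<gamma>) t)" for t
  have b: "integrable lborel b" unfolding b_def by (rule integrable_time_slab)
  have phase_int: "integrable RZ2 (\<lambda>\<zeta>. schroedinger_phase t \<zeta> * G \<zeta>)" for t
  proof (rule Bochner_Integration.integrable_bound[OF G])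
    have [measurable]: "(\<lambda>\<zeta>. schroedinger_phase t \<zeta>) \<in> borel_measurable RZ2"
      by (intro measurable_schroedinger_phase) auto
    show "(\<lambda>\<zeta>. schroedinger_phase t \<zeta> * G \<zeta>) \<in> borel_measurable RZ2" by measurable
  qed (auto simp: norm_mult)
  have G': "integrable RZ2 (\<lambda>\<zeta>. cnj (G \<zeta>))" using G by simp
  have "(LINT t|lborel. b t * (LINT z|cell_measure. F (z, t) * cnj (inv_fourier_integral (\<lambda>\<zeta>. schroedinger_phase t \<zeta> * G \<zeta>) z)))
    = (LINT t|lborel. c * (LINT \<zeta>|RZ2. cnj (G \<zeta>) * b t * (cnj (schroedinger_phase t \<zeta>) * fhat (\<lambda>z. F (z, t)) \<zeta>)))"
  proof (intro Bochner_Integration.integral_cong refl)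
    fix t
    have "(LINT z|cell_measure. F (z, t) * cnj (inv_fourier_integral (\<lambda>\<zeta>. schroedinger_phase t \<zeta> * G \<zeta>) z))
       = c * (LINT \<zeta>|RZ2. cnj (schroedinger_phase t \<zeta> * G \<zeta>) * fhat (\<lambda>z. F (z, t)) \<zeta>)"
      unfolding c_def by (rule inv_fourier_pairing[OF phase_int slab_test_slice_integrable])
    then have "b t * (LINT z|cell_measure. F (z, t) * cnj (inv_fourier_integral (\<lambda>\<zeta>. schroedinger_phase t \<zeta> * G \<zeta>) z))
       = c * (b t * (LINT \<zeta>|RZ2. cnj (schroedinger_phase t \<zeta> * G \<zeta>) * fhat (\<lambda>z. F (z, t)) \<zeta>))"
      by (simp only: mult_ac)
    also have "b t * (LINT \<zeta>|RZ2. cnj (schroedinger_phase t \<zeta> * G \<zeta>) * fhat (\<lambda>z. F (z, t)) \<zeta>)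
       = (LINT \<zeta>|RZ2. b t * (cnj (schroedinger_phase t \<zeta> * G \<zeta>) * fhat (\<lambda>z. F (z, t)) \<zeta>))"
      by (rule integral_mult_right_zero[symmetric])
    also have "\<dots> = (LINT \<zeta>|RZ2. cnj (G \<zeta>) * b t * (cnj (schroedinger_phase t \<zeta>) * fhat (\<lambda>z. F (z, t)) \<zeta>))"
      by (simp add: mult_ac)
    finally show "b t * (LINT z|cell_measure. F (z, t) * cnj (inv_fourier_integral (\<lambda>\<zeta>. schroedinger_phase t \<zeta> * G \<zeta>) z))
       = c * (LINT \<zeta>|RZ2. cnj (G \<zeta>) * b t * (cnj (schroedinger_phase t \<zeta>) * fhat (\<lambda>z. F (z, t)) \<zeta>))" .
  qed
  also have "\<dots> = c * (LINT t|lborel. LINT \<zeta>|RZ2. cnj (G \<zeta>) * b t * (cnj (schroedinger_phase t \<zeta>) * fhat (\<lambda>z. F (z, t)) \<zeta>))"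
    by (rule integral_mult_right_zero)
  also have "(LINT t|lborel. LINT \<zeta>|RZ2. cnj (G \<zeta>) * b t * (cnj (schroedinger_phase t \<zeta>) * fhat (\<lambda>z. F (z, t)) \<zeta>))
    = (LINT \<zeta>|RZ2. LINT t|lborel. cnj (G \<zeta>) * b t * (cnj (schroedinger_phase t \<zeta>) * fhat (\<lambda>z. F (z, t)) \<zeta>))"
    by (rule RZ2_time.swap_integrals_bounded[OF G' b, where C="LINT z|cell_measure. indicator {-X..X} (fst z)", symmetric])
      (measurable, simp add: norm_mult slab_test_fhat_bound)
  also have "\<dots> = (LINT \<zeta>|RZ2. cnj (G \<zeta>) * wave_transform F \<zeta>)"
    unfolding wave_transform_indicator b_def[symmetric] by (simp only: mult.assoc integral_mult_right_zero)
  finally show ?thesis by (simp only: b_def c_def)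
qed

end

text \<open>The weight is bounded below on the band, so it can be inserted into Cauchy-Schwarz at the cost
  of a constant, and it turns the \<open>\<xi>\<close>-integral of the kernel into \<open>gauss_kernel\<close>.\<close>

definition band_weight :: "int \<Rightarrow> real \<times> int \<times> int \<Rightarrow> real" where
  "band_weight M \<zeta> = exp (- (fst \<zeta>)\<^sup>2 / (2 * (real_of_int M)\<^sup>2)) * indicator (int_box M) (snd \<zeta>)"

lemma band_weight_nonneg: "band_weight M \<zeta> \<ge> 0"
  by (simp add: band_weight_def)

lemma band_weight_le_1: "band_weight M \<zeta> \<le> 1"
  unfolding band_weight_def by (intro mult_le_one) (auto simp: indicator_def)

lemma band_weight_ge:
  assumes "M \<ge> 1" "\<zeta> \<in> band (real_of_int M) (int_box M)"
  shows "band_weight M \<zeta> \<ge> exp (- 1 / 2)"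
proof -
  have "\<bar>fst \<zeta>\<bar> \<le> real_of_int M" using assms by (simp add: band_def)
  then have "(fst \<zeta>)\<^sup>2 \<le> (real_of_int M)\<^sup>2" using power_mono[of "\<bar>fst \<zeta>\<bar>" "real_of_int M" 2] by simp
  then have "(fst \<zeta>)\<^sup>2 / (2 * (real_of_int M)\<^sup>2) \<le> 1 / 2" using assms by (simp add: field_simps)
  then show ?thesis using assms by (simp add: band_weight_def band_def)
qed

text \<open>The weighted phase is a tensor product, so its kernel is a truncated Schroedinger kernel
  in x times one Weyl sum per periodic variable. Each factor is bounded uniformly in position,
  leaving a function of \<tau> alone.\<close>

lemma band_multiplier_kernel:
  assumes M: "M \<ge> 1"
  shows "integrable RZ2 (\<lambda>\<zeta>. of_real (band_weight M \<zeta>) * schroedinger_phase \<tau> \<zeta>)"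
    and "norm (multiplier_kernel (\<lambda>\<zeta>. of_real (band_weight M \<zeta>) * schroedinger_phase \<tau> \<zeta>) u) \<le> kernel_bound M \<tau>"
proof -
  define \<sigma> where "\<sigma> = real_of_int M"
  have \<sigma>: "\<sigma> > 0" using M by (simp add: \<sigma>_def)
  define a where "a \<xi> = of_real (exp (- \<xi>\<^sup>2 / (2 * \<sigma>\<^sup>2))) * cis (- \<tau> * \<xi>\<^sup>2)" for \<xi>
  define c where "c k = of_real (indicator {-M..M} k) * cis (- \<tau> * (real_of_int k)\<^sup>2)" for k
  have "integrable lborel (\<lambda>\<xi>. exp (- (1 / (2 * \<sigma>\<^sup>2)) * \<xi>\<^sup>2))"
    using \<sigma> by (intro integrable_gauss) auto
  then have "integrable lborel (\<lambda>\<xi>. exp (- \<xi>\<^sup>2 / (2 * \<sigma>\<^sup>2)))" by simp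
  then have a: "integrable lborel a"
  proof (rule Bochner_Integration.integrable_bound)
    show "a \<in> borel_measurable lborel" unfolding a_def by measurable
  qed (simp add: a_def norm_mult)
  have eq: "(\<lambda>\<zeta>. of_real (band_weight M \<zeta>) * schroedinger_phase \<tau> \<zeta>) = (\<lambda>\<zeta>. a (fst \<zeta>) * (c (fst (snd \<zeta>)) * c (snd (snd \<zeta>))))"
  proof
    fix \<zeta> :: "real \<times> int \<times> int"
    have "schroedinger_phase \<tau> \<zeta> = cis (- \<tau> * (fst \<zeta>)\<^sup>2) * (cis (- \<tau> * (real_of_int (fst (snd \<zeta>)))\<^sup>2) * cis (- \<tau> * (real_of_int (snd (snd \<zeta>)))\<^sup>2))"
      unfolding schroedinger_phase_def cis_mult by (simp add: algebra_simps)
    moreover have "indicator (int_box M) (snd \<zeta>) = (indicator {-M..M} (fst (snd \<zeta>)) * indicator {-M..M} (snd (snd \<zeta>)) :: real)"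
      by (cases \<zeta>) (auto simp: int_box_def indicator_def)
    ultimately show "of_real (band_weight M \<zeta>) * schroedinger_phase \<tau> \<zeta> = a (fst \<zeta>) * (c (fst (snd \<zeta>)) * c (snd (snd \<zeta>)))"
      by (simp add: band_weight_def a_def c_def \<sigma>_def)
  qed
  have c0: "c k = 0" if "k \<notin> {-M..M}" for k using that by (simp add: c_def)
  note P = multiplier_kernel_product[OF a, of "{-M..M}" c c, OF _ c0 c0]
  show "integrable RZ2 (\<lambda>\<zeta>. of_real (band_weight M \<zeta>) * schroedinger_phase \<tau> \<zeta>)"
    unfolding eq by (rule P(1)) auto
  have g: "(LINT \<xi>|lborel. a \<xi> * cis (\<xi> * x)) = gauss_kernel \<sigma> \<tau> x" for x
    unfolding gauss_kernel_def a_def mult.assoc cis_mult by (simp add: algebra_simps)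
  have w: "(\<Sum>k\<in>{-M..M}. c k * cis (real_of_int k * y)) = weyl_sum M \<tau> y" for y
    unfolding weyl_sum_def c_def mult.assoc cis_mult by (intro sum.cong refl) (simp add: algebra_simps)
  have "multiplier_kernel (\<lambda>\<zeta>. of_real (band_weight M \<zeta>) * schroedinger_phase \<tau> \<zeta>) u =
      gauss_kernel \<sigma> \<tau> (fst u) * (weyl_sum M \<tau> (fst (snd u)) * weyl_sum M \<tau> (snd (snd u)))"
    unfolding eq g[symmetric] w[symmetric] by (rule P(2)) auto
  moreover have "norm (gauss_kernel \<sigma> \<tau> x) \<le> sqrt (pi / sqrt (1 / (4 * \<sigma> ^ 4) + \<tau>\<^sup>2))" for x
    by (rule real_le_rsqrt) (rule norm_gauss_kernel[OF \<sigma>])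
  moreover have W: "norm (weyl_sum M \<tau> y) \<le> sqrt (weyl_bound M \<tau>)" for y
    by (rule real_le_rsqrt) (use norm_weyl_sum M in auto)
  ultimately have "norm (multiplier_kernel (\<lambda>\<zeta>. of_real (band_weight M \<zeta>) * schroedinger_phase \<tau> \<zeta>) u) \<le>
     sqrt (pi / sqrt (1 / (4 * \<sigma> ^ 4) + \<tau>\<^sup>2)) * (sqrt (weyl_bound M \<tau>) * sqrt (weyl_bound M \<tau>))"
    using weyl_bound_pos[of M \<tau>] M by (simp only: norm_mult) (intro mult_mono mult_nonneg_nonneg, auto)
  also have "sqrt (weyl_bound M \<tau>) * sqrt (weyl_bound M \<tau>) = weyl_bound M \<tau>"
    using weyl_bound_pos[of M \<tau>] M by simp
  finally show "norm (multiplier_kernel (\<lambda>\<zeta>. of_real (band_weight M \<zeta>) * schroedinger_phase \<tau> \<zeta>) u) \<le> kernel_bound M \<tau>"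
    by (simp add: kernel_bound_def \<sigma>_def)
qed

lemma integrable_band_weight:
  assumes "M \<ge> 1"
  shows "integrable RZ2 (\<lambda>\<zeta>. complex_of_real (band_weight M \<zeta>))"
  using band_multiplier_kernel(1)[OF assms, of 0] by (simp add: schroedinger_phase_def)

lemma measurable_band_weight [measurable]: "band_weight M \<in> borel_measurable RZ2"
proof -
  have [measurable]: "(\<lambda>\<zeta>. indicat_real (int_box M) (snd \<zeta>)) \<in> borel_measurable RZ2"
    by (rule measurable_RZ2_components(2))
  show ?thesis unfolding band_weight_def by measurable
qed

context
  fixes \<gamma> \<gamma>' :: int and X :: real and F F' and M :: int
  assumes F: "slab_test \<gamma> X F" and F': "slab_test \<gamma>' X F'" and M: "M \<ge> 1"
begin

text \<open>The frequency pairing of the slices at t and t' after each has been moved back to time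
  0. The two phases combine into one that depends only on t' - t.\<close>

definition time_correlation :: "real \<Rightarrow> real \<Rightarrow> complex" where
  "time_correlation t t' = (LINT \<zeta>|RZ2. of_real (band_weight M \<zeta>) * (cnj (schroedinger_phase t \<zeta>) * fhat (\<lambda>z. F (z, t)) \<zeta> *
     cnj (cnj (schroedinger_phase t' \<zeta>) * fhat (\<lambda>z. F' (z, t')) \<zeta>)))"

lemma time_correlation_eq:
  "time_correlation t t' = (LINT \<zeta>|RZ2. (of_real (band_weight M \<zeta>) * schroedinger_phase (t' - t) \<zeta>) * fhat (\<lambda>z. F (z, t)) \<zeta> * cnj (fhat (\<lambda>z. F' (z, t')) \<zeta>))"
proof -
  have "cnj (schroedinger_phase t \<zeta>) * schroedinger_phase t' \<zeta> = schroedinger_phase (t' - t) \<zeta>" for \<zeta>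
    unfolding schroedinger_phase_def cis_cnj cis_mult by (simp add: algebra_simps)
  then show ?thesis
    unfolding time_correlation_def by (intro Bochner_Integration.integral_cong refl) (simp add: mult_ac flip: \<open>\<And>\<zeta>. _ = schroedinger_phase (t' - t) \<zeta>\<close>)
qed

text \<open>The kernel bound is uniform in the space variables, so it comes out of the double
  integral and leaves the product of the L1 norms of the slices.\<close>

lemma time_correlation_dispersive:
  "ennreal (norm (time_correlation t t')) \<le> ennreal (kernel_bound M (t' - t)) * (slice_mass F t * slice_mass F' t')"
proof -
  note Fs = slab_test_slice_integrable[OF F] and Fs' = slab_test_slice_integrable[OF F']
  have [measurable]: "F \<in> borel_measurable borel" "F' \<in> borel_measurable borel"
    using slab_test_measurable[OF F] slab_test_measurable[OF F'] by auto
  define k where "k = kernel_bound M (t' - t)"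
  have "ennreal (norm (time_correlation t t')) \<le>
    (\<integral>\<^sup>+z. \<integral>\<^sup>+w. ennreal (norm (F (z, t)) * norm (F' (w, t')) * norm (multiplier_kernel (\<lambda>\<zeta>. of_real (band_weight M \<zeta>) * schroedinger_phase (t' - t) \<zeta>) (w - z))) \<partial>cell_measure \<partial>cell_measure)"
    unfolding time_correlation_eq by (rule norm_bilinear_le[OF band_multiplier_kernel(1)[OF M] Fs Fs'])
  also have "\<dots> \<le> (\<integral>\<^sup>+z. \<integral>\<^sup>+w. (ennreal k * ennreal (norm (F (z, t)))) * ennreal (norm (F' (w, t'))) \<partial>cell_measure \<partial>cell_measure)"
  proof (intro nn_integral_mono)
    fix z w
    have "norm (F (z, t)) * norm (F' (w, t')) * norm (multiplier_kernel (\<lambda>\<zeta>. of_real (band_weight M \<zeta>) * schroedinger_phase (t' - t) \<zeta>) (w - z))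
      \<le> norm (F (z, t)) * norm (F' (w, t')) * k"
      unfolding k_def by (intro mult_left_mono band_multiplier_kernel(2) M) auto
    then have "ennreal (norm (F (z, t)) * norm (F' (w, t')) * norm (multiplier_kernel (\<lambda>\<zeta>. of_real (band_weight M \<zeta>) * schroedinger_phase (t' - t) \<zeta>) (w - z)))
      \<le> ennreal (k * norm (F (z, t)) * norm (F' (w, t')))"
      by (intro ennreal_leI) (simp add: mult_ac)
    also have "\<dots> = (ennreal k * ennreal (norm (F (z, t)))) * ennreal (norm (F' (w, t')))"
      using kernel_bound_pos[OF M, of "t' - t"] by (simp add: ennreal_mult k_def)
    finally show "ennreal (norm (F (z, t)) * norm (F' (w, t')) * norm (multiplier_kernel (\<lambda>\<zeta>. of_real (band_weight M \<zeta>) * schroedinger_phase (t' - t) \<zeta>) (w - z)))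
      \<le> (ennreal k * ennreal (norm (F (z, t)))) * ennreal (norm (F' (w, t')))" .
  qed
  also have "\<dots> = ennreal k * (slice_mass F t * slice_mass F' t')"
    unfolding slice_mass_def by (simp add: nn_integral_cmult nn_integral_multc mult.assoc)
  finally show ?thesis by (simp add: k_def)
qed

text \<open>Cauchy-Schwarz in frequency and Bessel's inequality for each slice. The weight and the
  phase have modulus at most 1, so no decay in t' - t is obtained; the gain is a square root of the
  masses instead of their product.\<close>

lemma time_correlation_energy:
  "(ennreal (norm (time_correlation t t')))\<^sup>2 \<le> (ennreal ((2 * pi) ^ 3))\<^sup>2 * (slice_mass F t * slice_mass F' t')"
proof -
  define K where "K = ennreal ((2 * pi) ^ 3)"
  note Fs = slab_test_slice_integrable[OF F, of t] and Fs' = slab_test_slice_integrable[OF F', of t']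
  have [measurable]: "(\<lambda>z. F (z, t)) \<in> borel_measurable borel" "(\<lambda>z. F' (z, t')) \<in> borel_measurable borel"
    using measurable_slice[OF slab_test_measurable[OF F]] measurable_slice[OF slab_test_measurable[OF F']] by auto
  have [measurable]: "(\<lambda>\<zeta>. schroedinger_phase (t' - t) \<zeta>) \<in> borel_measurable RZ2"
    by (intro measurable_schroedinger_phase) auto
  have "(ennreal (norm (time_correlation t t')))\<^sup>2 \<le>
     sqnorm RZ2 (\<lambda>\<zeta>. (of_real (band_weight M \<zeta>) * schroedinger_phase (t' - t) \<zeta>) * fhat (\<lambda>z. F (z, t)) \<zeta>) * sqnorm RZ2 (\<lambda>\<zeta>. cnj (fhat (\<lambda>z. F' (z, t')) \<zeta>))"
    unfolding time_correlation_eq by (rule norm_integral_cauchy_schwarz) measurable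
  also have "\<dots> \<le> sqnorm RZ2 (fhat (\<lambda>z. F (z, t))) * sqnorm RZ2 (fhat (\<lambda>z. F' (z, t')))"
    using band_weight_le_1[of M] band_weight_nonneg[of M]
    by (intro mult_mono sqnorm_mono) (auto simp: norm_mult mult_left_le_one_le)
  also have "\<dots> \<le> (K * slice_mass F t) * (K * slice_mass F' t')"
    unfolding K_def
    by (intro mult_mono order_trans[OF bessel_inequality[OF Fs]] order_trans[OF bessel_inequality[OF Fs']]
        mult_left_mono sqnorm_slice_le[OF F] sqnorm_slice_le[OF F']) auto
  finally show ?thesis by (simp add: K_def power2_eq_square mult_ac)
qed

text \<open>The splitting at the level \<open>H\<close> of the kernel bound: small kernel values are treated by the
  dispersive estimate, the times where the kernel is large by the energy estimate.\<close>

lemma wave_bilinear_split: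
  fixes H h :: real
  defines "A \<equiv> {\<tau>. \<bar>\<tau> - 2 * pi * real_of_int (\<gamma>' - \<gamma>)\<bar> \<le> 2 * pi \<and> kernel_bound M \<tau> > H}"
  assumes H: "H \<ge> 0" and h: "h > 0"
  shows "ennreal (norm (LINT \<zeta>|RZ2. of_real (band_weight M \<zeta>) * wave_transform F \<zeta> * cnj (wave_transform F' \<zeta>))) \<le>
    ennreal H * (mass F * mass F') + ennreal ((2 * pi) ^ 3 / 2) * (ennreal h * mass F + ennreal (1 / h) * mass F') * emeasure lborel A"
proof -
  have [measurable]: "F \<in> borel_measurable borel" "F' \<in> borel_measurable borel"
    using slab_test_measurable[OF F] slab_test_measurable[OF F'] by auto
  have [measurable]: "A \<in> sets borel" unfolding A_def by measurable
  define K where "K = (2 * pi) ^ 3 / 2"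
  have K0: "K \<ge> 0" by (simp add: K_def)
  define C where "C = (LINT z|cell_measure. indicator {-X..X} (fst z) :: real)"
  define m m' where "m t = slice_mass F t" and "m' t = slice_mass F' t" for t
  have [measurable]: "m \<in> borel_measurable borel" "m' \<in> borel_measurable borel"
    unfolding m_def m'_def by measurable
  have pt: "ennreal (norm (complex_of_real (indicator (time_slab \<gamma>) t)) * norm (complex_of_real (indicator (time_slab \<gamma>') t')) * norm (time_correlation t t'))
     \<le> ennreal H * m t * m' t' + (ennreal (K * h) * m t * indicator A (t' - t) + ennreal (K * (1 / h)) * m' t' * indicator A (t' - t))" for t t'
  proof (cases "t \<in> time_slab \<gamma> \<and> t' \<in> time_slab \<gamma>'")
    case True
    \<comment> \<open>Both times range over intervals of length 2 pi, so their difference stays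
      within 2 pi of 2 pi (\<gamma>' - \<gamma>).\<close>
    then have win: "\<bar>(t' - t) - 2 * pi * real_of_int (\<gamma>' - \<gamma>)\<bar> \<le> 2 * pi"
      by (auto simp: time_slab_def abs_le_iff algebra_simps)
    define j where "j = norm (time_correlation t t')"
    obtain a where a: "m t = ennreal a" "a \<ge> 0" unfolding m_def slice_mass_eq[OF F] by (auto intro: Bochner_Integration.integral_nonneg)
    obtain a' where a': "m' t' = ennreal a'" "a' \<ge> 0" unfolding m'_def slice_mass_eq[OF F'] by (auto intro: Bochner_Integration.integral_nonneg)
    have "ennreal j \<le> ennreal H * m t * m' t' + (ennreal (K * h) * m t * indicator A (t' - t) + ennreal (K * (1 / h)) * m' t' * indicator A (t' - t))"
    proof (cases "kernel_bound M (t' - t) > H")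
      case False
      have "ennreal j \<le> ennreal (kernel_bound M (t' - t)) * (m t * m' t')"
        unfolding j_def m_def m'_def by (rule time_correlation_dispersive)
      also have "\<dots> \<le> ennreal H * (m t * m' t')"
        using False by (intro mult_right_mono ennreal_leI) auto
      finally show ?thesis by (simp add: mult.assoc add_increasing2)
    next
      case True
      then have inA: "t' - t \<in> A" using win by (simp add: A_def)
      have "(ennreal j)\<^sup>2 \<le> (ennreal (2 * K))\<^sup>2 * (m t * m' t')"
        using time_correlation_energy[of t t'] by (simp add: j_def m_def m'_def K_def)
      then have "ennreal (j\<^sup>2) \<le> ennreal ((2 * K)\<^sup>2 * (a * a'))"
        unfolding a a' using a(2) a'(2) K0 by (simp add: ennreal_power ennreal_mult j_def)
      then have "j\<^sup>2 \<le> (2 * K)\<^sup>2 * (a * a')"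
        using a(2) a'(2) K0 by (subst (asm) ennreal_le_iff) auto
      \<comment> \<open>The geometric mean of the two masses is replaced by a weighted arithmetic
        mean. Each summand then depends on one time only, so the other time integrates the indicator
        of a translate or reflection of A freely and yields its measure.\<close>
      also have "\<dots> \<le> (K * (h * a + 1 / h * a'))\<^sup>2"
      proof -
        have "4 * x * y \<le> (x + y)\<^sup>2" for x y :: real
          using sum_squares_bound[of x y] by (simp add: power2_sum)
        from this[of "h * a" "1 / h * a'"]
        have "4 * (h * a) * (1 / h * a') \<le> (h * a + 1 / h * a')\<^sup>2" .
        moreover have "4 * (h * a) * (1 / h * a') = 4 * (a * a')" using h by simp
        ultimately have "4 * (a * a') \<le> (h * a + 1 / h * a')\<^sup>2" by (simp only:)
        then have "K\<^sup>2 * (4 * (a * a')) \<le> K\<^sup>2 * (h * a + 1 / h * a')\<^sup>2" by (intro mult_left_mono) auto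
        then show ?thesis by (simp add: power_mult_distrib)
      qed
      finally have "j \<le> K * (h * a + 1 / h * a')"
      proof (rule power2_le_imp_le)
        show "0 \<le> K * (h * a + 1 / h * a')"
          using K0 h a(2) a'(2) by (intro mult_nonneg_nonneg add_nonneg_nonneg) auto
      qed
      then have "ennreal j \<le> ennreal (K * h * a + K * (1 / h) * a')"
        by (intro ennreal_leI) (simp add: algebra_simps)
      also have "\<dots> = ennreal (K * h) * m t * indicator A (t' - t) + ennreal (K * (1 / h)) * m' t' * indicator A (t' - t)"
        unfolding a a' using inA K0 h a(2) a'(2) by (simp add: ennreal_mult'[symmetric] ennreal_plus[symmetric] del: ennreal_plus)
      finally show ?thesis by (rule order_trans) (simp add: add_increasing)
    qed
    then show ?thesis using True by (simp add: j_def)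
  qed auto
  have meas: "case_prod (\<lambda>\<zeta> t. cnj (schroedinger_phase t \<zeta>) * fhat (\<lambda>z. F (z, t)) \<zeta>) \<in> borel_measurable (RZ2 \<Otimes>\<^sub>M lborel)"
    "case_prod (\<lambda>\<zeta> t. cnj (schroedinger_phase t \<zeta>) * fhat (\<lambda>z. F' (z, t)) \<zeta>) \<in> borel_measurable (RZ2 \<Otimes>\<^sub>M lborel)"
    using slab_test_fhat_measurable[OF F] slab_test_fhat_measurable[OF F'] by measurable
  have "ennreal (norm (LINT \<zeta>|RZ2. of_real (band_weight M \<zeta>) * wave_transform F \<zeta> * cnj (wave_transform F' \<zeta>))) \<le>
    (\<integral>\<^sup>+t. \<integral>\<^sup>+t'. ennreal (norm (complex_of_real (indicator (time_slab \<gamma>) t)) * norm (complex_of_real (indicator (time_slab \<gamma>') t')) * norm (time_correlation t t')) \<partial>lborel \<partial>lborel)"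
    unfolding wave_transform_indicator[OF F] wave_transform_indicator[OF F'] time_correlation_def
    by (rule RZ2_time.norm_double_integral_le[OF integrable_band_weight[OF M] integrable_time_slab[OF F] integrable_time_slab[OF F'] meas(1) _ meas(2), where C=C])
      (use slab_test_fhat_bound[OF F] slab_test_fhat_bound[OF F'] in \<open>auto simp: norm_mult C_def\<close>)
  also have "\<dots> \<le> (\<integral>\<^sup>+t. \<integral>\<^sup>+t'. ennreal H * m t * m' t' + (ennreal (K * h) * m t * indicator A (t' - t) + ennreal (K * (1 / h)) * m' t' * indicator A (t' - t)) \<partial>lborel \<partial>lborel)"
    by (intro nn_integral_mono pt)
  also have "\<dots> = (\<integral>\<^sup>+t. \<integral>\<^sup>+t'. ennreal H * m t * m' t' \<partial>lborel \<partial>lborel) +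
     ((\<integral>\<^sup>+t. \<integral>\<^sup>+t'. ennreal (K * h) * m t * indicator A (t' - t) \<partial>lborel \<partial>lborel) +
      (\<integral>\<^sup>+t. \<integral>\<^sup>+t'. ennreal (K * (1 / h)) * m' t' * indicator A (t' - t) \<partial>lborel \<partial>lborel))"
    by (simp add: nn_integral_add)
  also have "(\<integral>\<^sup>+t. \<integral>\<^sup>+t'. ennreal H * m t * m' t' \<partial>lborel \<partial>lborel) = ennreal H * (mass F * mass F')"
    by (simp add: nn_integral_cmult nn_integral_multc mass_def m_def m'_def mult.assoc)
  also have "(\<integral>\<^sup>+t. \<integral>\<^sup>+t'. ennreal (K * h) * m t * indicator A (t' - t) \<partial>lborel \<partial>lborel) = ennreal (K * h) * mass F * emeasure lborel A"
  proof -
    have "(\<integral>\<^sup>+t'. indicator A (t' - t) \<partial>lborel) = emeasure lborel A" for t :: real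
      by (subst nn_integral_real_affine[where c=1 and t=t]) auto
    then show ?thesis by (simp add: nn_integral_cmult nn_integral_multc mass_def m_def)
  qed
  also have "(\<integral>\<^sup>+t. \<integral>\<^sup>+t'. ennreal (K * (1 / h)) * m' t' * indicator A (t' - t) \<partial>lborel \<partial>lborel)
     = (\<integral>\<^sup>+t'. \<integral>\<^sup>+t. ennreal (K * (1 / h)) * m' t' * indicator A (t' - t) \<partial>lborel \<partial>lborel)"
    by (rule lborel_pair.Fubini') measurable
  also have "\<dots> = ennreal (K * (1 / h)) * mass F' * emeasure lborel A"
  proof -
    have "(\<integral>\<^sup>+t. indicator A (t' - t) \<partial>lborel) = emeasure lborel A" for t' :: real
      by (subst nn_integral_real_affine[where c="-1" and t=t']) auto
    then show ?thesis by (simp add: nn_integral_cmult nn_integral_multc mass_def m'_def)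
  qed
  also have "ennreal (K * h) * mass F * emeasure lborel A + ennreal (K * (1 / h)) * mass F' * emeasure lborel A
    = ennreal K * (ennreal h * mass F + ennreal (1 / h) * mass F') * emeasure lborel A"
    using K0 h by (simp only: ennreal_mult less_imp_le zero_le_divide_1_iff distrib_left distrib_right mult.assoc)
  finally show ?thesis by (simp only: K_def)
qed

end

definition wave_form :: "int \<Rightarrow> ((real \<times> real \<times> real) \<times> real \<Rightarrow> complex) \<Rightarrow> ((real \<times> real \<times> real) \<times> real \<Rightarrow> complex) \<Rightarrow> complex" where
  "wave_form M F F' = (LINT \<zeta>|RZ2. of_real (band_weight M \<zeta>) * wave_transform F \<zeta> * cnj (wave_transform F' \<zeta>))"

text \<open>With h = sqrt (e'/e) the two summands of the arithmetic mean, integrated in time, both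
  become sqrt (e e'), so the linearisation loses nothing.\<close>

lemma wave_form_balanced:
  assumes F: "slab_test \<gamma> X F" and F': "slab_test \<gamma>' X F'" and M: "M \<ge> 1"
    and pos: "mass F = ennreal e" "mass F' = ennreal e'" "e > 0" "e' > 0" and H: "H \<ge> 0" and \<mu>: "\<mu> \<ge> 0"
    and A: "emeasure lborel {\<tau>. \<bar>\<tau> - 2 * pi * real_of_int (\<gamma>' - \<gamma>)\<bar> \<le> 2 * pi \<and> kernel_bound M \<tau> > H} \<le> ennreal \<mu>"
  shows "norm (wave_form M F F') \<le> H * (e * e') + (2 * pi) ^ 3 * \<mu> * sqrt (e * e')"
proof -
  define h where "h = sqrt (e' / e)"
  have h: "h > 0" using pos by (simp add: h_def)
  define K where "K = (2 * pi) ^ 3 / 2"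
  have K0: "K \<ge> 0" by (simp add: K_def)
  have he: "h * e = sqrt (e * e')"
  proof -
    have "h * e = sqrt (e' / e) * sqrt (e\<^sup>2)" using pos by (simp add: h_def)
    also have "\<dots> = sqrt (e' / e * e\<^sup>2)" by (simp only: real_sqrt_mult)
    also have "e' / e * e\<^sup>2 = e * e'" using pos by (simp add: power2_eq_square)
    finally show ?thesis .
  qed
  have he': "1 / h * e' = sqrt (e * e')"
  proof -
    have "1 / h = sqrt (e / e')" by (simp add: h_def real_sqrt_divide)
    then have "1 / h * e' = sqrt (e / e') * sqrt (e'\<^sup>2)" using pos by simp
    also have "\<dots> = sqrt (e / e' * e'\<^sup>2)" by (simp only: real_sqrt_mult)
    also have "e / e' * e'\<^sup>2 = e * e'" using pos by (simp add: power2_eq_square)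
    finally show ?thesis .
  qed
  have "ennreal (norm (wave_form M F F')) \<le> ennreal H * (mass F * mass F') + ennreal K * (ennreal h * mass F + ennreal (1 / h) * mass F') *
      emeasure lborel {\<tau>. \<bar>\<tau> - 2 * pi * real_of_int (\<gamma>' - \<gamma>)\<bar> \<le> 2 * pi \<and> kernel_bound M \<tau> > H}"
    unfolding wave_form_def K_def by (rule wave_bilinear_split[OF F F' M H h])
  also have "\<dots> \<le> ennreal H * (mass F * mass F') + ennreal K * (ennreal h * mass F + ennreal (1 / h) * mass F') * ennreal \<mu>"
    by (intro add_left_mono mult_left_mono A) auto
  also have "\<dots> = ennreal (H * (e * e') + K * (h * e + 1 / h * e') * \<mu>)"
    unfolding pos(1,2) using H h K0 \<mu> pos(3,4)
    by (simp only: ennreal_mult[symmetric] ennreal_plus[symmetric] less_imp_le mult_nonneg_nonneg add_nonneg_nonneg zero_le_divide_1_iff)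
  finally have "norm (wave_form M F F') \<le> H * (e * e') + K * (h * e + 1 / h * e') * \<mu>"
    using H h K0 \<mu> pos(3,4) by (subst (asm) ennreal_le_iff) (auto intro!: add_nonneg_nonneg mult_nonneg_nonneg)
  also have "\<dots> = H * (e * e') + (2 * pi) ^ 3 * \<mu> * sqrt (e * e')"
    unfolding he he' K_def by simp
  finally show ?thesis .
qed

text \<open>\<open>\<iota>\<close> is the reciprocal of the weak-type exponent, 0 standing for the
  supremum. The decay exponent 1/2 - \<iota> is the number 2/q of the admissibility relation, which
  is what the discrete Hardy-Littlewood-Sobolev inequality expects.\<close>

lemma wave_form_bound:
  fixes \<iota> :: real
  assumes \<iota>: "\<iota> = 0 \<or> (1 / 6 < \<iota> \<and> \<iota> < 1 / 4)"
  obtains C where "C > 0" "\<And>\<gamma> \<gamma>' X F F' M e e'. slab_test \<gamma> X F \<Longrightarrow> slab_test \<gamma>' X F' \<Longrightarrow> M \<ge> 1 \<Longrightarrow>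
    mass F = ennreal e \<Longrightarrow> mass F' = ennreal e' \<Longrightarrow> e > 0 \<Longrightarrow> e' > 0 \<Longrightarrow>
    norm (wave_form M F F') \<le> C * real_of_int M powr (3 - 10 * \<iota>) * (1 + \<bar>real_of_int (\<gamma>' - \<gamma>)\<bar>) powr (- (1 / 2 - \<iota>)) * (e * e') powr (1 - \<iota>)"
proof (cases "\<iota> = 0")
  case True
  obtain C where C: "C > 0" and sup: "\<And>M n \<tau>. M \<ge> 1 \<Longrightarrow> \<bar>\<tau> - 2 * pi * real_of_int n\<bar> \<le> 2 * pi \<Longrightarrow>
    kernel_bound M \<tau> \<le> C * real_of_int M powr 3 * (1 + \<bar>real_of_int n\<bar>) powr (- (1 / 2))"
    using kernel_bound_sup by blast
  show ?thesis
  proof (rule that[OF C])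
    fix \<gamma> \<gamma>' :: int and X F F' and M :: int and e e' :: real
    assume F: "slab_test \<gamma> X F" and F': "slab_test \<gamma>' X F'" and M: "M \<ge> 1"
      and pos: "mass F = ennreal e" "mass F' = ennreal e'" "e > 0" "e' > 0"
    define H where "H = C * real_of_int M powr 3 * (1 + \<bar>real_of_int (\<gamma>' - \<gamma>)\<bar>) powr (- (1 / 2))"
    have H: "H \<ge> 0" using C by (simp add: H_def)
    \<comment> \<open>Here H is the supremum of the kernel majorant over the window, so there are no
      exceptional times and the dispersive term stands alone.\<close>
    have A: "{\<tau>. \<bar>\<tau> - 2 * pi * real_of_int (\<gamma>' - \<gamma>)\<bar> \<le> 2 * pi \<and> kernel_bound M \<tau> > H} = {}"
      using sup[OF M, of _ "\<gamma>' - \<gamma>"] unfolding H_def by (auto simp: not_less)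
    have "norm (wave_form M F F') \<le> H * (e * e') + (2 * pi) ^ 3 * 0 * sqrt (e * e')"
      by (rule wave_form_balanced[OF F F' M pos H]) (simp_all only: A emeasure_empty order_refl zero_le)
    then show "norm (wave_form M F F') \<le> C * real_of_int M powr (3 - 10 * \<iota>) * (1 + \<bar>real_of_int (\<gamma>' - \<gamma>)\<bar>) powr (- (1 / 2 - \<iota>)) * (e * e') powr (1 - \<iota>)"
      using True pos by (simp add: H_def)
  qed
next
  case False
  with \<iota> have \<iota>: "1 / 6 < \<iota>" "\<iota> < 1 / 4" by auto
  \<comment> \<open>Chosen so that 1/(1 + r) = 2 \<iota>; the conditions 1/6 < \<iota> < 1/4 are
    then 1 < r < 2.\<close>
  define r where "r = 1 / (2 * \<iota>) - 1"
  have r: "1 < r" "r < 2" using \<iota> by (auto simp: r_def field_simps)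
  obtain C where C: "C > 0" and lev: "\<And>M n H. M \<ge> 1 \<Longrightarrow> H > 0 \<Longrightarrow>
    emeasure lborel {\<tau>. \<bar>\<tau> - 2 * pi * real_of_int n\<bar> \<le> 2 * pi \<and> kernel_bound M \<tau> > H}
      \<le> ennreal (C * real_of_int M powr (3 * r - 2) * (1 + \<bar>real_of_int n\<bar>) powr (- (r / 2)) * H powr (- r))"
    using emeasure_kernel_bound_gt[OF r] by blast
  define C' where "C' = (1 + (2 * pi) ^ 3) * C powr (2 * \<iota>)"
  have C': "C' > 0" unfolding C'_def using C by (intro mult_pos_pos add_pos_nonneg) auto
  show ?thesis
  proof (rule that[OF C'])
    fix \<gamma> \<gamma>' :: int and X F F' and M :: int and e e' :: real
    assume F: "slab_test \<gamma> X F" and F': "slab_test \<gamma>' X F'" and M: "M \<ge> 1"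
      and pos: "mass F = ennreal e" "mass F' = ennreal e'" "e > 0" "e' > 0"
    define n1 where "n1 = 1 + \<bar>real_of_int (\<gamma>' - \<gamma>)\<bar>"
    have n1: "n1 > 0" by (simp add: n1_def add_pos_nonneg)
    define D where "D = C * real_of_int M powr (3 * r - 2) * n1 powr (- (r / 2))"
    have D: "D > 0" using C M n1 by (simp add: D_def)
    define P where "P = e * e'"
    have P: "P > 0" using pos by (simp add: P_def)
    \<comment> \<open>The level at which the two contributions agree: H * P = D * H powr (- r) *
      sqrt P. Both then equal D powr (2 \<iota>) * P powr (1 - \<iota>).\<close>
    define H where "H = (D * P powr (- (1 / 2))) powr (2 * \<iota>)"
    have H: "H > 0" using D P by (simp add: H_def)
    have "norm (wave_form M F F') \<le> H * (e * e') + (2 * pi) ^ 3 * (D * H powr (- r)) * sqrt (e * e')"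
      by (rule wave_form_balanced[OF F F' M pos]) (use H D lev[OF M H, of "\<gamma>' - \<gamma>"] in \<open>auto simp: D_def n1_def\<close>)
    also have "H * (e * e') = D powr (2 * \<iota>) * P powr (1 - \<iota>)"
    proof -
      have "H = D powr (2 * \<iota>) * P powr (- \<iota>)" using D P by (simp add: H_def powr_mult powr_powr)
      then have "H * P = D powr (2 * \<iota>) * (P powr (- \<iota>) * P powr 1)" using P by simp
      also have "P powr (- \<iota>) * P powr 1 = P powr (1 - \<iota>)" by (subst powr_add[symmetric]) simp
      finally show ?thesis by (simp add: P_def)
    qed
    also have "(2 * pi) ^ 3 * (D * H powr (- r)) * sqrt (e * e') = (2 * pi) ^ 3 * (D powr (2 * \<iota>) * P powr (1 - \<iota>))"
    proof -
      have "H powr (- r) = D powr (2 * \<iota> * (- r)) * P powr (- (1 / 2) * (2 * \<iota> * (- r)))"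
        using D P by (simp add: H_def powr_mult powr_powr)
      also have "2 * \<iota> * (- r) = 2 * \<iota> - 1" using \<iota> by (simp add: r_def field_simps)
      finally have Hr: "H powr (- r) = D powr (2 * \<iota> - 1) * P powr (- (1 / 2) * (2 * \<iota> - 1))" .
      have "D * H powr (- r) * sqrt P = (D powr 1 * D powr (2 * \<iota> - 1)) * (P powr (- (1 / 2) * (2 * \<iota> - 1)) * P powr (1 / 2))"
        using D P by (simp add: Hr powr_half_sqrt)
      also have "D powr 1 * D powr (2 * \<iota> - 1) = D powr (2 * \<iota>)" by (subst powr_add[symmetric]) simp
      also have "P powr (- (1 / 2) * (2 * \<iota> - 1)) * P powr (1 / 2) = P powr (1 - \<iota>)"
        by (simp add: powr_add[symmetric] algebra_simps)
      finally show ?thesis by (simp add: P_def mult.assoc)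
    qed
    also have "D powr (2 * \<iota>) * P powr (1 - \<iota>) + (2 * pi) ^ 3 * (D powr (2 * \<iota>) * P powr (1 - \<iota>)) = (1 + (2 * pi) ^ 3) * D powr (2 * \<iota>) * P powr (1 - \<iota>)"
      by (simp only: distrib_right mult_1 mult.assoc)
    also have "D powr (2 * \<iota>) = C powr (2 * \<iota>) * real_of_int M powr (3 - 10 * \<iota>) * n1 powr (- (1 / 2 - \<iota>))"
    proof -
      have "D powr (2 * \<iota>) = C powr (2 * \<iota>) * real_of_int M powr ((3 * r - 2) * (2 * \<iota>)) * n1 powr (- (r / 2) * (2 * \<iota>))"
        using C M n1 by (simp add: D_def powr_mult powr_powr)
      also have "(3 * r - 2) * (2 * \<iota>) = 3 - 10 * \<iota>" using \<iota> by (simp add: r_def field_simps)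
      also have "- (r / 2) * (2 * \<iota>) = - (1 / 2 - \<iota>)" using \<iota> by (simp add: r_def field_simps)
      finally show ?thesis .
    qed
    finally show "norm (wave_form M F F') \<le> C' * real_of_int M powr (3 - 10 * \<iota>) * (1 + \<bar>real_of_int (\<gamma>' - \<gamma>)\<bar>) powr (- (1 / 2 - \<iota>)) * (e * e') powr (1 - \<iota>)"
      by (simp only: C'_def n1_def P_def mult.assoc)
  qed
qed

definition wave :: "(real \<times> int \<times> int \<Rightarrow> complex) \<Rightarrow> (real \<times> real \<times> real) \<times> real \<Rightarrow> complex" where
  "wave G p = inv_fourier_integral (\<lambda>\<zeta>. schroedinger_phase (snd p) \<zeta> * G \<zeta>) (fst p)"

lemma measurable_wave [measurable]:
  assumes [measurable]: "G \<in> borel_measurable RZ2"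
  shows "wave G \<in> borel_measurable borel"
proof -
  have [measurable]: "fst \<in> (borel :: ((real \<times> real \<times> real) \<times> real) measure) \<rightarrow>\<^sub>M borel"
    "snd \<in> (borel :: ((real \<times> real \<times> real) \<times> real) measure) \<rightarrow>\<^sub>M borel"
    by (intro borel_measurable_continuous_onI continuous_intros)+
  show ?thesis unfolding wave_def inv_fourier_integral_def by measurable
qed

lemma norm_wave_le: "norm (wave G p) \<le> (LINT \<zeta>|RZ2. norm (G \<zeta>))"
  unfolding wave_def using norm_inv_fourier_integral_le[of "\<lambda>\<zeta>. schroedinger_phase (snd p) \<zeta> * G \<zeta>" "fst p"]
  by (simp add: norm_mult)

text \<open>With its own sign on E as test function, the wave pairs to the integral of its modulus
  over E, which is at least l times the volume. Since l > 0, \<open>sgn\<close> is unimodular on E,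
  so the mass of F is exactly this volume. The real number x records that the pairing is
  real.\<close>

lemma wave_pairing_ge:
  assumes G: "integrable RZ2 G" and E [measurable]: "E \<in> sets borel"
    and supp: "\<And>z t. (z, t) \<in> E \<Longrightarrow> \<bar>fst z\<bar> \<le> X \<and> t \<in> time_slab \<gamma>"
    and l: "l > 0" "\<And>p. p \<in> E \<Longrightarrow> norm (wave G p) \<ge> l"
  defines "F \<equiv> \<lambda>p. sgn (wave G p) * of_real (indicator E p)"
  shows "slab_test \<gamma> X F" "mass F = (\<integral>\<^sup>+t. \<integral>\<^sup>+z. indicator E (z, t) \<partial>cell_measure \<partial>lborel)"
    "\<exists>x. ennreal l * mass F \<le> ennreal x \<and> of_real x = of_real (1 / (2 * pi) ^ 3) * (LINT \<zeta>|RZ2. cnj (G \<zeta>) * wave_transform F \<zeta>)"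
proof -
  have [measurable]: "G \<in> borel_measurable RZ2" using G by auto
  have [measurable]: "(sgn :: complex \<Rightarrow> complex) \<in> borel_measurable borel"
    unfolding sgn_div_norm by measurable
  have [measurable]: "F \<in> borel_measurable borel" unfolding F_def by measurable
  have nF: "norm (F p) = indicator E p" for p
    using l(1) l(2)[of p] by (cases "p \<in> E") (auto simp: F_def norm_mult norm_sgn)
  show test: "slab_test \<gamma> X F"
    unfolding slab_test_def
  proof (intro conjI allI impI)
    show "norm (F p) \<le> 1" for p unfolding nF by (simp add: indicator_def)
    fix z t assume "F (z, t) \<noteq> 0"
    then have "(z, t) \<in> E" by (auto simp: F_def indicator_def split: if_splits)
    then show "\<bar>fst z\<bar> \<le> X" "t \<in> time_slab \<gamma>" using supp by blast+
  qed measurable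
  show "mass F = (\<integral>\<^sup>+t. \<integral>\<^sup>+z. indicator E (z, t) \<partial>cell_measure \<partial>lborel)"
    unfolding mass_def slice_mass_def nF by (simp add: ennreal_indicator)
  define u where "u p = norm (wave G p) * indicator E p" for p
  have [measurable]: "u \<in> borel_measurable borel" unfolding u_def by measurable
  have u0: "u p \<ge> 0" for p by (simp add: u_def)
  define B where "B = (LINT \<zeta>|RZ2. norm (G \<zeta>))"
  have B0: "B \<ge> 0" unfolding B_def by (intro Bochner_Integration.integral_nonneg) auto
  have uB: "u p \<le> B" for p using norm_wave_le[of G p] B0 by (auto simp: u_def B_def indicator_def)
  have uz: "u (z, t) = 0" if "\<not> (\<bar>fst z\<bar> \<le> X \<and> t \<in> time_slab \<gamma>)" for z t
    using that supp[of z t] by (cases "(z, t) \<in> E") (auto simp: u_def)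
  have FU: "F p * cnj (wave G p) = of_real (u p)" for p
  proof -
    have "sgn w * cnj w = of_real (norm w)" for w :: complex
    proof (cases "w = 0")
      case False
      have "sgn w * cnj w = w * cnj w / of_real (norm w)"
        by (simp add: sgn_div_norm scaleR_conv_of_real divide_inverse mult_ac)
      also have "w * cnj w = of_real ((norm w)\<^sup>2)" by (rule complex_norm_square[symmetric])
      finally show ?thesis using False by (simp add: power2_eq_square)
    qed simp
    then show ?thesis by (simp add: F_def u_def mult_ac)
  qed
  have uint: "integrable cell_measure (\<lambda>z. u (z, t))" for t
  proof -
    have [measurable]: "(\<lambda>z. u (z, t)) \<in> borel_measurable borel"
    proof -
      have "(\<lambda>z. (z, t)) \<in> borel \<rightarrow>\<^sub>M borel"
        by (intro borel_measurable_continuous_onI continuous_intros)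
      then show ?thesis by (rule measurable_compose) fact
    qed
    have "integrable cell_measure (\<lambda>z. complex_of_real (u (z, t)))"
      by (rule integrable_cell_bounded_strip[where B=B and R=X]) (auto simp: uB u0 uz)
    then show ?thesis by (simp only: complex_of_real_integrable_eq)
  qed
  define s where "s t = (LINT z|cell_measure. u (z, t))" for t
  have [measurable]: "s \<in> borel_measurable borel" unfolding s_def by measurable
  have s0: "s t \<ge> 0" for t unfolding s_def by (intro Bochner_Integration.integral_nonneg u0)
  define S where "S = B * (LINT z|cell_measure. indicator {-X..X} (fst z))"
  have sS: "s t \<le> S" for t
  proof -
    have "s t \<le> (LINT z|cell_measure. B * indicator {-X..X} (fst z))"
      unfolding s_def
    proof (rule integral_mono')
      show "integrable cell_measure (\<lambda>z. B * indicator {-X..X} (fst z) :: real)"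
        by (intro integrable_mult_right integrable_cell_strip)
      show "u (z, t) \<le> B * indicator {-X..X} (fst z)" for z
        using uB[of "(z, t)"] uz[of z t] by (cases "\<bar>fst z\<bar> \<le> X") (auto simp: indicator_def abs_le_iff)
    qed (use B0 in auto)
    then show ?thesis by (simp add: S_def)
  qed
  have sint: "integrable lborel (\<lambda>t. indicator (time_slab \<gamma>) t * s t)"
  proof (rule Bochner_Integration.integrable_bound)
    show "integrable lborel (\<lambda>t. indicator (time_slab \<gamma>) t * S)"
      by (intro integrable_mult_left integrable_real_indicator) (auto simp: time_slab_def emeasure_lborel_Icc_eq)
    show "AE t in lborel. norm (indicator (time_slab \<gamma>) t * s t) \<le> norm (indicator (time_slab \<gamma>) t * S)"
      using order_trans[OF sS abs_ge_self] s0 by (intro AE_I2) (auto simp: indicator_def)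
  qed measurable
  define x where "x = (LINT t|lborel. indicator (time_slab \<gamma>) t * s t)"
  have "of_real (1 / (2 * pi) ^ 3) * (LINT \<zeta>|RZ2. cnj (G \<zeta>) * wave_transform F \<zeta>) =
      (LINT t|lborel. of_real (indicator (time_slab \<gamma>) t) * (LINT z|cell_measure. F (z, t) * cnj (wave G (z, t))))"
    unfolding wave_def fst_conv snd_conv by (rule wave_pairing[OF test G, symmetric])
  also have "\<dots> = (LINT t|lborel. complex_of_real (indicator (time_slab \<gamma>) t * s t))"
    unfolding FU s_def by (simp only: integral_complex_of_real of_real_mult)
  also have "\<dots> = of_real x" unfolding x_def by (rule integral_complex_of_real)
  finally have eq: "of_real x = of_real (1 / (2 * pi) ^ 3) * (LINT \<zeta>|RZ2. cnj (G \<zeta>) * wave_transform F \<zeta>)" by (rule sym)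
  have "ennreal l * mass F \<le> ennreal x"
  proof -
    have "ennreal l * mass F = (\<integral>\<^sup>+t. \<integral>\<^sup>+z. ennreal l * ennreal (norm (F (z, t))) \<partial>cell_measure \<partial>lborel)"
      unfolding mass_def slice_mass_def by (simp add: nn_integral_cmult)
    also have "\<dots> \<le> (\<integral>\<^sup>+t. ennreal (indicator (time_slab \<gamma>) t * s t) \<partial>lborel)"
    proof (intro nn_integral_mono)
      fix t
      show "(\<integral>\<^sup>+z. ennreal l * ennreal (norm (F (z, t))) \<partial>cell_measure) \<le> ennreal (indicator (time_slab \<gamma>) t * s t)"
      proof (cases "t \<in> time_slab \<gamma>")
        case True
        have "(\<integral>\<^sup>+z. ennreal l * ennreal (norm (F (z, t))) \<partial>cell_measure) \<le> (\<integral>\<^sup>+z. ennreal (u (z, t)) \<partial>cell_measure)"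
          unfolding nF using l by (intro nn_integral_mono) (auto simp: u_def indicator_def intro: ennreal_leI)
        also have "\<dots> = ennreal (s t)" unfolding s_def by (intro nn_integral_eq_integral uint) (auto simp: u0)
        finally show ?thesis using True by simp
      next
        case False
        then have "F (z, t) = 0" for z using slab_test_support[OF test] by blast
        then show ?thesis by simp
      qed
    qed
    also have "\<dots> = ennreal x" unfolding x_def by (intro nn_integral_eq_integral sint) (auto simp: s0)
    finally show ?thesis .
  qed
  with eq show "\<exists>x. ennreal l * mass F \<le> ennreal x \<and> of_real x = of_real (1 / (2 * pi) ^ 3) * (LINT \<zeta>|RZ2. cnj (G \<zeta>) * wave_transform F \<zeta>)" by blast
qed

lemma integrable_weighted_waves:
  assumes F: "slab_test \<gamma> X F" and F': "slab_test \<gamma>' X F'" and M: "M \<ge> 1"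
  shows "integrable RZ2 (\<lambda>\<zeta>. of_real (band_weight M \<zeta>) * wave_transform F \<zeta> * cnj (wave_transform F' \<zeta>))"
proof -
  note [measurable] = measurable_wave_transform[OF F] measurable_wave_transform[OF F']
  define B where "B = 2 * pi * (LINT z|cell_measure. indicator {-X..X} (fst z))"
  have B: "norm (wave_transform F \<zeta>) \<le> B" "norm (wave_transform F' \<zeta>) \<le> B" for \<zeta>
    unfolding B_def by (rule norm_wave_transform_le[OF F], rule norm_wave_transform_le[OF F'])
  have "integrable RZ2 (\<lambda>\<zeta>. complex_of_real (B * B) * of_real (band_weight M \<zeta>))"
    by (intro integrable_mult_right integrable_band_weight M)
  then show ?thesis
  proof (rule Bochner_Integration.integrable_bound)
    show "AE \<zeta> in RZ2. norm (of_real (band_weight M \<zeta>) * wave_transform F \<zeta> * cnj (wave_transform F' \<zeta>)) \<le> norm (complex_of_real (B * B) * of_real (band_weight M \<zeta>))"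
    proof (intro AE_I2)
      fix \<zeta>
      have "norm (wave_transform F \<zeta>) * norm (wave_transform F' \<zeta>) \<le> B * B"
        using B[of \<zeta>] by (intro mult_mono) (auto intro: order_trans[OF norm_ge_zero])
      then have "band_weight M \<zeta> * (norm (wave_transform F \<zeta>) * norm (wave_transform F' \<zeta>)) \<le> band_weight M \<zeta> * (B * B)"
        by (intro mult_left_mono band_weight_nonneg)
      then show "norm (of_real (band_weight M \<zeta>) * wave_transform F \<zeta> * cnj (wave_transform F' \<zeta>)) \<le> norm (complex_of_real (B * B) * of_real (band_weight M \<zeta>))"
        using band_weight_nonneg[of M \<zeta>] by (simp add: norm_mult abs_mult mult_ac)
    qed
  qed measurable
qed

text \<open>The combination of pairings equals, up to normalisation, the inner product of G with V,
  the combined transforms of the test functions. Cauchy-Schwarz with the weight split between the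
  factors gives the norm of G times a weighted square of V, whose expansion is the double sum of
  bilinear forms.\<close>

lemma wave_duality:
  fixes c x :: "int \<Rightarrow> real"
  assumes G: "integrable RZ2 G" and fin: "sqnorm RZ2 G < top" and M: "M \<ge> 1"
    and supp: "\<And>\<zeta>. \<zeta> \<notin> band (real_of_int M) (int_box M) \<Longrightarrow> G \<zeta> = 0"
    and \<Gamma>: "finite \<Gamma>" and c: "\<And>\<gamma>. c \<gamma> \<ge> 0"
    and F: "\<And>\<gamma>. \<gamma> \<in> \<Gamma> \<Longrightarrow> slab_test \<gamma> X (F \<gamma>)"
    and x: "\<And>\<gamma>. \<gamma> \<in> \<Gamma> \<Longrightarrow> of_real (x \<gamma>) = of_real (1 / (2 * pi) ^ 3) * (LINT \<zeta>|RZ2. cnj (G \<zeta>) * wave_transform (F \<gamma>) \<zeta>)"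
  shows "(\<Sum>\<gamma>\<in>\<Gamma>. c \<gamma> * x \<gamma>)\<^sup>2 \<le> 2 * enn2real (sqnorm RZ2 G) * (\<Sum>\<gamma>\<in>\<Gamma>. \<Sum>\<gamma>'\<in>\<Gamma>. c \<gamma> * c \<gamma>' * norm (wave_form M (F \<gamma>) (F \<gamma>')))"
proof -
  have [measurable]: "G \<in> borel_measurable RZ2" using G by auto
  have Wm: "wave_transform (F \<gamma>) \<in> borel_measurable RZ2" if "\<gamma> \<in> \<Gamma>" for \<gamma>
    by (rule measurable_wave_transform[OF F[OF that]])
  define V where "V \<zeta> = (\<Sum>\<gamma>\<in>\<Gamma>. of_real (c \<gamma>) * wave_transform (F \<gamma>) \<zeta>)" for \<zeta>
  have [measurable]: "V \<in> borel_measurable RZ2"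
    unfolding V_def by (intro borel_measurable_sum borel_measurable_times borel_measurable_const Wm)
  define L where "L = (LINT \<zeta>|RZ2. cnj (G \<zeta>) * V \<zeta>)"
  have GW: "integrable RZ2 (\<lambda>\<zeta>. cnj (G \<zeta>) * wave_transform (F \<gamma>) \<zeta>)" if \<gamma>: "\<gamma> \<in> \<Gamma>" for \<gamma>
  proof -
    note [measurable] = Wm[OF \<gamma>]
    define B where "B = 2 * pi * (LINT z|cell_measure. indicator {-X..X} (fst z))"
    have B: "norm (wave_transform (F \<gamma>) \<zeta>) \<le> B" for \<zeta> unfolding B_def by (rule norm_wave_transform_le[OF F[OF \<gamma>]])
    have "integrable RZ2 (\<lambda>\<zeta>. of_real B * G \<zeta>)" using G by (intro integrable_mult_right)
    then show ?thesis
    proof (rule Bochner_Integration.integrable_bound)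
      show "AE \<zeta> in RZ2. norm (cnj (G \<zeta>) * wave_transform (F \<gamma>) \<zeta>) \<le> norm (complex_of_real B * G \<zeta>)"
      proof (intro AE_I2)
        fix \<zeta>
        have "norm (G \<zeta>) * norm (wave_transform (F \<gamma>) \<zeta>) \<le> norm (G \<zeta>) * \<bar>B\<bar>"
          using order_trans[OF B abs_ge_self] by (intro mult_left_mono) auto
        then show "norm (cnj (G \<zeta>) * wave_transform (F \<gamma>) \<zeta>) \<le> norm (complex_of_real B * G \<zeta>)"
          by (simp add: norm_mult mult.commute)
      qed
    qed measurable
  qed
  have "L = (LINT \<zeta>|RZ2. (\<Sum>\<gamma>\<in>\<Gamma>. of_real (c \<gamma>) * (cnj (G \<zeta>) * wave_transform (F \<gamma>) \<zeta>)))"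
    unfolding L_def V_def sum_distrib_left by (intro Bochner_Integration.integral_cong refl sum.cong) (simp add: mult_ac)
  also have "\<dots> = (\<Sum>\<gamma>\<in>\<Gamma>. LINT \<zeta>|RZ2. of_real (c \<gamma>) * (cnj (G \<zeta>) * wave_transform (F \<gamma>) \<zeta>))"
    by (intro Bochner_Integration.integral_sum integrable_mult_right GW)
  also have "\<dots> = (\<Sum>\<gamma>\<in>\<Gamma>. of_real (c \<gamma>) * (LINT \<zeta>|RZ2. cnj (G \<zeta>) * wave_transform (F \<gamma>) \<zeta>))"
    by (simp only: integral_mult_right_zero)
  finally have "of_real (1 / (2 * pi) ^ 3) * L = (\<Sum>\<gamma>\<in>\<Gamma>. of_real (c \<gamma>) * of_real (x \<gamma>))"
    by (simp only: sum_distrib_left x mult.left_commute cong: sum.cong)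
  then have Lx: "complex_of_real (\<Sum>\<gamma>\<in>\<Gamma>. c \<gamma> * x \<gamma>) = of_real (1 / (2 * pi) ^ 3) * L" by simp
  have "\<bar>\<Sum>\<gamma>\<in>\<Gamma>. c \<gamma> * x \<gamma>\<bar> = norm (complex_of_real (\<Sum>\<gamma>\<in>\<Gamma>. c \<gamma> * x \<gamma>))" by (simp only: norm_of_real)
  also have "\<dots> = 1 / (2 * pi) ^ 3 * norm L" unfolding Lx norm_mult norm_of_real by simp
  also have "\<dots> \<le> 1 * norm L"
  proof (intro mult_right_mono)
    have "1 \<le> (2 * pi) ^ 3" using pi_gt3 by (intro one_le_power) auto
    then show "1 / (2 * pi) ^ 3 \<le> 1" by (simp add: divide_le_eq)
  qed auto
  finally have "\<bar>\<Sum>\<gamma>\<in>\<Gamma>. c \<gamma> * x \<gamma>\<bar> \<le> norm L" by simp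
  then have 1: "(\<Sum>\<gamma>\<in>\<Gamma>. c \<gamma> * x \<gamma>)\<^sup>2 \<le> (norm L)\<^sup>2" by (rule abs_le_square_iff[THEN iffD1, of _ "norm L", simplified])
  \<comment> \<open>Where the weight vanishes the quotient is 0 by convention; this is harmless
    because such points lie outside the band, where G is 0.\<close>
  define f where "f \<zeta> = cnj (G \<zeta>) * of_real (1 / sqrt (band_weight M \<zeta>))" for \<zeta>
  define g where "g \<zeta> = of_real (sqrt (band_weight M \<zeta>)) * V \<zeta>" for \<zeta>
  have [measurable]: "f \<in> borel_measurable RZ2" "g \<in> borel_measurable RZ2" unfolding f_def g_def by measurable
  \<comment> \<open>On the band the weight is at least exp (- 1/2) \<ge> 1/2. This is the factor 2
    in the statement.\<close>
  have half: "band_weight M \<zeta> \<ge> 1 / 2" if "\<zeta> \<in> band (real_of_int M) (int_box M)" for \<zeta>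
  proof -
    have "1 + (- 1 / 2) \<le> exp (- 1 / 2 :: real)" by (rule exp_ge_add_one_self)
    then show ?thesis using band_weight_ge[OF M that] by linarith
  qed
  have "L = (LINT \<zeta>|RZ2. f \<zeta> * g \<zeta>)"
    unfolding L_def
  proof (intro Bochner_Integration.integral_cong refl)
    fix \<zeta>
    show "cnj (G \<zeta>) * V \<zeta> = f \<zeta> * g \<zeta>"
    proof (cases "\<zeta> \<in> band (real_of_int M) (int_box M)")
      case True
      then have "sqrt (band_weight M \<zeta>) \<noteq> 0" using half[OF True] by simp
      then have "complex_of_real (1 / sqrt (band_weight M \<zeta>)) * of_real (sqrt (band_weight M \<zeta>)) = 1"
        by (simp only: of_real_mult[symmetric]) simp
      then have "f \<zeta> * g \<zeta> = cnj (G \<zeta>) * (1 * V \<zeta>)"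
        unfolding f_def g_def by (metis mult.assoc)
      then show ?thesis by simp
    qed (simp add: supp f_def)
  qed
  then have "(ennreal (norm L))\<^sup>2 \<le> sqnorm RZ2 f * sqnorm RZ2 g"
    using norm_integral_cauchy_schwarz[of f RZ2 g] by simp
  also have "sqnorm RZ2 f \<le> ennreal (2 * enn2real (sqnorm RZ2 G))"
  proof -
    have "sqnorm RZ2 f \<le> (\<integral>\<^sup>+\<zeta>. ennreal 2 * ennreal ((norm (G \<zeta>))\<^sup>2) \<partial>RZ2)"
      unfolding sqnorm_def
    proof (intro nn_integral_mono)
      fix \<zeta>
      have "(norm (f \<zeta>))\<^sup>2 \<le> 2 * (norm (G \<zeta>))\<^sup>2"
      proof (cases "\<zeta> \<in> band (real_of_int M) (int_box M)")
        case True
        have w: "band_weight M \<zeta> \<ge> 1 / 2" by (rule half[OF True])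
        have "(norm (f \<zeta>))\<^sup>2 = (norm (G \<zeta>))\<^sup>2 * (1 / band_weight M \<zeta>)"
          using w by (simp add: f_def norm_mult power_mult_distrib power_divide norm_divide)
        also have "\<dots> \<le> (norm (G \<zeta>))\<^sup>2 * 2"
          using w by (intro mult_left_mono) (auto simp: field_simps)
        finally show ?thesis by simp
      qed (simp add: supp f_def)
      then show "ennreal ((norm (f \<zeta>))\<^sup>2) \<le> ennreal 2 * ennreal ((norm (G \<zeta>))\<^sup>2)"
        by (subst ennreal_mult[symmetric]) (auto intro: ennreal_leI)
    qed
    also have "\<dots> = ennreal 2 * sqnorm RZ2 G" unfolding sqnorm_def by (intro nn_integral_cmult) measurable
    also have "\<dots> = ennreal (2 * enn2real (sqnorm RZ2 G))" using fin by (simp add: ennreal_mult less_top)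
    finally show ?thesis .
  qed
  also have "sqnorm RZ2 g \<le> ennreal (\<Sum>\<gamma>\<in>\<Gamma>. \<Sum>\<gamma>'\<in>\<Gamma>. c \<gamma> * c \<gamma>' * norm (wave_form M (F \<gamma>) (F \<gamma>')))"
  proof -
    have VV: "of_real (band_weight M \<zeta>) * V \<zeta> * cnj (V \<zeta>) = (\<Sum>\<gamma>\<in>\<Gamma>. \<Sum>\<gamma>'\<in>\<Gamma>. of_real (c \<gamma> * c \<gamma>') *
        (of_real (band_weight M \<zeta>) * wave_transform (F \<gamma>) \<zeta> * cnj (wave_transform (F \<gamma>') \<zeta>)))" for \<zeta>
    proof -
      have "V \<zeta> * cnj (V \<zeta>) = (\<Sum>\<gamma>\<in>\<Gamma>. \<Sum>\<gamma>'\<in>\<Gamma>. (of_real (c \<gamma>) * wave_transform (F \<gamma>) \<zeta>) * cnj (of_real (c \<gamma>') * wave_transform (F \<gamma>') \<zeta>))"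
        unfolding V_def cnj_sum by (rule sum_product)
      then show ?thesis
        unfolding mult.assoc by (simp add: sum_distrib_left mult_ac)
    qed
    have int2: "integrable RZ2 (\<lambda>\<zeta>. \<Sum>\<gamma>'\<in>\<Gamma>. of_real (c \<gamma> * c \<gamma>') * (of_real (band_weight M \<zeta>) * wave_transform (F \<gamma>) \<zeta> * cnj (wave_transform (F \<gamma>') \<zeta>)))"
      if "\<gamma> \<in> \<Gamma>" for \<gamma>
      using that by (intro Bochner_Integration.integrable_sum integrable_mult_right integrable_weighted_waves[OF F F M])
    have int: "integrable RZ2 (\<lambda>\<zeta>. of_real (band_weight M \<zeta>) * V \<zeta> * cnj (V \<zeta>))"
      unfolding VV by (intro Bochner_Integration.integrable_sum int2)
    have sq: "of_real (band_weight M \<zeta>) * V \<zeta> * cnj (V \<zeta>) = complex_of_real (band_weight M \<zeta> * (norm (V \<zeta>))\<^sup>2)" for \<zeta>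
      by (simp only: mult.assoc complex_norm_square[symmetric] of_real_mult)
    have int': "integrable RZ2 (\<lambda>\<zeta>. band_weight M \<zeta> * (norm (V \<zeta>))\<^sup>2)"
      using int unfolding sq by (simp only: complex_of_real_integrable_eq)
    define y where "y = (LINT \<zeta>|RZ2. band_weight M \<zeta> * (norm (V \<zeta>))\<^sup>2)"
    have "sqnorm RZ2 g = (\<integral>\<^sup>+\<zeta>. ennreal (band_weight M \<zeta> * (norm (V \<zeta>))\<^sup>2) \<partial>RZ2)"
      unfolding sqnorm_def g_def norm_mult norm_of_real power_mult_distrib by (simp add: band_weight_nonneg)
    also have "\<dots> = ennreal y"
      unfolding y_def by (intro nn_integral_eq_integral int') (auto simp: band_weight_nonneg)
    also have "y \<le> (\<Sum>\<gamma>\<in>\<Gamma>. \<Sum>\<gamma>'\<in>\<Gamma>. c \<gamma> * c \<gamma>' * norm (wave_form M (F \<gamma>) (F \<gamma>')))"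
    proof -
      have "complex_of_real y = (LINT \<zeta>|RZ2. of_real (band_weight M \<zeta>) * V \<zeta> * cnj (V \<zeta>))"
        unfolding sq y_def by (rule integral_complex_of_real[symmetric])
      also have "\<dots> = (\<Sum>\<gamma>\<in>\<Gamma>. LINT \<zeta>|RZ2. (\<Sum>\<gamma>'\<in>\<Gamma>. of_real (c \<gamma> * c \<gamma>') * (of_real (band_weight M \<zeta>) * wave_transform (F \<gamma>) \<zeta> * cnj (wave_transform (F \<gamma>') \<zeta>))))"
        unfolding VV by (intro Bochner_Integration.integral_sum int2)
      also have "\<dots> = (\<Sum>\<gamma>\<in>\<Gamma>. \<Sum>\<gamma>'\<in>\<Gamma>. of_real (c \<gamma> * c \<gamma>') * wave_form M (F \<gamma>) (F \<gamma>'))"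
      proof (intro sum.cong refl)
        fix \<gamma> assume \<gamma>: "\<gamma> \<in> \<Gamma>"
        have "(LINT \<zeta>|RZ2. (\<Sum>\<gamma>'\<in>\<Gamma>. of_real (c \<gamma> * c \<gamma>') * (of_real (band_weight M \<zeta>) * wave_transform (F \<gamma>) \<zeta> * cnj (wave_transform (F \<gamma>') \<zeta>))))
           = (\<Sum>\<gamma>'\<in>\<Gamma>. LINT \<zeta>|RZ2. of_real (c \<gamma> * c \<gamma>') * (of_real (band_weight M \<zeta>) * wave_transform (F \<gamma>) \<zeta> * cnj (wave_transform (F \<gamma>') \<zeta>)))"
          using \<gamma> by (intro Bochner_Integration.integral_sum integrable_mult_right integrable_weighted_waves[OF F F M])
        also have "\<dots> = (\<Sum>\<gamma>'\<in>\<Gamma>. of_real (c \<gamma> * c \<gamma>') * wave_form M (F \<gamma>) (F \<gamma>'))"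
          by (simp only: integral_mult_right_zero wave_form_def)
        finally show "(LINT \<zeta>|RZ2. (\<Sum>\<gamma>'\<in>\<Gamma>. of_real (c \<gamma> * c \<gamma>') * (of_real (band_weight M \<zeta>) * wave_transform (F \<gamma>) \<zeta> * cnj (wave_transform (F \<gamma>') \<zeta>))))
           = (\<Sum>\<gamma>'\<in>\<Gamma>. of_real (c \<gamma> * c \<gamma>') * wave_form M (F \<gamma>) (F \<gamma>'))" .
      qed
      finally have "\<bar>y\<bar> = norm (\<Sum>\<gamma>\<in>\<Gamma>. \<Sum>\<gamma>'\<in>\<Gamma>. of_real (c \<gamma> * c \<gamma>') * wave_form M (F \<gamma>) (F \<gamma>'))"
        by (metis norm_of_real)
      also have "\<dots> \<le> (\<Sum>\<gamma>\<in>\<Gamma>. \<Sum>\<gamma>'\<in>\<Gamma>. norm (of_real (c \<gamma> * c \<gamma>') * wave_form M (F \<gamma>) (F \<gamma>')))"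
        by (intro order_trans[OF norm_sum] sum_mono norm_sum)
      also have "\<dots> = (\<Sum>\<gamma>\<in>\<Gamma>. \<Sum>\<gamma>'\<in>\<Gamma>. c \<gamma> * c \<gamma>' * norm (wave_form M (F \<gamma>) (F \<gamma>')))"
        using c by (simp only: norm_mult norm_of_real abs_mult abs_of_nonneg)
      finally show ?thesis by linarith
    qed
    finally show ?thesis by (simp add: ennreal_leI)
  qed
  finally have "(ennreal (norm L))\<^sup>2 \<le> ennreal (2 * enn2real (sqnorm RZ2 G)) * ennreal (\<Sum>\<gamma>\<in>\<Gamma>. \<Sum>\<gamma>'\<in>\<Gamma>. c \<gamma> * c \<gamma>' * norm (wave_form M (F \<gamma>) (F \<gamma>')))"
    by (simp add: mult_mono mult_left_mono mult_right_mono)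
  then have "ennreal ((norm L)\<^sup>2) \<le> ennreal (2 * enn2real (sqnorm RZ2 G) * (\<Sum>\<gamma>\<in>\<Gamma>. \<Sum>\<gamma>'\<in>\<Gamma>. c \<gamma> * c \<gamma>' * norm (wave_form M (F \<gamma>) (F \<gamma>'))))"
    by (simp add: ennreal_power ennreal_mult')
  then have "(norm L)\<^sup>2 \<le> 2 * enn2real (sqnorm RZ2 G) * (\<Sum>\<gamma>\<in>\<Gamma>. \<Sum>\<gamma>'\<in>\<Gamma>. c \<gamma> * c \<gamma>' * norm (wave_form M (F \<gamma>) (F \<gamma>')))"
    using c by (subst (asm) ennreal_le_iff) (auto intro!: mult_nonneg_nonneg sum_nonneg)
  with 1 show ?thesis by linarith
qed

section \<open>The weak-type estimate\<close>

definition space_time_volume :: "((real \<times> real \<times> real) \<times> real) set \<Rightarrow> ennreal" where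
  "space_time_volume E = (\<integral>\<^sup>+t. \<integral>\<^sup>+z. indicator E (z, t) \<partial>cell_measure \<partial>lborel)"

text \<open>An l^q bound proved by duality: the test functions of the slabs are combined with the
  coefficients extremal in Hoelder's inequality, normalised in the dual exponent. The bilinear bound
  and the discrete inequality then control the square of the l^q norm. Only finitely many slabs and
  sets bounded in x are treated, so that all quantities are finite.\<close>

lemma weak_type:
  fixes \<iota> q :: real
  assumes \<iota>: "\<iota> = 0 \<or> (1 / 6 < \<iota> \<and> \<iota> < 1 / 4)" and q: "q > 2" "2 / q = 1 / 2 - \<iota>"
  obtains C where "C > 0" "\<And>G M B \<Gamma> X E l v. integrable RZ2 G \<Longrightarrow> B > 0 \<Longrightarrow> sqnorm RZ2 G \<le> ennreal (B\<^sup>2) \<Longrightarrow> M \<ge> 1 \<Longrightarrow>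
    (\<And>\<zeta>. \<zeta> \<notin> band (real_of_int M) (int_box M) \<Longrightarrow> G \<zeta> = 0) \<Longrightarrow> finite \<Gamma> \<Longrightarrow>
    (\<And>\<gamma>. \<gamma> \<in> \<Gamma> \<Longrightarrow> E \<gamma> \<in> sets borel) \<Longrightarrow>
    (\<And>\<gamma> z t. \<gamma> \<in> \<Gamma> \<Longrightarrow> (z, t) \<in> E \<gamma> \<Longrightarrow> \<bar>fst z\<bar> \<le> X \<and> t \<in> time_slab \<gamma>) \<Longrightarrow>
    (\<And>\<gamma>. \<gamma> \<in> \<Gamma> \<Longrightarrow> l \<gamma> > 0) \<Longrightarrow> (\<And>\<gamma> p. \<gamma> \<in> \<Gamma> \<Longrightarrow> p \<in> E \<gamma> \<Longrightarrow> norm (wave G p) \<ge> l \<gamma>) \<Longrightarrow>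
    (\<And>\<gamma>. \<gamma> \<in> \<Gamma> \<Longrightarrow> v \<gamma> > 0) \<Longrightarrow> (\<And>\<gamma>. \<gamma> \<in> \<Gamma> \<Longrightarrow> space_time_volume (E \<gamma>) = ennreal (v \<gamma>)) \<Longrightarrow>
    (\<Sum>\<gamma>\<in>\<Gamma>. (l \<gamma> * v \<gamma> powr \<iota>) powr q) \<le> (C * real_of_int M powr (3 / 2 - 5 * \<iota>) * B) powr q"
proof -
  obtain Cw where Cw: "Cw > 0" and form: "\<And>\<gamma> \<gamma>' X F F' M e e'. slab_test \<gamma> X F \<Longrightarrow> slab_test \<gamma>' X F' \<Longrightarrow> M \<ge> 1 \<Longrightarrow>
    mass F = ennreal e \<Longrightarrow> mass F' = ennreal e' \<Longrightarrow> e > 0 \<Longrightarrow> e' > 0 \<Longrightarrow>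
    norm (wave_form M F F') \<le> Cw * real_of_int M powr (3 - 10 * \<iota>) * (1 + \<bar>real_of_int (\<gamma>' - \<gamma>)\<bar>) powr (- (1 / 2 - \<iota>)) * (e * e') powr (1 - \<iota>)"
    using wave_form_bound[OF \<iota>] by metis
  define Ch where "Ch = 2 * (4 / (1 - 2 / q) + 3)"
  have Ch: "Ch > 0" using q by (simp add: Ch_def field_simps)
  define C where "C = sqrt (2 * Cw * Ch)"
  have C: "C > 0" using Cw Ch by (simp add: C_def)
  show ?thesis
  proof (rule that[OF C])
    fix G M B \<Gamma> X E and l v :: "int \<Rightarrow> real"
    assume G: "integrable RZ2 G" and B: "B > 0" "sqnorm RZ2 G \<le> ennreal (B\<^sup>2)" and M: "M \<ge> 1"
      and supp: "\<And>\<zeta>. \<zeta> \<notin> band (real_of_int M) (int_box M) \<Longrightarrow> G \<zeta> = 0" and \<Gamma>: "finite \<Gamma>"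
      and E: "\<And>\<gamma>. \<gamma> \<in> \<Gamma> \<Longrightarrow> E \<gamma> \<in> sets borel"
      and Es: "\<And>\<gamma> z t. \<gamma> \<in> \<Gamma> \<Longrightarrow> (z, t) \<in> E \<gamma> \<Longrightarrow> \<bar>fst z\<bar> \<le> X \<and> t \<in> time_slab \<gamma>"
      and l: "\<And>\<gamma>. \<gamma> \<in> \<Gamma> \<Longrightarrow> l \<gamma> > 0" and wl: "\<And>\<gamma> p. \<gamma> \<in> \<Gamma> \<Longrightarrow> p \<in> E \<gamma> \<Longrightarrow> norm (wave G p) \<ge> l \<gamma>"
      and v: "\<And>\<gamma>. \<gamma> \<in> \<Gamma> \<Longrightarrow> v \<gamma> > 0" and vol: "\<And>\<gamma>. \<gamma> \<in> \<Gamma> \<Longrightarrow> space_time_volume (E \<gamma>) = ennreal (v \<gamma>)"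
    have fin: "sqnorm RZ2 G < top" using B(2) by (rule le_less_trans) simp
    define g2 where "g2 = enn2real (sqnorm RZ2 G)"
    have g2: "0 \<le> g2" "g2 \<le> B\<^sup>2"
    proof -
      show "0 \<le> g2" by (simp add: g2_def)
      have "enn2real (sqnorm RZ2 G) \<le> enn2real (ennreal (B\<^sup>2))" using B(2) by (intro enn2real_mono) auto
      then show "g2 \<le> B\<^sup>2" by (simp add: g2_def)
    qed
    define F where "F \<gamma> p = sgn (wave G p) * of_real (indicator (E \<gamma>) p)" for \<gamma> p
    have test: "slab_test \<gamma> X (F \<gamma>)" and massF: "mass (F \<gamma>) = ennreal (v \<gamma>)"
      and "\<exists>x. ennreal (l \<gamma>) * mass (F \<gamma>) \<le> ennreal x \<and> of_real x = of_real (1 / (2 * pi) ^ 3) * (LINT \<zeta>|RZ2. cnj (G \<zeta>) * wave_transform (F \<gamma>) \<zeta>)"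
      if \<gamma>: "\<gamma> \<in> \<Gamma>" for \<gamma>
      using wave_pairing_ge[OF G E[OF \<gamma>] Es[OF \<gamma>] l[OF \<gamma>] wl[OF \<gamma>]] vol[OF \<gamma>]
      unfolding F_def[abs_def] space_time_volume_def by simp_all
    then have "\<forall>\<gamma>\<in>\<Gamma>. \<exists>x. ennreal (l \<gamma>) * mass (F \<gamma>) \<le> ennreal x \<and> of_real x = of_real (1 / (2 * pi) ^ 3) * (LINT \<zeta>|RZ2. cnj (G \<zeta>) * wave_transform (F \<gamma>) \<zeta>)"
      by blast
    from bchoice[OF this] obtain x where x: "\<And>\<gamma>. \<gamma> \<in> \<Gamma> \<Longrightarrow> ennreal (l \<gamma>) * mass (F \<gamma>) \<le> ennreal (x \<gamma>)"
      "\<And>\<gamma>. \<gamma> \<in> \<Gamma> \<Longrightarrow> of_real (x \<gamma>) = of_real (1 / (2 * pi) ^ 3) * (LINT \<zeta>|RZ2. cnj (G \<zeta>) * wave_transform (F \<gamma>) \<zeta>)"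
      by blast
    have xl: "l \<gamma> * v \<gamma> \<le> x \<gamma>" if \<gamma>: "\<gamma> \<in> \<Gamma>" for \<gamma>
    proof -
      have "ennreal (l \<gamma> * v \<gamma>) \<le> ennreal (x \<gamma>)"
        using x(1)[OF \<gamma>] l[OF \<gamma>] v[OF \<gamma>] by (simp add: massF[OF \<gamma>] ennreal_mult)
      moreover have "0 < l \<gamma> * v \<gamma>" using l[OF \<gamma>] v[OF \<gamma>] by simp
      ultimately show ?thesis by (metis ennreal_le_iff ennreal_neg ennreal_eq_0_iff le_zero_eq linear not_less)
    qed
    define a where "a \<gamma> = l \<gamma> * v \<gamma> powr \<iota>" for \<gamma>
    have a: "a \<gamma> > 0" if "\<gamma> \<in> \<Gamma>" for \<gamma> using l[OF that] v[OF that] by (simp add: a_def)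
    define S where "S = (\<Sum>\<gamma>\<in>\<Gamma>. a \<gamma> powr q)"
    have "S \<le> (C * real_of_int M powr (3 / 2 - 5 * \<iota>) * B) powr q"
    proof (cases "\<Gamma> = {}")
      case False
      then have S: "S > 0" unfolding S_def using \<Gamma> a
        by (intro sum_pos) (auto simp: less_imp_neq[THEN not_sym])
      \<comment> \<open>The dual extremiser of a in l^q: its powers with exponent q/(q - 1) sum to
        1, and its pairing with a is S powr (1/q).\<close>
      define b where "b \<gamma> = (if \<gamma> \<in> \<Gamma> then a \<gamma> powr (q - 1) * S powr (- (1 - 1 / q)) else 0)" for \<gamma>
      \<comment> \<open>The extra power of the volume does double duty: it cancels (v v') powr (1 -
        \<iota>) in the bilinear bound, and it turns l * v into l * v powr \<iota>.\<close>
      define c where "c \<gamma> = b \<gamma> * v \<gamma> powr (- (1 - \<iota>))" for \<gamma>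
      have b0: "b \<gamma> \<ge> 0" for \<gamma> by (simp add: b_def)
      have c0: "c \<gamma> \<ge> 0" for \<gamma> by (simp add: c_def b0)
      have "(\<Sum>\<gamma>\<in>\<Gamma>. b \<gamma> powr (q / (q - 1))) = (\<Sum>\<gamma>\<in>\<Gamma>. a \<gamma> powr q * S powr (- 1))"
      proof (intro sum.cong refl)
        fix \<gamma> assume \<gamma>: "\<gamma> \<in> \<Gamma>"
        have "b \<gamma> powr (q / (q - 1)) = a \<gamma> powr ((q - 1) * (q / (q - 1))) * S powr (- (1 - 1 / q) * (q / (q - 1)))"
          using a[OF \<gamma>] S \<gamma> by (simp add: b_def powr_mult powr_powr)
        also have "(q - 1) * (q / (q - 1)) = q" using q by simp
        also have "- (1 - 1 / q) * (q / (q - 1)) = - 1" using q by (simp add: field_simps)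
        finally show "b \<gamma> powr (q / (q - 1)) = a \<gamma> powr q * S powr (- 1)" .
      qed
      also have "\<dots> = S * S powr (- 1)" by (simp only: S_def sum_distrib_right)
      also have "\<dots> = 1" using S by (simp add: powr_minus)
      finally have bsum: "(\<Sum>\<gamma>\<in>\<Gamma>. b \<gamma> powr (q / (q - 1))) = 1" .
      have hls: "(\<Sum>j\<in>\<Gamma>. \<Sum>k\<in>\<Gamma>. b j * b k * (1 + \<bar>real_of_int (j - k)\<bar>) powr (- (2 / q))) \<le> Ch"
        unfolding Ch_def by (rule discrete_hls[OF q(1) \<Gamma>]) (simp_all add: b0 bsum)
      have lower: "S powr (1 / q) \<le> (\<Sum>\<gamma>\<in>\<Gamma>. c \<gamma> * x \<gamma>)"
      proof -
        have "S powr (1 / q) = S powr 1 * S powr (- (1 - 1 / q))" by (subst powr_add[symmetric]) simp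
        also have "\<dots> = (\<Sum>\<gamma>\<in>\<Gamma>. a \<gamma> powr q * S powr (- (1 - 1 / q)))" using S by (simp add: S_def sum_distrib_right)
        also have "\<dots> = (\<Sum>\<gamma>\<in>\<Gamma>. c \<gamma> * (l \<gamma> * v \<gamma>))"
        proof (intro sum.cong refl)
          fix \<gamma> assume \<gamma>: "\<gamma> \<in> \<Gamma>"
          have 1: "a \<gamma> powr (q - 1) * a \<gamma> powr 1 = a \<gamma> powr q" by (subst powr_add[symmetric]) simp
          have 2: "v \<gamma> powr (- (1 - \<iota>)) * v \<gamma> powr 1 = v \<gamma> powr \<iota>" by (subst powr_add[symmetric]) simp
          have "c \<gamma> * (l \<gamma> * v \<gamma>) = b \<gamma> * (l \<gamma> * (v \<gamma> powr (- (1 - \<iota>)) * v \<gamma> powr 1))"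
            using v[OF \<gamma>] by (simp add: c_def)
          also have "\<dots> = b \<gamma> * a \<gamma> powr 1" unfolding 2 using a[OF \<gamma>] by (simp add: a_def)
          also have "\<dots> = (a \<gamma> powr (q - 1) * a \<gamma> powr 1) * S powr (- (1 - 1 / q))" using \<gamma> by (simp add: b_def)
          finally show "a \<gamma> powr q * S powr (- (1 - 1 / q)) = c \<gamma> * (l \<gamma> * v \<gamma>)" unfolding 1 by simp
        qed
        also have "\<dots> \<le> (\<Sum>\<gamma>\<in>\<Gamma>. c \<gamma> * x \<gamma>)" by (intro sum_mono mult_left_mono xl c0)
        finally show ?thesis .
      qed
      have upper: "(\<Sum>\<gamma>\<in>\<Gamma>. \<Sum>\<gamma>'\<in>\<Gamma>. c \<gamma> * c \<gamma>' * norm (wave_form M (F \<gamma>) (F \<gamma>'))) \<le> Cw * real_of_int M powr (3 - 10 * \<iota>) * Ch"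
      proof -
        define D where "D = Cw * real_of_int M powr (3 - 10 * \<iota>)"
        have D: "D \<ge> 0" using Cw by (simp add: D_def)
        have "(\<Sum>\<gamma>\<in>\<Gamma>. \<Sum>\<gamma>'\<in>\<Gamma>. c \<gamma> * c \<gamma>' * norm (wave_form M (F \<gamma>) (F \<gamma>')))
           \<le> (\<Sum>\<gamma>\<in>\<Gamma>. \<Sum>\<gamma>'\<in>\<Gamma>. D * (b \<gamma> * b \<gamma>' * (1 + \<bar>real_of_int (\<gamma> - \<gamma>')\<bar>) powr (- (2 / q))))"
        proof (intro sum_mono)
          fix \<gamma> \<gamma>' assume \<gamma>: "\<gamma> \<in> \<Gamma>" and \<gamma>': "\<gamma>' \<in> \<Gamma>"
          define w where "w = (1 + \<bar>real_of_int (\<gamma>' - \<gamma>)\<bar>) powr (- (2 / q))"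
          define vv where "vv = v \<gamma> * v \<gamma>'"
          have vv: "vv > 0" using v[OF \<gamma>] v[OF \<gamma>'] by (simp add: vv_def)
          have "norm (wave_form M (F \<gamma>) (F \<gamma>')) \<le> D * w * vv powr (1 - \<iota>)"
            using form[OF test[OF \<gamma>] test[OF \<gamma>'] M massF[OF \<gamma>] massF[OF \<gamma>'] v[OF \<gamma>] v[OF \<gamma>']]
            unfolding q(2)[symmetric] by (simp add: D_def w_def vv_def)
          then have "c \<gamma> * c \<gamma>' * norm (wave_form M (F \<gamma>) (F \<gamma>')) \<le> c \<gamma> * c \<gamma>' * (D * w * vv powr (1 - \<iota>))"
            by (intro mult_left_mono mult_nonneg_nonneg c0)
          also have "c \<gamma> * c \<gamma>' * (D * w * vv powr (1 - \<iota>)) = b \<gamma> * b \<gamma>' * vv powr (- (1 - \<iota>)) * (D * w * vv powr (1 - \<iota>))"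
            using v[OF \<gamma>] v[OF \<gamma>'] by (simp add: c_def vv_def powr_mult)
          also have "b \<gamma> * b \<gamma>' * vv powr (- (1 - \<iota>)) * (D * w * vv powr (1 - \<iota>)) = D * (b \<gamma> * b \<gamma>' * w) * (vv powr (- (1 - \<iota>)) * vv powr (1 - \<iota>))"
            by (simp only: mult_ac)
          also have "vv powr (- (1 - \<iota>)) * vv powr (1 - \<iota>) = 1" using vv by (subst powr_add[symmetric]) simp
          also have "w = (1 + \<bar>real_of_int (\<gamma> - \<gamma>')\<bar>) powr (- (2 / q))" by (simp add: w_def abs_minus_commute)
          finally show "c \<gamma> * c \<gamma>' * norm (wave_form M (F \<gamma>) (F \<gamma>')) \<le> D * (b \<gamma> * b \<gamma>' * (1 + \<bar>real_of_int (\<gamma> - \<gamma>')\<bar>) powr (- (2 / q)))" by simp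
        qed
        also have "\<dots> = D * (\<Sum>j\<in>\<Gamma>. \<Sum>k\<in>\<Gamma>. b j * b k * (1 + \<bar>real_of_int (j - k)\<bar>) powr (- (2 / q)))"
          by (simp only: sum_distrib_left)
        also have "\<dots> \<le> D * Ch" by (intro mult_left_mono hls D)
        finally show ?thesis by (simp add: D_def)
      qed
      have "(S powr (1 / q))\<^sup>2 \<le> (\<Sum>\<gamma>\<in>\<Gamma>. c \<gamma> * x \<gamma>)\<^sup>2" using lower by (intro power_mono) auto
      also have "\<dots> \<le> 2 * g2 * (\<Sum>\<gamma>\<in>\<Gamma>. \<Sum>\<gamma>'\<in>\<Gamma>. c \<gamma> * c \<gamma>' * norm (wave_form M (F \<gamma>) (F \<gamma>')))"
        unfolding g2_def by (rule wave_duality[OF G fin M supp \<Gamma> c0 test x(2)])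
      also have "\<dots> \<le> 2 * B\<^sup>2 * (Cw * real_of_int M powr (3 - 10 * \<iota>) * Ch)"
      proof (rule mult_mono[OF _ upper])
        show "2 * g2 \<le> 2 * B\<^sup>2" using g2 by simp
        show "0 \<le> (\<Sum>\<gamma>\<in>\<Gamma>. \<Sum>\<gamma>'\<in>\<Gamma>. c \<gamma> * c \<gamma>' * norm (wave_form M (F \<gamma>) (F \<gamma>')))"
          by (intro sum_nonneg mult_nonneg_nonneg c0 norm_ge_zero)
      qed simp
      also have "\<dots> = (C * real_of_int M powr (3 / 2 - 5 * \<iota>) * B)\<^sup>2"
      proof -
        have "(real_of_int M powr (3 / 2 - 5 * \<iota>))\<^sup>2 = real_of_int M powr ((3 / 2 - 5 * \<iota>) * 2)"
          unfolding powr_powr[symmetric] using M by (subst powr_numeral) auto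
        also have "(3 / 2 - 5 * \<iota>) * 2 = 3 - 10 * \<iota>" by simp
        finally have 1: "(real_of_int M powr (3 / 2 - 5 * \<iota>))\<^sup>2 = real_of_int M powr (3 - 10 * \<iota>)" .
        have 2: "C\<^sup>2 = 2 * Cw * Ch" using Cw Ch by (simp add: C_def)
        show ?thesis unfolding power_mult_distrib 1 2 by simp
      qed
      finally have "S powr (1 / q) \<le> C * real_of_int M powr (3 / 2 - 5 * \<iota>) * B"
        by (rule power2_le_imp_le) (use C B(1) in \<open>intro mult_nonneg_nonneg powr_ge_zero less_imp_le\<close>)
      then have "(S powr (1 / q)) powr q \<le> (C * real_of_int M powr (3 / 2 - 5 * \<iota>) * B) powr q"
        using q by (intro powr_mono2) auto
      then show ?thesis using S q by (simp add: powr_powr)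
    qed (simp add: S_def)
    then show "(\<Sum>\<gamma>\<in>\<Gamma>. (l \<gamma> * v \<gamma> powr \<iota>) powr q) \<le> (C * real_of_int M powr (3 / 2 - 5 * \<iota>) * B) powr q"
      by (simp add: S_def a_def)
  qed
qed

section \<open>From weak to strong type\<close>

lemma nn_integral_RT2_slab:
  fixes f :: "(real \<times> real \<times> real) \<times> real \<Rightarrow> ennreal"
  assumes [measurable]: "f \<in> borel_measurable borel"
  shows "(\<integral>\<^sup>+p. f p \<partial>RT2_slab \<gamma>) = (\<integral>\<^sup>+t. \<integral>\<^sup>+z. f (z, t) * indicator (time_slab \<gamma>) t \<partial>cell_measure \<partial>lborel)"
proof -
  have [measurable]: "RT2_cell \<times> time_slab \<gamma> \<in> sets (borel :: ((real \<times> real \<times> real) \<times> real) measure)"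
    unfolding borel_prod[where 'a="real \<times> real \<times> real", symmetric] by (intro pair_measureI) auto
  define g :: "(real \<times> real \<times> real) \<times> real \<Rightarrow> ennreal" where "g p = f p * indicator (RT2_cell \<times> time_slab \<gamma>) p" for p
  have [measurable]: "g \<in> borel_measurable borel" unfolding g_def by measurable
  have g: "g \<in> borel_measurable (lborel \<Otimes>\<^sub>M lborel)" by (simp add: lborel_prod)
  have "(\<integral>\<^sup>+p. f p \<partial>RT2_slab \<gamma>) = (\<integral>\<^sup>+p. g p \<partial>lborel)"
    unfolding RT2_slab_def time_slab_def[symmetric] g_def by (rule nn_integral_restrict_space) simp
  also have "\<dots> = (\<integral>\<^sup>+p. g p \<partial>(lborel \<Otimes>\<^sub>M lborel))" by (simp only: lborel_prod)
  also have "\<dots> = (\<integral>\<^sup>+t. \<integral>\<^sup>+z. g (z, t) \<partial>lborel \<partial>lborel)"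
    by (rule lborel_pair.nn_integral_snd[OF g, symmetric])
  also have "\<dots> = (\<integral>\<^sup>+t. \<integral>\<^sup>+z. f (z, t) * indicator (time_slab \<gamma>) t \<partial>cell_measure \<partial>lborel)"
  proof (intro nn_integral_cong)
    fix t
    have [measurable]: "(\<lambda>z. f (z, t)) \<in> borel_measurable borel"
      by (rule measurable_compose[OF borel_measurable_continuous_onI assms]) (intro continuous_intros)
    show "(\<integral>\<^sup>+z. g (z, t) \<partial>lborel) = (\<integral>\<^sup>+z. f (z, t) * indicator (time_slab \<gamma>) t \<partial>cell_measure)"
      unfolding cell_measure_def g_def
      by (subst nn_integral_density) (auto intro!: nn_integral_cong simp: indicator_def)
  qed
  finally show ?thesis .
qed

lemma space_RT2_slab: "space (RT2_slab \<gamma>) = RT2_cell \<times> time_slab \<gamma>"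
  by (simp add: RT2_slab_def time_slab_def space_restrict_space)

lemma borel_measurable_RT2_slab [measurable (raw)]:
  "f \<in> borel_measurable borel \<Longrightarrow> f \<in> borel_measurable (RT2_slab \<gamma>)"
  unfolding RT2_slab_def by (simp add: measurable_restrict_space1)

lemma Int_space_RT2_slab:
  fixes E :: "((real \<times> real \<times> real) \<times> real) set"
  assumes "E \<in> sets borel"
  shows "E \<inter> space (RT2_slab \<gamma>) \<in> sets (RT2_slab \<gamma>)"
proof -
  have "(\<lambda>p. p) -` E \<inter> space (RT2_slab \<gamma>) \<in> sets (RT2_slab \<gamma>)"
    by (rule measurable_sets[OF borel_measurable_RT2_slab assms]) simp
  then show ?thesis by simp
qed

lemma emeasure_RT2_slab:
  assumes [measurable]: "E \<in> sets borel" and t: "\<And>z t. (z, t) \<in> E \<Longrightarrow> t \<in> time_slab \<gamma>"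
  shows "emeasure (RT2_slab \<gamma>) (E \<inter> space (RT2_slab \<gamma>)) = space_time_volume E"
proof -
  have [measurable]: "E \<inter> space (RT2_slab \<gamma>) \<in> sets (RT2_slab \<gamma>)"
    by (rule Int_space_RT2_slab) fact
  have "emeasure (RT2_slab \<gamma>) (E \<inter> space (RT2_slab \<gamma>)) = (\<integral>\<^sup>+p. indicator (E \<inter> space (RT2_slab \<gamma>)) p \<partial>RT2_slab \<gamma>)"
    by simp
  also have "\<dots> = (\<integral>\<^sup>+p. indicator E p \<partial>RT2_slab \<gamma>)"
    by (intro nn_integral_cong) (auto simp: indicator_def)
  also have "\<dots> = (\<integral>\<^sup>+t. \<integral>\<^sup>+z. indicator E (z, t) * indicator (time_slab \<gamma>) t \<partial>cell_measure \<partial>lborel)"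
    by (rule nn_integral_RT2_slab) measurable
  also have "\<dots> = space_time_volume E"
    unfolding space_time_volume_def by (intro nn_integral_cong) (auto simp: indicator_def dest: t)
  finally show ?thesis .
qed

lemma space_time_volume_mono: "E \<subseteq> E' \<Longrightarrow> space_time_volume E \<le> space_time_volume E'"
  unfolding space_time_volume_def by (intro nn_integral_mono) (auto simp: indicator_def)

lemma space_time_volume_finite:
  assumes "\<And>z t. (z, t) \<in> E \<Longrightarrow> \<bar>fst z\<bar> \<le> X \<and> t \<in> time_slab \<gamma>"
  shows "space_time_volume E < top"
proof -
  define S where "S = (LINT z|cell_measure. indicator {-X..X} (fst z) :: real)"
  have S: "(\<integral>\<^sup>+z. ennreal (indicator {-X..X} (fst z)) \<partial>cell_measure) = ennreal S"
    unfolding S_def by (intro nn_integral_eq_integral integrable_cell_strip) auto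
  have "space_time_volume E \<le> (\<integral>\<^sup>+t. \<integral>\<^sup>+z. indicator (time_slab \<gamma>) t * ennreal (indicator {-X..X} (fst z)) \<partial>cell_measure \<partial>lborel)"
    unfolding space_time_volume_def
    by (intro nn_integral_mono) (auto simp: indicator_def abs_le_iff dest!: assms)
  also have "\<dots> = (\<integral>\<^sup>+t. indicator (time_slab \<gamma>) t * ennreal S \<partial>lborel)"
    by (intro nn_integral_cong) (simp add: nn_integral_cmult S)
  also have "\<dots> = ennreal S * emeasure lborel (time_slab \<gamma>)"
    by (simp add: nn_integral_multc mult.commute[of "ennreal S"] del: nn_integral_indicator_singleton nn_integral_cmult_indicator)
  also have "\<dots> < top" by (simp add: time_slab_def ennreal_mult_less_top emeasure_lborel_Icc_eq)
  finally show ?thesis .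
qed

text \<open>Interpolation between a supremum bound S and a weak bound of exponent p0: the range of u
  is cut into the dyadic layers below S. The layer of height S / 2 ^ j contributes 2 powr (- j * (p
  - p0)), a geometric series because p > p0.\<close>

lemma nn_integral_powr_weak_le:
  fixes u :: "'a \<Rightarrow> real"
  assumes [measurable]: "u \<in> borel_measurable M" and u0: "\<And>x. u x \<ge> 0"
    and uS: "AE x in M. u x \<le> S" and S: "S \<ge> 0"
    and weak: "\<And>l. l > 0 \<Longrightarrow> emeasure M {x \<in> space M. u x > l} \<le> ennreal ((w / l) powr p0)" and w: "w \<ge> 0"
    and p: "0 < p0" "p0 < p"
  shows "(\<integral>\<^sup>+x. ennreal (u x powr p) \<partial>M) \<le> ennreal (2 powr p0 / (1 - 2 powr (p0 - p)) * S powr (p - p0) * w powr p0)"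
proof (cases "S = 0")
  case True
  have "(\<integral>\<^sup>+x. ennreal (u x powr p) \<partial>M) = (\<integral>\<^sup>+x. 0 \<partial>M)"
    using uS u0 True by (intro nn_integral_cong_AE) (auto elim!: eventually_mono intro: antisym)
  then show ?thesis by simp
next
  case False
  then have S: "S > 0" using S by simp
  define s where "s j = S * (1 / 2) ^ j" for j :: nat
  have s: "s j > 0" for j using S by (simp add: s_def)
  define A where "A j = {x \<in> space M. u x > s (Suc j)}" for j
  have [measurable]: "A j \<in> sets M" for j unfolding A_def by measurable
  define r where "r = 2 powr (p0 - p)"
  have r: "0 < r" "r < 1" using p by (auto simp: r_def powr_less_one)
  define K where "K = 2 powr p0 * S powr (p - p0) * w powr p0"
  have K: "K \<ge> 0" by (simp add: K_def)
  have "(\<integral>\<^sup>+x. ennreal (u x powr p) \<partial>M) \<le> (\<integral>\<^sup>+x. (\<Sum>j. ennreal (s j powr p) * indicator (A j) x) \<partial>M)"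
  proof (rule nn_integral_mono_AE)
    show "AE x in M. ennreal (u x powr p) \<le> (\<Sum>j. ennreal (s j powr p) * indicator (A j) x)"
      using uS AE_space
    proof eventually_elim
      fix x assume x: "u x \<le> S" "x \<in> space M"
      show "ennreal (u x powr p) \<le> (\<Sum>j. ennreal (s j powr p) * indicator (A j) x)"
      proof (cases "u x = 0")
        case False
        then have ux: "u x > 0" using u0[of x] by simp
        have "s \<longlonglongrightarrow> S * 0" unfolding s_def by (intro tendsto_intros LIMSEQ_power_zero) auto
        then have "\<forall>\<^sub>F n in sequentially. s n < u x" using ux by (intro order_tendstoD(2)) auto
        then obtain n where n: "s n < u x" by (auto simp: eventually_sequentially)
        \<comment> \<open>The first dyadic value below u x. It is not the initial one, because u x
          \<le> S = s 0; its predecessor j therefore satisfies s (j + 1) < u x \<le> s j.\<close>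
        define m where "m = (LEAST n. s n < u x)"
        have m: "s m < u x" unfolding m_def by (rule LeastI) (rule n)
        have "m \<noteq> 0" using m x by (cases m) (auto simp: s_def)
        then obtain j where j: "m = Suc j" by (cases m) auto
        have "\<not> s j < u x" using not_less_Least[of j "\<lambda>n. s n < u x"] j by (simp add: m_def)
        then have "u x powr p \<le> s j powr p" using ux p by (intro powr_mono2) auto
        then have "ennreal (u x powr p) \<le> ennreal (s j powr p) * indicator (A j) x"
          using m j x by (simp add: A_def ennreal_leI)
        also have "\<dots> \<le> (\<Sum>i\<in>{j}. ennreal (s i powr p) * indicator (A i) x)" by (simp only: sum.insert finite.emptyI empty_iff sum.empty simp_thms add_0_right order_refl)
        also have "\<dots> \<le> (\<Sum>i. ennreal (s i powr p) * indicator (A i) x)"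
          by (intro sum_le_suminf) auto
        finally show ?thesis .
      qed simp
    qed
  qed
  also have "\<dots> = (\<Sum>j. \<integral>\<^sup>+x. ennreal (s j powr p) * indicator (A j) x \<partial>M)"
    by (rule nn_integral_suminf) measurable
  also have "\<dots> = (\<Sum>j. ennreal (s j powr p) * emeasure M (A j))"
    by (simp add: nn_integral_cmult_indicator)
  also have "\<dots> \<le> (\<Sum>j. ennreal (K * r ^ j))"
  proof (intro suminf_le)
    fix j
    have "ennreal (s j powr p) * emeasure M (A j) \<le> ennreal (s j powr p) * ennreal ((w / s (Suc j)) powr p0)"
      unfolding A_def by (intro mult_left_mono weak s) auto
    also have "\<dots> = ennreal (s j powr p * (w / s (Suc j)) powr p0)" by (simp add: ennreal_mult)
    also have "s j powr p * (w / s (Suc j)) powr p0 = K * r ^ j"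
    proof -
      have "(w / s (Suc j)) powr p0 = (2 * w / s j) powr p0" by (simp add: s_def mult.commute)
      also have "\<dots> = 2 powr p0 * w powr p0 / s j powr p0"
        using w s[of j] by (simp add: powr_divide powr_mult)
      finally have "s j powr p * (w / s (Suc j)) powr p0 = 2 powr p0 * w powr p0 * (s j powr p / s j powr p0)" by simp
      also have "s j powr p / s j powr p0 = s j powr (p - p0)" by (simp add: powr_diff)
      also have "s j powr (p - p0) = S powr (p - p0) * ((1 / 2) ^ j) powr (p - p0)"
        using S by (simp add: s_def powr_mult)
      also have "((1 / 2 :: real) ^ j) powr (p - p0) = r ^ j"
      proof -
        have "((1 / 2 :: real) ^ j) powr (p - p0) = ((1 / 2) powr (p - p0)) ^ j"
          by (simp add: powr_realpow[symmetric] powr_powr mult.commute)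
        also have "(1 / 2 :: real) powr (p - p0) = r" by (simp add: r_def powr_divide powr_minus_divide[symmetric])
        finally show ?thesis .
      qed
      finally show ?thesis by (simp add: K_def)
    qed
    finally show "ennreal (s j powr p) * emeasure M (A j) \<le> ennreal (K * r ^ j)" .
  qed auto
  also have "\<dots> = ennreal (\<Sum>j. K * r ^ j)"
    using r K by (intro suminf_ennreal2) (auto intro!: summable_mult summable_geometric)
  also have "(\<Sum>j. K * r ^ j) = K / (1 - r)"
    using r by (simp add: suminf_mult summable_geometric suminf_geometric)
  finally show ?thesis by (simp add: K_def r_def)
qed

section \<open>Level sets of the wave and their volumes\<close>

text \<open>The cutoff \<bar>x\<bar> \<le> X makes the volume finite and the set admissible for
  testing. It is removed later by continuity of the measure from below.\<close>

definition wave_level :: "(real \<times> int \<times> int \<Rightarrow> complex) \<Rightarrow> int \<Rightarrow> real \<Rightarrow> real \<Rightarrow> ((real \<times> real \<times> real) \<times> real) set" where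
  "wave_level G \<gamma> l X = {p. norm (wave G p) > l \<and> \<bar>fst (fst p)\<bar> \<le> X \<and> snd p \<in> time_slab \<gamma>}"

definition level_volume :: "(real \<times> int \<times> int \<Rightarrow> complex) \<Rightarrow> int \<Rightarrow> real \<Rightarrow> real \<Rightarrow> real" where
  "level_volume G \<gamma> l X = enn2real (space_time_volume (wave_level G \<gamma> l X))"

lemma wave_level_borel [measurable]:
  assumes [measurable]: "G \<in> borel_measurable RZ2"
  shows "wave_level G \<gamma> l X \<in> sets borel"
proof -
  have [measurable]: "(\<lambda>p :: (real \<times> real \<times> real) \<times> real. fst (fst p)) \<in> borel_measurable borel"
    "(snd :: (real \<times> real \<times> real) \<times> real \<Rightarrow> real) \<in> borel_measurable borel"
    by (intro borel_measurable_continuous_onI continuous_intros)+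
  have [measurable]: "wave G \<in> borel_measurable borel" by (rule measurable_wave) measurable
  have "{p \<in> space borel. norm (wave G p) > l \<and> \<bar>fst (fst p)\<bar> \<le> X \<and> snd p \<in> time_slab \<gamma>} \<in> sets borel"
    by measurable
  then show ?thesis by (simp add: wave_level_def)
qed

lemma level_volume: "space_time_volume (wave_level G \<gamma> l X) = ennreal (level_volume G \<gamma> l X)"
  unfolding level_volume_def
  by (intro ennreal_enn2real[symmetric] space_time_volume_finite[where X=X and \<gamma>=\<gamma>]) (auto simp: wave_level_def)

lemma level_volume_nonneg: "level_volume G \<gamma> l X \<ge> 0"
  by (simp add: level_volume_def)

lemma level_volume_mono: "X \<le> X' \<Longrightarrow> level_volume G \<gamma> l X \<le> level_volume G \<gamma> l X'"
proof -
  assume "X \<le> X'"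
  then have "space_time_volume (wave_level G \<gamma> l X) \<le> space_time_volume (wave_level G \<gamma> l X')"
    by (intro space_time_volume_mono) (auto simp: wave_level_def)
  then show ?thesis unfolding level_volume by (simp add: level_volume_nonneg)
qed

text \<open>The truncated level sets increase to the full one as X runs through the naturals, so a
  bound uniform in X passes to the limit.\<close>

lemma emeasure_wave_superlevel_le:
  assumes [measurable]: "G \<in> borel_measurable RZ2" and c: "c \<ge> 0" "\<And>X. level_volume G \<gamma> l X \<le> c"
  shows "emeasure (RT2_slab \<gamma>) {p \<in> space (RT2_slab \<gamma>). norm (wave G p) > l} \<le> ennreal c"
proof -
  define E where "E n = wave_level G \<gamma> l (real n) \<inter> space (RT2_slab \<gamma>)" for n :: nat
  have E: "range E \<subseteq> sets (RT2_slab \<gamma>)"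
    unfolding E_def by (intro image_subsetI Int_space_RT2_slab wave_level_borel assms)
  have "incseq E" by (auto simp: incseq_def E_def wave_level_def)
  then have "emeasure (RT2_slab \<gamma>) (\<Union>n. E n) = (SUP n. emeasure (RT2_slab \<gamma>) (E n))"
    using E by (intro SUP_emeasure_incseq[symmetric]) auto
  also have "\<dots> \<le> ennreal c"
  proof (intro SUP_least)
    fix n
    have "emeasure (RT2_slab \<gamma>) (E n) = ennreal (level_volume G \<gamma> l (real n))"
      unfolding E_def level_volume[symmetric] by (rule emeasure_RT2_slab[OF wave_level_borel[OF assms(1)]]) (simp add: wave_level_def)
    then show "emeasure (RT2_slab \<gamma>) (E n) \<le> ennreal c" using c by (simp add: ennreal_leI)
  qed
  also have "(\<Union>n. E n) = {p \<in> space (RT2_slab \<gamma>). norm (wave G p) > l}"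
  proof (intro equalityI subsetI)
    fix p assume p: "p \<in> {p \<in> space (RT2_slab \<gamma>). norm (wave G p) > l}"
    obtain n where "\<bar>fst (fst p)\<bar> \<le> real n" using real_arch_simple by blast
    moreover have "snd p \<in> time_slab \<gamma>" using p by (auto simp: space_RT2_slab)
    ultimately have "p \<in> E n" using p by (simp add: E_def wave_level_def)
    then show "p \<in> (\<Union>n. E n)" by blast
  qed (auto simp: E_def wave_level_def)
  finally show ?thesis .
qed

text \<open>B is a strictly positive majorant of the norm of G, not the norm itself: strict
  positivity keeps the later powers and quotients nondegenerate, even for the zero datum.\<close>

definition band_limited_data :: "(real \<times> int \<times> int \<Rightarrow> complex) \<Rightarrow> int \<Rightarrow> real \<Rightarrow> bool" where
  "band_limited_data G M B \<longleftrightarrow> integrable RZ2 G \<and> B > 0 \<and> sqnorm RZ2 G \<le> ennreal (B\<^sup>2) \<and> M \<ge> 1 \<and>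
     (\<forall>\<zeta>. \<zeta> \<notin> band (real_of_int M) (int_box M) \<longrightarrow> G \<zeta> = 0)"

text \<open>The convention \<open>0 powr 0 = 0\<close> matters: for \<open>\<iota> = 0\<close> only level sets of positive volume count, so
  \<open>w \<gamma>\<close> is then an essential supremum.\<close>

lemma weak_norms:
  fixes \<iota> q :: real
  assumes \<iota>: "\<iota> = 0 \<or> (1 / 6 < \<iota> \<and> \<iota> < 1 / 4)" and q: "q > 2" "2 / q = 1 / 2 - \<iota>"
  shows "\<exists>C>0. \<forall>G M B. band_limited_data G M B \<longrightarrow>
    (\<exists>w. (\<forall>\<gamma>. w \<gamma> \<ge> 0) \<and> (\<forall>\<gamma> l X. l > 0 \<longrightarrow> l * level_volume G \<gamma> l X powr \<iota> \<le> w \<gamma>) \<and>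
      (\<forall>\<Gamma>. finite \<Gamma> \<longrightarrow> (\<Sum>\<gamma>\<in>\<Gamma>. w \<gamma> powr q) \<le> (C * real_of_int M powr (3 / 2 - 5 * \<iota>) * B) powr q))"
proof (rule weak_type[OF assms])
  have \<iota>0: "\<iota> \<ge> 0" using \<iota> by auto
  fix C :: real
  assume C: "C > 0" and weak: "\<And>G M B \<Gamma> X E l v. integrable RZ2 G \<Longrightarrow> B > 0 \<Longrightarrow> sqnorm RZ2 G \<le> ennreal (B\<^sup>2) \<Longrightarrow> M \<ge> 1 \<Longrightarrow>
    (\<And>\<zeta>. \<zeta> \<notin> band (real_of_int M) (int_box M) \<Longrightarrow> G \<zeta> = 0) \<Longrightarrow> finite \<Gamma> \<Longrightarrow>
    (\<And>\<gamma>. \<gamma> \<in> \<Gamma> \<Longrightarrow> E \<gamma> \<in> sets borel) \<Longrightarrow>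
    (\<And>\<gamma> z t. \<gamma> \<in> \<Gamma> \<Longrightarrow> (z, t) \<in> E \<gamma> \<Longrightarrow> \<bar>fst z\<bar> \<le> X \<and> t \<in> time_slab \<gamma>) \<Longrightarrow>
    (\<And>\<gamma>. \<gamma> \<in> \<Gamma> \<Longrightarrow> l \<gamma> > 0) \<Longrightarrow> (\<And>\<gamma> p. \<gamma> \<in> \<Gamma> \<Longrightarrow> p \<in> E \<gamma> \<Longrightarrow> norm (wave G p) \<ge> l \<gamma>) \<Longrightarrow>
    (\<And>\<gamma>. \<gamma> \<in> \<Gamma> \<Longrightarrow> v \<gamma> > 0) \<Longrightarrow> (\<And>\<gamma>. \<gamma> \<in> \<Gamma> \<Longrightarrow> space_time_volume (E \<gamma>) = ennreal (v \<gamma>)) \<Longrightarrow>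
    (\<Sum>\<gamma>\<in>\<Gamma>. (l \<gamma> * v \<gamma> powr \<iota>) powr q) \<le> (C * real_of_int M powr (3 / 2 - 5 * \<iota>) * B) powr q"
  show ?thesis
  proof (intro exI[of _ "2 * C"] conjI allI impI)
    fix G M B assume "band_limited_data G M B"
    then have G: "integrable RZ2 G" and B: "B > 0" "sqnorm RZ2 G \<le> ennreal (B\<^sup>2)" and M: "M \<ge> 1"
      and supp: "\<And>\<zeta>. \<zeta> \<notin> band (real_of_int M) (int_box M) \<Longrightarrow> G \<zeta> = 0"
      by (auto simp: band_limited_data_def)
    have Gm: "G \<in> borel_measurable RZ2" using G by auto
    define D where "D = C * real_of_int M powr (3 / 2 - 5 * \<iota>) * B"
    have D: "D > 0" using C B M by (simp add: D_def)
    have levels: "(\<Sum>\<gamma>\<in>\<Gamma>. (l \<gamma> * level_volume G \<gamma> (l \<gamma>) X powr \<iota>) powr q) \<le> D powr q"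
      if "finite \<Gamma>" "\<And>\<gamma>. \<gamma> \<in> \<Gamma> \<Longrightarrow> l \<gamma> > 0" "\<And>\<gamma>. \<gamma> \<in> \<Gamma> \<Longrightarrow> level_volume G \<gamma> (l \<gamma>) X > 0" for \<Gamma> X and l :: "int \<Rightarrow> real"
      unfolding D_def
    proof (rule weak[OF G B M supp that(1), where E="\<lambda>\<gamma>. wave_level G \<gamma> (l \<gamma>) X" and X=X])
      show "wave_level G \<gamma> (l \<gamma>) X \<in> sets borel" for \<gamma> by (rule wave_level_borel[OF Gm])
      show "\<bar>fst z\<bar> \<le> X \<and> t \<in> time_slab \<gamma>" if "(z, t) \<in> wave_level G \<gamma> (l \<gamma>) X" for \<gamma> z t
        using that by (simp add: wave_level_def)
      show "l \<gamma> \<le> norm (wave G p)" if "p \<in> wave_level G \<gamma> (l \<gamma>) X" for \<gamma> p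
        using that by (simp add: wave_level_def)
      show "space_time_volume (wave_level G \<gamma> (l \<gamma>) X) = ennreal (level_volume G \<gamma> (l \<gamma>) X)" for \<gamma>
        by (rule level_volume)
    qed (use that in auto)
    define \<phi> where "\<phi> \<gamma> p = fst p * level_volume G \<gamma> (fst p) (snd p) powr \<iota>" for \<gamma> and p :: "real \<times> real"
    define P where "P = {0 :: real<..} \<times> (UNIV :: real set)"
    have "(1, 0) \<in> P" by (simp add: P_def)
    then have P: "P \<noteq> {}" by blast
    \<comment> \<open>The estimate for a single slab already bounds all levels and cutoffs at once.
      This is what makes the supremum in the definition of w a genuine real number.\<close>
    have \<phi>D: "\<phi> \<gamma> p \<le> D" if p: "p \<in> P" for \<gamma> p
    proof (rule ccontr)
      assume "\<not> \<phi> \<gamma> p \<le> D"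
      then have gt: "\<phi> \<gamma> p > D" by simp
      have l: "fst p > 0" using p by (auto simp: P_def)
      have "level_volume G \<gamma> (fst p) (snd p) \<noteq> 0" using gt D by (auto simp: \<phi>_def)
      then have "level_volume G \<gamma> (fst p) (snd p) > 0" using level_volume_nonneg[of G \<gamma> "fst p" "snd p"] by linarith
      then have "\<phi> \<gamma> p powr q \<le> D powr q"
        using levels[of "{\<gamma>}" "\<lambda>_. fst p" "snd p"] l by (simp add: \<phi>_def)
      moreover have "D powr q < \<phi> \<gamma> p powr q" using gt D q by (intro powr_less_mono2) auto
      ultimately show False by linarith
    qed
    define w where "w \<gamma> = (SUP p\<in>P. \<phi> \<gamma> p)" for \<gamma>
    have bdd: "bdd_above (\<phi> \<gamma> ` P)" for \<gamma> using \<phi>D by (rule bdd_aboveI2)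
    have up: "l * level_volume G \<gamma> l X powr \<iota> \<le> w \<gamma>" if "l > 0" for \<gamma> l X
      using cSUP_upper[OF _ bdd, of "(l, X)" \<gamma>] that by (simp add: w_def P_def \<phi>_def)
    have w0: "w \<gamma> \<ge> 0" for \<gamma>
      using up[of 1 \<gamma> 0] powr_ge_zero[of "level_volume G \<gamma> 1 0" \<iota>] by linarith
    have sum: "(\<Sum>\<gamma>\<in>\<Gamma>. w \<gamma> powr q) \<le> (2 * D) powr q" if \<Gamma>: "finite \<Gamma>" for \<Gamma>
    proof -
      define \<Gamma>' where "\<Gamma>' = {\<gamma> \<in> \<Gamma>. w \<gamma> > 0}"
      have \<Gamma>': "finite \<Gamma>'" using \<Gamma> by (simp add: \<Gamma>'_def)
      \<comment> \<open>The supremum need not be attained; a pair reaching half of it is enough and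
        accounts for the constant 2 * C.\<close>
      have "\<exists>p. p \<in> P \<and> w \<gamma> / 2 < \<phi> \<gamma> p" if "\<gamma> \<in> \<Gamma>'" for \<gamma>
      proof -
        have "w \<gamma> / 2 < (SUP p\<in>P. \<phi> \<gamma> p)" using that by (simp add: \<Gamma>'_def w_def[symmetric])
        then show ?thesis using less_cSUP_iff[OF P bdd] by blast
      qed
      then obtain p where p: "\<And>\<gamma>. \<gamma> \<in> \<Gamma>' \<Longrightarrow> p \<gamma> \<in> P" "\<And>\<gamma>. \<gamma> \<in> \<Gamma>' \<Longrightarrow> w \<gamma> / 2 < \<phi> \<gamma> (p \<gamma>)" by metis
      define l where "l \<gamma> = fst (p \<gamma>)" for \<gamma>
      \<comment> \<open>The weak estimate takes one cutoff for all slabs. The largest one works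
        since volumes grow with it, and the inserted 0 keeps the set nonempty.\<close>
      define X where "X = Max (insert 0 ((\<lambda>\<gamma>. snd (p \<gamma>)) ` \<Gamma>'))"
      define v where "v \<gamma> = level_volume G \<gamma> (l \<gamma>) X" for \<gamma>
      have l: "l \<gamma> > 0" if "\<gamma> \<in> \<Gamma>'" for \<gamma> using p(1)[OF that] by (auto simp: P_def l_def)
      have vX: "level_volume G \<gamma> (l \<gamma>) (snd (p \<gamma>)) \<le> v \<gamma>" if "\<gamma> \<in> \<Gamma>'" for \<gamma>
        unfolding v_def by (rule level_volume_mono) (use that \<Gamma>' in \<open>auto simp: X_def intro!: Max_ge\<close>)
      have wl: "w \<gamma> \<le> 2 * (l \<gamma> * v \<gamma> powr \<iota>)" if \<gamma>: "\<gamma> \<in> \<Gamma>'" for \<gamma>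
      proof -
        have "\<phi> \<gamma> (p \<gamma>) \<le> l \<gamma> * v \<gamma> powr \<iota>"
          unfolding \<phi>_def l_def[symmetric]
          using vX[OF \<gamma>] l[OF \<gamma>] \<iota>0 by (intro mult_left_mono powr_mono2 level_volume_nonneg) auto
        then show ?thesis using p(2)[OF \<gamma>] by simp
      qed
      \<comment> \<open>A vanishing volume would give w \<gamma> \<le> 0, because
        \<open>0 powr \<iota>\<close> is 0 for every \<iota>, also for \<iota> = 0.\<close>
      have v: "v \<gamma> > 0" if \<gamma>: "\<gamma> \<in> \<Gamma>'" for \<gamma>
      proof -
        have "v \<gamma> \<noteq> 0" using wl[OF \<gamma>] \<gamma> by (auto simp: \<Gamma>'_def)
        then show ?thesis using level_volume_nonneg[of G \<gamma> "l \<gamma>" X] by (simp add: v_def)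
      qed
      have "(\<Sum>\<gamma>\<in>\<Gamma>. w \<gamma> powr q) = (\<Sum>\<gamma>\<in>\<Gamma>'. w \<gamma> powr q)"
        using \<Gamma> w0 by (intro sum.mono_neutral_right) (auto simp: \<Gamma>'_def intro: antisym)
      also have "\<dots> \<le> (\<Sum>\<gamma>\<in>\<Gamma>'. 2 powr q * (l \<gamma> * v \<gamma> powr \<iota>) powr q)"
      proof (intro sum_mono)
        fix \<gamma> assume \<gamma>: "\<gamma> \<in> \<Gamma>'"
        have "w \<gamma> powr q \<le> (2 * (l \<gamma> * v \<gamma> powr \<iota>)) powr q"
          using wl[OF \<gamma>] w0 q by (intro powr_mono2) auto
        then show "w \<gamma> powr q \<le> 2 powr q * (l \<gamma> * v \<gamma> powr \<iota>) powr q"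
          using l[OF \<gamma>] by (simp add: powr_mult[of 2])
      qed
      also have "\<dots> = 2 powr q * (\<Sum>\<gamma>\<in>\<Gamma>'. (l \<gamma> * v \<gamma> powr \<iota>) powr q)" by (rule sum_distrib_left[symmetric])
      also have "\<dots> \<le> 2 powr q * D powr q"
        using levels[where X=X, OF \<Gamma>' l] v unfolding v_def by (intro mult_left_mono) auto
      also have "\<dots> = (2 * D) powr q" using D by (simp add: powr_mult)
      finally show ?thesis .
    qed
    have D2: "2 * D = 2 * C * real_of_int M powr (3 / 2 - 5 * \<iota>) * B" by (simp add: D_def)
    show "\<exists>w. (\<forall>\<gamma>. w \<gamma> \<ge> 0) \<and> (\<forall>\<gamma> l X. l > 0 \<longrightarrow> l * level_volume G \<gamma> l X powr \<iota> \<le> w \<gamma>) \<and>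
        (\<forall>\<Gamma>. finite \<Gamma> \<longrightarrow> (\<Sum>\<gamma>\<in>\<Gamma>. w \<gamma> powr q) \<le> (2 * C * real_of_int M powr (3 / 2 - 5 * \<iota>) * B) powr q)"
      using w0 up sum unfolding D2 by blast
  qed (use C in simp)
qed

text \<open>A positive volume to the power 0 is 1, so the hypothesis says l \<le> w for every level
  whose set has positive volume. Hence all level sets above w are null.\<close>

lemma AE_wave_le:
  assumes Gm: "G \<in> borel_measurable RZ2" and w: "w \<ge> 0"
    and up: "\<And>l X. l > 0 \<Longrightarrow> l * level_volume G \<gamma> l X powr 0 \<le> w"
  shows "AE p in RT2_slab \<gamma>. norm (wave G p) \<le> w"
proof -
  have "AE p in RT2_slab \<gamma>. norm (wave G p) \<le> w + 1 / Suc n" for n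
  proof -
    \<comment> \<open>Countably many levels decreasing to w, so that the exceptional null sets can
      be united.\<close>
    define l where "l = w + 1 / Suc n"
    have l: "l > w" "l > 0" using w by (auto simp: l_def intro: add_nonneg_pos)
    have "level_volume G \<gamma> l X = 0" for X
    proof (rule ccontr)
      assume "level_volume G \<gamma> l X \<noteq> 0"
      then show False using up[OF l(2), of X] l(1) by simp
    qed
    then have "emeasure (RT2_slab \<gamma>) {p \<in> space (RT2_slab \<gamma>). norm (wave G p) > l} \<le> ennreal 0"
      by (intro emeasure_wave_superlevel_le[OF Gm]) auto
    then have "emeasure (RT2_slab \<gamma>) {p \<in> space (RT2_slab \<gamma>). \<not> norm (wave G p) \<le> l} = 0"
      by (simp add: not_le)
    moreover have "{p \<in> space (RT2_slab \<gamma>). \<not> norm (wave G p) \<le> l} \<in> sets (RT2_slab \<gamma>)"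
    proof -
      have [measurable]: "wave G \<in> borel_measurable (RT2_slab \<gamma>)"
        by (intro borel_measurable_RT2_slab measurable_wave Gm)
      show ?thesis by measurable
    qed
    ultimately show ?thesis unfolding l_def[symmetric] by (rule AE_I[OF subset_refl])
  qed
  then have "AE p in RT2_slab \<gamma>. \<forall>n. norm (wave G p) \<le> w + 1 / Suc n"
    by (subst AE_all_countable) blast
  then show ?thesis
  proof (rule AE_mp, intro AE_I2 impI)
    fix p assume *: "\<forall>n. norm (wave G p) \<le> w + 1 / Suc n"
    show "norm (wave G p) \<le> w"
    proof (rule field_le_epsilon)
      fix e :: real assume "e > 0"
      then obtain n where "1 / Suc n < e" using nat_approx_posE by blast
      then show "norm (wave G p) \<le> w + e" using spec[OF *, of n] by linarith
    qed
  qed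
qed

lemma ennpowr_le_ennreal:
  assumes "a \<le> ennreal b" "b \<ge> 0" "r \<ge> 0"
  shows "ennpowr a r \<le> ennreal (b powr r)"
proof -
  have a: "a \<noteq> top" using assms(1) by (auto simp: top_unique)
  have "enn2real a \<le> b" using assms by (simp add: enn2real_leI)
  then show ?thesis using a assms(3) by (simp add: ennpowr_def ennreal_leI powr_mono2)
qed

lemma ennpowr_ennreal: "x \<ge> 0 \<Longrightarrow> ennpowr (ennreal x) r = ennreal (x powr r)"
  by (simp add: ennpowr_def)

text \<open>The dyadic interpolation applied inside one slab, with w0 as essential supremum and w1
  as weak norm of exponent p0.\<close>

lemma Lp_norm_wave_le:
  assumes Gm: "G \<in> borel_measurable RZ2" and p: "0 < p0" "p0 < p" and w: "w0 \<ge> 0" "w1 \<ge> 0"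
    and up0: "\<And>l X. l > 0 \<Longrightarrow> l * level_volume G \<gamma> l X powr 0 \<le> w0"
    and up1: "\<And>l X. l > 0 \<Longrightarrow> l * level_volume G \<gamma> l X powr (1 / p0) \<le> w1"
  shows "Lp_norm (RT2_slab \<gamma>) (ennreal p) (wave G) \<le>
    ennreal ((2 powr p0 / (1 - 2 powr (p0 - p)) * w0 powr (p - p0) * w1 powr p0) powr (1 / p))"
proof -
  have [measurable]: "wave G \<in> borel_measurable (RT2_slab \<gamma>)"
    by (intro borel_measurable_RT2_slab measurable_wave Gm)
  have le: "(\<integral>\<^sup>+x. ennreal (norm (wave G x) powr p) \<partial>RT2_slab \<gamma>) \<le>
      ennreal (2 powr p0 / (1 - 2 powr (p0 - p)) * w0 powr (p - p0) * w1 powr p0)"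
  proof (rule nn_integral_powr_weak_le)
    show "AE x in RT2_slab \<gamma>. norm (wave G x) \<le> w0" by (rule AE_wave_le[OF Gm w(1) up0])
    fix l :: real assume l: "l > 0"
    show "emeasure (RT2_slab \<gamma>) {x \<in> space (RT2_slab \<gamma>). l < norm (wave G x)} \<le> ennreal ((w1 / l) powr p0)"
    proof (rule emeasure_wave_superlevel_le[OF Gm])
      fix X
      have "level_volume G \<gamma> l X = (level_volume G \<gamma> l X powr (1 / p0)) powr p0"
        using p level_volume_nonneg[of G \<gamma> l X] by (simp add: powr_powr)
      also have "\<dots> \<le> (w1 / l) powr p0"
        using up1[OF l, of X] l p by (intro powr_mono2) (auto simp: field_simps)
      finally show "level_volume G \<gamma> l X \<le> (w1 / l) powr p0" .
    qed simp
  qed (use w p in auto)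
  have r: "2 powr (p0 - p) < 1" using p by (simp add: powr_less_one)
  have "Lp_norm (RT2_slab \<gamma>) (ennreal p) (wave G) = ennpowr (\<integral>\<^sup>+x. ennreal (norm (wave G x) powr p) \<partial>RT2_slab \<gamma>) (1 / p)"
    using p by (simp add: Lp_norm_def Lp_ennnorm_def ennpowr_ennreal)
  also have "\<dots> \<le> ennreal ((2 powr p0 / (1 - 2 powr (p0 - p)) * w0 powr (p - p0) * w1 powr p0) powr (1 / p))"
    using r p by (intro ennpowr_le_ennreal[OF le]) auto
  finally show ?thesis .
qed

text \<open>Hoelder's inequality with the sums replaced by positive majorants A and B: after
  division by these, Young's inequality holds term by term. Terms with a zero entry are treated
  apart because Young's inequality is applied to positive numbers only.\<close>

lemma sum_powr_Hoelder_le: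
  fixes a b :: "'a \<Rightarrow> real"
  assumes exps: "\<alpha> \<ge> 0" "\<beta> \<ge> 0" "\<alpha> + \<beta> = 1"
    and a: "\<And>i. i \<in> I \<Longrightarrow> a i \<ge> 0" "sum a I \<le> A" "A > 0"
    and b: "\<And>i. i \<in> I \<Longrightarrow> b i \<ge> 0" "sum b I \<le> B" "B > 0"
  shows "(\<Sum>i\<in>I. a i powr \<alpha> * b i powr \<beta>) \<le> A powr \<alpha> * B powr \<beta>"
proof -
  have "(\<Sum>i\<in>I. a i powr \<alpha> * b i powr \<beta>) \<le> (\<Sum>i\<in>I. (A powr \<alpha> * B powr \<beta>) * (\<alpha> / A * a i + \<beta> / B * b i))"
  proof (intro sum_mono)
    fix i assume i: "i \<in> I"
    show "a i powr \<alpha> * b i powr \<beta> \<le> (A powr \<alpha> * B powr \<beta>) * (\<alpha> / A * a i + \<beta> / B * b i)"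
    proof (cases "a i = 0 \<or> b i = 0")
      case True
      then have "a i powr \<alpha> * b i powr \<beta> = 0" by auto
      also have "0 \<le> (A powr \<alpha> * B powr \<beta>) * (\<alpha> / A * a i + \<beta> / B * b i)"
        using exps a(1)[OF i] b(1)[OF i] a(3) b(3) by (intro mult_nonneg_nonneg add_nonneg_nonneg) auto
      finally show ?thesis .
    next
      case False
      then have pos: "a i / A > 0" "b i / B > 0"
        using a(1)[OF i] b(1)[OF i] a(3) b(3) by (simp_all add: less_le)
      have "a i powr \<alpha> * b i powr \<beta> = (A powr \<alpha> * B powr \<beta>) * ((a i / A) powr \<alpha> * (b i / B) powr \<beta>)"
        using a(1)[OF i] b(1)[OF i] a(3) b(3) by (simp add: powr_divide)
      also have "\<dots> \<le> (A powr \<alpha> * B powr \<beta>) * (\<alpha> * (a i / A) + \<beta> * (b i / B))"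
        by (intro mult_left_mono Youngs_inequality_0 exps pos) auto
      finally show ?thesis by simp
    qed
  qed
  also have "\<dots> = (A powr \<alpha> * B powr \<beta>) * (\<alpha> / A * sum a I + \<beta> / B * sum b I)"
    by (simp only: sum_distrib_left[symmetric] sum.distrib)
  also have "\<dots> \<le> (A powr \<alpha> * B powr \<beta>) * (\<alpha> / A * A + \<beta> / B * B)"
    using exps a b by (intro mult_left_mono add_mono) auto
  also have "\<alpha> / A * A + \<beta> / B * B = 1" using exps a(3) b(3) by simp
  finally show ?thesis by simp
qed

text \<open>For infinite p the relation between the exponents forces q = 4 and the supremum estimate
  is already the claim. For finite p the supremum and one weak exponent p0 < p are combined; since
  1/q is affine in 1/p, the interpolated exponents stay on the admissible line.\<close>

lemma slab_norms:
  fixes p q :: ennreal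
  assumes p: "p > 4" and pq: "2 / q + 1 / p = 1 / 2"
  shows "\<exists>C>0. \<exists>r>0. q = ennreal r \<and> (\<forall>G M B. band_limited_data G M B \<longrightarrow>
    (\<exists>L. (\<forall>\<gamma>. L \<gamma> \<ge> 0) \<and> (\<forall>\<gamma>. Lp_norm (RT2_slab \<gamma>) p (wave G) \<le> ennreal (L \<gamma>)) \<and>
      (\<forall>\<Gamma>. finite \<Gamma> \<longrightarrow> (\<Sum>\<gamma>\<in>\<Gamma>. L \<gamma> powr r) \<le> (C * real_of_int M powr (3 / 2 - enn2real (5 / p)) * B) powr r)))"
proof -
  obtain C0 where C0: "C0 > 0" and sup: "\<And>G M B. band_limited_data G M B \<Longrightarrow>
    (\<exists>w. (\<forall>\<gamma>. w \<gamma> \<ge> 0) \<and> (\<forall>\<gamma> l X. l > 0 \<longrightarrow> l * level_volume G \<gamma> l X powr 0 \<le> w \<gamma>) \<and>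
      (\<forall>\<Gamma>. finite \<Gamma> \<longrightarrow> (\<Sum>\<gamma>\<in>\<Gamma>. w \<gamma> powr 4) \<le> (C0 * real_of_int M powr (3 / 2 - 5 * 0) * B) powr 4))"
    using weak_norms[of 0 4] by auto
  have half: "(1 / 2 :: ennreal) = ennreal (1 / 2)" by (simp add: divide_ennreal_def divide_ennreal[symmetric])
  have half_top: "(1 / 2 :: ennreal) \<noteq> top" unfolding half by (rule ennreal_neq_top)
  show ?thesis
  proof (cases p)
    case top
    have q: "q = ennreal 4"
    proof (cases q)
      case q': (real q')
      \<comment> \<open>For q = 0 the quotient 2 / q would be infinite.\<close>
      have "q' \<noteq> 0" using pq q' top half_top by (auto simp: ennreal_divide_zero)
      then have "q' > 0" using q' by simp
      then have "2 / q = ennreal (2 / q')" using q' by (simp add: divide_ennreal[symmetric])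
      then have "ennreal (2 / q') = ennreal (1 / 2)" unfolding half[symmetric] using pq top by simp
      then have "2 / q' = 1 / 2" using \<open>q' > 0\<close> by (subst (asm) ennreal_inj) auto
      then show ?thesis using q' \<open>q' > 0\<close> by (simp add: field_simps)
    qed (use pq top half in auto)
    show ?thesis
    proof (rule exI[of _ C0], rule conjI[OF C0], rule exI[of _ 4], intro conjI q allI impI)
      fix G M B assume data: "band_limited_data G M B"
      then have Gm: "G \<in> borel_measurable RZ2" and B: "B > 0" and M: "M \<ge> 1" by (auto simp: band_limited_data_def)
      obtain w where w: "\<And>\<gamma>. w \<gamma> \<ge> 0" "\<And>\<gamma> l X. l > 0 \<Longrightarrow> l * level_volume G \<gamma> l X powr 0 \<le> w \<gamma>"
        "\<And>\<Gamma>. finite \<Gamma> \<Longrightarrow> (\<Sum>\<gamma>\<in>\<Gamma>. w \<gamma> powr 4) \<le> (C0 * real_of_int M powr (3 / 2 - 5 * 0) * B) powr 4"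
        using sup[OF data] by blast
      have "Lp_norm (RT2_slab \<gamma>) p (wave G) \<le> ennreal (w \<gamma>)" for \<gamma>
      proof -
        have [measurable]: "wave G \<in> borel_measurable (RT2_slab \<gamma>)"
          by (intro borel_measurable_RT2_slab measurable_wave Gm)
        have "AE x in RT2_slab \<gamma>. norm (wave G x) \<le> w \<gamma>" by (rule AE_wave_le[OF Gm w(1,2)])
        then have "AE x in RT2_slab \<gamma>. ennreal (norm (wave G x)) \<le> ennreal (w \<gamma>)"
          by (rule AE_mp) (intro AE_I2 impI ennreal_leI)
        then show ?thesis unfolding Lp_norm_def Lp_ennnorm_def using top by (auto intro!: esssup_I)
      qed
      then show "\<exists>L. (\<forall>\<gamma>. L \<gamma> \<ge> 0) \<and> (\<forall>\<gamma>. Lp_norm (RT2_slab \<gamma>) p (wave G) \<le> ennreal (L \<gamma>)) \<and>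
        (\<forall>\<Gamma>. finite \<Gamma> \<longrightarrow> (\<Sum>\<gamma>\<in>\<Gamma>. L \<gamma> powr 4) \<le> (C0 * real_of_int M powr (3 / 2 - enn2real (5 / p)) * B) powr 4)"
        using w(1,3) top by (intro exI[of _ w]) simp
    qed simp
  next
    case (real p')
    have p': "p' > 4"
    proof -
      have "ennreal 4 < ennreal p'" using p real by simp
      then show ?thesis by (subst (asm) ennreal_less_iff) auto
    qed
    \<comment> \<open>The solution q of 2/q + 1/p' = 1/2; \<open>q0\<close> below solves the same
      relation for \<open>p0\<close>.\<close>
    define r where "r = 4 * p' / (p' - 2)"
    have r: "r > 0" using p' by (simp add: r_def)
    have inv: "1 / p = ennreal (1 / p')" "5 / p = ennreal (5 / p')"
      using p' real by (simp_all add: divide_ennreal[symmetric])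
    have e5: "enn2real (5 / p) = 5 / p'" using inv p' by simp
    have q: "q = ennreal r"
    proof (cases q)
      case q': (real q')
      have "q' \<noteq> 0" using pq q' half_top by (auto simp: ennreal_divide_zero)
      then have q'0: "q' > 0" using q' by simp
      then have "2 / q = ennreal (2 / q')" using q' by (simp add: divide_ennreal[symmetric])
      then have "ennreal (2 / q' + 1 / p') = ennreal (1 / 2)" using pq inv half q'0 p' by (simp add: ennreal_plus)
      then have "2 / q' + 1 / p' = 1 / 2" using q'0 p' by (subst (asm) ennreal_inj) auto
      then have "q' = r" using q'0 p' by (simp add: r_def field_simps)
      then show ?thesis using q' by simp
    next
      case top
      then have "ennreal (1 / p') = ennreal (1 / 2)" using pq inv half by simp
      then have "1 / p' = 1 / 2" using p' by (subst (asm) ennreal_inj) auto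
      then show ?thesis using p' by simp
    qed
    \<comment> \<open>The midpoint of 4 and p', capped at 5 so that it stays below 6. In both cases
      it lies strictly between 4 and p'.\<close>
    define p0 where "p0 = min (5::real) ((p' + 4) / 2)"
    have p0: "4 < p0" "p0 < 6" "p0 < p'" using p' by (auto simp: p0_def min_def)
    define q0 where "q0 = 4 * p0 / (p0 - 2)"
    have q0: "q0 > 2" "2 / q0 = 1 / 2 - 1 / p0" using p0 by (auto simp: q0_def field_simps)
    have "1 / p0 = 0 \<or> (1 / 6 < 1 / p0 \<and> 1 / p0 < 1 / 4)" using p0 by (simp add: field_simps)
    from weak_norms[OF this q0] obtain C1 where C1: "C1 > 0" and wk: "\<And>G M B. band_limited_data G M B \<Longrightarrow>
      (\<exists>w. (\<forall>\<gamma>. w \<gamma> \<ge> 0) \<and> (\<forall>\<gamma> l X. l > 0 \<longrightarrow> l * level_volume G \<gamma> l X powr (1 / p0) \<le> w \<gamma>) \<and>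
        (\<forall>\<Gamma>. finite \<Gamma> \<longrightarrow> (\<Sum>\<gamma>\<in>\<Gamma>. w \<gamma> powr q0) \<le> (C1 * real_of_int M powr (3 / 2 - 5 * (1 / p0)) * B) powr q0))"
      by blast
    \<comment> \<open>The interpolation parameter in 1/p' = \<theta>/p0 + (1 -
      \<theta>)/\<infinity>.\<close>
    define \<theta> where "\<theta> = p0 / p'"
    have \<theta>: "0 < \<theta>" "\<theta> < 1" using p0 by (auto simp: \<theta>_def)
    define K where "K = 2 powr p0 / (1 - 2 powr (p0 - p'))"
    have K: "K > 0" unfolding K_def using p0 by (intro divide_pos_pos) (auto simp: powr_less_one)
    define C where "C = K powr (1 / p') * (C0 powr (1 - \<theta>) * C1 powr \<theta>)"
    have C: "C > 0" using K C0 C1 by (simp add: C_def)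
    define \<alpha> where "\<alpha> = (1 - \<theta>) * r / 4"
    define \<beta> where "\<beta> = \<theta> * r / q0"
    have \<alpha>0: "\<alpha> \<ge> 0" "\<beta> \<ge> 0" using \<theta> r q0 by (auto simp: \<alpha>_def \<beta>_def)
    \<comment> \<open>Equivalent to 1/r = (1 - \<theta>)/4 + \<theta>/q0, the statement that r
      interpolates the sequence exponents 4 and q0 with the same parameter; it makes Hoelder's
      inequality over the slabs applicable.\<close>
    have \<alpha>\<beta>: "\<alpha> + \<beta> = 1"
    proof -
      have "\<theta> / q0 = (p0 - 2) / (4 * p')" using p0 by (simp add: \<theta>_def q0_def field_simps)
      moreover have "(1 - \<theta>) / 4 = (p' - p0) / (4 * p')" using p0 by (simp add: \<theta>_def field_simps)
      ultimately have "(1 - \<theta>) / 4 + \<theta> / q0 = (p' - 2) / (4 * p')" by (simp only: add_divide_distrib[symmetric]) simp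
      moreover have "\<alpha> + \<beta> = r * ((1 - \<theta>) / 4 + \<theta> / q0)" by (simp add: \<alpha>_def \<beta>_def distrib_left mult.commute)
      ultimately show ?thesis using p' by (simp add: r_def)
    qed
    show ?thesis
    proof (rule exI[of _ C], rule conjI[OF C], rule exI[of _ r], intro conjI r q allI impI)
      fix G M B assume data: "band_limited_data G M B"
      then have Gm: "G \<in> borel_measurable RZ2" and B: "B > 0" and M: "M \<ge> 1" by (auto simp: band_limited_data_def)
      obtain w0 where w0: "\<And>\<gamma>. w0 \<gamma> \<ge> 0" "\<And>\<gamma> l X. l > 0 \<Longrightarrow> l * level_volume G \<gamma> l X powr 0 \<le> w0 \<gamma>"
        "\<And>\<Gamma>. finite \<Gamma> \<Longrightarrow> (\<Sum>\<gamma>\<in>\<Gamma>. w0 \<gamma> powr 4) \<le> (C0 * real_of_int M powr (3 / 2 - 5 * 0) * B) powr 4"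
        using sup[OF data] by blast
      obtain w1 where w1: "\<And>\<gamma>. w1 \<gamma> \<ge> 0" "\<And>\<gamma> l X. l > 0 \<Longrightarrow> l * level_volume G \<gamma> l X powr (1 / p0) \<le> w1 \<gamma>"
        "\<And>\<Gamma>. finite \<Gamma> \<Longrightarrow> (\<Sum>\<gamma>\<in>\<Gamma>. w1 \<gamma> powr q0) \<le> (C1 * real_of_int M powr (3 / 2 - 5 * (1 / p0)) * B) powr q0"
        using wk[OF data] by blast
      define A0 where "A0 = C0 * real_of_int M powr (3 / 2 - 5 * 0) * B"
      define A1 where "A1 = C1 * real_of_int M powr (3 / 2 - 5 * (1 / p0)) * B"
      have A: "A0 > 0" "A1 > 0" using C0 C1 B M by (auto simp: A0_def A1_def)
      define L where "L \<gamma> = (K * w0 \<gamma> powr (p' - p0) * w1 \<gamma> powr p0) powr (1 / p')" for \<gamma>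
      have "Lp_norm (RT2_slab \<gamma>) p (wave G) \<le> ennreal (L \<gamma>)" for \<gamma>
        unfolding L_def K_def real(2)
        by (rule Lp_norm_wave_le[OF Gm _ p0(3) w0(1) w1(1) w0(2) w1(2)]) (use p0 in auto)
      moreover have "(\<Sum>\<gamma>\<in>\<Gamma>. L \<gamma> powr r) \<le> (C * real_of_int M powr (3 / 2 - enn2real (5 / p)) * B) powr r"
        if \<Gamma>: "finite \<Gamma>" for \<Gamma>
      proof -
        have e1: "4 * \<alpha> = (1 - \<theta>) * r" "q0 * \<beta> = \<theta> * r" using q0 by (simp_all add: \<alpha>_def \<beta>_def)
        have L: "L \<gamma> powr r = K powr (r / p') * ((w0 \<gamma> powr 4) powr \<alpha> * (w1 \<gamma> powr q0) powr \<beta>)" for \<gamma>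
        proof -
          have "(p' - p0) * (1 / p') * r = 4 * \<alpha>" "p0 * (1 / p') * r = q0 * \<beta>"
            using p' unfolding e1 \<theta>_def by (simp_all add: diff_divide_distrib)
          moreover have "L \<gamma> powr r = K powr (r / p') * (w0 \<gamma> powr ((p' - p0) * (1 / p') * r) * w1 \<gamma> powr (p0 * (1 / p') * r))"
            using K w0(1)[of \<gamma>] w1(1)[of \<gamma>] by (simp add: L_def powr_mult powr_powr mult.assoc)
          ultimately show ?thesis by (simp only: powr_powr)
        qed
        have "(\<Sum>\<gamma>\<in>\<Gamma>. L \<gamma> powr r) = K powr (r / p') * (\<Sum>\<gamma>\<in>\<Gamma>. (w0 \<gamma> powr 4) powr \<alpha> * (w1 \<gamma> powr q0) powr \<beta>)"
          unfolding L by (rule sum_distrib_left[symmetric])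
        also have "\<dots> \<le> K powr (r / p') * ((A0 powr 4) powr \<alpha> * (A1 powr q0) powr \<beta>)"
          using w0(3)[OF \<Gamma>] w1(3)[OF \<Gamma>] A
          by (intro mult_left_mono sum_powr_Hoelder_le \<alpha>0 \<alpha>\<beta>) (auto simp: A0_def A1_def)
        also have "\<dots> = (K powr (1 / p') * (A0 powr (1 - \<theta>) * A1 powr \<theta>)) powr r"
          unfolding powr_powr[of A0] powr_powr[of A1] e1 using K A by (simp add: powr_mult powr_powr)
        also have "A0 powr (1 - \<theta>) * A1 powr \<theta> = C0 powr (1 - \<theta>) * C1 powr \<theta> * real_of_int M powr (3 / 2 - 5 / p') * B"
        proof -
          have "A0 powr (1 - \<theta>) * A1 powr \<theta> = C0 powr (1 - \<theta>) * C1 powr \<theta> *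
              (real_of_int M powr (3 / 2 * (1 - \<theta>)) * real_of_int M powr ((3 / 2 - 5 / p0) * \<theta>)) * (B powr (1 - \<theta>) * B powr \<theta>)"
            unfolding A0_def A1_def using C0 C1 B M by (simp add: powr_mult powr_powr)
          also have "real_of_int M powr (3 / 2 * (1 - \<theta>)) * real_of_int M powr ((3 / 2 - 5 / p0) * \<theta>) = real_of_int M powr (3 / 2 * (1 - \<theta>) + (3 / 2 - 5 / p0) * \<theta>)"
            by (rule powr_add[symmetric])
          also have "3 / 2 * (1 - \<theta>) + (3 / 2 - 5 / p0) * \<theta> = 3 / 2 - 5 / p'"
            using p0 by (simp add: \<theta>_def field_simps)
          also have "B powr (1 - \<theta>) * B powr \<theta> = B" using B by (subst powr_add[symmetric]) simp
          finally show ?thesis .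
        qed
        finally show ?thesis by (simp add: C_def e5 mult.assoc)
      qed
      ultimately show "\<exists>L. (\<forall>\<gamma>. L \<gamma> \<ge> 0) \<and> (\<forall>\<gamma>. Lp_norm (RT2_slab \<gamma>) p (wave G) \<le> ennreal (L \<gamma>)) \<and>
        (\<forall>\<Gamma>. finite \<Gamma> \<longrightarrow> (\<Sum>\<gamma>\<in>\<Gamma>. L \<gamma> powr r) \<le> (C * real_of_int M powr (3 / 2 - enn2real (5 / p)) * B) powr r)"
        by (intro exI[of _ L]) (auto simp: L_def)
    qed
  qed
qed

text \<open>The finite sums exhaust the integral over all integers along the symmetric intervals
  \<open>J n\<close>, by monotone convergence.\<close>

lemma lq_norm_le:
  fixes a :: "int \<Rightarrow> ennreal"
  assumes r: "r > 0" and L: "\<And>\<gamma>. L \<gamma> \<ge> 0" "\<And>\<gamma>. a \<gamma> \<le> ennreal (L \<gamma>)" and D: "D \<ge> 0"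
    and sums: "\<And>\<Gamma>. finite \<Gamma> \<Longrightarrow> (\<Sum>\<gamma>\<in>\<Gamma>. L \<gamma> powr r) \<le> D powr r"
  shows "lq_norm (ennreal r) a \<le> ennreal D"
proof -
  define f where "f \<gamma> = ennreal (L \<gamma> powr r)" for \<gamma>
  define J where "J n = {- int n..int n}" for n
  have "(\<integral>\<^sup>+\<gamma>. ennpowr (a \<gamma>) r \<partial>count_space UNIV) \<le> (\<integral>\<^sup>+\<gamma>. (SUP n. f \<gamma> * indicator (J n) \<gamma>) \<partial>count_space UNIV)"
  proof (rule nn_integral_mono)
    fix \<gamma> :: int
    have "ennpowr (a \<gamma>) r \<le> f \<gamma>" unfolding f_def using L r by (intro ennpowr_le_ennreal) auto
    also have "\<dots> = f \<gamma> * indicator (J (nat \<bar>\<gamma>\<bar>)) \<gamma>" by (auto simp: J_def indicator_def)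
    also have "\<dots> \<le> (SUP n. f \<gamma> * indicator (J n) \<gamma>)" by (rule SUP_upper) simp
    finally show "ennpowr (a \<gamma>) r \<le> (SUP n. f \<gamma> * indicator (J n) \<gamma>)" .
  qed
  also have "\<dots> = (SUP n. \<integral>\<^sup>+\<gamma>. f \<gamma> * indicator (J n) \<gamma> \<partial>count_space UNIV)"
    by (rule nn_integral_monotone_convergence_SUP) (auto simp: incseq_def le_fun_def J_def indicator_def)
  also have "\<dots> \<le> ennreal (D powr r)"
  proof (intro SUP_least)
    fix n
    have fin: "finite (J n)" by (simp add: J_def)
    have "(\<integral>\<^sup>+\<gamma>. f \<gamma> * indicator (J n) \<gamma> \<partial>count_space UNIV) = (\<Sum>\<gamma>\<in>J n. f \<gamma> * indicator (J n) \<gamma>)"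
      by (rule nn_integral_count_space'[OF fin]) (auto simp: indicator_def)
    also have "\<dots> = (\<Sum>\<gamma>\<in>J n. f \<gamma>)" by (intro sum.cong) auto
    also have "\<dots> = ennreal (\<Sum>\<gamma>\<in>J n. L \<gamma> powr r)" unfolding f_def by (intro sum_ennreal) auto
    also have "\<dots> \<le> ennreal (D powr r)" by (intro ennreal_leI sums fin)
    finally show "(\<integral>\<^sup>+\<gamma>. f \<gamma> * indicator (J n) \<gamma> \<partial>count_space UNIV) \<le> ennreal (D powr r)" .
  qed
  finally have "ennpowr (\<integral>\<^sup>+\<gamma>. ennpowr (a \<gamma>) r \<partial>count_space UNIV) (1 / r) \<le> ennreal ((D powr r) powr (1 / r))"
    using r by (intro ennpowr_le_ennreal) auto
  then show ?thesis using r D by (simp add: Lp_ennnorm_def powr_powr)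
qed

theorem theorem3p1:
  fixes \<eta> :: "real \<Rightarrow> real" and p q :: ennreal
  assumes "smooth_cutoff \<eta>"
    and "p > 4"
    and "2 / q + 1 / p = 1 / 2"
  shows "\<exists>C::real. \<forall>N::nat. (\<exists>n. N = 2 ^ n) \<longrightarrow> (\<forall>u0 \<in> L2_RT2.
    lq_norm q (\<lambda>\<gamma>::int. Lp_norm (RT2_slab \<gamma>) p (\<lambda>(z, t). schroedinger t (P_le \<eta> N u0) z))
      \<le> ennreal (C * real N powr (3 / 2 - enn2real (5 / p))) * Lp_norm RT2 2 u0)"
proof -
  define e where "e = 3 / 2 - enn2real (5 / p)"
  from slab_norms[OF assms(2,3)] obtain C r where C: "C > 0" and r: "r > 0" "q = ennreal r"
    and slabs: "\<And>G M B. band_limited_data G M B \<Longrightarrow>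
      \<exists>L. (\<forall>\<gamma>. L \<gamma> \<ge> 0) \<and> (\<forall>\<gamma>. Lp_norm (RT2_slab \<gamma>) p (wave G) \<le> ennreal (L \<gamma>)) \<and>
        (\<forall>\<Gamma>. finite \<Gamma> \<longrightarrow> (\<Sum>\<gamma>\<in>\<Gamma>. L \<gamma> powr r) \<le> (C * real_of_int M powr e * B) powr r)"
    unfolding e_def by blast
  obtain A where A: "A > 0" and repr: "\<And>N u0. N \<ge> 1 \<Longrightarrow> u0 \<in> L2_RT2 \<Longrightarrow>
      \<exists>G. integrable RZ2 G \<and> sqnorm RZ2 G \<le> ennreal A * sqnorm cell_measure u0 \<and>
        (\<forall>\<zeta>. \<zeta> \<notin> band (2 * real N) (int_box (2 * int N)) \<longrightarrow> G \<zeta> = 0) \<and>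
        (\<forall>t z. schroedinger t (P_le \<eta> N u0) z = inv_fourier_integral (\<lambda>\<zeta>. schroedinger_phase t \<zeta> * G \<zeta>) z)"
    using evolution_representation[OF assms(1)] by blast
  have "lq_norm q (\<lambda>\<gamma>. Lp_norm (RT2_slab \<gamma>) p (\<lambda>(z, t). schroedinger t (P_le \<eta> N u0) z))
      \<le> ennreal (C * 2 powr e * sqrt A * real N powr e) * Lp_norm RT2 2 u0"
    if N: "N = 2 ^ n" and u0: "u0 \<in> L2_RT2" for N n u0
  proof -
    have N1: "N \<ge> 1" using N by simp
    have [measurable]: "u0 \<in> borel_measurable borel" using u0 by (simp add: L2_RT2_def)
    have m: "u0 \<in> borel_measurable RT2" by (rule borel_measurable_RT2) measurable
    have sq: "sqnorm RT2 u0 = sqnorm cell_measure u0"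
      unfolding sqnorm_def by (rule nn_integral_RT2) measurable
    have "sqnorm cell_measure u0 < top"
      using u0 Lp_norm_2_finite_iff[of RT2 u0] by (simp add: L2_RT2_def sq)
    then obtain b where b: "b \<ge> 0" "sqnorm cell_measure u0 = ennreal b" by (cases "sqnorm cell_measure u0") auto
    have u0_norm: "Lp_norm RT2 2 u0 = ennreal (sqrt b)"
      using b by (simp add: Lp_norm_2[OF m] sq ennpowr_ennreal powr_half_sqrt)
    obtain G where G: "integrable RZ2 G" "sqnorm RZ2 G \<le> ennreal A * ennreal b"
      "\<And>\<zeta>. \<zeta> \<notin> band (2 * real N) (int_box (2 * int N)) \<Longrightarrow> G \<zeta> = 0"
      "\<And>t z. schroedinger t (P_le \<eta> N u0) z = inv_fourier_integral (\<lambda>\<zeta>. schroedinger_phase t \<zeta> * G \<zeta>) z"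
      using repr[OF N1 u0] unfolding b(2) by blast
    \<comment> \<open>The band has half-width 2N because the cutoff vanishes only from 2 on; the
      factor 2 powr e goes into the constant.\<close>
    define D where "D = C * (2 * real N) powr e"
    have D: "D > 0" using C N1 by (simp add: D_def)
    have eq: "(\<lambda>(z, t). schroedinger t (P_le \<eta> N u0) z) = wave G"
      by (auto simp: fun_eq_iff G(4) wave_def)
    \<comment> \<open>The positive \<epsilon> supplies the strictly positive B demanded by
      \<open>band_limited_data\<close>, which covers data of norm 0.\<close>
    have bound: "lq_norm q (\<lambda>\<gamma>. Lp_norm (RT2_slab \<gamma>) p (wave G)) \<le> ennreal (D * (sqrt (A * b) + \<epsilon>))"
      if \<epsilon>: "\<epsilon> > 0" for \<epsilon>
    proof -
      define B where "B = sqrt (A * b) + \<epsilon>"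
      have s: "sqrt (A * b) \<ge> 0" using A b by simp
      have B: "B > 0" using s \<epsilon> by (simp add: B_def add_nonneg_pos)
      have "A * b = (sqrt (A * b))\<^sup>2" using A b by simp
      also have "\<dots> \<le> B\<^sup>2" using s \<epsilon> by (intro power_mono) (auto simp: B_def)
      finally have "ennreal A * ennreal b \<le> ennreal (B\<^sup>2)" using A b by (simp add: ennreal_mult[symmetric] ennreal_leI)
      then have "sqnorm RZ2 G \<le> ennreal (B\<^sup>2)" using G(2) by (rule order_trans[rotated])
      then have "band_limited_data G (2 * int N) B"
        using G(1,3) B N1 by (simp add: band_limited_data_def)
      then obtain L where L: "\<And>\<gamma>. L \<gamma> \<ge> 0" "\<And>\<gamma>. Lp_norm (RT2_slab \<gamma>) p (wave G) \<le> ennreal (L \<gamma>)"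
        "\<And>\<Gamma>. finite \<Gamma> \<Longrightarrow> (\<Sum>\<gamma>\<in>\<Gamma>. L \<gamma> powr r) \<le> (D * B) powr r"
        using slabs[of G "2 * int N" B] by (auto simp: D_def)
      show ?thesis unfolding r(2) B_def[symmetric]
        by (rule lq_norm_le[OF r(1) L(1,2) _ L(3)]) (use D B in auto)
    qed
    have "lq_norm q (\<lambda>\<gamma>. Lp_norm (RT2_slab \<gamma>) p (wave G)) \<le> ennreal (D * sqrt (A * b))"
    proof (rule ennreal_le_epsilon)
      fix \<epsilon> :: real assume \<epsilon>: "\<epsilon> > 0"
      \<comment> \<open>Dividing by D makes the total error exactly \<epsilon>, so that it can be
        sent to 0.\<close>
      have "lq_norm q (\<lambda>\<gamma>. Lp_norm (RT2_slab \<gamma>) p (wave G)) \<le> ennreal (D * (sqrt (A * b) + \<epsilon> / D))"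
        using \<epsilon> D by (intro bound) simp
      also have "D * (sqrt (A * b) + \<epsilon> / D) = D * sqrt (A * b) + \<epsilon>" using D by (simp add: distrib_left)
      also have "ennreal \<dots> = ennreal (D * sqrt (A * b)) + ennreal \<epsilon>"
        using D A b \<epsilon> by (intro ennreal_plus) auto
      finally show "lq_norm q (\<lambda>\<gamma>. Lp_norm (RT2_slab \<gamma>) p (wave G)) \<le> ennreal (D * sqrt (A * b)) + ennreal \<epsilon>" .
    qed
    also have "D * sqrt (A * b) = (C * 2 powr e * sqrt A * real N powr e) * sqrt b"
      by (simp add: D_def powr_mult real_sqrt_mult)
    also have "ennreal \<dots> = ennreal (C * 2 powr e * sqrt A * real N powr e) * Lp_norm RT2 2 u0"
      unfolding u0_norm using C A b by (intro ennreal_mult) auto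
    finally show ?thesis unfolding eq .
  qed
  then show ?thesis unfolding e_def by blast
qed

end
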